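(* Let $p$ be a prime, $m>0$ and $i\ge0$. Let $d_1:\mathrm{Ext}^0_{\Gamma(m+1)}(T_m^{(i)}\otimes_{BP_*}D^0_{m+1})\to\mathrm{Ext}^0_{\Gamma(m+1)}(T_m^{(i)}\otimes_{BP_*}E^1_{m+1})$ be the map induced by the projection $D^0_{m+1}\to E^1_{m+1}$. Then the Adams-Novikov $E_2$-term for $T(m)_{(i)}$ is $$\mathrm{Ext}^n_{\Gamma(m+1)}(T_m^{(i)})\cong\begin{cases}\ker d_1&\text{for }n=0,\\ \mathrm{coker}\,d_1&\text{for }n=1,\\ \mathrm{Ext}^{n-1}_{\Gamma(m+1)}(T_m^{(i)}\otimes_{BP_*}E^1_{m+1})&\text{for }n\ge2.\end{cases}$$
   Context: $BP_*=\mathbf Z_{(p)}[v_1,v_2,\dots]$ (Hazewinkel generators), $BP_*(BP)=BP_*[t_1,t_2,\dots]$, $|v_i|=|t_i|=2(p^i-1)$. $\Gamma(k)=BP_*(BP)/(t_1,\dots,t_{k-1})$, with Hopf algebroid structure over $BP_*$ inherited from $BP_*(BP)$; $\mathrm{Ext}_{\Gamma}(M)$ means $\mathrm{Ext}_\Gamma(BP_*,M)$. $A(m)=\mathbf Z_{(p)}[v_1,\dots,v_m]$. $T(m)$ is the connective $p$-local ring spectrum with $BP_*(T(m))=BP_*[t_1,\dots,t_m]\subset BP_*(BP)$. $T(m)_{(i)}$ is the $T(m)$-module spectrum with $BP_*(T(m)_{(i)})=BP_*(T(m))\{t_{m+1}^\ell\mid0\le\ell<p^i\}$; its Adams-Novikov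 $E_2$-term $\mathrm{Ext}^n_{BP_*(BP)}(BP_*,BP_*(T(m)_{(i)}))$ is isomorphic to $\mathrm{Ext}^n_{\Gamma(m+1)}(BP_*,T_m^{(i)})$, where $T_m^{(i)}\subset\Gamma(m+1)$ is the free $BP_*$-module on $\{t_{m+1}^\ell\mid0\le\ell<p^i\}$. Let $\ell_0=1$ and $p\ell_n=\sum_{0\le j<n}\ell_jv_{n-j}^{p^j}$ in $\mathbf Q\otimes BP_*$, $\hat\ell_k=\ell_{m+k}$, and define $\hat\lambda_k$ by $\hat\ell_k=\sum_{0\le j<k}\ell_j\hat\lambda_{k-j}^{p^j}$. $D^0_{m+1}=A(m)[\hat\lambda_1,\hat\lambda_2,\dots]\subset\mathbf Q\otimes BP_*$ is a $\Gamma(m+1)$-comodule containing $BP_*$; it is weak injective (i.e. $\mathrm{Ext}^s_{\Gamma(m+1)}(D^0_{m+1})=0$ for $s>0$) and $BP_*\to D_{m+1}^0$ induces an isomorphism in $\mathrm{Ext}^0_{\Gamma(m+1)}$. $E^1_{m+1}=D^0_{m+1}/BP_*$.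
   Formalization: Here ℓ̂_k is ℓ_{m+k} minus its terms involving only v_1,…,v_m; with ℓ̂_k = ℓ_{m+k} as written, D^0_{m+1} would not contain v_{m+1}, hence not BP_*, for any m>0, so E^1_{m+1} and the tensor product over BP_* would be undefined. *)

theory Defs
  imports "HOL-Algebra.Free_Abelian_Groups" "HOL-Algebra.Generated_Rings" "HOL-Algebra.QuotRing"
    "HOL-Library.Poly_Mapping" "HOL-Computational_Algebra.Primes"
begin

section \<open>Hopf algebroids, comodules and the cobar complex\<close>

text \<open>
  A formal sum is an element of a free abelian group in the sense of
  \<^theory>\<open>HOL-Algebra.Free_Abelian_Groups\<close>.  Elements of a tensor product are cosets of formal sums;
  \<open>rep\<close> picks a formal sum out of such a coset, and maps out of a tensor product are defined
  on formal sums and applied to a representative.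
\<close>

definition rep :: "'x set \<Rightarrow> 'x" where
  "rep X = (SOME x. x \<in> X)"

text \<open>
  A pair of rings \<open>A = base\<close>, \<open>\<Gamma> = total\<close> with left and right unit; \<open>\<Gamma>\<close> is an \<open>A\<close>-bimodule,
  on the left through the left unit and on the right through the right unit.
\<close>

record ('a, 'g) algebroid =
  base :: "'a ring"
  total :: "'g ring"
  lunit :: "'a \<Rightarrow> 'g"
  runit :: "'a \<Rightarrow> 'g"

text \<open>
  The word \<open>([g\<^sub>1, \<dots>, g\<^sub>s], x)\<close> stands for the elementary tensor \<open>g\<^sub>1 \<otimes> \<dots> \<otimes> g\<^sub>s \<otimes> x\<close>.
  \<open>cobar_tensor H M s\<close> is \<open>\<Gamma> \<otimes>\<^sub>A \<dots> \<otimes>\<^sub>A \<Gamma> \<otimes>\<^sub>A M\<close> with \<open>s\<close> factors \<open>\<Gamma>\<close>: the free abelian group on the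
  words of length \<open>s\<close> modulo additivity in every slot and \<open>A\<close>-balancedness at every tensor sign.
  Of the record \<open>M\<close> only the additive group and the scalar multiplication matter, here and
  below; the fields for an internal multiplication and unit are inherited from the library's record
  for modules.
\<close>

definition cobar_words ::
    "('a, 'g, 'h) algebroid_scheme \<Rightarrow> ('a, 'm, 'c) module_scheme \<Rightarrow> nat \<Rightarrow> ('g list \<times> 'm) set" where
  "cobar_words H M s =
     {(gs, x). length gs = s \<and> set gs \<subseteq> carrier (total H) \<and> x \<in> carrier M}"

definition cobar_relations ::
    "('a, 'g, 'h) algebroid_scheme \<Rightarrow> ('a, 'm, 'c) module_scheme \<Rightarrow> nat \<Rightarrow>
     ('g list \<times> 'm \<Rightarrow>\<^sub>0 int) set" where
  "cobar_relations H M s =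
     {frag_of (xs @ [g \<oplus>\<^bsub>total H\<^esub> h] @ ys, x) - frag_of (xs @ [g] @ ys, x) - frag_of (xs @ [h] @ ys, x)
        | xs g h ys x.
          (xs @ [g] @ ys, x) \<in> cobar_words H M s \<and> (xs @ [h] @ ys, x) \<in> cobar_words H M s}
   \<union> {frag_of (gs, x \<oplus>\<^bsub>M\<^esub> y) - frag_of (gs, x) - frag_of (gs, y)
        | gs x y. (gs, x) \<in> cobar_words H M s \<and> (gs, y) \<in> cobar_words H M s}
   \<union> {frag_of (xs @ [g \<otimes>\<^bsub>total H\<^esub> runit H a, h] @ ys, x)
        - frag_of (xs @ [g, lunit H a \<otimes>\<^bsub>total H\<^esub> h] @ ys, x)
        | xs g h ys a x. a \<in> carrier (base H) \<and> (xs @ [g, h] @ ys, x) \<in> cobar_words H M s}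
   \<union> {frag_of (xs @ [g \<otimes>\<^bsub>total H\<^esub> runit H a], x) - frag_of (xs @ [g], a \<odot>\<^bsub>M\<^esub> x)
        | xs g a x. a \<in> carrier (base H) \<and> (xs @ [g], x) \<in> cobar_words H M s}"

definition cobar_null ::
    "('a, 'g, 'h) algebroid_scheme \<Rightarrow> ('a, 'm, 'c) module_scheme \<Rightarrow> nat \<Rightarrow>
     ('g list \<times> 'm \<Rightarrow>\<^sub>0 int) set" where
  "cobar_null H M s =
     generate (free_Abelian_group (cobar_words H M s)) (cobar_relations H M s)"

definition cobar_tensor ::
    "('a, 'g, 'h) algebroid_scheme \<Rightarrow> ('a, 'm, 'c) module_scheme \<Rightarrow> nat \<Rightarrow>
     ('g list \<times> 'm \<Rightarrow>\<^sub>0 int) set monoid" where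
  "cobar_tensor H M s = free_Abelian_group (cobar_words H M s) Mod cobar_null H M s"

definition cobar_class ::
    "('a, 'g, 'h) algebroid_scheme \<Rightarrow> ('a, 'm, 'c) module_scheme \<Rightarrow> nat \<Rightarrow>
     ('g list \<times> 'm \<Rightarrow>\<^sub>0 int) \<Rightarrow> ('g list \<times> 'm \<Rightarrow>\<^sub>0 int) set" where
  "cobar_class H M s c = cobar_null H M s #>\<^bsub>free_Abelian_group (cobar_words H M s)\<^esub> c"

text \<open>
  \<open>comult\<close> takes values in \<open>\<Gamma> \<otimes>\<^sub>A \<Gamma>\<close>, that is, in the carrier of \<open>cobar_tensor\<close> in degree 1 with
  \<open>M = \<Gamma>\<close> as a left module; \<open>coact\<close> takes values in \<open>\<Gamma> \<otimes>\<^sub>A M\<close>.  Comodules are left comodules.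
  Counit and conjugation do not occur in the (unnormalized) cobar complex and are not recorded.
\<close>

record ('a, 'g) hopf_algebroid = "('a, 'g) algebroid" +
  comult :: "'g \<Rightarrow> ('g list \<times> 'g \<Rightarrow>\<^sub>0 int) set"

record ('a, 'g, 'm) comodule = "('a, 'm) module" +
  coact :: "'m \<Rightarrow> ('g list \<times> 'm \<Rightarrow>\<^sub>0 int) set"

definition total_module :: "('a, 'g, 'h) algebroid_scheme \<Rightarrow> ('a, 'g) module" where
  "total_module H = ring.extend (total H) (module.fields (\<lambda>a g. lunit H a \<otimes>\<^bsub>total H\<^esub> g))"

definition total_comodule :: "('a, 'g, 'h) hopf_algebroid_scheme \<Rightarrow> ('a, 'g, 'g) comodule" where
  "total_comodule H = module.extend (total_module H) (comodule.fields (comult H))"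

text \<open>
  \<open>d(g\<^sub>1 | \<dots> | g\<^sub>s | x) = 1 | g\<^sub>1 | \<dots> | g\<^sub>s | x
     + \<Sum>\<^sub>j (-1)\<^sup>j g\<^sub>1 | \<dots> | \<Delta>(g\<^sub>j) | \<dots> | g\<^sub>s | x + (-1)\<^sup>s\<^sup>+\<^sup>1 g\<^sub>1 | \<dots> | g\<^sub>s | \<psi>(x)\<close>.
\<close>

definition cobar_diff_word ::
    "('a, 'g, 'h) hopf_algebroid_scheme \<Rightarrow> ('a, 'g, 'm, 'c) comodule_scheme \<Rightarrow>
     'g list \<times> 'm \<Rightarrow> ('g list \<times> 'm \<Rightarrow>\<^sub>0 int)" where
  "cobar_diff_word H M = (\<lambda>(gs, x).
     frag_of (\<one>\<^bsub>total H\<^esub> # gs, x)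
   + (\<Sum>j<length gs. frag_cmul ((-1) ^ (j + 1))
        (frag_extend (\<lambda>(hs, h). frag_of (take j gs @ hs @ [h] @ drop (Suc j) gs, x))
          (rep (comult H (gs ! j)))))
   + frag_cmul ((-1) ^ (length gs + 1))
        (frag_extend (\<lambda>(hs, y). frag_of (gs @ hs, y)) (rep (coact M x))))"

definition cobar_diff ::
    "('a, 'g, 'h) hopf_algebroid_scheme \<Rightarrow> ('a, 'g, 'm, 'c) comodule_scheme \<Rightarrow> nat \<Rightarrow>
     ('g list \<times> 'm \<Rightarrow>\<^sub>0 int) set \<Rightarrow> ('g list \<times> 'm \<Rightarrow>\<^sub>0 int) set" where
  "cobar_diff H M s X = cobar_class H M (Suc s) (frag_extend (cobar_diff_word H M) (rep X))"

definition cobar_cocycles ::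
    "('a, 'g, 'h) hopf_algebroid_scheme \<Rightarrow> ('a, 'g, 'm, 'c) comodule_scheme \<Rightarrow> nat \<Rightarrow>
     ('g list \<times> 'm \<Rightarrow>\<^sub>0 int) set set" where
  "cobar_cocycles H M s =
     kernel (cobar_tensor H M s) (cobar_tensor H M (Suc s)) (cobar_diff H M s)"

definition cobar_coboundaries ::
    "('a, 'g, 'h) hopf_algebroid_scheme \<Rightarrow> ('a, 'g, 'm, 'c) comodule_scheme \<Rightarrow> nat \<Rightarrow>
     ('g list \<times> 'm \<Rightarrow>\<^sub>0 int) set set" where
  "cobar_coboundaries H M s =
     (case s of 0 \<Rightarrow> {\<one>\<^bsub>cobar_tensor H M 0\<^esub>}
      | Suc r \<Rightarrow> cobar_diff H M r ` carrier (cobar_tensor H M r))"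

text \<open>\<open>Ext_comod H M s\<close> is \<open>Ext\<^sup>s\<^sub>\<Gamma>(A, M)\<close>, the cohomology of the cobar complex of \<open>M\<close>.\<close>

definition Ext_comod ::
    "('a, 'g, 'h) hopf_algebroid_scheme \<Rightarrow> ('a, 'g, 'm, 'c) comodule_scheme \<Rightarrow> nat \<Rightarrow>
     ('g list \<times> 'm \<Rightarrow>\<^sub>0 int) set set monoid" where
  "Ext_comod H M s =
     (cobar_tensor H M s)\<lparr>carrier := cobar_cocycles H M s\<rparr> Mod cobar_coboundaries H M s"

definition cobar_map ::
    "('a, 'g, 'h) algebroid_scheme \<Rightarrow> ('a, 'n, 'd) module_scheme \<Rightarrow> ('m \<Rightarrow> 'n) \<Rightarrow> nat \<Rightarrow>
     ('g list \<times> 'm \<Rightarrow>\<^sub>0 int) set \<Rightarrow> ('g list \<times> 'n \<Rightarrow>\<^sub>0 int) set" where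
  "cobar_map H N f s X = cobar_class H N s (frag_extend (\<lambda>(gs, x). frag_of (gs, f x)) (rep X))"

text \<open>The homomorphism \<open>Ext\<^sup>s(M) \<rightarrow> Ext\<^sup>s(N)\<close> induced by a comodule homomorphism \<open>f : M \<rightarrow> N\<close>.\<close>

definition Ext_comod_map ::
    "('a, 'g, 'h) hopf_algebroid_scheme \<Rightarrow> ('a, 'g, 'n, 'd) comodule_scheme \<Rightarrow> ('m \<Rightarrow> 'n) \<Rightarrow> nat \<Rightarrow>
     ('g list \<times> 'm \<Rightarrow>\<^sub>0 int) set set \<Rightarrow> ('g list \<times> 'n \<Rightarrow>\<^sub>0 int) set set" where
  "Ext_comod_map H N f s Y =
     cobar_coboundaries H N s #>\<^bsub>cobar_tensor H N s\<^esub> cobar_map H N f s (rep Y)"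

section \<open>Subcomodules, quotient comodules and tensor products of comodules\<close>

text \<open>
  The coaction of a subcomodule \<open>S\<close> of \<open>M\<close> is the lift of the coaction of \<open>M\<close> along
  \<open>\<Gamma> \<otimes>\<^sub>A S \<rightarrow> \<Gamma> \<otimes>\<^sub>A M\<close>, which is injective when \<open>\<Gamma>\<close> is flat.
\<close>

definition subcomodule ::
    "('a, 'g, 'h) algebroid_scheme \<Rightarrow> ('a, 'g, 'm) comodule \<Rightarrow> 'm set \<Rightarrow> ('a, 'g, 'm) comodule" where
  "subcomodule H M S = M\<lparr>carrier := S,
     coact := (\<lambda>x. THE X. X \<in> carrier (cobar_tensor H (M\<lparr>carrier := S\<rparr>) 1) \<and>
                          cobar_map H M id 1 X = coact M x)\<rparr>"

definition quotient_proj :: "('a, 'g, 'm) comodule \<Rightarrow> 'm set \<Rightarrow> 'm \<Rightarrow> 'm set" where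
  "quotient_proj M S x = S +>\<^bsub>M\<^esub> x"

definition quotient_module :: "('a, 'g, 'm) comodule \<Rightarrow> 'm set \<Rightarrow> ('a, 'm set) module" where
  "quotient_module M S =
     \<lparr>carrier = a_rcosets\<^bsub>M\<^esub> S, monoid.mult = undefined, one = undefined,
      zero = S, add = set_add M, smult = (\<lambda>a X. quotient_proj M S (a \<odot>\<^bsub>M\<^esub> rep X))\<rparr>"

definition quotient_comodule ::
    "('a, 'g, 'h) algebroid_scheme \<Rightarrow> ('a, 'g, 'm) comodule \<Rightarrow> 'm set \<Rightarrow> ('a, 'g, 'm set) comodule" where
  "quotient_comodule H M S = module.extend (quotient_module M S) (comodule.fields
     (\<lambda>X. cobar_map H (quotient_module M S) (quotient_proj M S) 1 (coact M (rep X))))"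

definition tensor_relations ::
    "('a, 'r) ring_scheme \<Rightarrow> ('a, 'm, 'c) module_scheme \<Rightarrow> ('a, 'n, 'd) module_scheme \<Rightarrow>
     ('m \<times> 'n \<Rightarrow>\<^sub>0 int) set" where
  "tensor_relations A M N =
     {frag_of (x \<oplus>\<^bsub>M\<^esub> x', y) - frag_of (x, y) - frag_of (x', y)
        | x x' y. x \<in> carrier M \<and> x' \<in> carrier M \<and> y \<in> carrier N}
   \<union> {frag_of (x, y \<oplus>\<^bsub>N\<^esub> y') - frag_of (x, y) - frag_of (x, y')
        | x y y'. x \<in> carrier M \<and> y \<in> carrier N \<and> y' \<in> carrier N}
   \<union> {frag_of (a \<odot>\<^bsub>M\<^esub> x, y) - frag_of (x, a \<odot>\<^bsub>N\<^esub> y)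
        | a x y. a \<in> carrier A \<and> x \<in> carrier M \<and> y \<in> carrier N}"

definition tensor_null ::
    "('a, 'r) ring_scheme \<Rightarrow> ('a, 'm, 'c) module_scheme \<Rightarrow> ('a, 'n, 'd) module_scheme \<Rightarrow>
     ('m \<times> 'n \<Rightarrow>\<^sub>0 int) set" where
  "tensor_null A M N =
     generate (free_Abelian_group (carrier M \<times> carrier N)) (tensor_relations A M N)"

definition tensor_class ::
    "('a, 'r) ring_scheme \<Rightarrow> ('a, 'm, 'c) module_scheme \<Rightarrow> ('a, 'n, 'd) module_scheme \<Rightarrow>
     ('m \<times> 'n \<Rightarrow>\<^sub>0 int) \<Rightarrow> ('m \<times> 'n \<Rightarrow>\<^sub>0 int) set" where
  "tensor_class A M N c = tensor_null A M N #>\<^bsub>free_Abelian_group (carrier M \<times> carrier N)\<^esub> c"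

definition tensor_module ::
    "('a, 'r) ring_scheme \<Rightarrow> ('a, 'm, 'c) module_scheme \<Rightarrow> ('a, 'n, 'd) module_scheme \<Rightarrow>
     ('a, ('m \<times> 'n \<Rightarrow>\<^sub>0 int) set) module" where
  "tensor_module A M N =
     (let Q = free_Abelian_group (carrier M \<times> carrier N) Mod tensor_null A M N in
      \<lparr>carrier = carrier Q, monoid.mult = undefined, one = undefined,
       zero = \<one>\<^bsub>Q\<^esub>, add = (\<otimes>\<^bsub>Q\<^esub>),
       smult = (\<lambda>a X. tensor_class A M N
                  (frag_extend (\<lambda>(x, y). frag_of (a \<odot>\<^bsub>M\<^esub> x, y)) (rep X)))\<rparr>)"

text \<open>
  The diagonal coaction: if \<open>\<psi>(x) = \<Sum> x' \<otimes> x''\<close> and \<open>\<psi>(y) = \<Sum> y' \<otimes> y''\<close>, then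
  \<open>\<psi>(x \<otimes> y) = \<Sum> x'y' \<otimes> (x'' \<otimes> y'')\<close>.  The lists \<open>gs\<close> and \<open>hs\<close> below have length one.
\<close>

definition tensor_comodule ::
    "('a, 'g, 'h) algebroid_scheme \<Rightarrow> ('a, 'g, 'm) comodule \<Rightarrow> ('a, 'g, 'n) comodule \<Rightarrow>
     ('a, 'g, ('m \<times> 'n \<Rightarrow>\<^sub>0 int) set) comodule" where
  "tensor_comodule H M N =
     module.extend (tensor_module (base H) M N) (comodule.fields
       (\<lambda>X. cobar_class H (tensor_module (base H) M N) 1
          (frag_extend (\<lambda>(x, y).
             frag_extend (\<lambda>(gs, x'').
               frag_extend (\<lambda>(hs, y'').
                 frag_of ([hd gs \<otimes>\<^bsub>total H\<^esub> hd hs],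
                          tensor_class (base H) M N (frag_of (x'', y''))))
                 (rep (coact N y)))
               (rep (coact M x)))
             (rep X))))"

definition tensor_map_right ::
    "('a, 'r) ring_scheme \<Rightarrow> ('a, 'm, 'c) module_scheme \<Rightarrow> ('a, 'n, 'd) module_scheme \<Rightarrow>
     ('k \<Rightarrow> 'n) \<Rightarrow> ('m \<times> 'k \<Rightarrow>\<^sub>0 int) set \<Rightarrow> ('m \<times> 'n \<Rightarrow>\<^sub>0 int) set" where
  "tensor_map_right A M N f X =
     tensor_class A M N (frag_extend (\<lambda>(x, y). frag_of (x, f y)) (rep X))"

section \<open>The Hopf algebroid of Brown-Peterson homology\<close>

text \<open>
  Polynomials are finitely supported functions on monomials.  All rings below sit inside the
  rational polynomial ring in \<open>v\<^sub>i\<close>, \<open>t\<^sub>i\<close> and a second copy \<open>u\<^sub>i\<close> of the \<open>t\<^sub>i\<close>, which is used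
  for \<open>1 \<otimes> t\<^sub>i\<close>.  The variables with index 0 are not used.
\<close>

datatype gen = V nat | T nat | U nat

type_synonym qpoly = "(gen \<Rightarrow>\<^sub>0 nat) \<Rightarrow>\<^sub>0 rat"

definition qconst :: "rat \<Rightarrow> qpoly" where
  "qconst c = Poly_Mapping.single 0 c"

definition qvar :: "gen \<Rightarrow> qpoly" where
  "qvar x = Poly_Mapping.single (Poly_Mapping.single x 1) 1"

definition qsubst :: "(gen \<Rightarrow> qpoly) \<Rightarrow> qpoly \<Rightarrow> qpoly" where
  "qsubst \<sigma> f = (\<Sum>e\<in>Poly_Mapping.keys f. qconst (Poly_Mapping.lookup f e) *
     (\<Prod>x\<in>Poly_Mapping.keys e. \<sigma> x ^ Poly_Mapping.lookup e x))"

definition polys_over :: "rat set \<Rightarrow> gen set \<Rightarrow> qpoly set" where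
  "polys_over C S = {f. \<forall>e\<in>Poly_Mapping.keys f. Poly_Mapping.lookup f e \<in> C \<and> Poly_Mapping.keys e \<subseteq> S}"

definition subring_of_qpoly :: "qpoly set \<Rightarrow> qpoly ring" where
  "subring_of_qpoly S = \<lparr>carrier = S, monoid.mult = (*), one = 1, zero = 0, add = (+)\<rparr>"

definition Z_local :: "nat \<Rightarrow> rat set" where
  "Z_local p = {of_int a / of_int b | a b. \<not> int p dvd b}"

definition BP :: "nat \<Rightarrow> qpoly set" where
  "BP p = polys_over (Z_local p) (V ` {1..})"

definition BP_rational :: "qpoly set" where
  "BP_rational = polys_over UNIV (V ` {1..})"

definition BPBP :: "nat \<Rightarrow> qpoly set" where
  "BPBP p = polys_over (Z_local p) (V ` {1..} \<union> T ` {1..})"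

definition A_sub :: "nat \<Rightarrow> nat \<Rightarrow> qpoly set" where
  "A_sub p m = polys_over (Z_local p) (V ` {1..m})"

fun ell :: "nat \<Rightarrow> nat \<Rightarrow> qpoly" where
  "ell p n = (if n = 0 then 1
     else qconst (1 / of_nat p) * (\<Sum>j<n. ell p j * qvar (V (n - j)) ^ (p ^ j)))"

declare ell.simps [simp del]

definition t_gen :: "nat \<Rightarrow> qpoly" where
  "t_gen n = (if n = 0 then 1 else qvar (T n))"

definition u_gen :: "nat \<Rightarrow> qpoly" where
  "u_gen n = (if n = 0 then 1 else qvar (U n))"

text \<open>\<open>\<eta>\<^sub>R(\<ell>\<^sub>n) = \<Sum>\<^sub>i \<ell>\<^sub>i t\<^sub>n\<^sub>-\<^sub>i\<^bsup>p^i\<^esup>\<close> with \<open>t\<^sub>0 = 1\<close>.\<close>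

definition eta_R_ell :: "nat \<Rightarrow> nat \<Rightarrow> qpoly" where
  "eta_R_ell p n = (\<Sum>i\<le>n. ell p i * t_gen (n - i) ^ (p ^ i))"

text \<open>
  The right unit on \<open>v\<^sub>n\<close>, \<open>n \<ge> 1\<close>, obtained by applying it to
  \<open>p \<ell>\<^sub>n = \<Sum>\<^sub>0\<^sub>\<le>\<^sub>j\<^sub><\<^sub>n \<ell>\<^sub>j v\<^sub>n\<^sub>-\<^sub>j\<^bsup>p^j\<^esup>\<close> and solving for the summand with \<open>j = 0\<close>.
\<close>

fun eta_R_v :: "nat \<Rightarrow> nat \<Rightarrow> qpoly" where
  "eta_R_v p n = of_nat p * eta_R_ell p n
     - (\<Sum>j\<in>{1..<n}. eta_R_ell p j * eta_R_v p (n - j) ^ (p ^ j))"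

declare eta_R_v.simps [simp del]

definition eta_R :: "nat \<Rightarrow> qpoly \<Rightarrow> qpoly" where
  "eta_R p = qsubst (\<lambda>x. case x of V n \<Rightarrow> eta_R_v p n | _ \<Rightarrow> qvar x)"

text \<open>
  The image of \<open>\<Delta>(t\<^sub>n)\<close> in the rational polynomial ring in \<open>v\<close>, \<open>t\<close>, \<open>u\<close>, from
  \<open>\<Sum>\<^sub>i \<ell>\<^sub>i \<Delta>(t\<^sub>n\<^sub>-\<^sub>i)\<^bsup>p^i\<^esup> = \<Sum>\<^sub>i\<^sub>+\<^sub>j\<^sub>+\<^sub>k\<^sub>=\<^sub>n \<ell>\<^sub>i t\<^sub>j\<^bsup>p^i\<^esup> \<otimes> t\<^sub>k\<^bsup>p^(i+j)\<^esup>\<close>.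
\<close>

fun Delta_t :: "nat \<Rightarrow> nat \<Rightarrow> qpoly" where
  "Delta_t p n =
     (\<Sum>i\<le>n. \<Sum>j\<le>n - i. ell p i * t_gen j ^ (p ^ i) * u_gen (n - i - j) ^ (p ^ (i + j)))
     - (\<Sum>i\<in>{1..n}. ell p i * Delta_t p (n - i) ^ (p ^ i))"

declare Delta_t.simps [simp del]

definition Delta_rational :: "nat \<Rightarrow> qpoly \<Rightarrow> qpoly" where
  "Delta_rational p = qsubst (\<lambda>x. case x of T n \<Rightarrow> Delta_t p n | _ \<Rightarrow> qvar x)"

text \<open>
  The map \<open>BP\<^sub>*(BP) \<otimes> BP\<^sub>*(BP) \<rightarrow> \<rat>[v, t, u]\<close>, \<open>x \<otimes> y \<mapsto> x \<cdot> y(\<eta>\<^sub>R(v), u)\<close> (on formal sums).  On the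
  tensor product over \<open>BP\<^sub>*\<close> it is injective, so that \<open>\<Delta>(x)\<close> is determined by its image.
\<close>

definition eval_tensor :: "nat \<Rightarrow> (qpoly list \<times> qpoly \<Rightarrow>\<^sub>0 int) \<Rightarrow> qpoly" where
  "eval_tensor p c = (\<Sum>w\<in>Poly_Mapping.keys c. of_int (Poly_Mapping.lookup c w) *
     (hd (fst w) * qsubst (\<lambda>x. case x of V n \<Rightarrow> eta_R_v p n | T n \<Rightarrow> qvar (U n) | U n \<Rightarrow> qvar x) (snd w)))"

definition BPBP_algebroid :: "nat \<Rightarrow> (qpoly, qpoly) algebroid" where
  "BPBP_algebroid p =
     \<lparr>base = subring_of_qpoly (BP p), total = subring_of_qpoly (BPBP p), lunit = id, runit = eta_R p\<rparr>"

definition BPBP_comult :: "nat \<Rightarrow> qpoly \<Rightarrow> (qpoly list \<times> qpoly \<Rightarrow>\<^sub>0 int) set" where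
  "BPBP_comult p x =
     (let H = BPBP_algebroid p; M = total_module H in
      cobar_class H M 1 (SOME c. c \<in> carrier (free_Abelian_group (cobar_words H M 1)) \<and>
                                 eval_tensor p c = Delta_rational p x))"

text \<open>\<open>\<Gamma>(k) = BP\<^sub>*(BP) / (t\<^sub>1, \<dots>, t\<^sub>k\<^sub>-\<^sub>1)\<close>; its elements are cosets.\<close>

definition Gamma_ideal :: "nat \<Rightarrow> nat \<Rightarrow> qpoly set" where
  "Gamma_ideal p k = genideal (subring_of_qpoly (BPBP p)) (t_gen ` {1..<k})"

definition Gamma_proj :: "nat \<Rightarrow> nat \<Rightarrow> qpoly \<Rightarrow> qpoly set" where
  "Gamma_proj p k x = Gamma_ideal p k +>\<^bsub>subring_of_qpoly (BPBP p)\<^esub> x"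

definition Gamma_algebroid :: "nat \<Rightarrow> nat \<Rightarrow> (qpoly, qpoly set) algebroid" where
  "Gamma_algebroid p k =
     \<lparr>base = subring_of_qpoly (BP p),
      total = subring_of_qpoly (BPBP p) Quot Gamma_ideal p k,
      lunit = Gamma_proj p k,
      runit = (\<lambda>a. Gamma_proj p k (eta_R p a))\<rparr>"

definition Gamma :: "nat \<Rightarrow> nat \<Rightarrow> (qpoly, qpoly set) hopf_algebroid" where
  "Gamma p k = algebroid.extend (Gamma_algebroid p k) (hopf_algebroid.fields
     (\<lambda>X. cobar_class (Gamma_algebroid p k) (total_module (Gamma_algebroid p k)) 1
        (frag_extend (\<lambda>(gs, g). frag_of (map (Gamma_proj p k) gs, Gamma_proj p k g))
          (rep (BPBP_comult p (rep X))))))"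

section \<open>The comodules\<close>

text \<open>\<open>T_comod p m i\<close> is \<open>T\<^sub>m\<^sup>(\<^sup>i\<^sup>)\<close>, the \<open>BP\<^sub>*\<close>-span of \<open>t\<^sub>m\<^sub>+\<^sub>1\<^sup>l\<close>, \<open>l < p\<^sup>i\<close>, in \<open>\<Gamma>(m+1)\<close>.\<close>

definition T_comod :: "nat \<Rightarrow> nat \<Rightarrow> nat \<Rightarrow> (qpoly, qpoly set, qpoly set) comodule" where
  "T_comod p m i = subcomodule (Gamma p (m + 1)) (total_comodule (Gamma p (m + 1)))
     {Gamma_proj p (m + 1) (\<Sum>l<p ^ i. a l * t_gen (m + 1) ^ l) | a. \<forall>l. a l \<in> BP p}"

text \<open>
  The coaction on \<open>\<rat> \<otimes> BP\<^sub>*\<close> is the rational extension of the coaction \<open>a \<mapsto> \<eta>\<^sub>L(a) \<otimes> 1\<close> on \<open>BP\<^sub>*\<close>: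
  if \<open>N x \<in> BP\<^sub>*\<close> with \<open>N > 0\<close>, then \<open>x \<mapsto> \<eta>\<^sub>L(N x) \<otimes> 1/N\<close>.
\<close>

definition rational_module :: "(qpoly, qpoly) module" where
  "rational_module = ring.extend (subring_of_qpoly BP_rational) (module.fields (*))"

definition rational_comod :: "nat \<Rightarrow> nat \<Rightarrow> (qpoly, qpoly set, qpoly) comodule" where
  "rational_comod p k = module.extend rational_module (comodule.fields
     (\<lambda>x. let N = (SOME N::nat. N > 0 \<and> of_nat N * x \<in> BP p) in
        cobar_class (Gamma p k) rational_module 1
          (frag_of ([lunit (Gamma p k) (of_nat N * x)], qconst (1 / of_nat N)))))"

text \<open>
  The elements \<open>\<ell>^\<^sub>k\<close> and \<open>\<lambda>^\<^sub>k\<close>.  \<open>\<ell>^\<^sub>k\<close> is \<open>\<ell>\<^sub>m\<^sub>+\<^sub>k\<close> without the terms that only involve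
  \<open>v\<^sub>1, \<dots>, v\<^sub>m\<close>.  These terms lie in \<open>\<rat> \<otimes> A(m)\<close>, hence are primitive, but they are not in
  \<open>A(m)\<close>: for \<open>m = 1\<close>, \<open>\<ell>\<^sub>2 = v\<^sub>2/p + v\<^sub>1\<^bsup>p+1\<^esup>/p^2\<close>.  If they were kept, then \<open>A(m)[\<lambda>^\<^sub>1, \<dots>]\<close> would
  not contain \<open>v\<^sub>m\<^sub>+\<^sub>1\<close> and would not be a \<open>BP\<^sub>*\<close>-submodule of \<open>\<rat> \<otimes> BP\<^sub>*\<close>.  As it is,
  \<open>\<lambda>^\<^sub>1 = v\<^sub>m\<^sub>+\<^sub>1/p\<close>.
\<close>

definition hat_ell :: "nat \<Rightarrow> nat \<Rightarrow> nat \<Rightarrow> qpoly" where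
  "hat_ell p m k = ell p (m + k)
     - qsubst (\<lambda>x. case x of V n \<Rightarrow> if n \<le> m then qvar (V n) else 0 | _ \<Rightarrow> qvar x) (ell p (m + k))"

fun hat_lambda :: "nat \<Rightarrow> nat \<Rightarrow> nat \<Rightarrow> qpoly" where
  "hat_lambda p m k =
     hat_ell p m k - (\<Sum>j\<in>{1..<k}. ell p j * hat_lambda p m (k - j) ^ (p ^ j))"

declare hat_lambda.simps [simp del]

text \<open>\<open>D0_comod p m\<close> and \<open>E1_comod p m\<close> are \<open>D\<^sup>0\<^sub>m\<^sub>+\<^sub>1\<close> and \<open>E\<^sup>1\<^sub>m\<^sub>+\<^sub>1\<close>, over \<open>\<Gamma>(m+1)\<close>.\<close>

definition D0_comod :: "nat \<Rightarrow> nat \<Rightarrow> (qpoly, qpoly set, qpoly) comodule" where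
  "D0_comod p m = subcomodule (Gamma p (m + 1)) (rational_comod p (m + 1))
     (generate_ring (subring_of_qpoly BP_rational) (A_sub p m \<union> hat_lambda p m ` {1..}))"

definition E1_comod :: "nat \<Rightarrow> nat \<Rightarrow> (qpoly, qpoly set, qpoly set) comodule" where
  "E1_comod p m = quotient_comodule (Gamma p (m + 1)) (D0_comod p m) (BP p)"

definition T_D0 :: "nat \<Rightarrow> nat \<Rightarrow> nat \<Rightarrow> (qpoly, qpoly set, (qpoly set \<times> qpoly \<Rightarrow>\<^sub>0 int) set) comodule" where
  "T_D0 p m i = tensor_comodule (Gamma p (m + 1)) (T_comod p m i) (D0_comod p m)"

definition T_E1 :: "nat \<Rightarrow> nat \<Rightarrow> nat \<Rightarrow> (qpoly, qpoly set, (qpoly set \<times> qpoly set \<Rightarrow>\<^sub>0 int) set) comodule" where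
  "T_E1 p m i = tensor_comodule (Gamma p (m + 1)) (T_comod p m i) (E1_comod p m)"

definition d1 ::
    "nat \<Rightarrow> nat \<Rightarrow> nat \<Rightarrow>
     (qpoly set list \<times> (qpoly set \<times> qpoly \<Rightarrow>\<^sub>0 int) set \<Rightarrow>\<^sub>0 int) set set \<Rightarrow>
     (qpoly set list \<times> (qpoly set \<times> qpoly set \<Rightarrow>\<^sub>0 int) set \<Rightarrow>\<^sub>0 int) set set" where
  "d1 p m i = Ext_comod_map (Gamma p (m + 1)) (T_E1 p m i)
     (tensor_map_right (base (Gamma p (m + 1))) (T_comod p m i) (E1_comod p m)
        (quotient_proj (D0_comod p m) (BP p))) 0"

end

theory Submission
  imports Defs "HOL-Library.Function_Algebras"
begin

text \<open>
  Over the rationals a point of \<open>BP\<^sub>*\<close> over a fixed \<open>(v\<^sub>1, \<dots>, v\<^sub>m)\<close> is given by the coordinates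
  \<open>\<lambda>^\<^sub>1, \<lambda>^\<^sub>2, \<dots>\<close>, and between two such points there is exactly one morphism of \<open>\<Gamma>(m+1)\<close>.  Hence a cochain
  of degree \<open>s\<close> is a function of \<open>s + 1\<close> points, and the cobar differential is the alternating sum
  over the omissions of a point.  For \<open>T \<otimes> D\<^sup>0\<close> an additional point \<open>w\<close> enters as a parameter, with
  \<open>t\<^sub>m\<^sub>+\<^sub>1 = w\<^sub>1 - \<lambda>^\<^sub>1\<close>; the cochains are exactly the functions \<open>\<Sum> f\<^sub>l w\<^sub>1\<^sup>l\<close>, \<open>l < p\<^sup>i\<close>, where \<open>f\<^sub>l\<close> is a
  polynomial over the \<open>p\<close>-local integers in \<open>v\<^sub>1, \<dots>, v\<^sub>m\<close> and the coordinates of all points.  That these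
  polynomials are the right ones is an integrality statement about \<open>p\<close>-typical sums, proved with Dwork's
  lemma.  Inserting the point with \<open>\<lambda>^ = 0\<close> contracts this complex in positive degrees, so that
  \<open>T \<otimes> D\<^sup>0\<close> has no higher Ext.  The cochains of \<open>T\<close> form a subcomplex, and those of \<open>T \<otimes> E\<^sup>1\<close> are the
  quotient; the theorem is read off from the long exact sequence.
\<close>

text \<open>An element of a group in the statement is a coset of formal sums, and maps out of it are
  applied to chosen representatives, so everything depends on a test for a formal sum to be null.
  Functions supply it because \<Gamma>(m+1) is free over BP_*, acting through the right unit, on the
  monomials in \<open>t_(m+1), t_(m+2), ...\<close>: scalars are pushed to the right until only
  basis words are left, and the coefficients are read off by moving the leftmost point while the
  others stay fixed. As E^1 is a quotient, the test is made modulo a group \<open>K\<close> of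
  functions. The obstacle is integrality. The coordinates \<lambda>^ are not in BP_*, and the
  formulas that relate them to v and t have denominators p. Passing from two points to the morphism
  between them, and from the morphism and its target back to the source, must both be p-locally
  integral: the former bounds the cochains of T \<otimes> D^0 from above, the latter shows that
  every polynomial occurs. The contraction exists on this larger complex only:
  \<open>t_(m+1)\<close> from a point to the origin is \<open>- \<lambda>^_1\<close>, which lies in
  D^0 but not in BP_*.\<close>

definition flin :: "('w \<Rightarrow> 'r::comm_ring_1) \<Rightarrow> ('w \<Rightarrow>\<^sub>0 int) \<Rightarrow> 'r" where
  "flin f c = (\<Sum>w\<in>Poly_Mapping.keys c. of_int (Poly_Mapping.lookup c w) * f w)"

lemma flin_superset:
  assumes "finite S" "Poly_Mapping.keys c \<subseteq> S"
  shows "flin f c = (\<Sum>w\<in>S. of_int (Poly_Mapping.lookup c w) * f w)"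
  unfolding flin_def
  by (rule sum.mono_neutral_left) (use assms in \<open>auto simp: in_keys_iff\<close>)

lemma flin_0 [simp]: "flin f 0 = 0"
  by (simp add: flin_def)

lemma flin_of [simp]: "flin f (frag_of w) = f w"
  by (simp add: flin_def)

lemma flin_add: "flin f (c + d) = flin f c + flin f d"
proof -
  let ?S = "Poly_Mapping.keys c \<union> Poly_Mapping.keys d"
  show ?thesis
    by (subst (1 2 3) flin_superset[of ?S])
      (use keys_add[of c d] in \<open>auto simp: lookup_add ring_distribs sum.distrib\<close>)
qed

lemma flin_cmul: "flin f (frag_cmul k c) = of_int k * flin f c"
  by (subst (1 2) flin_superset[of "Poly_Mapping.keys c"])
    (auto simp: sum_distrib_left mult.assoc)

lemma flin_uminus: "flin f (- c) = - flin f c"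
  using flin_cmul[of f "-1" c] by simp

lemma flin_diff: "flin f (c - d) = flin f c - flin f d"
  using flin_add[of f c "- d"] by (simp add: flin_uminus)

lemma flin_sum: "flin f (\<Sum>i\<in>I. c i) = (\<Sum>i\<in>I. flin f (c i))"
  by (induction I rule: infinite_finite_induct) (auto simp: flin_add)

lemma flin_frag_extend: "flin f (frag_extend b c) = flin (\<lambda>w. flin f (b w)) c"
proof -
  have "Poly_Mapping.keys c \<subseteq> UNIV" by simp
  then show ?thesis
    by (induction c rule: frag_induction) (auto simp: frag_extend_diff flin_diff)
qed

lemma flin_cong: "(\<And>w. w \<in> Poly_Mapping.keys c \<Longrightarrow> f w = g w) \<Longrightarrow> flin f c = flin g c"
  unfolding flin_def by (rule sum.cong) auto

lemma flin_in:
  assumes "\<And>w. w \<in> Poly_Mapping.keys c \<Longrightarrow> f w \<in> X"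
    and "0 \<in> X" "\<And>x y. x \<in> X \<Longrightarrow> y \<in> X \<Longrightarrow> x - y \<in> X"
  shows "flin f c \<in> X"
proof -
  have "Poly_Mapping.keys c \<subseteq> {w. f w \<in> X}" using assms(1) by auto
  then show ?thesis
    by (induction c rule: frag_induction) (use assms in \<open>auto simp: flin_diff\<close>)
qed

lemma flin_hom:
  assumes "h 0 = 0" and "\<And>x y. h (x - y) = h x - h y"
  shows "h (flin f c) = flin (\<lambda>w. h (f w)) c"
proof -
  have "Poly_Mapping.keys c \<subseteq> UNIV" by simp
  then show ?thesis
    by (induction c rule: frag_induction) (auto simp: assms flin_diff)
qed

lemma flin_mult_left: "flin (\<lambda>w. x * f w) c = x * flin f c"
  by (rule flin_hom[symmetric]) (auto simp: algebra_simps)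

lemma flin_mult_right: "flin (\<lambda>w. f w * x) c = flin f c * x"
  by (rule flin_hom[symmetric, where h = "\<lambda>y. y * x"]) (auto simp: algebra_simps)


section \<open>Polynomials as functions on rational points\<close>

definition mon :: "('x \<Rightarrow> rat) \<Rightarrow> ('x \<Rightarrow>\<^sub>0 nat) \<Rightarrow> rat" where
  "mon \<rho> e = (\<Prod>x\<in>Poly_Mapping.keys e. \<rho> x ^ Poly_Mapping.lookup e x)"

definition ev :: "('x \<Rightarrow> rat) \<Rightarrow> (('x \<Rightarrow>\<^sub>0 nat) \<Rightarrow>\<^sub>0 rat) \<Rightarrow> rat" where
  "ev \<rho> f = (\<Sum>e\<in>Poly_Mapping.keys f. Poly_Mapping.lookup f e * mon \<rho> e)"

lemma mon_superset:
  assumes "finite S" "Poly_Mapping.keys e \<subseteq> S"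
  shows "mon \<rho> e = (\<Prod>x\<in>S. \<rho> x ^ Poly_Mapping.lookup e x)"
  unfolding mon_def
  by (rule prod.mono_neutral_left) (use assms in \<open>auto simp: in_keys_iff\<close>)

lemma mon_0 [simp]: "mon \<rho> 0 = 1"
  by (simp add: mon_def)

lemma mon_single [simp]: "mon \<rho> (Poly_Mapping.single x n) = \<rho> x ^ n"
  by (simp add: mon_def)

lemma mon_add: "mon \<rho> (e + e') = mon \<rho> e * mon \<rho> e'"
proof -
  let ?S = "Poly_Mapping.keys e \<union> Poly_Mapping.keys e'"
  show ?thesis
    by (subst (1 2 3) mon_superset[of ?S])
      (use keys_add[of e e'] in \<open>auto simp: lookup_add power_add prod.distrib\<close>)
qed

lemma mon_times: "mon (\<lambda>x. \<rho> x * \<tau> x) e = mon \<rho> e * mon \<tau> e"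
  by (simp add: mon_def power_mult_distrib prod.distrib)

lemma mon_one [simp]: "mon (\<lambda>x. 1) e = 1"
  by (simp add: mon_def)

lemma mon_cong: "(\<And>x. x \<in> Poly_Mapping.keys e \<Longrightarrow> \<rho> x = \<tau> x) \<Longrightarrow> mon \<rho> e = mon \<tau> e"
  by (simp add: mon_def)

lemma ev_superset:
  assumes "finite S" "Poly_Mapping.keys f \<subseteq> S"
  shows "ev \<rho> f = (\<Sum>e\<in>S. Poly_Mapping.lookup f e * mon \<rho> e)"
  unfolding ev_def
  by (rule sum.mono_neutral_left) (use assms in \<open>auto simp: in_keys_iff\<close>)

lemma ev_0 [simp]: "ev \<rho> 0 = 0"
  by (simp add: ev_def)

lemma ev_single [simp]: "ev \<rho> (Poly_Mapping.single e c) = c * mon \<rho> e"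
  by (cases "c = 0") (auto simp: ev_def)

lemma ev_1 [simp]: "ev \<rho> 1 = 1"
  by (metis ev_single mon_0 mult_1 single_one)

lemma ev_add: "ev \<rho> (f + g) = ev \<rho> f + ev \<rho> g"
proof -
  let ?S = "Poly_Mapping.keys f \<union> Poly_Mapping.keys g"
  show ?thesis
    by (subst (1 2 3) ev_superset[of ?S])
      (use keys_add[of f g] in \<open>auto simp: lookup_add ring_distribs sum.distrib\<close>)
qed

lemma ev_uminus: "ev \<rho> (- f) = - ev \<rho> f"
  using ev_add[of \<rho> f "- f"] by simp

lemma ev_diff: "ev \<rho> (f - g) = ev \<rho> f - ev \<rho> g"
  using ev_add[of \<rho> f "- g"] by (simp add: ev_uminus)

lemma ev_sum: "ev \<rho> (\<Sum>i\<in>I. f i) = (\<Sum>i\<in>I. ev \<rho> (f i))"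
  by (induction I rule: infinite_finite_induct) (auto simp: ev_add)

lemma poly_mapping_sum_single:
  "f = (\<Sum>e\<in>Poly_Mapping.keys f. Poly_Mapping.single e (Poly_Mapping.lookup f e))"
proof (rule poly_mapping_eqI)
  fix k
  have "(\<Sum>e\<in>Poly_Mapping.keys f. Poly_Mapping.lookup (Poly_Mapping.single e (Poly_Mapping.lookup f e)) k)
    = (\<Sum>e\<in>Poly_Mapping.keys f. if e = k then Poly_Mapping.lookup f e else 0)"
    by (rule sum.cong) (auto simp: lookup_single)
  also have "\<dots> = Poly_Mapping.lookup f k"
    by (simp add: sum.delta in_keys_iff)
  finally show "Poly_Mapping.lookup f k =
      Poly_Mapping.lookup (\<Sum>e\<in>Poly_Mapping.keys f. Poly_Mapping.single e (Poly_Mapping.lookup f e)) k"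
    by (simp add: lookup_sum)
qed

lemma poly_mapping_mult_expand:
  fixes f g :: "('x::monoid_add) \<Rightarrow>\<^sub>0 ('c::comm_semiring_1)"
  shows "f * g = (\<Sum>e\<in>Poly_Mapping.keys f. \<Sum>e'\<in>Poly_Mapping.keys g.
     Poly_Mapping.single (e + e') (Poly_Mapping.lookup f e * Poly_Mapping.lookup g e'))"
proof -
  have "f * g = (\<Sum>e\<in>Poly_Mapping.keys f. Poly_Mapping.single e (Poly_Mapping.lookup f e)) *
      (\<Sum>e'\<in>Poly_Mapping.keys g. Poly_Mapping.single e' (Poly_Mapping.lookup g e'))"
    using poly_mapping_sum_single[of f] poly_mapping_sum_single[of g] by simp
  then show ?thesis
    by (simp add: sum_product mult_single)
qed

lemma ev_mult: "ev \<rho> (f * g) = ev \<rho> f * ev \<rho> g"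
proof -
  have "ev \<rho> (f * g) = (\<Sum>e\<in>Poly_Mapping.keys f. \<Sum>e'\<in>Poly_Mapping.keys g.
      (Poly_Mapping.lookup f e * mon \<rho> e) * (Poly_Mapping.lookup g e' * mon \<rho> e'))"
    by (subst poly_mapping_mult_expand) (simp add: ev_sum mon_add mult.assoc mult.left_commute)
  then show ?thesis
    by (simp add: ev_def sum_product)
qed

lemma ev_power: "ev \<rho> (f ^ n) = ev \<rho> f ^ n"
  by (induction n) (auto simp: ev_mult)

lemma ev_prod: "ev \<rho> (\<Prod>i\<in>I. f i) = (\<Prod>i\<in>I. ev \<rho> (f i))"
  by (induction I rule: infinite_finite_induct) (auto simp: ev_mult)

lemma ev_of_nat: "ev \<rho> (of_nat n) = of_nat n"
  by (metis ev_single mon_0 mult.right_neutral single_of_nat)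

lemma ev_qconst [simp]: "ev \<rho> (qconst c) = c"
  by (simp add: qconst_def)

lemma ev_qvar [simp]: "ev \<rho> (qvar x) = \<rho> x"
  by (simp add: qvar_def)

lemma ev_qsubst: "ev \<rho> (qsubst \<sigma> f) = ev (\<lambda>x. ev \<rho> (\<sigma> x)) f"
  unfolding qsubst_def
  by (simp add: ev_sum ev_mult ev_prod ev_power) (simp add: ev_def mon_def)

lemma ev_cong:
  "(\<And>x. x \<in> (\<Union>e\<in>Poly_Mapping.keys f. Poly_Mapping.keys e) \<Longrightarrow> \<rho> x = \<tau> x) \<Longrightarrow> ev \<rho> f = ev \<tau> f"
  unfolding ev_def by (intro sum.cong refl arg_cong2[where f = "(*)"] mon_cong) auto

lemma ev_flin: "ev \<rho> (flin f c) = flin (\<lambda>w. ev \<rho> (f w)) c"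
  by (rule flin_hom) (auto simp: ev_diff)

section \<open>Independence of monomials, as distinct characters of the multiplicative monoid of
  points\<close>

lemma characters_independent:
  fixes \<chi> :: "'e \<Rightarrow> ('x \<Rightarrow> rat) \<Rightarrow> rat"
  assumes mult: "\<And>e x y. e \<in> F \<Longrightarrow> x \<in> X \<Longrightarrow> y \<in> X \<Longrightarrow> \<chi> e (\<lambda>i. x i * y i) = \<chi> e x * \<chi> e y"
    and closed: "\<And>x y. x \<in> X \<Longrightarrow> y \<in> X \<Longrightarrow> (\<lambda>i. x i * y i) \<in> X"
    and one: "(\<lambda>_. 1) \<in> X" "\<And>e. e \<in> F \<Longrightarrow> \<chi> e (\<lambda>_. 1) = 1"
    and distinct: "\<And>e e'. e \<in> F \<Longrightarrow> e' \<in> F \<Longrightarrow> e \<noteq> e' \<Longrightarrow> \<exists>x\<in>X. \<chi> e x \<noteq> \<chi> e' x"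
    and fin: "finite F"
    and zero: "\<And>x. x \<in> X \<Longrightarrow> (\<Sum>e\<in>F. c e * \<chi> e x) = 0"
    and e: "e \<in> F"
  shows "c e = 0"
  using fin mult one(2) distinct zero e
proof (induction F arbitrary: c e rule: finite_induct)
  case empty
  then show ?case by simp
next
  case (insert e0 F)
  \<comment> \<open>Dedekind's argument: the relation at the product of x and y, minus
    \<open>\<chi> e0 x\<close> times the relation at y, has no \<open>e0\<close> term left and
    coefficients \<open>c f * (\<chi> f x - \<chi> e0 x)\<close>, so the induction hypothesis
    applies to it.\<close>
  have *: "c f = 0" if f: "f \<in> F" for f
  proof -
    obtain x where x: "x \<in> X" "\<chi> e0 x \<noteq> \<chi> f x"
      using insert.prems(3)[of e0 f] f insert.hyps by auto
    have "c f * (\<chi> f x - \<chi> e0 x) = 0"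
    proof (rule insert.IH[where c = "\<lambda>f. c f * (\<chi> f x - \<chi> e0 x)"])
      fix y assume y: "y \<in> X"
      have "(\<Sum>e\<in>insert e0 F. c e * \<chi> e (\<lambda>i. x i * y i)) - \<chi> e0 x * (\<Sum>e\<in>insert e0 F. c e * \<chi> e y) = 0"
        using insert.prems(4) closed[OF x(1) y] y by simp
      moreover have "(\<Sum>e\<in>F. c e * \<chi> e (\<lambda>i. x i * y i)) = (\<Sum>e\<in>F. c e * (\<chi> e x * \<chi> e y))"
        by (rule sum.cong) (use insert.prems(1) x y in auto)
      moreover have "\<chi> e0 (\<lambda>i. x i * y i) = \<chi> e0 x * \<chi> e0 y"
        using insert.prems(1) x y by auto
      ultimately show "(\<Sum>e\<in>F. c e * (\<chi> e x - \<chi> e0 x) * \<chi> e y) = 0"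
        using insert.hyps
        by (simp add: ring_distribs sum_subtractf sum_distrib_left mult.assoc mult.left_commute)
    qed (use insert.prems f in auto)
    then show ?thesis using x(2) by simp
  qed
  have "c e0 = 0"
    using insert.prems(4)[OF one(1)] insert.prems(2) insert.hyps * by simp
  then show ?case using * insert.prems(5) by auto
qed

text \<open>The point with value 2 at one variable and 1 elsewhere reads off the exponent of that
  variable.\<close>

lemma mon_distinct:
  assumes "e \<noteq> e'" shows "\<exists>\<rho>. mon \<rho> e \<noteq> mon \<rho> e'"
proof -
  obtain i where i: "Poly_Mapping.lookup e i \<noteq> Poly_Mapping.lookup e' i"
    using assms poly_mapping_eqI[of e e'] by auto
  have "mon (\<lambda>x. if x = i then 2 else 1) d = 2 ^ Poly_Mapping.lookup d i" for d :: "'a \<Rightarrow>\<^sub>0 nat"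
  proof -
    have "mon (\<lambda>x. if x = i then 2 else 1) d
        = (\<Prod>x\<in>insert i (Poly_Mapping.keys d). (if x = i then 2 else 1) ^ Poly_Mapping.lookup d x)"
      by (rule mon_superset) auto
    also have "\<dots> = (\<Prod>x\<in>insert i (Poly_Mapping.keys d). if x = i then 2 ^ Poly_Mapping.lookup d i else 1)"
      by (rule prod.cong) auto
    also have "\<dots> = 2 ^ Poly_Mapping.lookup d i"
      by (subst prod.delta) auto
    finally show ?thesis by simp
  qed
  then show ?thesis using i by (intro exI[of _ "\<lambda>x. if x = i then 2 else 1"]) auto
qed

lemma mon_independent:
  assumes "finite F" "\<And>\<rho>. (\<Sum>e\<in>F. c e * mon \<rho> e) = 0" "e \<in> F"
  shows "c e = (0::rat)"
  by (rule characters_independent[where X = UNIV and F = F and \<chi> = "\<lambda>e \<rho>. mon \<rho> e"])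
    (use assms mon_distinct in \<open>auto simp: mon_times\<close>)

text \<open>Monomials are multiplicative in the point (\<open>mon_times\<close>), so independence of
  characters applies, for any number of variables at once. Identities between polynomials may
  therefore be checked at rational points.\<close>

lemma ev_eq_0:
  assumes "\<And>\<rho>. ev \<rho> f = 0" shows "f = 0"
proof (rule poly_mapping_eqI)
  fix k
  show "Poly_Mapping.lookup f k = Poly_Mapping.lookup 0 k"
    using mon_independent[of "Poly_Mapping.keys f" "Poly_Mapping.lookup f" k] assms
    by (cases "k \<in> Poly_Mapping.keys f") (auto simp: ev_def in_keys_iff)
qed

lemma ev_eqI:
  assumes "\<And>\<rho>. ev \<rho> f = ev \<rho> g" shows "f = g"
  using ev_eq_0[of "f - g"] assms by (simp add: ev_diff)

text \<open>The \<open>C\<close>-algebra of functions generated by \<open>G\<close>. The generators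
  need not be coordinates: right units together with the t's, or coordinates together with values of
  \<open>tseq\<close>, also serve. A change of generators is then an instance of
  \<open>zpoly_subst\<close>, and integrality over other generators is a statement about
  membership.\<close>

inductive_set zpoly :: "rat set \<Rightarrow> ('s \<Rightarrow> rat) set \<Rightarrow> ('s \<Rightarrow> rat) set" for C G where
  const: "c \<in> C \<Longrightarrow> (\<lambda>_. c) \<in> zpoly C G"
| gen: "g \<in> G \<Longrightarrow> g \<in> zpoly C G"
| add: "f \<in> zpoly C G \<Longrightarrow> g \<in> zpoly C G \<Longrightarrow> (\<lambda>x. f x + g x) \<in> zpoly C G"
| mult: "f \<in> zpoly C G \<Longrightarrow> g \<in> zpoly C G \<Longrightarrow> (\<lambda>x. f x * g x) \<in> zpoly C G"

definition ratring :: "rat set \<Rightarrow> bool" where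
  "ratring C \<longleftrightarrow> 1 \<in> C \<and> (\<forall>x\<in>C. \<forall>y\<in>C. x - y \<in> C \<and> x * y \<in> C)"

lemma ratring_0: "ratring C \<Longrightarrow> 0 \<in> C" unfolding ratring_def by (metis diff_self)
lemma ratring_1: "ratring C \<Longrightarrow> 1 \<in> C" unfolding ratring_def by simp
lemma ratring_diff: "ratring C \<Longrightarrow> x \<in> C \<Longrightarrow> y \<in> C \<Longrightarrow> x - y \<in> C" unfolding ratring_def by simp
lemma ratring_mult: "ratring C \<Longrightarrow> x \<in> C \<Longrightarrow> y \<in> C \<Longrightarrow> x * y \<in> C" unfolding ratring_def by simp
lemma ratring_uminus: "ratring C \<Longrightarrow> x \<in> C \<Longrightarrow> - x \<in> C"
  using ratring_diff[OF _ ratring_0] by force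
lemma ratring_add: "ratring C \<Longrightarrow> x \<in> C \<Longrightarrow> y \<in> C \<Longrightarrow> x + y \<in> C"
  using ratring_diff[of C x "- y"] ratring_uminus by force
lemma ratring_of_nat: "ratring C \<Longrightarrow> of_nat n \<in> C"
  by (induction n) (auto intro: ratring_0 ratring_1 ratring_add)
lemma ratring_of_int: "ratring C \<Longrightarrow> of_int n \<in> C"
  by (cases n rule: int_diff_cases) (auto intro: ratring_of_nat ratring_diff)
lemma ratring_UNIV: "ratring UNIV" by (simp add: ratring_def)

lemma zpoly_diff:
  assumes "ratring C" "f \<in> zpoly C G" "g \<in> zpoly C G"
  shows "(\<lambda>x. f x - g x) \<in> zpoly C G"
proof -
  have "(\<lambda>x. f x + (\<lambda>_. -1) x * g x) \<in> zpoly C G"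
    by (intro zpoly.add zpoly.mult zpoly.const assms ratring_uminus ratring_1)
  then show ?thesis by simp
qed

lemma zpoly_sum:
  assumes "ratring C" "\<And>i. i \<in> I \<Longrightarrow> f i \<in> zpoly C G"
  shows "(\<lambda>x. \<Sum>i\<in>I. f i x) \<in> zpoly C G"
  using assms(2)
  by (induction I rule: infinite_finite_induct)
    (auto intro: zpoly.add zpoly.const ratring_0 assms(1))

lemma zpoly_power:
  assumes "ratring C" "f \<in> zpoly C G"
  shows "(\<lambda>x. f x ^ n) \<in> zpoly C G"
  by (induction n) (auto intro: zpoly.mult zpoly.const ratring_1 assms)

lemma zpoly_subst:
  assumes "f \<in> zpoly C G" "\<And>g. g \<in> G \<Longrightarrow> (\<lambda>x. g (h x)) \<in> zpoly C G'"
  shows "(\<lambda>x. f (h x)) \<in> zpoly C G'"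
  using assms(1) by induction (auto intro: zpoly.intros assms(2))

lemma zpoly_mono_const: "f \<in> zpoly C G \<Longrightarrow> C \<subseteq> C' \<Longrightarrow> f \<in> zpoly C' G"
  by (induction rule: zpoly.induct) (auto intro: zpoly.intros)

lemma polys_over_add:
  assumes C: "ratring C" and fg: "f \<in> polys_over C S" "g \<in> polys_over C S"
  shows "f + g \<in> polys_over C S"
proof -
  have *: "Poly_Mapping.lookup h e \<in> C" if "h \<in> polys_over C S" for h e
    using that ratring_0[OF C] by (cases "e \<in> Poly_Mapping.keys h") (auto simp: polys_over_def in_keys_iff)
  show ?thesis
    using fg keys_add[of f g] *[OF fg(1)] *[OF fg(2)]
    by (fastforce simp: polys_over_def lookup_add intro: ratring_add[OF C])
qed

lemma polys_over_sum:
  assumes "ratring C" "\<And>i. i \<in> I \<Longrightarrow> f i \<in> polys_over C S"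
  shows "(\<Sum>i\<in>I. f i) \<in> polys_over C S"
  using assms(2)
proof (induction I rule: infinite_finite_induct)
  case (insert x F)
  then show ?case by (simp add: polys_over_add[OF assms(1)])
qed (simp_all add: polys_over_def)

lemma polys_over_single:
  "c \<in> C \<Longrightarrow> Poly_Mapping.keys e \<subseteq> S \<Longrightarrow> Poly_Mapping.single e c \<in> polys_over C S"
  by (auto simp: polys_over_def lookup_single split: if_splits)

lemma polys_over_mult:
  assumes C: "ratring C" and fg: "f \<in> polys_over C S" "g \<in> polys_over C S"
  shows "f * g \<in> polys_over C S"
proof (subst poly_mapping_mult_expand, intro polys_over_sum[OF C] polys_over_single)
  fix e e' assume e: "e \<in> Poly_Mapping.keys f" "e' \<in> Poly_Mapping.keys g"
  show "Poly_Mapping.lookup f e * Poly_Mapping.lookup g e' \<in> C"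
    using e fg by (auto simp: polys_over_def intro: ratring_mult[OF C])
  show "Poly_Mapping.keys (e + e') \<subseteq> S"
    using e fg keys_add[of e e'] by (fastforce simp: polys_over_def)
qed

lemma polys_over_qconst: "c \<in> C \<Longrightarrow> qconst c \<in> polys_over C S"
  by (simp add: qconst_def polys_over_single)

lemma polys_over_qvar: "ratring C \<Longrightarrow> x \<in> S \<Longrightarrow> qvar x \<in> polys_over C S"
  by (simp add: qvar_def polys_over_single ratring_1)

lemma polys_over_1: "ratring C \<Longrightarrow> 1 \<in> polys_over C S"
  by (metis polys_over_qconst qconst_def ratring_1 single_one)

lemma polys_over_0: "0 \<in> polys_over C S"
  by (simp add: polys_over_def)

lemma polys_over_uminus: "ratring C \<Longrightarrow> f \<in> polys_over C S \<Longrightarrow> - f \<in> polys_over C S"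
  by (auto simp: polys_over_def intro: ratring_uminus)

lemma polys_over_diff:
  "ratring C \<Longrightarrow> f \<in> polys_over C S \<Longrightarrow> g \<in> polys_over C S \<Longrightarrow> f - g \<in> polys_over C S"
  using polys_over_add[of C f S "- g"] polys_over_uminus by force

lemma polys_over_power: "ratring C \<Longrightarrow> f \<in> polys_over C S \<Longrightarrow> f ^ n \<in> polys_over C S"
  by (induction n) (auto intro: polys_over_mult polys_over_1)

lemma polys_over_mono: "C \<subseteq> C' \<Longrightarrow> S \<subseteq> S' \<Longrightarrow> polys_over C S \<subseteq> polys_over C' S'"
  by (fastforce simp: polys_over_def)

lemma zpoly_prod:
  assumes "ratring C" "\<And>i. i \<in> I \<Longrightarrow> f i \<in> zpoly C G"
  shows "(\<lambda>x. \<Prod>i\<in>I. f i x) \<in> zpoly C G"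
  using assms(2)
  by (induction I rule: infinite_finite_induct)
    (auto intro: zpoly.mult zpoly.const ratring_1 assms(1))

lemma zpoly_ev:
  assumes C: "ratring C" and f: "f \<in> polys_over C S"
    and \<rho>: "\<And>x. x \<in> S \<Longrightarrow> (\<lambda>s. \<rho> s x) \<in> zpoly C G"
  shows "(\<lambda>s. ev (\<rho> s) f) \<in> zpoly C G"
  unfolding ev_def mon_def
  by (intro zpoly_sum[OF C] zpoly.mult zpoly.const zpoly_prod[OF C] zpoly_power[OF C] \<rho>)
    (use f in \<open>auto simp: polys_over_def\<close>)

lemma zpoly_imp_ev:
  assumes C: "ratring C" and f: "f \<in> zpoly C ((\<lambda>x \<rho>. \<rho> x) ` S)"
  shows "\<exists>h\<in>polys_over C S. \<forall>\<rho>. ev \<rho> h = f \<rho>"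
  using f
proof induction
  case (const c)
  then show ?case by (intro bexI[of _ "Poly_Mapping.single 0 c"] polys_over_single) auto
next
  case (gen g)
  then obtain x where x: "x \<in> S" "g = (\<lambda>\<rho>. \<rho> x)" by auto
  then show ?case
    by (intro bexI[of _ "Poly_Mapping.single (Poly_Mapping.single x 1) 1"] polys_over_single)
      (auto intro: ratring_1[OF C])
next
  case (add f g)
  then obtain h h' where "h \<in> polys_over C S" "\<forall>\<rho>. ev \<rho> h = f \<rho>" "h' \<in> polys_over C S" "\<forall>\<rho>. ev \<rho> h' = g \<rho>"
    by auto
  then show ?case by (intro bexI[of _ "h + h'"]) (auto simp: ev_add intro: polys_over_add[OF C])
next
  case (mult f g)
  then obtain h h' where "h \<in> polys_over C S" "\<forall>\<rho>. ev \<rho> h = f \<rho>" "h' \<in> polys_over C S" "\<forall>\<rho>. ev \<rho> h' = g \<rho>"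
    by auto
  then show ?case by (intro bexI[of _ "h * h'"]) (auto simp: ev_mult intro: polys_over_mult[OF C])
qed

text \<open>The polynomial built from the algebra expression has the same values as f, hence equals
  f. Integrality of a rational polynomial can thus be proved for its values.\<close>

lemma polys_over_if_zpoly:
  assumes "ratring C" "(\<lambda>\<rho>. ev \<rho> f) \<in> zpoly C ((\<lambda>x \<rho>. \<rho> x) ` S)"
  shows "f \<in> polys_over C S"
  using zpoly_imp_ev[OF assms] ev_eqI by metis

lemma Z_local_ratring:
  assumes "Factorial_Ring.prime p" shows "ratring (Z_local p)"
proof -
  have pr: "Factorial_Ring.prime (int p)" using assms by simp
  have *: "x - y \<in> Z_local p \<and> x * y \<in> Z_local p" if xy: "x \<in> Z_local p" "y \<in> Z_local p" for x y
  proof -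
    obtain a b c d where x: "x = of_int a / of_int b" "\<not> int p dvd b"
      and y: "y = of_int c / of_int d" "\<not> int p dvd d"
      using xy by (auto simp: Z_local_def)
    have bd: "\<not> int p dvd b * d" using x y pr by (auto simp: prime_dvd_mult_iff)
    have nz: "b \<noteq> 0" "d \<noteq> 0" using x y by auto
    have "x - y = of_int (a * d - c * b) / of_int (b * d)" "x * y = of_int (a * c) / of_int (b * d)"
      using nz by (auto simp: x y field_simps)
    then show ?thesis using bd unfolding Z_local_def by blast
  qed
  have "(1::rat) = of_int 1 / of_int 1" by simp
  moreover have "\<not> int p dvd 1"
    using assms prime_gt_1_nat[of p] by auto
  ultimately have "1 \<in> Z_local p" unfolding Z_local_def by blast
  then show ?thesis using * by (auto simp: ratring_def)
qed

section \<open>Integrality of p-typical sums\<close>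

text \<open>\<open>Lf p v n\<close> is the value of \<open>\<ell>\<^sub>n\<close> when the Hazewinkel generators take the values \<open>v\<close>, and
  \<open>Wf p v x n\<close> is then the value of \<open>\<Sum> \<ell>\<^sub>j x\<^sub>n\<^sub>-\<^sub>j\<^bsup>p^j\<^esup>\<close>; in particular \<open>\<eta>\<^sub>R(\<ell>\<^sub>n) = Wf p v t n\<close>.\<close>

fun Lf :: "nat \<Rightarrow> (nat \<Rightarrow> rat) \<Rightarrow> nat \<Rightarrow> rat" where
  "Lf p v n = (if n = 0 then 1 else 1 / of_nat p * (\<Sum>j<n. Lf p v j * v (n - j) ^ (p ^ j)))"

declare Lf.simps [simp del]

lemma Lf_0 [simp]: "Lf p v 0 = 1"
  by (simp add: Lf.simps)

lemma Lf_cong: "(\<And>i. 1 \<le> i \<Longrightarrow> i \<le> n \<Longrightarrow> v i = w i) \<Longrightarrow> Lf p v n = Lf p w n"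
proof (induction n rule: less_induct)
  case (less n)
  show ?case
    by (subst (1 2) Lf.simps) (auto intro!: sum.cong simp: less)
qed

lemma p_Lf: "p > 0 \<Longrightarrow> n > 0 \<Longrightarrow> of_nat p * Lf p v n = (\<Sum>j<n. Lf p v j * v (n - j) ^ (p ^ j))"
  by (subst Lf.simps) simp

definition Wf :: "nat \<Rightarrow> (nat \<Rightarrow> rat) \<Rightarrow> (nat \<Rightarrow> rat) \<Rightarrow> nat \<Rightarrow> rat" where
  "Wf p v x n = (\<Sum>d\<le>n. Lf p v (n - d) * x d ^ (p ^ (n - d)))"

lemma sum_triangle_swap:
  fixes n :: nat
  shows "(\<Sum>j\<in>{1..<n}. \<Sum>i\<in>{1..j}. f i j) = (\<Sum>i\<in>{1..<n}. \<Sum>j\<in>{i..<n}. f i j)"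
  unfolding sum.Sigma[OF finite_atLeastLessThan ballI[OF finite_atLeastAtMost]]
    sum.Sigma[OF finite_atLeastLessThan ballI[OF finite_atLeastLessThan]]
  by (rule sum.reindex_bij_witness[where i = "\<lambda>(a,b). (b,a)" and j = "\<lambda>(a,b). (b,a)"]) auto

lemma sum_shift_lower:
  fixes i n :: nat
  assumes "i \<le> n"
  shows "(\<Sum>j\<in>{i..<n}. f j) = (\<Sum>k<n - i. f (k + i))"
  using sum.shift_bounds_nat_ivl[of f 0 i "n - i"] assms by (simp add: atLeast0LessThan)

lemma lessThan_eq_insert_0: "n > 0 \<Longrightarrow> {..<n} = insert 0 {1..<n::nat}"
  by auto

text \<open>The recursion defining \<open>Lf\<close> splits the last factor off each product in the
  expansion of \<ell>_n; here the first factor v_i / p is split off, and the remaining ones are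
  raised to the power p^i. This is Hazewinkel's functional equation, the form in which a lift of
  Frobenius enters.\<close>

lemma Lf_Frobenius_rec:
  assumes "p > 0" "n > 0"
  shows "Lf p v n = (\<Sum>i\<in>{1..n}. v i / of_nat p * Lf p (\<lambda>j. v j ^ (p ^ i)) (n - i))"
  using \<open>n > 0\<close>
proof (induction n rule: less_induct)
  case (less n)
  have "of_nat p * Lf p v n = v n + (\<Sum>j\<in>{1..<n}. Lf p v j * v (n - j) ^ (p ^ j))"
    using less.prems by (simp add: p_Lf[OF assms(1)] lessThan_eq_insert_0)
  also have "(\<Sum>j\<in>{1..<n}. Lf p v j * v (n - j) ^ (p ^ j))
     = (\<Sum>j\<in>{1..<n}. \<Sum>i\<in>{1..j}. v i / of_nat p * Lf p (\<lambda>j. v j ^ (p ^ i)) (j - i) * v (n - j) ^ (p ^ j))"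
    by (intro sum.cong refl) (simp add: less.IH sum_distrib_right)
  also have "\<dots> = (\<Sum>i\<in>{1..<n}. \<Sum>j\<in>{i..<n}. v i / of_nat p * Lf p (\<lambda>j. v j ^ (p ^ i)) (j - i) * v (n - j) ^ (p ^ j))"
    by (rule sum_triangle_swap)
  also have "\<dots> = (\<Sum>i\<in>{1..<n}. v i * Lf p (\<lambda>j. v j ^ (p ^ i)) (n - i))"
  proof (intro sum.cong refl)
    fix i assume i: "i \<in> {1..<n}"
    have "(\<Sum>j\<in>{i..<n}. v i / of_nat p * Lf p (\<lambda>j. v j ^ (p ^ i)) (j - i) * v (n - j) ^ (p ^ j))
      = (\<Sum>k<n - i. v i / of_nat p * (Lf p (\<lambda>j. v j ^ (p ^ i)) k * (v (n - i - k) ^ (p ^ i)) ^ (p ^ k)))"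
      using i by (subst sum_shift_lower) (auto intro!: sum.cong simp: power_mult[symmetric] power_add mult.commute add.commute mult.assoc)
    also have "\<dots> = v i / of_nat p * (of_nat p * Lf p (\<lambda>j. v j ^ (p ^ i)) (n - i))"
      using i by (subst p_Lf[OF assms(1)]) (auto simp: sum_distrib_left)
    finally show "(\<Sum>j\<in>{i..<n}. v i / of_nat p * Lf p (\<lambda>j. v j ^ (p ^ i)) (j - i) * v (n - j) ^ (p ^ j))
       = v i * Lf p (\<lambda>j. v j ^ (p ^ i)) (n - i)"
      using assms(1) by simp
  qed
  also have "v n + \<dots> = (\<Sum>i\<in>{1..n}. v i * Lf p (\<lambda>j. v j ^ (p ^ i)) (n - i))"
  proof -
    have "{1..n} = insert n {1..<n}" using less.prems by auto
    then show ?thesis by simp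
  qed
  finally show ?case
    using assms(1) by (simp add: sum_divide_distrib[symmetric] field_simps)
qed

text \<open>Raising all coordinates to the \<open>p\<close>-th power is a lift of Frobenius to the integer polynomial
  functions; this is what makes Dwork's argument work on functions.\<close>

definition Ipoly :: "((nat \<Rightarrow> nat \<Rightarrow> rat) \<Rightarrow> rat) set" where
  "Ipoly = zpoly \<int> {\<lambda>\<omega>. \<omega> i j | i j. True}"

definition frob :: "nat \<Rightarrow> nat \<Rightarrow> (nat \<Rightarrow> nat \<Rightarrow> rat) \<Rightarrow> nat \<Rightarrow> nat \<Rightarrow> rat" where
  "frob p k \<omega> = (\<lambda>i j. \<omega> i j ^ (p ^ k))"

lemma ratring_Ints: "ratring \<int>"
  by (simp add: ratring_def)

lemma Ipoly_const: "of_int c = c' \<Longrightarrow> (\<lambda>_. c') \<in> Ipoly"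
  unfolding Ipoly_def by (rule zpoly.const) auto
lemma Ipoly_gen: "(\<lambda>\<omega>. \<omega> i j) \<in> Ipoly"
  unfolding Ipoly_def by (rule zpoly.gen) auto
lemma Ipoly_add: "f \<in> Ipoly \<Longrightarrow> g \<in> Ipoly \<Longrightarrow> (\<lambda>x. f x + g x) \<in> Ipoly"
  unfolding Ipoly_def by (rule zpoly.add)
lemma Ipoly_diff: "f \<in> Ipoly \<Longrightarrow> g \<in> Ipoly \<Longrightarrow> (\<lambda>x. f x - g x) \<in> Ipoly"
  unfolding Ipoly_def by (rule zpoly_diff[OF ratring_Ints])
lemma Ipoly_mult: "f \<in> Ipoly \<Longrightarrow> g \<in> Ipoly \<Longrightarrow> (\<lambda>x. f x * g x) \<in> Ipoly"
  unfolding Ipoly_def by (rule zpoly.mult)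
lemma Ipoly_sum: "(\<And>i. i \<in> I \<Longrightarrow> f i \<in> Ipoly) \<Longrightarrow> (\<lambda>x. \<Sum>i\<in>I. f i x) \<in> Ipoly"
  unfolding Ipoly_def by (rule zpoly_sum[OF ratring_Ints])
lemma Ipoly_power: "f \<in> Ipoly \<Longrightarrow> (\<lambda>x. f x ^ n) \<in> Ipoly"
  unfolding Ipoly_def by (rule zpoly_power[OF ratring_Ints])
lemma Ipoly_of_nat: "(\<lambda>_. of_nat n) \<in> Ipoly"
  by (rule Ipoly_const[of "int n"]) simp

lemma Ipoly_frob: "f \<in> Ipoly \<Longrightarrow> (\<lambda>\<omega>. f (frob p k \<omega>)) \<in> Ipoly"
  unfolding Ipoly_def
  by (erule zpoly_subst) (use Ipoly_power[OF Ipoly_gen] in \<open>auto simp: frob_def Ipoly_def\<close>)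

section \<open>Congruences modulo powers of p between integer polynomial functions\<close>

definition pcong :: "nat \<Rightarrow> nat \<Rightarrow> ((nat \<Rightarrow> nat \<Rightarrow> rat) \<Rightarrow> rat) \<Rightarrow> ((nat \<Rightarrow> nat \<Rightarrow> rat) \<Rightarrow> rat) \<Rightarrow> bool" where
  "pcong p k f g \<longleftrightarrow> (\<exists>h\<in>Ipoly. \<forall>\<omega>. f \<omega> - g \<omega> = of_nat p ^ k * h \<omega>)"

lemma pcongI: "h \<in> Ipoly \<Longrightarrow> (\<And>\<omega>. f \<omega> - g \<omega> = of_nat p ^ k * h \<omega>) \<Longrightarrow> pcong p k f g"
  unfolding pcong_def by blast

text \<open>f^p - g^p = (f - g) S with S = \<Sum> g^(p-1-j) f^j. Modulo p, where f and g agree, S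
  becomes p g^(p-1), so S is divisible by p; this is the additional factor.\<close>

lemma pcong_power:
  assumes f: "f \<in> Ipoly" and g: "g \<in> Ipoly" and fg: "pcong p (Suc k) f g"
  shows "pcong p (Suc (Suc k)) (\<lambda>\<omega>. f \<omega> ^ p) (\<lambda>\<omega>. g \<omega> ^ p)"
proof -
  obtain h where h: "h \<in> Ipoly" "\<And>\<omega>. f \<omega> - g \<omega> = of_nat p ^ Suc k * h \<omega>"
    using fg unfolding pcong_def by blast
  define S where "S i \<omega> = (\<Sum>j<i. g \<omega> ^ (i - Suc j) * f \<omega> ^ j)" for i \<omega>
  have S: "f \<omega> ^ i - g \<omega> ^ i = (f \<omega> - g \<omega>) * S i \<omega>" for i \<omega>
    unfolding S_def by (rule power_diff_sumr2)
  have SI: "S i \<in> Ipoly" for i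
    unfolding S_def by (intro Ipoly_sum Ipoly_mult Ipoly_power f g)
  \<comment> \<open>\<open>q\<close> is \<open>S p\<close> divided by p, written out: f^i = g^i + (f
    - g) * \<open>S i\<close>, and one p is taken out of the factor p^(k+1) of f - g.\<close>
  define q where "q \<omega> = g \<omega> ^ (p - 1) + (\<Sum>i<p. g \<omega> ^ (p - Suc i) * (of_nat p ^ k * h \<omega> * S i \<omega>))" for \<omega>
  have qI: "q \<in> Ipoly"
    unfolding q_def
    by (intro Ipoly_add Ipoly_sum Ipoly_mult Ipoly_power f g h SI Ipoly_of_nat)
  have Sp: "S p \<omega> = of_nat p * q \<omega>" for \<omega>
  proof -
    have "S p \<omega> = (\<Sum>i<p. g \<omega> ^ (p - Suc i) * (g \<omega> ^ i + (f \<omega> - g \<omega>) * S i \<omega>))"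
      unfolding S_def[of p] S[symmetric] by simp
    also have "\<dots> = (\<Sum>i<p. g \<omega> ^ (p - 1) + of_nat p * (g \<omega> ^ (p - Suc i) * (of_nat p ^ k * h \<omega> * S i \<omega>)))"
    proof (intro sum.cong refl)
      fix i assume "i \<in> {..<p}"
      then have "g \<omega> ^ (p - Suc i) * g \<omega> ^ i = g \<omega> ^ (p - 1)"
        by (simp add: power_add[symmetric])
      then show "g \<omega> ^ (p - Suc i) * (g \<omega> ^ i + (f \<omega> - g \<omega>) * S i \<omega>)
        = g \<omega> ^ (p - 1) + of_nat p * (g \<omega> ^ (p - Suc i) * (of_nat p ^ k * h \<omega> * S i \<omega>))"
        by (simp add: h(2) distrib_left mult.assoc mult.left_commute)
    qed
    also have "\<dots> = of_nat p * q \<omega>"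
      by (simp add: q_def sum.distrib distrib_left sum_distrib_left)
    finally show ?thesis .
  qed
  show ?thesis
    by (rule pcongI[where h = "\<lambda>\<omega>. h \<omega> * q \<omega>"]) (auto intro: Ipoly_mult h qI simp: S Sp h(2))
qed

lemma pcong_power_iter:
  assumes f: "f \<in> Ipoly" and g: "g \<in> Ipoly" and fg: "pcong p 1 f g"
  shows "pcong p (Suc k) (\<lambda>\<omega>. f \<omega> ^ (p ^ k)) (\<lambda>\<omega>. g \<omega> ^ (p ^ k))"
proof (induction k)
  case 0
  then show ?case using fg by simp
next
  case (Suc k)
  have "pcong p (Suc (Suc k)) (\<lambda>\<omega>. (f \<omega> ^ (p ^ k)) ^ p) (\<lambda>\<omega>. (g \<omega> ^ (p ^ k)) ^ p)"
    by (rule pcong_power[OF Ipoly_power[OF f] Ipoly_power[OF g] Suc])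
  then show ?case by (simp add: power_mult[symmetric] mult.commute)
qed

lemma pcong_freshman:
  assumes p: "Factorial_Ring.prime p" and f: "f \<in> Ipoly" and g: "g \<in> Ipoly"
  shows "pcong p 1 (\<lambda>\<omega>. (f \<omega> + g \<omega>) ^ p) (\<lambda>\<omega>. f \<omega> ^ p + g \<omega> ^ p)"
proof (rule pcongI[where h = "\<lambda>\<omega>. \<Sum>k\<in>{1..<p}. of_nat ((p choose k) div p) * (f \<omega> ^ k * g \<omega> ^ (p - k))"])
  show "(\<lambda>\<omega>. \<Sum>k\<in>{1..<p}. of_nat ((p choose k) div p) * (f \<omega> ^ k * g \<omega> ^ (p - k))) \<in> Ipoly"
    by (intro Ipoly_sum Ipoly_mult Ipoly_of_nat Ipoly_power f g)
  fix \<omega>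
  have p0: "p > 0" using p prime_gt_0_nat by blast
  have "{..p} = insert 0 (insert p {1..<p})" using p0 by auto
  then have "(f \<omega> + g \<omega>) ^ p = f \<omega> ^ p + g \<omega> ^ p + (\<Sum>k\<in>{1..<p}. of_nat (p choose k) * f \<omega> ^ k * g \<omega> ^ (p - k))"
    using p0 by (simp add: binomial_ring)
  also have "(\<Sum>k\<in>{1..<p}. of_nat (p choose k) * f \<omega> ^ k * g \<omega> ^ (p - k))
     = (\<Sum>k\<in>{1..<p}. of_nat p * (of_nat ((p choose k) div p) * (f \<omega> ^ k * g \<omega> ^ (p - k))))"
  proof (intro sum.cong refl)
    fix k assume "k \<in> {1..<p}"
    then have "p dvd (p choose k)" using p by (intro dvd_choose_prime) auto
    then have "of_nat (p choose k) = of_nat p * (of_nat ((p choose k) div p) :: rat)"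
      by (metis dvd_mult_div_cancel of_nat_mult)
    then show "of_nat (p choose k) * f \<omega> ^ k * g \<omega> ^ (p - k) = of_nat p * (of_nat ((p choose k) div p) * (f \<omega> ^ k * g \<omega> ^ (p - k)))"
      by simp
  qed
  finally show "(f \<omega> + g \<omega>) ^ p - (f \<omega> ^ p + g \<omega> ^ p)
     = of_nat p ^ 1 * (\<Sum>k\<in>{1..<p}. of_nat ((p choose k) div p) * (f \<omega> ^ k * g \<omega> ^ (p - k)))"
    by (simp add: sum_distrib_left)
qed

lemma pcong_sym: "pcong p k f g \<Longrightarrow> pcong p k g f"
proof -
  assume "pcong p k f g"
  then obtain h where h: "h \<in> Ipoly" "\<And>\<omega>. f \<omega> - g \<omega> = of_nat p ^ k * h \<omega>" unfolding pcong_def by blast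
  show ?thesis
  proof (rule pcongI[where h = "\<lambda>\<omega>. (\<lambda>_. 0) \<omega> - h \<omega>"])
    show "(\<lambda>\<omega>. (\<lambda>_. 0) \<omega> - h \<omega>) \<in> Ipoly" by (intro Ipoly_diff h Ipoly_const[of 0]) simp
    show "g \<omega> - f \<omega> = of_nat p ^ k * (0 - h \<omega>)" for \<omega>
      using h(2)[of \<omega>] by (simp add: algebra_simps)
  qed
qed

lemma pcong_add:
  assumes "pcong p k f g" "pcong p k f' g'"
  shows "pcong p k (\<lambda>\<omega>. f \<omega> + f' \<omega>) (\<lambda>\<omega>. g \<omega> + g' \<omega>)"
proof -
  obtain h h' where h: "h \<in> Ipoly" "\<And>\<omega>. f \<omega> - g \<omega> = of_nat p ^ k * h \<omega>"
    "h' \<in> Ipoly" "\<And>\<omega>. f' \<omega> - g' \<omega> = of_nat p ^ k * h' \<omega>"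
    using assms unfolding pcong_def by blast
  show ?thesis
  proof (rule pcongI[where h = "\<lambda>\<omega>. h \<omega> + h' \<omega>"])
    show "f \<omega> + f' \<omega> - (g \<omega> + g' \<omega>) = of_nat p ^ k * (h \<omega> + h' \<omega>)" for \<omega>
      using h(2,4)[of \<omega>] by (simp add: algebra_simps)
  qed (intro Ipoly_add h)
qed

lemma pcong_refl: "pcong p k f f"
  by (rule pcongI[where h = "\<lambda>_. 0"]) (auto intro: Ipoly_const[of 0])

lemma pcong_diff:
  assumes "pcong p k f g" "pcong p k f' g'"
  shows "pcong p k (\<lambda>\<omega>. f \<omega> - f' \<omega>) (\<lambda>\<omega>. g \<omega> - g' \<omega>)"
proof -
  obtain h h' where h: "h \<in> Ipoly" "\<And>\<omega>. f \<omega> - g \<omega> = of_nat p ^ k * h \<omega>"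
    "h' \<in> Ipoly" "\<And>\<omega>. f' \<omega> - g' \<omega> = of_nat p ^ k * h' \<omega>"
    using assms unfolding pcong_def by blast
  show ?thesis
  proof (rule pcongI[where h = "\<lambda>\<omega>. h \<omega> - h' \<omega>"])
    show "f \<omega> - f' \<omega> - (g \<omega> - g' \<omega>) = of_nat p ^ k * (h \<omega> - h' \<omega>)" for \<omega>
      using h(2,4)[of \<omega>] by (simp add: algebra_simps)
  qed (intro Ipoly_diff h)
qed

lemma pcong_trans:
  assumes "pcong p k f g" "pcong p k g h" shows "pcong p k f h"
proof -
  obtain u w where u: "u \<in> Ipoly" "\<And>\<omega>. f \<omega> - g \<omega> = of_nat p ^ k * u \<omega>"
    "w \<in> Ipoly" "\<And>\<omega>. g \<omega> - h \<omega> = of_nat p ^ k * w \<omega>"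
    using assms unfolding pcong_def by blast
  show ?thesis
  proof (rule pcongI[where h = "\<lambda>\<omega>. u \<omega> + w \<omega>"])
    show "f \<omega> - h \<omega> = of_nat p ^ k * (u \<omega> + w \<omega>)" for \<omega>
      using u(2,4)[of \<omega>] by (simp add: algebra_simps)
  qed (intro Ipoly_add u)
qed

lemma pcong_mult:
  assumes "pcong p k f g" "pcong p k f' g'" "f' \<in> Ipoly" "g \<in> Ipoly"
  shows "pcong p k (\<lambda>\<omega>. f \<omega> * f' \<omega>) (\<lambda>\<omega>. g \<omega> * g' \<omega>)"
proof -
  obtain h h' where h: "h \<in> Ipoly" "\<And>\<omega>. f \<omega> - g \<omega> = of_nat p ^ k * h \<omega>"
    "h' \<in> Ipoly" "\<And>\<omega>. f' \<omega> - g' \<omega> = of_nat p ^ k * h' \<omega>"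
    using assms unfolding pcong_def by blast
  show ?thesis
  proof (rule pcongI[where h = "\<lambda>\<omega>. h \<omega> * f' \<omega> + g \<omega> * h' \<omega>"])
    show "f \<omega> * f' \<omega> - g \<omega> * g' \<omega> = of_nat p ^ k * (h \<omega> * f' \<omega> + g \<omega> * h' \<omega>)" for \<omega>
    proof -
      have "f \<omega> * f' \<omega> - g \<omega> * g' \<omega> = (f \<omega> - g \<omega>) * f' \<omega> + g \<omega> * (f' \<omega> - g' \<omega>)"
        by (simp add: algebra_simps)
      then show ?thesis by (simp only: h) (simp add: algebra_simps)
    qed
  qed (intro Ipoly_add Ipoly_mult h assms)
qed

text \<open>Fermat's little theorem, by induction for natural numbers. An arbitrary integer is
  written c = a - b and the binomial congruence is applied to c + b = a, so that no sign (-1)^p has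
  to be treated.\<close>

lemma pcong_frob_const:
  assumes p: "Factorial_Ring.prime p"
  shows "pcong p 1 (\<lambda>_. of_int c ^ p) (\<lambda>_. of_int c)"
proof -
  have p0: "p > 0" using p prime_gt_0_nat by blast
  have nat: "pcong p 1 (\<lambda>_. of_nat n ^ p) (\<lambda>_. of_nat n)" for n
  proof (induction n)
    case 0
    show ?case using pcong_refl[of p 1 "\<lambda>_. 0"] by (simp add: zero_power p0)
  next
    case (Suc n)
    have "pcong p 1 (\<lambda>_. (of_nat n + 1) ^ p) (\<lambda>_. of_nat n ^ p + 1 ^ p)"
      by (rule pcong_freshman[OF p]) (auto intro: Ipoly_of_nat Ipoly_const[of 1])
    moreover have "pcong p 1 (\<lambda>_. of_nat n ^ p + 1 ^ p) (\<lambda>_. of_nat n + 1 ^ p)"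
      by (rule pcong_add[OF Suc pcong_refl])
    ultimately have "pcong p 1 (\<lambda>_. (of_nat n + 1) ^ p) (\<lambda>_. of_nat n + 1 ^ p)"
      by (rule pcong_trans)
    then show ?case by (simp add: add.commute)
  qed
  obtain a b where c: "c = int a - int b" by (rule int_diff_cases)
  have c': "of_int c = (of_nat a - of_nat b :: rat)" by (simp add: c)
  have "pcong p 1 (\<lambda>_. (of_int c + of_nat b) ^ p) (\<lambda>_. of_int c ^ p + of_nat b ^ p)"
    by (rule pcong_freshman[OF p Ipoly_const[OF refl] Ipoly_of_nat])
  then have "pcong p 1 (\<lambda>_. of_int c ^ p + of_nat b ^ p) (\<lambda>_. of_nat a ^ p)"
    by (rule pcong_sym[THEN pcong_trans]) (simp add: c' pcong_refl)
  from pcong_diff[OF pcong_trans[OF this nat] nat[of b]]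
  show ?thesis by (simp add: c')
qed

text \<open>Modulo p both sides are additive and multiplicative in f, and they agree on coordinates
  by the definition of \<open>frob\<close>; on constants this is Fermat's theorem.\<close>

lemma pcong_frob:
  assumes p: "Factorial_Ring.prime p" and f: "f \<in> Ipoly"
  shows "pcong p 1 (\<lambda>\<omega>. f \<omega> ^ p) (\<lambda>\<omega>. f (frob p 1 \<omega>))"
  using f unfolding Ipoly_def
proof induction
  case (const c)
  then obtain k where k: "c = of_int k" by (auto elim: Ints_cases)
  show ?case using pcong_frob_const[OF p, of k] by (simp add: k)
next
  case (gen g)
  then show ?case using pcong_refl by (auto simp: frob_def)
next
  case (add f g)
  have "pcong p 1 (\<lambda>\<omega>. (f \<omega> + g \<omega>) ^ p) (\<lambda>\<omega>. f \<omega> ^ p + g \<omega> ^ p)"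
    by (rule pcong_freshman[OF p]) (use add in \<open>simp_all add: Ipoly_def\<close>)
  then show ?case by (rule pcong_trans) (rule pcong_add[OF add.IH])
next
  case (mult f g)
  have "pcong p 1 (\<lambda>\<omega>. f \<omega> ^ p * g \<omega> ^ p) (\<lambda>\<omega>. f (frob p 1 \<omega>) * g (frob p 1 \<omega>))"
    by (rule pcong_mult) (use mult Ipoly_power Ipoly_frob in \<open>auto simp: Ipoly_def\<close>)
  then show ?case unfolding power_mult_distrib .
qed

lemma pcong_frob_iter:
  assumes p: "Factorial_Ring.prime p" and f: "f \<in> Ipoly"
  shows "pcong p 1 (\<lambda>\<omega>. f \<omega> ^ (p ^ i)) (\<lambda>\<omega>. f (frob p i \<omega>))"
proof (induction i)
  case 0
  then show ?case using pcong_refl by (simp add: frob_def)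
next
  case (Suc i)
  \<comment> \<open>\<open>pcong_power\<close> gives the congruence modulo p^2; it is weakened to p
    below.\<close>
  have "pcong p (Suc (Suc 0)) (\<lambda>\<omega>. (f \<omega> ^ (p ^ i)) ^ p) (\<lambda>\<omega>. (f (frob p i \<omega>)) ^ p)"
    by (rule pcong_power) (use Suc f Ipoly_power Ipoly_frob in auto)
  then obtain h where h: "h \<in> Ipoly" "\<And>\<omega>. (f \<omega> ^ (p ^ i)) ^ p - (f (frob p i \<omega>)) ^ p = of_nat p ^ 2 * h \<omega>"
    unfolding pcong_def by (auto simp: numeral_2_eq_2)
  have "pcong p 1 (\<lambda>\<omega>. (f \<omega> ^ (p ^ i)) ^ p) (\<lambda>\<omega>. (f (frob p i \<omega>)) ^ p)"
    by (rule pcongI[where h = "\<lambda>\<omega>. of_nat p * h \<omega>"])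
      (auto simp: h power2_eq_square intro: Ipoly_mult Ipoly_of_nat)
  moreover have "pcong p 1 (\<lambda>\<omega>. f (frob p i \<omega>) ^ p) (\<lambda>\<omega>. f (frob p i (frob p 1 \<omega>)))"
    by (rule pcong_frob[OF p Ipoly_frob[OF f]])
  moreover have "frob p i (frob p 1 \<omega>) = frob p (Suc i) \<omega>" for \<omega>
    by (simp only: frob_def power_mult[symmetric] power_one_right power_Suc)
  ultimately have "pcong p 1 (\<lambda>\<omega>. (f \<omega> ^ (p ^ i)) ^ p) (\<lambda>\<omega>. f (frob p (Suc i) \<omega>))"
    by (simp only:) (rule pcong_trans)
  then show ?case by (simp add: power_mult[symmetric] mult.commute)
qed

section \<open>Dwork's lemma: the difference of two p-typical sums has integral coordinates\<close>

lemma p_power_Lf_Ipoly: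
  assumes p0: "p > 0"
  shows "(\<lambda>\<omega>. of_nat p ^ n * Lf p (\<omega> 0) n) \<in> Ipoly"
proof (induction n rule: less_induct)
  case (less n)
  show ?case
  proof (cases "n = 0")
    case True
    then show ?thesis by (auto intro: Ipoly_const[of 1])
  next
    case False
    have eq: "of_nat p ^ n * Lf p (\<omega> 0) n
        = (\<Sum>j<n. of_nat p ^ (n - 1 - j) * (of_nat p ^ j * Lf p (\<omega> 0) j) * \<omega> 0 (n - j) ^ (p ^ j))" for \<omega>
    proof -
      have "of_nat p ^ n * Lf p (\<omega> 0) n = of_nat p ^ (n - 1) * (of_nat p * Lf p (\<omega> 0) n)"
        using False by (cases n) auto
      also have "\<dots> = (\<Sum>j<n. of_nat p ^ (n - 1) * Lf p (\<omega> 0) j * \<omega> 0 (n - j) ^ (p ^ j))"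
        using False p0 by (subst p_Lf) (auto simp: sum_distrib_left mult.assoc)
      also have "\<dots> = (\<Sum>j<n. of_nat p ^ (n - 1 - j) * (of_nat p ^ j * Lf p (\<omega> 0) j) * \<omega> 0 (n - j) ^ (p ^ j))"
      proof (intro sum.cong refl)
        fix j assume "j \<in> {..<n}"
        then have "(of_nat p :: rat) ^ (n - 1) = of_nat p ^ (n - 1 - j) * of_nat p ^ j"
          by (simp add: power_add[symmetric])
        then show "of_nat p ^ (n - 1) * Lf p (\<omega> 0) j * \<omega> 0 (n - j) ^ (p ^ j)
           = of_nat p ^ (n - 1 - j) * (of_nat p ^ j * Lf p (\<omega> 0) j) * \<omega> 0 (n - j) ^ (p ^ j)"
          by simp
      qed
      finally show ?thesis .
    qed
    show ?thesis
      unfolding eq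
      by (intro Ipoly_sum Ipoly_mult Ipoly_power Ipoly_of_nat Ipoly_gen less.IH) auto
  qed
qed

text \<open>Dwork's operator for the Frobenius lift \<open>frob\<close>, with v_i =
  \<open>\<omega> 0 i\<close>. By \<open>Lf_Frobenius_rec\<close> it annihilates the sequence of the
  \<ell>_n in positive degrees, and it takes p-typical sums of integral coordinates to integral
  functions.\<close>

definition Dop :: "nat \<Rightarrow> (nat \<Rightarrow> (nat \<Rightarrow> nat \<Rightarrow> rat) \<Rightarrow> rat) \<Rightarrow> nat \<Rightarrow> (nat \<Rightarrow> nat \<Rightarrow> rat) \<Rightarrow> rat" where
  "Dop p w n \<omega> = w n \<omega> - (\<Sum>i\<in>{1..n}. \<omega> 0 i / of_nat p * w (n - i) (frob p i \<omega>))"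

text \<open>By \<open>Lf_Frobenius_rec\<close> the value is a sum of terms v_i / p, times
  \<ell>_(n-i) at the Frobenius twist, times y^(p^n) - y(\<open>frob p i\<close>)^(p^(n-i)). The
  last difference is divisible by p^(n-i+1), which pays for the denominators p and p^(n-i).\<close>

lemma Dop_single_Ipoly:
  assumes p: "Factorial_Ring.prime p" and y: "y \<in> Ipoly"
  shows "Dop p (\<lambda>k \<omega>. Lf p (\<omega> 0) k * y \<omega> ^ (p ^ k)) n \<in> Ipoly"
proof (cases "n = 0")
  case True
  then have "Dop p (\<lambda>k \<omega>. Lf p (\<omega> 0) k * y \<omega> ^ (p ^ k)) n = y" by (simp add: Dop_def fun_eq_iff)
  then show ?thesis using y by simp
next
  case False
  have p0: "p > 0" using p prime_gt_0_nat by blast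
  have "\<forall>i. \<exists>h. i \<in> {1..n} \<longrightarrow> h \<in> Ipoly \<and> (\<forall>\<omega>. y \<omega> ^ (p ^ n) - y (frob p i \<omega>) ^ (p ^ (n - i)) = of_nat p ^ Suc (n - i) * h \<omega>)"
  proof (rule allI)
    fix i
    show "\<exists>h. i \<in> {1..n} \<longrightarrow> h \<in> Ipoly \<and> (\<forall>\<omega>. y \<omega> ^ (p ^ n) - y (frob p i \<omega>) ^ (p ^ (n - i)) = of_nat p ^ Suc (n - i) * h \<omega>)"
    proof (cases "i \<in> {1..n}")
      case True
      have "pcong p (Suc (n - i)) (\<lambda>\<omega>. (y \<omega> ^ (p ^ i)) ^ (p ^ (n - i))) (\<lambda>\<omega>. y (frob p i \<omega>) ^ (p ^ (n - i)))"
        by (rule pcong_power_iter) (use y p Ipoly_power Ipoly_frob pcong_frob_iter in auto)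
      moreover have "p ^ i * p ^ (n - i) = p ^ n" using True by (simp add: power_add[symmetric])
      ultimately show ?thesis unfolding pcong_def by (simp add: power_mult[symmetric]) blast
    qed auto
  qed
  then obtain h where h: "\<And>i. i \<in> {1..n} \<Longrightarrow> h i \<in> Ipoly"
    "\<And>i \<omega>. i \<in> {1..n} \<Longrightarrow> y \<omega> ^ (p ^ n) - y (frob p i \<omega>) ^ (p ^ (n - i)) = of_nat p ^ Suc (n - i) * h i \<omega>"
    by metis
  have eq: "Dop p (\<lambda>k \<omega>. Lf p (\<omega> 0) k * y \<omega> ^ (p ^ k)) n \<omega>
     = (\<Sum>i\<in>{1..n}. \<omega> 0 i * (of_nat p ^ (n - i) * Lf p (frob p i \<omega> 0) (n - i)) * h i \<omega>)" for \<omega>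
  proof -
    have "Dop p (\<lambda>k \<omega>. Lf p (\<omega> 0) k * y \<omega> ^ (p ^ k)) n \<omega>
      = (\<Sum>i\<in>{1..n}. \<omega> 0 i / of_nat p * Lf p (frob p i \<omega> 0) (n - i) * (y \<omega> ^ (p ^ n) - y (frob p i \<omega>) ^ (p ^ (n - i))))"
      using False
      by (simp add: Dop_def Lf_Frobenius_rec[OF p0, of n "\<omega> 0"] frob_def sum_distrib_right
          sum_subtractf[symmetric] right_diff_distrib mult.assoc)
    also have "\<dots> = (\<Sum>i\<in>{1..n}. \<omega> 0 i * (of_nat p ^ (n - i) * Lf p (frob p i \<omega> 0) (n - i)) * h i \<omega>)"
      by (intro sum.cong refl) (use p0 h(2) in \<open>simp add: field_simps\<close>)
    finally show ?thesis .
  qed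
  have "(\<lambda>\<omega>. \<Sum>i\<in>{1..n}. \<omega> 0 i * (of_nat p ^ (n - i) * Lf p (frob p i \<omega> 0) (n - i)) * h i \<omega>) \<in> Ipoly"
    by (intro Ipoly_sum Ipoly_mult[OF Ipoly_mult[OF Ipoly_gen Ipoly_frob[OF p_power_Lf_Ipoly[OF p0]]] h(1)])
  then show ?thesis by (subst ext[OF eq])
qed

text \<open>\<open>Wf\<close> is the sum over d of the sequences \<ell>_k x_d^(p^k) shifted by d,
  and \<open>Dop\<close> is compatible with sums and shifts: in the d-th summand only i \<le> n - d
  occurs.\<close>

lemma Dop_Wf:
  "Dop p (\<lambda>n \<omega>. Wf p (\<omega> 0) (\<lambda>d. x d \<omega>) n) n \<omega>
     = (\<Sum>d\<le>n. Dop p (\<lambda>k \<omega>. Lf p (\<omega> 0) k * x d \<omega> ^ (p ^ k)) (n - d) \<omega>)"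
proof -
  let ?f = "\<lambda>i d. \<omega> 0 i / of_nat p * (Lf p (frob p i \<omega> 0) (n - i - d) * x d (frob p i \<omega>) ^ (p ^ (n - i - d)))"
  have "(\<Sum>i\<in>{1..n}. \<Sum>d\<le>n - i. ?f i d) = (\<Sum>d\<le>n. \<Sum>i\<in>{1..n - d}. ?f i d)"
    unfolding sum.Sigma[OF finite_atLeastAtMost ballI[OF finite_atMost]]
      sum.Sigma[OF finite_atMost ballI[OF finite_atLeastAtMost]]
    by (rule sum.reindex_bij_witness[where i = "\<lambda>(a,b). (b,a)" and j = "\<lambda>(a,b). (b,a)"]) auto
  moreover have "n - i - d = n - d - i" for i d :: nat by simp
  ultimately show ?thesis
    by (simp add: Dop_def Wf_def sum_subtractf sum_distrib_left)
qed

text \<open>\<open>Wf p v x n\<close> is the coefficient of T^(p^n) in the logarithm of the formal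
  sum of the x_d T^(p^d), for the p-typical formal group law given by v. So this is subtraction of
  p-typical curves: row 0 of \<omega> holds v, rows 1 and 2 hold the two curves, and the recursion
  solves \<open>Wf_xdiff\<close> for its top coordinate.\<close>

fun xdiff :: "nat \<Rightarrow> (nat \<Rightarrow> nat \<Rightarrow> rat) \<Rightarrow> nat \<Rightarrow> rat" where
  "xdiff p \<omega> n = Wf p (\<omega> 0) (\<omega> 1) n - Wf p (\<omega> 0) (\<omega> 2) n
     - (\<Sum>d<n. Lf p (\<omega> 0) (n - d) * xdiff p \<omega> d ^ (p ^ (n - d)))"

declare xdiff.simps [simp del]

lemma Wf_last: "Wf p v x n = (\<Sum>d<n. Lf p v (n - d) * x d ^ (p ^ (n - d))) + x n"
proof -
  have "{..n} = insert n {..<n}" by auto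
  then show ?thesis by (simp add: Wf_def)
qed

lemma Wf_xdiff: "Wf p (\<omega> 0) (xdiff p \<omega>) n = Wf p (\<omega> 0) (\<omega> 1) n - Wf p (\<omega> 0) (\<omega> 2) n"
  by (subst Wf_last, subst (2) xdiff.simps) simp

lemma Dop_diff: "Dop p (\<lambda>n \<omega>. f n \<omega> - g n \<omega>) n \<omega> = Dop p f n \<omega> - Dop p g n \<omega>"
  by (simp add: Dop_def right_diff_distrib sum_subtractf)

lemma Dop_0: "Dop p w 0 \<omega> = w 0 \<omega>"
  by (simp add: Dop_def)

text \<open>Apply \<open>Dop\<close> to \<open>Wf_xdiff\<close>. The right side becomes integral by
  \<open>Dop_single_Ipoly\<close>; on the left the coordinates below n contribute integral terms by
  induction, and coordinate n contributes itself by \<open>Dop_0\<close>, so it can be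
  isolated.\<close>

lemma xdiff_Ipoly:
  assumes p: "Factorial_Ring.prime p"
  shows "(\<lambda>\<omega>. xdiff p \<omega> n) \<in> Ipoly"
proof (induction n rule: less_induct)
  case (less n)
  let ?D = "\<lambda>y m \<omega>. Dop p (\<lambda>k \<omega>. Lf p (\<omega> 0) k * y \<omega> ^ (p ^ k)) m \<omega>"
  have "(\<Sum>d<n. ?D (\<lambda>\<omega>. xdiff p \<omega> d) (n - d) \<omega>) + xdiff p \<omega> n
     = (\<Sum>d\<le>n. ?D (\<lambda>\<omega>. \<omega> 1 d) (n - d) \<omega>) - (\<Sum>d\<le>n. ?D (\<lambda>\<omega>. \<omega> 2 d) (n - d) \<omega>)" for \<omega>
  proof -
    have "{..n} = insert n {..<n}" by auto
    then have "(\<Sum>d<n. ?D (\<lambda>\<omega>. xdiff p \<omega> d) (n - d) \<omega>) + xdiff p \<omega> n = (\<Sum>d\<le>n. ?D (\<lambda>\<omega>. xdiff p \<omega> d) (n - d) \<omega>)"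
      by (simp add: Dop_0)
    also have "\<dots> = Dop p (\<lambda>n \<omega>. Wf p (\<omega> 0) (\<lambda>d. \<omega> 1 d) n - Wf p (\<omega> 0) (\<lambda>d. \<omega> 2 d) n) n \<omega>"
      unfolding Dop_Wf[symmetric] by (simp add: Wf_xdiff)
    finally show ?thesis unfolding Dop_diff Dop_Wf .
  qed
  then have eq: "(\<lambda>\<omega>. xdiff p \<omega> n) = (\<lambda>\<omega>. ((\<Sum>d\<le>n. ?D (\<lambda>\<omega>. \<omega> 1 d) (n - d) \<omega>) - (\<Sum>d\<le>n. ?D (\<lambda>\<omega>. \<omega> 2 d) (n - d) \<omega>))
      - (\<Sum>d<n. ?D (\<lambda>\<omega>. xdiff p \<omega> d) (n - d) \<omega>))"
    by (auto simp: fun_eq_iff algebra_simps)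
  show ?case
    unfolding eq
    by (intro Ipoly_diff Ipoly_sum Dop_single_Ipoly[OF p] Ipoly_gen less.IH) auto
qed

text \<open>\<open>w\<close> is a \<open>p\<close>-typical sum with coordinates in \<open>B\<close>, up to index \<open>N\<close>.\<close>

definition Wit :: "nat \<Rightarrow> ('s \<Rightarrow> rat) set \<Rightarrow> ('s \<Rightarrow> nat \<Rightarrow> rat) \<Rightarrow> nat \<Rightarrow> (nat \<Rightarrow> 's \<Rightarrow> rat) \<Rightarrow> bool" where
  "Wit p B v N w \<longleftrightarrow> (\<exists>x. (\<forall>n\<le>N. x n \<in> B) \<and> (\<forall>n\<le>N. \<forall>s. w n s = Wf p (v s) (\<lambda>d. x d s) n))"

lemma Wf_cong: "(\<And>d. d \<le> n \<Longrightarrow> x d = y d) \<Longrightarrow> Wf p v x n = Wf p v y n"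
  by (simp add: Wf_def)

lemma Wit_cong: "Wit p B v N w \<Longrightarrow> (\<And>n s. n \<le> N \<Longrightarrow> w n s = w' n s) \<Longrightarrow> Wit p B v N w'"
  unfolding Wit_def by metis

lemma Wit_seq: "(\<And>n. n \<le> N \<Longrightarrow> (\<lambda>s. x s n) \<in> B) \<Longrightarrow> Wit p B v N (\<lambda>n s. Wf p (v s) (x s) n)"
  unfolding Wit_def by (intro exI[of _ "\<lambda>n s. x s n"]) auto

text \<open>The equations for the coordinates are triangular with leading coefficient 1, so w
  determines them. A sequence known to solve them, typically one given by a recursion with
  denominators, inherits the integrality.\<close>

lemma Wit_unique:
  assumes "Wit p B v N w" "\<And>n s. n \<le> N \<Longrightarrow> w n s = Wf p (v s) (z s) n" "n \<le> N"
  shows "(\<lambda>s. z s n) \<in> B"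
proof -
  obtain x where x: "\<And>n. n \<le> N \<Longrightarrow> x n \<in> B" "\<And>n s. n \<le> N \<Longrightarrow> w n s = Wf p (v s) (\<lambda>d. x d s) n"
    using assms(1) unfolding Wit_def by blast
  have "n \<le> N \<longrightarrow> z s n = x n s" for n s
  proof (induction n rule: less_induct)
    case (less n)
    show ?case
    proof
      assume n: "n \<le> N"
      have "Wf p (v s) (z s) n = Wf p (v s) (\<lambda>d. x d s) n" using x(2) assms(2) n by metis
      moreover have "(\<Sum>d<n. Lf p (v s) (n - d) * z s d ^ (p ^ (n - d))) = (\<Sum>d<n. Lf p (v s) (n - d) * x d s ^ (p ^ (n - d)))"
        using less n by (intro sum.cong) auto
      ultimately show "z s n = x n s" by (simp add: Wf_last)
    qed
  qed
  then have "(\<lambda>s. z s n) = x n" using assms(3) by auto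
  then show ?thesis using x assms(3) by simp
qed

text \<open>\<open>xdiff\<close> is a universal integer polynomial in v and the two coordinate
  sequences, and is specialised here to the given functions.\<close>

lemma Wit_diff:
  assumes p: "Factorial_Ring.prime p" and C: "ratring C"
    and v: "\<And>i. 1 \<le> i \<Longrightarrow> i \<le> N \<Longrightarrow> (\<lambda>s. v s i) \<in> zpoly C G"
    and w: "Wit p (zpoly C G) v N w" and w': "Wit p (zpoly C G) v N w'"
  shows "Wit p (zpoly C G) v N (\<lambda>n s. w n s - w' n s)"
proof -
  obtain x where x: "\<And>n. n \<le> N \<Longrightarrow> x n \<in> zpoly C G" "\<And>n s. n \<le> N \<Longrightarrow> w n s = Wf p (v s) (\<lambda>d. x d s) n"
    using w unfolding Wit_def by blast
  obtain x' where x': "\<And>n. n \<le> N \<Longrightarrow> x' n \<in> zpoly C G" "\<And>n s. n \<le> N \<Longrightarrow> w' n s = Wf p (v s) (\<lambda>d. x' d s) n"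
    using w' unfolding Wit_def by blast
  \<comment> \<open>Entries of index above N are replaced by 0, because nothing is known about them;
    the sums up to index N do not involve them.\<close>
  define \<Omega> where "\<Omega> s i j = (if i = 0 then (if 1 \<le> j \<and> j \<le> N then v s j else 0)
      else if j \<le> N then (if i = 1 then x j s else if i = 2 then x' j s else 0) else 0)" for s and i j :: nat
  have \<Omega>: "(\<lambda>s. \<Omega> s i j) \<in> zpoly C G" for i j
    unfolding \<Omega>_def
    by (cases "i = 0"; cases "1 \<le> j"; cases "j \<le> N"; cases "i = 1"; cases "i = 2")
      (auto intro: zpoly.const ratring_0[OF C] v x x')
  have L: "Lf p (\<Omega> s 0) n = Lf p (v s) n" if "n \<le> N" for s n
    by (rule Lf_cong) (use that in \<open>auto simp: \<Omega>_def\<close>)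
  have W: "Wf p (\<Omega> s 0) y n = Wf p (v s) y n" if "n \<le> N" for s n y
    using that by (simp add: Wf_def L)
  show ?thesis
    unfolding Wit_def
  proof (intro exI[of _ "\<lambda>n s. xdiff p (\<Omega> s) n"] conjI allI impI)
    fix n assume n: "n \<le> N"
    have "(\<lambda>\<omega>. xdiff p \<omega> n) \<in> zpoly C {\<lambda>\<omega>. \<omega> i j | i j. True}"
      using xdiff_Ipoly[OF p, of n] C
      by (auto simp: Ipoly_def Ints_def intro: zpoly_mono_const ratring_of_int)
    then show "(\<lambda>s. xdiff p (\<Omega> s) n) \<in> zpoly C G"
      by (rule zpoly_subst) (auto intro: \<Omega>)
    fix s
    have "Wf p (v s) (\<lambda>n. xdiff p (\<Omega> s) n) n = Wf p (v s) (\<Omega> s 1) n - Wf p (v s) (\<Omega> s 2) n"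
      using Wf_xdiff[of p "\<Omega> s" n] n by (simp add: W)
    moreover have "Wf p (v s) (\<Omega> s 1) n = Wf p (v s) (\<lambda>d. x d s) n" "Wf p (v s) (\<Omega> s 2) n = Wf p (v s) (\<lambda>d. x' d s) n"
      using n by (auto intro!: Wf_cong simp: \<Omega>_def)
    ultimately show "w n s - w' n s = Wf p (v s) (\<lambda>d. xdiff p (\<Omega> s) d) n"
      using n x(2) x'(2) by simp
  qed
qed

lemma Wit_single:
  assumes "p > 0" "ratring C" "y \<in> zpoly C G"
  shows "Wit p (zpoly C G) v N (\<lambda>n s. if d \<le> n then Lf p (v s) (n - d) * y s ^ (p ^ (n - d)) else 0)"
proof (rule Wit_cong[OF Wit_seq[where x = "\<lambda>s e. if e = d then y s else 0"]])
  show "(\<lambda>s. if n = d then y s else 0) \<in> zpoly C G" for n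
    by (cases "n = d") (use assms in \<open>auto intro: zpoly.const ratring_0\<close>)
  show "Wf p (v s) (\<lambda>e. if e = d then y s else 0) n = (if d \<le> n then Lf p (v s) (n - d) * y s ^ (p ^ (n - d)) else 0)" for n s
  proof -
    have "Wf p (v s) (\<lambda>e. if e = d then y s else 0) n = (\<Sum>e\<le>n. if e = d then Lf p (v s) (n - d) * y s ^ (p ^ (n - d)) else 0)"
      unfolding Wf_def by (intro sum.cong) (use assms(1) in auto)
    then show ?thesis by (simp add: sum.delta)
  qed
qed

lemma Wit_zero: "p > 0 \<Longrightarrow> ratring C \<Longrightarrow> Wit p (zpoly C G) v N (\<lambda>n s. 0)"
  by (rule Wit_cong[OF Wit_seq[where x = "\<lambda>s e. 0"]]) (auto simp: Wf_def zero_power intro: zpoly.const ratring_0)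

lemma finite_triangle: "finite {(a, b). a + b \<le> (n::nat)}"
  by (rule finite_subset[of _ "{..n} \<times> {..n}"]) auto

lemma sum_triangle_restrict:
  assumes "n \<le> (N::nat)"
  shows "(\<Sum>(a, b)\<in>{(a, b). a + b \<le> N}. if a + b \<le> n then F a b else 0) = (\<Sum>(a, b)\<in>{(a, b). a + b \<le> n}. F a b)"
proof -
  have "(\<Sum>(a, b)\<in>{(a, b). a + b \<le> n}. F a b) = (\<Sum>(a, b)\<in>{(a, b). a + b \<le> n}. if a + b \<le> n then F a b else 0)"
    by (rule sum.cong) auto
  also have "\<dots> = (\<Sum>(a, b)\<in>{(a, b). a + b \<le> N}. if a + b \<le> n then F a b else 0)"
    by (rule sum.mono_neutral_left[OF finite_triangle]) (use assms in \<open>auto split: if_splits\<close>)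
  finally show ?thesis by simp
qed

lemma sum_triangle_pairs:
  "(\<Sum>j\<le>n. \<Sum>a\<le>j. F a (n - j)) = (\<Sum>(a, b)\<in>{(a, b). a + b \<le> (n::nat)}. F a b)"
  unfolding sum.Sigma[OF finite_atMost ballI[OF finite_atMost]]
  by (rule sum.reindex_bij_witness[where i = "\<lambda>(a, b). (n - b, a)" and j = "\<lambda>(j, a). (a, n - j)"]) auto

section \<open>Closure properties of p-typical sums with integral coordinates\<close>

locale witt =
  fixes p :: nat and C :: "rat set" and G :: "('s \<Rightarrow> rat) set" and v :: "'s \<Rightarrow> nat \<Rightarrow> rat" and N :: nat
  assumes p: "Factorial_Ring.prime p" and C: "ratring C"
    and v: "\<And>i. 1 \<le> i \<Longrightarrow> i \<le> N \<Longrightarrow> (\<lambda>s. v s i) \<in> zpoly C G"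
begin

lemma p0: "p > 0" using p prime_gt_0_nat by blast

lemma diff: "Wit p (zpoly C G) v N w \<Longrightarrow> Wit p (zpoly C G) v N w' \<Longrightarrow> Wit p (zpoly C G) v N (\<lambda>n s. w n s - w' n s)"
  by (rule Wit_diff[OF p C v])

lemma add:
  assumes "Wit p (zpoly C G) v N w" "Wit p (zpoly C G) v N w'"
  shows "Wit p (zpoly C G) v N (\<lambda>n s. w n s + w' n s)"
  using diff[OF assms(1) diff[OF Wit_zero[OF p0 C] assms(2)]] by simp

lemma sum:
  assumes "\<And>i. i \<in> I \<Longrightarrow> Wit p (zpoly C G) v N (w i)"
  shows "Wit p (zpoly C G) v N (\<lambda>n s. \<Sum>i\<in>I. w i n s)"
  using assms
  by (induction I rule: infinite_finite_induct) (auto intro: add Wit_zero[OF p0 C])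

lemma scale:
  assumes "Wit p (zpoly C G) v N w"
  shows "Wit p (zpoly C G) v N (\<lambda>n s. of_nat k * w n s)"
  using sum[of "{..<k}" "\<lambda>_. w"] assms by simp

text \<open>Expanding \<open>Wf\<close> yields one sequence \<ell>_(n-a-b) (t_a
  x_b^(p^a))^(p^(n-a-b)) for each pair (a, b), that is, the contribution of a single coordinate
  placed in degree a + b; these finitely many sequences are added as p-typical sums.\<close>

lemma comp:
  assumes tx: "\<And>a b. a + b \<le> N \<Longrightarrow> (\<lambda>s. t s a * x s b ^ (p ^ a)) \<in> zpoly C G"
  shows "Wit p (zpoly C G) v N (\<lambda>n s. \<Sum>j\<le>n. Wf p (v s) (t s) j * x s (n - j) ^ (p ^ j))"
proof -
  let ?S = "\<lambda>N. {(a, b). a + b \<le> (N::nat)}"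
  have fin: "finite (?S N)" for N
    by (rule finite_subset[of _ "{..N} \<times> {..N}"]) auto
  let ?w = "\<lambda>(a, b) n s. if a + b \<le> n then Lf p (v s) (n - (a + b)) * (t s a * x s b ^ (p ^ a)) ^ (p ^ (n - (a + b))) else 0"
  have "Wit p (zpoly C G) v N (\<lambda>n s. \<Sum>q\<in>?S N. ?w q n s)"
  proof (rule sum)
    fix q assume "q \<in> ?S N"
    then obtain a b where q: "q = (a, b)" "a + b \<le> N" by auto
    show "Wit p (zpoly C G) v N (?w q)"
      using Wit_single[OF p0 C tx[OF q(2)], of v N "a + b"] by (simp add: q)
  qed
  then show ?thesis
  proof (rule Wit_cong)
    fix n s assume n: "n \<le> N"
    define F where "F a b = Lf p (v s) (n - (a + b)) * (t s a * x s b ^ (p ^ a)) ^ (p ^ (n - (a + b)))" for a b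
    have "(\<Sum>q\<in>?S N. ?w q n s) = (\<Sum>(a, b)\<in>?S N. if a + b \<le> n then F a b else 0)"
      by (intro sum.cong refl) (simp add: F_def case_prod_beta)
    also have "\<dots> = (\<Sum>(a, b)\<in>?S n. F a b)"
      by (rule sum_triangle_restrict[OF n])
    also have "\<dots> = (\<Sum>j\<le>n. \<Sum>a\<le>j. F a (n - j))"
      by (rule sum_triangle_pairs[symmetric])
    also have "\<dots> = (\<Sum>j\<le>n. Wf p (v s) (t s) j * x s (n - j) ^ (p ^ j))"
      unfolding Wf_def sum_distrib_right
    proof (intro sum.cong refl)
      fix j a assume ja: "j \<in> {..n}" "a \<in> {..j}"
      have e: "n - (a + (n - j)) = j - a" "p ^ j = p ^ a * p ^ (j - a)"
        using ja by (simp_all add: power_add[symmetric])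
      show "F a (n - j) = Lf p (v s) (j - a) * t s a ^ (p ^ (j - a)) * x s (n - j) ^ (p ^ j)"
        unfolding F_def e by (simp add: power_mult power_mult_distrib)
    qed
    finally show "(\<Sum>q\<in>?S N. ?w q n s) = (\<Sum>j\<le>n. Wf p (v s) (t s) j * x s (n - j) ^ (p ^ j))" .
  qed
qed

text \<open>If the values below N vanish, so do the coordinates below N, and coordinate N equals the
  value. This isolates one unknown, as in \<open>act_integral\<close> and
  \<open>conj_integral\<close>.\<close>

lemma single_integral:
  assumes "Wit p (zpoly C G) v N (\<lambda>n s. if n = N then y s else 0)"
  shows "y \<in> zpoly C G"
proof -
  have "(\<lambda>s. (if N = N then y s else 0)) \<in> zpoly C G"
  proof (rule Wit_unique[OF assms, where z = "\<lambda>s n. if n = N then y s else 0"])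
    fix n s assume n: "n \<le> N"
    have "(\<Sum>d<n. Lf p (v s) (n - d) * (if d = N then y s else 0) ^ (p ^ (n - d))) = 0"
      by (rule sum.neutral) (use n p0 in auto)
    then show "(if n = N then y s else 0) = Wf p (v s) (\<lambda>n. if n = N then y s else 0) n"
      by (simp add: Wf_last)
  qed simp
  then show ?thesis by simp
qed

end

lemma zpoly_if:
  "(P \<Longrightarrow> f \<in> zpoly C G) \<Longrightarrow> (\<not> P \<Longrightarrow> g \<in> zpoly C G) \<Longrightarrow> (\<lambda>s. if P then f s else g s) \<in> zpoly C G"
  by (cases P) auto

text \<open>For the sequence \<open>v'\<close> of the right units of the \<open>v\<^sub>n\<close>.\<close>

lemma act_integral:
  assumes p: "Factorial_Ring.prime p" and C: "ratring C"
    and v: "\<And>i. 1 \<le> i \<Longrightarrow> i \<le> N \<Longrightarrow> (\<lambda>s. v s i) \<in> zpoly C G"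
    and t: "\<And>i. i \<le> N \<Longrightarrow> (\<lambda>s. t s i) \<in> zpoly C G" and t0: "\<And>s. t s 0 = 1"
    and v': "\<And>n s. n \<le> N \<Longrightarrow> Lf p (v' s) n = Wf p (v s) (t s) n"
    and n: "1 \<le> n" "n \<le> N"
  shows "(\<lambda>s. v' s n) \<in> zpoly C G"
  using n
proof (induction n rule: less_induct)
  case (less n)
  interpret witt p C G v n
    using p C v less.prems by unfold_locales auto
  have p0: "p > 0" by (rule p0)
  \<comment> \<open>\<open>x\<close> is v' cut off below n, where integrality is known by induction.
    In degree n the recursion for v' then lacks exactly the summand \<open>v' s n\<close>.\<close>
  define x where "x s b = (if 1 \<le> b \<and> b < n then v' s b else 0)" for s b
  have xB: "(\<lambda>s. x s b) \<in> zpoly C G" for b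
    by (cases "1 \<le> b \<and> b < n") (use less in \<open>auto simp: x_def zpoly.const ratring_0[OF C]\<close>)
  have 1: "Wit p (zpoly C G) v n (\<lambda>k s. \<Sum>j\<le>k. Wf p (v s) (t s) j * x s (k - j) ^ (p ^ j))"
    by (rule comp) (use less.prems in \<open>auto intro!: zpoly.mult t zpoly_power[OF C] xB\<close>)
  \<comment> \<open>The right unit of p \<ell>_k is p times the part with t_d, d > 0, plus p
    \<ell>_k itself, which by Hazewinkel's recursion is the p-typical sum of 0, v_1, v_2, ... for k
    > 0. In this form all sequences vanish at k = 0, as a remainder concentrated in degree n
    requires.\<close>
  have 2: "Wit p (zpoly C G) v n (\<lambda>k s. of_nat p * Wf p (v s) (\<lambda>d. if d = 0 then 0 else t s d) k)"
    by (intro scale Wit_seq) (use less.prems in \<open>auto intro!: zpoly_if t zpoly.const ratring_0[OF C]\<close>)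
  have 3: "Wit p (zpoly C G) v n (\<lambda>k s. Wf p (v s) (\<lambda>d. if d = 0 then 0 else v s d) k)"
    by (intro Wit_seq) (use less.prems in \<open>auto intro!: zpoly_if v zpoly.const ratring_0[OF C]\<close>)
  have "Wit p (zpoly C G) v n (\<lambda>k s. if k = n then v' s n else 0)"
  proof (rule Wit_cong[OF diff[OF add[OF 2 3] 1]])
    fix k s assume k: "k \<le> n"
    have eqt: "Wf p (v s) (t s) k = Lf p (v s) k + Wf p (v s) (\<lambda>d. if d = 0 then 0 else t s d) k"
    proof -
      have "{..k} = insert 0 {1..k}" by auto
      then show ?thesis using p0 by (simp add: Wf_def t0)
    qed
    show "of_nat p * Wf p (v s) (\<lambda>d. if d = 0 then 0 else t s d) k
        + Wf p (v s) (\<lambda>d. if d = 0 then 0 else v s d) k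
        - (\<Sum>j\<le>k. Wf p (v s) (t s) j * x s (k - j) ^ (p ^ j)) = (if k = n then v' s n else 0)"
    proof (cases "k = 0")
      case True
      then show ?thesis using less.prems by (simp add: Wf_def x_def)
    next
      case False
      have "Wf p (v s) (\<lambda>d. if d = 0 then 0 else v s d) k = (\<Sum>d<k. Lf p (v s) d * v s (k - d) ^ (p ^ d))"
      proof -
        have "{..k} = insert 0 {1..k}" by auto
        then have "Wf p (v s) (\<lambda>d. if d = 0 then 0 else v s d) k = (\<Sum>d\<in>{1..k}. Lf p (v s) (k - d) * v s d ^ (p ^ (k - d)))"
          using p0 by (simp add: Wf_def)
        also have "\<dots> = (\<Sum>d<k. Lf p (v s) d * v s (k - d) ^ (p ^ d))"
          by (rule sum.reindex_bij_witness[where i = "\<lambda>d. k - d" and j = "\<lambda>d. k - d"]) auto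
        finally show ?thesis .
      qed
      also have "\<dots> = of_nat p * Lf p (v s) k" using False p0 by (simp add: p_Lf)
      finally have A: "of_nat p * Wf p (v s) (\<lambda>d. if d = 0 then 0 else t s d) k
        + Wf p (v s) (\<lambda>d. if d = 0 then 0 else v s d) k = of_nat p * Lf p (v' s) k"
        using v' k less.prems eqt by (simp add: algebra_simps)
      have "(\<Sum>j\<le>k. Wf p (v s) (t s) j * x s (k - j) ^ (p ^ j)) = (\<Sum>j<k. Lf p (v' s) j * x s (k - j) ^ (p ^ j))"
      proof -
        have "{..k} = insert k {..<k}" by auto
        then show ?thesis using p0 k less.prems by (simp add: x_def v'[symmetric])
      qed
      also have "\<dots> = (\<Sum>j<k. Lf p (v' s) j * v' s (k - j) ^ (p ^ j)) - (if k = n then v' s n else 0)"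
      proof -
        have "{..<k} = insert 0 {1..<k}" using False by auto
        moreover have "(\<Sum>j\<in>{1..<k}. Lf p (v' s) j * x s (k - j) ^ (p ^ j)) = (\<Sum>j\<in>{1..<k}. Lf p (v' s) j * v' s (k - j) ^ (p ^ j))"
          by (intro sum.cong) (use k in \<open>auto simp: x_def\<close>)
        ultimately show ?thesis using k False by (auto simp: x_def)
      qed
      also have "\<dots> = of_nat p * Lf p (v' s) k - (if k = n then v' s n else 0)"
        using False p0 by (simp add: p_Lf)
      finally show ?thesis using A by simp
    qed
  qed
  then show ?case by (rule single_integral)
qed

text \<open>Here \<open>c\<close> is the conjugate of \<open>t\<close> in \<open>BP\<^sub>*(BP)\<close>.\<close>

lemma conj_integral:
  assumes p: "Factorial_Ring.prime p" and C: "ratring C"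
    and v: "\<And>i. 1 \<le> i \<Longrightarrow> i \<le> N \<Longrightarrow> (\<lambda>s. v s i) \<in> zpoly C G"
    and t: "\<And>i. i \<le> N \<Longrightarrow> (\<lambda>s. t s i) \<in> zpoly C G"
    and t0: "\<And>s. t s 0 = 1" and c0: "\<And>s. c s 0 = 1"
    and tc: "\<And>n s. n \<le> N \<Longrightarrow> (\<Sum>j\<le>n. Wf p (v s) (c s) j * t s (n - j) ^ (p ^ j)) = Lf p (v s) n"
    and n: "n \<le> N"
  shows "(\<lambda>s. c s n) \<in> zpoly C G"
  using n
proof (induction n rule: less_induct)
  case (less n)
  show ?case
  proof (cases "n = 0")
    case True
    then show ?thesis by (auto simp: c0 intro: zpoly.const ratring_1[OF C])
  next
    case False
    interpret witt p C G v n
      using p C v less.prems by unfold_locales auto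
    \<comment> \<open>The unknown \<open>c s n\<close> is left out; it enters the relation only in
      degree n, with factor t_0 = 1, so the remainder is concentrated there.\<close>
    define c' where "c' s b = (if b < n then c s b else 0)" for s b
    have cB: "(\<lambda>s. c' s b) \<in> zpoly C G" for b
      by (cases "b < n") (use less in \<open>auto simp: c'_def intro: zpoly.const ratring_0[OF C]\<close>)
    have 1: "Wit p (zpoly C G) v n (\<lambda>k s. \<Sum>j\<le>k. Wf p (v s) (c' s) j * t s (k - j) ^ (p ^ j))"
      by (rule comp) (use less.prems in \<open>auto intro!: zpoly.mult t zpoly_power[OF C] cB\<close>)
    have 2: "Wit p (zpoly C G) v n (\<lambda>k s. if 0 \<le> k then Lf p (v s) (k - 0) * 1 ^ (p ^ (k - 0)) else 0)"
      by (rule Wit_single[OF p0 C]) (auto intro: zpoly.const ratring_1[OF C])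
    have "Wit p (zpoly C G) v n (\<lambda>k s. if k = n then c s n else 0)"
    proof (rule Wit_cong[OF diff[OF 2 1]])
      fix k s assume k: "k \<le> n"
      have W: "Wf p (v s) (c' s) j = Wf p (v s) (c s) j - (if j = n then c s n else 0)" if "j \<le> n" for j
      proof (cases "j = n")
        case True
        then show ?thesis by (simp add: Wf_last c'_def)
      next
        case False
        then show ?thesis using that by (auto intro!: Wf_cong simp: c'_def)
      qed
      have "(\<Sum>j\<le>k. Wf p (v s) (c' s) j * t s (k - j) ^ (p ^ j))
         = (\<Sum>j\<le>k. Wf p (v s) (c s) j * t s (k - j) ^ (p ^ j)) - (\<Sum>j\<le>k. if j = n then c s n * t s (k - j) ^ (p ^ j) else 0)"
        unfolding sum_subtractf[symmetric]
        by (intro sum.cong) (use k in \<open>auto simp: W left_diff_distrib\<close>)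
      also have "(\<Sum>j\<le>k. if j = n then c s n * t s (k - j) ^ (p ^ j) else 0) = (if k = n then c s n else 0)"
        using k by (auto simp: sum.delta t0)
      finally show "(if 0 \<le> k then Lf p (v s) (k - 0) * 1 ^ (p ^ (k - 0)) else 0)
         - (\<Sum>j\<le>k. Wf p (v s) (c' s) j * t s (k - j) ^ (p ^ j)) = (if k = n then c s n else 0)"
        using tc k less.prems by simp
    qed
    then show ?thesis by (rule single_integral)
  qed
qed

section \<open>Rational points of the Hopf algebroid\<close>

lemma Wf_alt: "Wf p v x n = (\<Sum>j\<le>n. Lf p v j * x (n - j) ^ (p ^ j))"
  unfolding Wf_def
  by (rule sum.reindex_bij_witness[where i = "\<lambda>d. n - d" and j = "\<lambda>d. n - d"]) auto

lemma Wf_cong_v: "(\<And>i. 1 \<le> i \<Longrightarrow> i \<le> n \<Longrightarrow> v i = w i) \<Longrightarrow> Wf p v x n = Wf p w x n"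
  unfolding Wf_def by (intro sum.cong refl arg_cong2[where f = "(*)"] Lf_cong) auto

text \<open>The inverse of \<open>Lf\<close>: the Hazewinkel generators belonging to the p-typical
  logarithm with coefficients l. Index 0, which \<open>Lf\<close> never reads, is set to 0.\<close>

fun vof :: "nat \<Rightarrow> (nat \<Rightarrow> rat) \<Rightarrow> nat \<Rightarrow> rat" where
  "vof p l n = (if n = 0 then 0 else of_nat p * l n - (\<Sum>j\<in>{1..<n}. l j * vof p l (n - j) ^ (p ^ j)))"

declare vof.simps [simp del]

lemma vof_cong: "(\<And>i. 1 \<le> i \<Longrightarrow> i \<le> n \<Longrightarrow> l i = l' i) \<Longrightarrow> vof p l n = vof p l' n"
proof (induction n rule: less_induct)
  case (less n)
  have "(\<Sum>j\<in>{1..<n}. l j * vof p l (n - j) ^ (p ^ j)) = (\<Sum>j\<in>{1..<n}. l' j * vof p l' (n - j) ^ (p ^ j))"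
    by (intro sum.cong refl arg_cong2[where f = "(*)"] arg_cong2[where f = "(^)"]) (auto simp: less)
  then show ?case
    by (subst (1 2) vof.simps) (simp add: less)
qed

lemma Lf_vof:
  assumes p0: "p > 0" and l0: "l 0 = 1"
  shows "Lf p (vof p l) n = l n"
proof (induction n rule: less_induct)
  case (less n)
  show ?case
  proof (cases "n = 0")
    case False
    have "of_nat p * Lf p (vof p l) n = vof p l n + (\<Sum>j\<in>{1..<n}. Lf p (vof p l) j * vof p l (n - j) ^ (p ^ j))"
      using False by (simp add: p_Lf[OF p0] lessThan_eq_insert_0)
    also have "(\<Sum>j\<in>{1..<n}. Lf p (vof p l) j * vof p l (n - j) ^ (p ^ j)) = (\<Sum>j\<in>{1..<n}. l j * vof p l (n - j) ^ (p ^ j))"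
      by (intro sum.cong) (auto simp: less)
    also have "vof p l n + \<dots> = of_nat p * l n"
      using False by (subst vof.simps) simp
    finally show ?thesis using p0 by simp
  qed (simp add: l0)
qed

lemma vof_Lf:
  assumes p0: "p > 0" and n: "n \<ge> 1"
  shows "vof p (Lf p v) n = v n"
  using n
proof (induction n rule: less_induct)
  case (less n)
  have "of_nat p * Lf p v n = v n + (\<Sum>j\<in>{1..<n}. Lf p v j * v (n - j) ^ (p ^ j))"
    using less.prems by (simp add: p_Lf[OF p0] lessThan_eq_insert_0)
  moreover have "(\<Sum>j\<in>{1..<n}. Lf p v j * v (n - j) ^ (p ^ j)) = (\<Sum>j\<in>{1..<n}. Lf p v j * vof p (Lf p v) (n - j) ^ (p ^ j))"
    by (intro sum.cong refl) (use less in auto)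
  ultimately show ?case
    using less.prems by (subst vof.simps) simp
qed

text \<open>A point \<open>v\<close> of \<open>BP\<^sub>*\<close> and a sequence \<open>t\<close> form a morphism from \<open>v\<close> to \<open>act p v t\<close>; conversely \<open>tseq p v v'\<close> is
  the only morphism from \<open>v\<close> to \<open>v'\<close>, as the coefficients are rational.\<close>

definition act :: "nat \<Rightarrow> (nat \<Rightarrow> rat) \<Rightarrow> (nat \<Rightarrow> rat) \<Rightarrow> nat \<Rightarrow> rat" where
  "act p v t = vof p (Wf p v t)"

lemma Wf_0: "Wf p v t 0 = t 0"
  by (simp add: Wf_def)

lemma Lf_act: "p > 0 \<Longrightarrow> t 0 = 1 \<Longrightarrow> Lf p (act p v t) n = Wf p v t n"
  unfolding act_def by (rule Lf_vof) (auto simp: Wf_0)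

fun tseq :: "nat \<Rightarrow> (nat \<Rightarrow> rat) \<Rightarrow> (nat \<Rightarrow> rat) \<Rightarrow> nat \<Rightarrow> rat" where
  "tseq p v v' n = Lf p v' n - (\<Sum>d<n. Lf p v (n - d) * tseq p v v' d ^ (p ^ (n - d)))"

declare tseq.simps [simp del]

lemma tseq_0 [simp]: "tseq p v v' 0 = 1"
  by (subst tseq.simps) simp

lemma Wf_tseq: "Wf p v (tseq p v v') n = Lf p v' n"
  by (subst Wf_last, subst (2) tseq.simps) simp

lemma Wf_inj:
  assumes "\<And>n. Wf p v x n = Wf p v y n" shows "x n = y n"
proof (induction n rule: less_induct)
  case (less n)
  then have "(\<Sum>d<n. Lf p v (n - d) * x d ^ (p ^ (n - d))) = (\<Sum>d<n. Lf p v (n - d) * y d ^ (p ^ (n - d)))"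
    by simp
  then show ?case using assms[of n] by (simp add: Wf_last)
qed

lemma tseq_unique: "(\<And>n. Wf p v t n = Lf p v' n) \<Longrightarrow> tseq p v v' = t"
  by (rule ext, rule Wf_inj[of p v]) (simp add: Wf_tseq)

lemma act_tseq: "p > 0 \<Longrightarrow> n \<ge> 1 \<Longrightarrow> act p v (tseq p v v') n = v' n"
  unfolding act_def using vof_Lf[of p n v'] by (simp add: Wf_tseq[abs_def])

text \<open>The value of \<Delta>(t_n) when t is a morphism out of v and u one out of its target; in
  \<open>Wf_Dt\<close> the \<ell>_i and t_j are collected into right units of \<ell>_(i+j).\<close>

fun Dt :: "nat \<Rightarrow> (nat \<Rightarrow> rat) \<Rightarrow> (nat \<Rightarrow> rat) \<Rightarrow> (nat \<Rightarrow> rat) \<Rightarrow> nat \<Rightarrow> rat" where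
  "Dt p v t u n = (\<Sum>j\<le>n. Wf p v t j * u (n - j) ^ (p ^ j)) - (\<Sum>d<n. Lf p v (n - d) * Dt p v t u d ^ (p ^ (n - d)))"

declare Dt.simps [simp del]

lemma Wf_Dt: "Wf p v (Dt p v t u) n = (\<Sum>j\<le>n. Wf p v t j * u (n - j) ^ (p ^ j))"
  by (subst Wf_last, subst (2) Dt.simps) simp

text \<open>Composition of morphisms. As the morphism between two points is unique, the coproduct
  amounts to forgetting the middle point.\<close>

lemma Dt_tseq: "Dt p v (tseq p v v') (tseq p v' v'') = tseq p v v''"
  by (rule tseq_unique[symmetric]) (simp add: Wf_Dt Wf_tseq Wf_alt[symmetric])

section \<open>Values of the right unit and the coproduct at points, and their integrality\<close>

definition venv :: "(nat \<Rightarrow> rat) \<Rightarrow> (nat \<Rightarrow> rat) \<Rightarrow> (nat \<Rightarrow> rat) \<Rightarrow> gen \<Rightarrow> rat" where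
  "venv v t u x = (case x of V n \<Rightarrow> v n | gen.T n \<Rightarrow> t n | U n \<Rightarrow> u n)"

lemma venv_simps [simp]: "venv v t u (V n) = v n" "venv v t u (gen.T n) = t n" "venv v t u (U n) = u n"
  by (simp_all add: venv_def)

lemma ev_ell: "ev \<rho> (ell p n) = Lf p (\<lambda>n. \<rho> (V n)) n"
proof (induction n rule: less_induct)
  case (less n)
  show ?case
    by (subst ell.simps, subst Lf.simps) (simp add: ev_mult ev_sum ev_power less)
qed

lemma ev_t_gen: "ev \<rho> (t_gen n) = (if n = 0 then 1 else \<rho> (gen.T n))"
  by (simp add: t_gen_def)

lemma ev_u_gen: "ev \<rho> (u_gen n) = (if n = 0 then 1 else \<rho> (U n))"
  by (simp add: u_gen_def)

abbreviation v_at :: "(gen \<Rightarrow> rat) \<Rightarrow> nat \<Rightarrow> rat" where "v_at \<rho> \<equiv> \<lambda>n. \<rho> (V n)"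
abbreviation t_at :: "(gen \<Rightarrow> rat) \<Rightarrow> nat \<Rightarrow> rat" where "t_at \<rho> \<equiv> \<lambda>n. if n = 0 then 1 else \<rho> (gen.T n)"
abbreviation u_at :: "(gen \<Rightarrow> rat) \<Rightarrow> nat \<Rightarrow> rat" where "u_at \<rho> \<equiv> \<lambda>n. if n = 0 then 1 else \<rho> (U n)"

lemma ev_eta_R_ell: "ev \<rho> (eta_R_ell p n) = Wf p (v_at \<rho>) (t_at \<rho>) n"
  by (simp add: eta_R_ell_def Wf_alt ev_sum ev_mult ev_power ev_ell ev_t_gen)

lemma ev_eta_R_v: "n \<ge> 1 \<Longrightarrow> ev \<rho> (eta_R_v p n) = act p (v_at \<rho>) (t_at \<rho>) n"
proof (induction n rule: less_induct)
  case (less n)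
  have "(\<Sum>j = 1..<n. Wf p (v_at \<rho>) (t_at \<rho>) j * ev \<rho> (eta_R_v p (n - j)) ^ (p ^ j))
     = (\<Sum>j = 1..<n. Wf p (v_at \<rho>) (t_at \<rho>) j * act p (v_at \<rho>) (t_at \<rho>) (n - j) ^ (p ^ j))"
    by (intro sum.cong refl) (use less in auto)
  then show ?case
    using less.prems unfolding act_def
    by (subst eta_R_v.simps, subst vof.simps)
      (simp add: ev_diff ev_mult ev_of_nat ev_sum ev_power ev_eta_R_ell)
qed

lemma ev_eta_R:
  assumes "f \<in> polys_over C (V ` {1..})"
  shows "ev \<rho> (eta_R p f) = ev (venv (act p (v_at \<rho>) (t_at \<rho>)) t u) f"
  unfolding eta_R_def ev_qsubst
proof (rule ev_cong)
  fix x assume "x \<in> (\<Union>e\<in>Poly_Mapping.keys f. Poly_Mapping.keys e)"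
  then obtain n where "x = V n" "n \<ge> 1" using assms unfolding polys_over_def by fastforce
  then show "ev \<rho> (case x of V n \<Rightarrow> eta_R_v p n | _ \<Rightarrow> qvar x) = venv (act p (v_at \<rho>) (t_at \<rho>)) t u x"
    by (simp add: ev_eta_R_v)
qed

lemma ev_Delta_t: "ev \<rho> (Delta_t p n) = Dt p (v_at \<rho>) (t_at \<rho>) (u_at \<rho>) n"
proof (induction n rule: less_induct)
  case (less n)
  let ?v = "v_at \<rho>" and ?t = "t_at \<rho>" and ?u = "u_at \<rho>"
  have 1: "(\<Sum>i = 1..n. Lf p ?v i * ev \<rho> (Delta_t p (n - i)) ^ (p ^ i))
     = (\<Sum>d<n. Lf p ?v (n - d) * Dt p ?v ?t ?u d ^ (p ^ (n - d)))"
    by (rule sum.reindex_bij_witness[where i = "\<lambda>d. n - d" and j = "\<lambda>d. n - d"]) (auto simp: less)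
  have 2: "(\<Sum>i\<le>n. \<Sum>j\<le>n - i. Lf p ?v i * ?t j ^ (p ^ i) * ?u (n - i - j) ^ (p ^ (i + j)))
     = (\<Sum>j\<le>n. Wf p ?v ?t j * ?u (n - j) ^ (p ^ j))"
    unfolding Wf_alt sum_distrib_right
    unfolding sum.Sigma[OF finite_atMost ballI[OF finite_atMost]]
    by (rule sum.reindex_bij_witness[where i = "\<lambda>(k, i). (i, k - i)" and j = "\<lambda>(i, j). (i + j, i)"]) auto
  show ?case
    by (subst Delta_t.simps, subst Dt.simps)
      (simp only: ev_diff ev_sum ev_mult ev_power ev_ell ev_t_gen ev_u_gen 1 2)
qed

definition pgens :: "gen set \<Rightarrow> ((gen \<Rightarrow> rat) \<Rightarrow> rat) set" where
  "pgens S = (\<lambda>x \<rho>. \<rho> x) ` S"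

lemma zpoly_at: "x \<in> S \<Longrightarrow> (\<lambda>\<rho>. \<rho> x) \<in> zpoly C (pgens S)"
  by (rule zpoly.gen) (auto simp: pgens_def)

lemma eta_R_v_integral:
  assumes p: "Factorial_Ring.prime p" and n: "n \<ge> 1"
  shows "eta_R_v p n \<in> BPBP p"
proof -
  have C: "ratring (Z_local p)" by (rule Z_local_ratring[OF p])
  have p0: "p > 0" using p prime_gt_0_nat by blast
  let ?S = "V ` {1..} \<union> gen.T ` {1..}"
  have "(\<lambda>\<rho>. act p (v_at \<rho>) (t_at \<rho>) n) \<in> zpoly (Z_local p) (pgens ?S)"
  proof (rule act_integral[OF p C, where v = v_at and t = t_at and N = n])
    show "(\<lambda>s. t_at s i) \<in> zpoly (Z_local p) (pgens ?S)" for i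
      by (rule zpoly_if) (auto intro!: zpoly.const ratring_1[OF C] zpoly_at)
  qed (use n in \<open>auto intro!: zpoly_at simp: Lf_act[OF p0]\<close>)
  then show ?thesis
    unfolding BPBP_def using n by (intro polys_over_if_zpoly[OF C]) (simp add: ev_eta_R_v pgens_def)
qed

text \<open>\<open>comp\<close> exhibits the right-hand side of \<open>Wf_Dt\<close> as a p-typical
  sum with integral coordinates, and \<open>Wit_unique\<close> identifies these with the values of
  \<open>Delta_t\<close>, whose recursion has denominators.\<close>

lemma Delta_t_integral:
  assumes p: "Factorial_Ring.prime p"
  shows "Delta_t p n \<in> polys_over (Z_local p) (V ` {1..} \<union> gen.T ` {1..} \<union> U ` {1..})"
proof -
  have C: "ratring (Z_local p)" by (rule Z_local_ratring[OF p])
  let ?S = "V ` {1..} \<union> gen.T ` {1..} \<union> U ` {1..}"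
  interpret witt p "Z_local p" "pgens ?S" v_at n
    by unfold_locales (auto intro!: p C zpoly_at)
  have t: "(\<lambda>\<rho>. t_at \<rho> i) \<in> zpoly (Z_local p) (pgens ?S)" for i
    by (rule zpoly_if) (auto intro!: zpoly.const ratring_1[OF C] zpoly_at)
  have u: "(\<lambda>\<rho>. u_at \<rho> i) \<in> zpoly (Z_local p) (pgens ?S)" for i
    by (rule zpoly_if) (auto intro!: zpoly.const ratring_1[OF C] zpoly_at)
  have "Wit p (zpoly (Z_local p) (pgens ?S)) v_at n (\<lambda>n \<rho>. \<Sum>j\<le>n. Wf p (v_at \<rho>) (t_at \<rho>) j * u_at \<rho> (n - j) ^ (p ^ j))"
    by (rule comp) (intro zpoly.mult t u zpoly_power[OF C])
  from Wit_unique[OF this, where z = "\<lambda>\<rho>. Dt p (v_at \<rho>) (t_at \<rho>) (u_at \<rho>)" and n = n]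
  have "(\<lambda>\<rho>. Dt p (v_at \<rho>) (t_at \<rho>) (u_at \<rho>) n) \<in> zpoly (Z_local p) (pgens ?S)"
    by (simp add: Wf_Dt)
  then show ?thesis
    by (intro polys_over_if_zpoly[OF C]) (simp add: ev_Delta_t pgens_def)
qed

text \<open>The source is obtained from the target by the inverse morphism, which is integral by
  \<open>conj_integral\<close>, so \<open>act_integral\<close> applies to it. In this way left units
  become polynomials in right units and the t's.\<close>

lemma left_integral:
  assumes p: "Factorial_Ring.prime p" and C: "ratring C"
    and v': "\<And>i. 1 \<le> i \<Longrightarrow> (\<lambda>s. v' s i) \<in> zpoly C G"
    and t: "\<And>i. (\<lambda>s. tseq p (v s) (v' s) i) \<in> zpoly C G"
    and n: "1 \<le> n"
  shows "(\<lambda>s. v s n) \<in> zpoly C G"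
proof (rule act_integral[OF p C v', where t = "\<lambda>s. tseq p (v' s) (v s)" and N = n])
  show "(\<lambda>s. tseq p (v' s) (v s) i) \<in> zpoly C G" if "i \<le> n" for i
  proof (rule conj_integral[OF p C v' t, where N = i])
    show "(\<Sum>j\<le>n. Wf p (v' s) (tseq p (v' s) (v s)) j * tseq p (v s) (v' s) (n - j) ^ p ^ j) = Lf p (v' s) n" for n s
      by (simp add: Wf_tseq Wf_alt[symmetric])
  qed auto
qed (use n in \<open>auto simp: Wf_tseq\<close>)

text \<open>The coordinates of a point: \<open>a\<close> holds \<open>v\<^sub>1, \<dots>, v\<^sub>m\<close> and \<open>y\<close> holds \<open>\<lambda>^\<^sub>1, \<lambda>^\<^sub>2, \<dots>\<close>.\<close>

definition vtrunc :: "nat \<Rightarrow> (nat \<Rightarrow> rat) \<Rightarrow> nat \<Rightarrow> rat" where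
  "vtrunc m a i = (if i \<le> m then a i else 0)"

text \<open>The logarithm coefficients of the point with coordinates a and y: the relation between
  \<ell>^_k and the \<lambda>^ is solved for \<ell>_(m+k). For n \<le> m the sum is empty and only a
  enters.\<close>

fun Lp :: "nat \<Rightarrow> nat \<Rightarrow> (nat \<Rightarrow> rat) \<Rightarrow> (nat \<Rightarrow> rat) \<Rightarrow> nat \<Rightarrow> rat" where
  "Lp p m a y n = Lf p (vtrunc m a) n + (\<Sum>j<n - m. Lp p m a y j * y (n - m - j) ^ (p ^ j))"

declare Lp.simps [simp del]

definition pt :: "nat \<Rightarrow> nat \<Rightarrow> (nat \<Rightarrow> rat) \<Rightarrow> (nat \<Rightarrow> rat) \<Rightarrow> nat \<Rightarrow> rat" where
  "pt p m a y = vof p (Lp p m a y)"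

lemma Lp_low: "n \<le> m \<Longrightarrow> Lp p m a y n = Lf p (vtrunc m a) n"
  by (subst Lp.simps) simp

lemma Lf_pt: "p > 0 \<Longrightarrow> Lf p (pt p m a y) n = Lp p m a y n"
  unfolding pt_def by (rule Lf_vof) (auto simp: Lp_low)

lemma pt_low: "p > 0 \<Longrightarrow> 1 \<le> i \<Longrightarrow> i \<le> m \<Longrightarrow> pt p m a y i = a i"
proof -
  assume p0: "p > 0" and i: "1 \<le> i" "i \<le> m"
  have "vof p (Lp p m a y) i = vof p (Lf p (vtrunc m a)) i"
    by (rule vof_cong) (use i in \<open>simp add: Lp_low\<close>)
  then show ?thesis using vof_Lf[OF p0 i(1)] i by (simp add: pt_def vtrunc_def)
qed

fun lam :: "nat \<Rightarrow> nat \<Rightarrow> (nat \<Rightarrow> rat) \<Rightarrow> nat \<Rightarrow> rat" where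
  "lam p m v k = Lf p v (m + k) - Lf p (vtrunc m v) (m + k) - (\<Sum>j\<in>{1..<k}. Lf p v j * lam p m v (k - j) ^ (p ^ j))"

declare lam.simps [simp del]

lemma ev_hat_lambda: "ev \<rho> (hat_lambda p m k) = lam p m (v_at \<rho>) k"
proof (induction k rule: less_induct)
  case (less k)
  have "ev \<rho> (hat_ell p m k) = Lf p (v_at \<rho>) (m + k) - Lf p (vtrunc m (v_at \<rho>)) (m + k)"
    unfolding hat_ell_def ev_diff ev_ell ev_qsubst
    by (auto intro!: arg_cong2[where f = "(-)"] Lf_cong simp: vtrunc_def)
  then show ?case
    by (subst hat_lambda.simps, subst lam.simps)
      (simp add: ev_diff ev_sum ev_mult ev_power ev_ell less)
qed

lemma Lp_high: "k \<ge> 1 \<Longrightarrow> Lp p m a y (m + k) = Lf p (vtrunc m a) (m + k) + y k + (\<Sum>j\<in>{1..<k}. Lp p m a y j * y (k - j) ^ (p ^ j))"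
  by (subst Lp.simps) (simp add: lessThan_eq_insert_0 Lp_low)

lemma vtrunc_cong: "(\<And>i. 1 \<le> i \<Longrightarrow> i \<le> m \<Longrightarrow> v i = w i) \<Longrightarrow> Lf p (vtrunc m v) n = Lf p (vtrunc m w) n"
  by (rule Lf_cong) (auto simp: vtrunc_def)

lemma lam_pt:
  assumes p0: "p > 0" and k: "k \<ge> 1"
  shows "lam p m (pt p m a y) k = y k"
  using k
proof (induction k rule: less_induct)
  case (less k)
  have "(\<Sum>j\<in>{1..<k}. Lp p m a y j * lam p m (pt p m a y) (k - j) ^ (p ^ j)) = (\<Sum>j\<in>{1..<k}. Lp p m a y j * y (k - j) ^ (p ^ j))"
    by (intro sum.cong refl) (use less in auto)
  moreover have "Lf p (vtrunc m (pt p m a y)) (m + k) = Lf p (vtrunc m a) (m + k)"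
    by (rule vtrunc_cong) (simp add: pt_low[OF p0])
  ultimately show ?case
    using less.prems by (subst lam.simps) (simp add: Lf_pt[OF p0] Lp_high)
qed

text \<open>Together with \<open>lam_pt\<close> this makes v_1, ..., v_m and the \<lambda>^_k a
  coordinate system on all rational points, so a polynomial in the v_n is determined by its function
  of the coordinates.\<close>

lemma pt_lam:
  assumes p0: "p > 0" and a: "\<And>i. 1 \<le> i \<Longrightarrow> i \<le> m \<Longrightarrow> a i = v i" and n: "n \<ge> 1"
  shows "pt p m a (lam p m v) n = v n"
proof -
  have "Lp p m a (lam p m v) n = Lf p v n" for n
  proof (induction n rule: less_induct)
    case (less n)
    have tr: "Lf p (vtrunc m a) n = Lf p (vtrunc m v) n"
      by (rule vtrunc_cong) (simp add: a)
    show ?case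
    proof (cases "n \<le> m")
      case True
      then show ?thesis by (simp add: Lp_low tr) (rule Lf_cong, simp add: vtrunc_def)
    next
      case False
      then obtain k where k: "n = m + k" "k \<ge> 1" by (metis add.commute le_Suc_ex not_less_eq_eq Suc_eq_plus1 add_leD2 nat_le_linear le_add_same_cancel1 less_one not_le add_0_right)
      have "(\<Sum>j\<in>{1..<k}. Lp p m a (lam p m v) j * lam p m v (k - j) ^ (p ^ j)) = (\<Sum>j\<in>{1..<k}. Lf p v j * lam p m v (k - j) ^ (p ^ j))"
        by (intro sum.cong refl) (use less k in auto)
      then show ?thesis
        using k tr by (simp add: Lp_high) (subst lam.simps, simp)
    qed
  qed
  then have "Lp p m a (lam p m v) = Lf p v" by blast
  then show ?thesis unfolding pt_def using vof_Lf[OF p0 n] by simp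
qed

section \<open>Morphisms between points with the same v_1, ..., v_m\<close>

lemma tseq_cong:
  assumes "\<And>i. 1 \<le> i \<Longrightarrow> v i = w i" "\<And>i. 1 \<le> i \<Longrightarrow> v' i = w' i"
  shows "tseq p v v' = tseq p w w'"
proof (rule tseq_unique)
  fix n
  have "Wf p v (tseq p w w') n = Wf p w (tseq p w w') n" by (rule Wf_cong_v) (use assms in auto)
  also have "\<dots> = Lf p w' n" by (rule Wf_tseq)
  also have "\<dots> = Lf p v' n" by (rule Lf_cong) (use assms in auto)
  finally show "Wf p v (tseq p w w') n = Lf p v' n" .
qed

text \<open>Points with common a have the same \<ell>_n for n \<le> m, so t_1, ..., t_m vanish. This
  is why the morphism belongs to \<Gamma>(m+1).\<close>

lemma tseq_low:
  assumes p0: "p > 0" and n: "1 \<le> n" "n \<le> m"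
  shows "tseq p (pt p m a y) (pt p m a w) n = 0"
  using n
proof (induction n rule: less_induct)
  case (less n)
  have "{..<n} = insert 0 {1..<n}" using less.prems by auto
  moreover have "(\<Sum>d\<in>{1..<n}. Lf p (pt p m a y) (n - d) * tseq p (pt p m a y) (pt p m a w) d ^ (p ^ (n - d))) = 0"
    by (rule sum.neutral) (use less p0 in auto)
  ultimately show ?case
    using less.prems by (subst tseq.simps) (simp add: Lf_pt[OF p0] Lp_low)
qed

lemma tseq_first:
  assumes p0: "p > 0"
  shows "tseq p (pt p m a y) (pt p m a w) (Suc m) = w 1 - y 1"
proof -
  have "{..<Suc m} = insert 0 {1..m}" by auto
  moreover have "(\<Sum>d\<in>{1..m}. Lf p (pt p m a y) (Suc m - d) * tseq p (pt p m a y) (pt p m a w) d ^ (p ^ (Suc m - d))) = 0"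
    by (rule sum.neutral) (use p0 in \<open>auto simp: tseq_low\<close>)
  moreover have "Lp p m a u (Suc m) = Lf p (vtrunc m a) (Suc m) + u 1" for u
    using Lp_high[of 1 p m a u] by simp
  ultimately show ?thesis
    by (subst tseq.simps) (simp add: Lf_pt[OF p0])
qed

text \<open>Logarithm coefficients of the source of a morphism t, given those of its target: the
  formula for the right unit of \<ell>_n is solved for the summand that contains t_0 = 1.\<close>

fun lback :: "nat \<Rightarrow> (nat \<Rightarrow> rat) \<Rightarrow> (nat \<Rightarrow> rat) \<Rightarrow> nat \<Rightarrow> rat" where
  "lback p l t n = l n - (\<Sum>i<n. lback p l t i * t (n - i) ^ (p ^ i))"

declare lback.simps [simp del]

text \<open>Moving the first point of a chain makes the t's of its first step arbitrary while all
  points to the right stay fixed; \<open>gf_indep\<close> reads off coefficients in this way. The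
  source built by \<open>lback\<close> keeps v_1, ..., v_m because t_1, ..., t_m vanish.\<close>

lemma exists_left_point:
  assumes p0: "p > 0" and t0: "t 0 = 1" and t: "\<And>n. 1 \<le> n \<Longrightarrow> n \<le> m \<Longrightarrow> t n = 0"
  shows "\<exists>y. tseq p (pt p m a y) (pt p m a w) = t"
proof -
  define l where "l = lback p (Lf p (pt p m a w)) t"
  have l0: "l 0 = 1" by (simp add: l_def) (subst lback.simps, simp)
  have lr: "l n = Lf p (pt p m a w) n - (\<Sum>i<n. l i * t (n - i) ^ (p ^ i))" for n
    unfolding l_def by (rule lback.simps)
  define v where "v = vof p l"
  have Lv: "Lf p v n = l n" for n unfolding v_def by (rule Lf_vof[of p l, OF p0 l0])
  have low: "l n = Lf p (pt p m a w) n" if "1 \<le> n" "n \<le> m" for n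
  proof -
    have "(\<Sum>i<n. l i * t (n - i) ^ (p ^ i)) = 0"
      by (rule sum.neutral) (use that t p0 in auto)
    then show ?thesis unfolding l_def by (subst lback.simps) simp
  qed
  have vlow: "v i = a i" if "1 \<le> i" "i \<le> m" for i
  proof -
    have "v i = vof p (Lf p (pt p m a w)) i"
      unfolding v_def by (rule vof_cong) (use that low in auto)
    then show ?thesis using that vof_Lf[OF p0] pt_low[OF p0] by simp
  qed
  have pv: "pt p m a (lam p m v) i = v i" if "1 \<le> i" for i
    by (rule pt_lam[OF p0 _ that]) (use vlow in auto)
  have "Wf p v t n = Lf p (pt p m a w) n" for n
  proof -
    have "{..n} = insert n {..<n}" by auto
    then show ?thesis
      using lr[of n] by (simp add: Wf_alt Lv t0)
  qed
  then have "tseq p v (pt p m a w) = t" by (rule tseq_unique)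
  then have "tseq p (pt p m a (lam p m v)) (pt p m a w) = t"
    using tseq_cong[of "pt p m a (lam p m v)" v "pt p m a w" "pt p m a w" p] pv by simp
  then show ?thesis by blast
qed

text \<open>The target is \<open>act p v t\<close>, and it keeps v_1, ..., v_m because t_1, ..., t_m
  vanish. This lets \<open>exists_penv\<close> realise every value of the t's by a pair of
  points.\<close>

lemma exists_right_point:
  assumes p0: "p > 0" and t0: "t 0 = 1" and t: "\<And>n. 1 \<le> n \<Longrightarrow> n \<le> m \<Longrightarrow> t n = 0"
  shows "\<exists>w. tseq p (pt p m v (lam p m v)) (pt p m v w) = t"
proof -
  define v' where "v' = act p v t"
  have Lv: "Lf p v' n = Wf p v t n" for n unfolding v'_def by (rule Lf_act[of p t, OF p0 t0])
  have low: "Lf p v' n = Lf p v n" if "n \<le> m" for n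
  proof -
    have "{..n} = insert 0 {1..n}" by auto
    moreover have "(\<Sum>d\<in>{1..n}. Lf p v (n - d) * t d ^ (p ^ (n - d))) = 0"
      by (rule sum.neutral) (use that t p0 in auto)
    ultimately show ?thesis by (simp add: Lv Wf_def t0)
  qed
  have vlow: "v' i = v i" if "1 \<le> i" "i \<le> m" for i
  proof -
    have "vof p (Lf p v') i = vof p (Lf p v) i"
      by (rule vof_cong) (use that low in auto)
    then show ?thesis using that by (simp add: vof_Lf[OF p0])
  qed
  have "tseq p (pt p m v (lam p m v)) (pt p m v (lam p m v')) = tseq p v v'"
    by (rule tseq_cong; rule pt_lam[OF p0]) (use vlow in auto)
  also have "tseq p v v' = t" by (rule tseq_unique) (simp add: Lv)
  finally show ?thesis by blast
qed

section \<open>Integrality of the coordinate changes between v, \<lambda>^ and t\<close>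

definition zero0 :: "(nat \<Rightarrow> rat) \<Rightarrow> nat \<Rightarrow> rat" where
  "zero0 x d = (if d = 0 then 0 else x d)"

text \<open>\<ell>^_k is itself a p-typical sum, with coordinates 0, \<lambda>^_1, \<lambda>^_2,
  ...; this brings the closure properties of such sums to bear on the \<lambda>^.\<close>

lemma Lf_pt_diff:
  assumes p0: "p > 0"
  shows "Lf p (pt p m a y) (m + k) = Lf p (vtrunc m a) (m + k) + Wf p (pt p m a y) (zero0 y) k"
proof -
  have "{..k} = insert k {..<k}" by auto
  moreover have "(\<Sum>j<k. Lp p m a y j * zero0 y (k - j) ^ (p ^ j)) = (\<Sum>j<k. Lp p m a y j * y (k - j) ^ (p ^ j))"
    by (intro sum.cong) (auto simp: zero0_def)
  ultimately have "Wf p (pt p m a y) (zero0 y) k = (\<Sum>j<k. Lp p m a y j * y (k - j) ^ (p ^ j))"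
    using p0 by (simp add: Wf_alt Lf_pt) (simp add: zero0_def)
  then show ?thesis by (subst Lf_pt[OF p0], subst Lp.simps) simp
qed

text \<open>Let h be \<ell> minus its truncation. In p h_(m+k) the Hazewinkel recursions of both
  parts combine: the summands with j < k form the p-typical sum of the v_(m+d), those with j \<ge> k
  are h_j times powers of v_1, ..., v_m, and h_j is a p-typical sum of the \<lambda>^. Solving for
  the v_(m+d) leaves integral sequences only.\<close>

lemma pt_integral:
  fixes a y :: "'s \<Rightarrow> nat \<Rightarrow> rat"
  assumes p: "Factorial_Ring.prime p" and C: "ratring C" and m: "m > 0"
    and a: "\<And>i. 1 \<le> i \<Longrightarrow> i \<le> m \<Longrightarrow> (\<lambda>s. a s i) \<in> zpoly C G"
    and y: "\<And>i. 1 \<le> i \<Longrightarrow> (\<lambda>s. y s i) \<in> zpoly C G"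
    and n: "n \<ge> 1"
  shows "(\<lambda>s. pt p m (a s) (y s) n) \<in> zpoly C G"
  using n
proof (induction n rule: less_induct)
  case (less n)
  have p0: "p > 0" using p prime_gt_0_nat by blast
  define v where "v s = pt p m (a s) (y s)" for s
  have vlow: "v s i = a s i" if "1 \<le> i" "i \<le> m" for s i
    using that by (simp add: v_def pt_low[OF p0])
  show ?case
  proof (cases "n \<le> m")
    case True
    then show ?thesis using a less.prems by (simp add: pt_low[OF p0])
  next
    case False
    define k where "k = n - m"
    have k: "n = m + k" "k \<ge> 1" using False by (auto simp: k_def)
    \<comment> \<open>The coefficients involve v_1, ..., v_k only, and k < n because m > 0, so the
      induction hypothesis covers them.\<close>
    interpret witt p C G v k
      by unfold_locales (use p C less.IH k m in \<open>auto simp: v_def\<close>)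
    \<comment> \<open>The exponent of \<open>a s c\<close> is chosen so that in
      \<open>z c s (k' - j) ^ (p ^ j)\<close> it becomes p^(m+k'-c) for every j; the factor then
      leaves the sum over j.\<close>
    define z where "z c s d = (if d \<ge> c then zero0 (y s) (d - c) * a s c ^ (p ^ (m + d - c)) else 0)" for c s d
    define x where "x s d = (if d = 0 then 0 else v s (m + d))" for s d
    have yB: "(\<lambda>s. zero0 (y s) i) \<in> zpoly C G" for i
      unfolding zero0_def by (rule zpoly_if) (auto intro: y zpoly.const ratring_0[OF C])
    have "Wit p (zpoly C G) v k (\<lambda>k s. of_nat p * Wf p (v s) (zero0 (y s)) k - (\<Sum>c\<in>{1..m}. Wf p (v s) (z c s) k))"
    proof (intro diff scale sum Wit_seq)
      fix c i assume c: "c \<in> {1..m}"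
      show "(\<lambda>s. z c s i) \<in> zpoly C G"
        unfolding z_def using c by (intro zpoly_if zpoly.mult yB zpoly_power[OF C] a) (auto intro: zpoly.const ratring_0[OF C])
    qed (rule yB)
    then have "(\<lambda>s. x s k) \<in> zpoly C G"
    proof (rule Wit_unique)
      fix k' s assume "k' \<le> k"
      define L where "L = Lf p (v s)"
      define K where "K = Lf p (vtrunc m (a s))"
      define h where "h j = L j - K j" for j
      have hW: "h (m + j) = Wf p (v s) (zero0 (y s)) j" for j
        unfolding h_def L_def K_def v_def Lf_pt_diff[OF p0] by simp
      have h0: "h j = 0" if "j \<le> m" for j
        using that by (simp add: h_def L_def K_def v_def Lf_pt[OF p0] Lp_low)
      have Wz: "Wf p (v s) (z c s) k' = h (m + k' - c) * a s c ^ (p ^ (m + k' - c))" if c: "c \<in> {1..m}" for c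
      proof (cases "c \<le> k'")
        case True
        have "Wf p (v s) (z c s) k' = (\<Sum>j\<le>k' - c. L j * z c s (k' - j) ^ (p ^ j))"
          unfolding Wf_alt L_def
          by (rule sum.mono_neutral_right) (use p0 in \<open>auto simp: z_def\<close>)
        also have "\<dots> = (\<Sum>j\<le>k' - c. L j * zero0 (y s) (k' - c - j) ^ (p ^ j) * a s c ^ (p ^ (m + k' - c)))"
        proof (intro sum.cong refl)
          fix j assume j: "j \<in> {..k' - c}"
          then have e: "k' - j - c = k' - c - j" "c \<le> k' - j" "p ^ (m + k' - c) = p ^ (m + (k' - j) - c) * p ^ j"
            using True by (auto simp: power_add[symmetric])
          show "L j * z c s (k' - j) ^ (p ^ j) = L j * zero0 (y s) (k' - c - j) ^ (p ^ j) * a s c ^ (p ^ (m + k' - c))"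
            using e(2) unfolding z_def e by (simp add: power_mult power_mult_distrib)
        qed
        also have "\<dots> = Wf p (v s) (zero0 (y s)) (k' - c) * a s c ^ (p ^ (m + k' - c))"
          by (simp add: Wf_alt L_def sum_distrib_right)
        finally show ?thesis using True hW[of "k' - c"] by simp
      next
        case False
        then show ?thesis
          using c p0 by (simp add: h0) (auto simp: Wf_alt z_def intro!: sum.neutral)
      qed
      show "of_nat p * Wf p (v s) (zero0 (y s)) k' - (\<Sum>c\<in>{1..m}. Wf p (v s) (z c s) k') = Wf p (v s) (x s) k'"
      proof (cases "k' = 0")
        case True
        have "(\<Sum>c\<in>{1..m}. Wf p (v s) (z c s) k') = 0"
          by (rule sum.neutral) (use Wz True in \<open>simp add: h0\<close>)
        then show ?thesis using True by (simp add: Wf_0 x_def zero0_def)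
      next
        case False
        have "of_nat p * h (m + k') = (\<Sum>j<m + k'. L j * v s (m + k' - j) ^ (p ^ j) - K j * vtrunc m (a s) (m + k' - j) ^ (p ^ j))"
          using m by (simp add: h_def right_diff_distrib L_def K_def p_Lf[OF p0] sum_subtractf)
        also have "\<dots> = (\<Sum>j<m + k'. if j < k' then L j * v s (m + k' - j) ^ (p ^ j) else h j * a s (m + k' - j) ^ (p ^ j))"
          by (intro sum.cong refl) (use p0 in \<open>auto simp: vtrunc_def vlow h_def algebra_simps\<close>)
        also have "\<dots> = (\<Sum>j<k'. L j * v s (m + k' - j) ^ (p ^ j)) + (\<Sum>j\<in>{k'..<m + k'}. h j * a s (m + k' - j) ^ (p ^ j))"
        proof -
          have "{..<m + k'} = {..<k'} \<union> {k'..<m + k'}" by auto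
          then show ?thesis by (simp add: sum.union_disjoint ivl_disj_int)
        qed
        also have "(\<Sum>j\<in>{k'..<m + k'}. h j * a s (m + k' - j) ^ (p ^ j)) = (\<Sum>c\<in>{1..m}. h (m + k' - c) * a s c ^ (p ^ (m + k' - c)))"
          by (rule sum.reindex_bij_witness[where i = "\<lambda>c. m + k' - c" and j = "\<lambda>j. m + k' - j"]) auto
        also have "\<dots> = (\<Sum>c\<in>{1..m}. Wf p (v s) (z c s) k')"
          by (intro sum.cong) (simp_all add: Wz)
        also have "(\<Sum>j<k'. L j * v s (m + k' - j) ^ (p ^ j)) = Wf p (v s) (x s) k'"
        proof -
          have "{..k'} = insert k' {..<k'}" by auto
          then show ?thesis
            using p0 by (simp add: Wf_alt L_def) (simp add: x_def)
        qed
        finally show ?thesis by (simp add: hW)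
      qed
    qed simp
    then show ?thesis using k by (simp add: x_def v_def)
  qed
qed

text \<open>Both sides express the right unit of \<ell>^_k. On the left, the truncated part is
  common to the two points and t_1, ..., t_m vanish; on the right, \<ell>^_k is written in the
  coordinates of the target, where its coefficients are right units of the \<ell>_j.\<close>

lemma tseq_relation:
  fixes a y w :: "'s \<Rightarrow> nat \<Rightarrow> rat" and p m :: nat
  assumes p0: "p > 0"
  defines "v \<equiv> \<lambda>s. pt p m (a s) (y s)" and "t \<equiv> \<lambda>s. tseq p (pt p m (a s) (y s)) (pt p m (a s) (w s))"
  shows "Wf p (v s) (\<lambda>d. if d = 0 then 0 else t s (m + d)) k + Wf p (v s) (zero0 (y s)) k
     = (\<Sum>j\<le>k. Wf p (v s) (t s) j * zero0 (w s) (k - j) ^ (p ^ j))"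
proof -
  let ?x = "\<lambda>d. if d = 0 then 0 else t s (m + d)"
  have "(\<Sum>j\<le>k. Wf p (v s) (t s) j * zero0 (w s) (k - j) ^ (p ^ j)) = Wf p (pt p m (a s) (w s)) (zero0 (w s)) k"
    unfolding v_def t_def by (simp add: Wf_alt[of p "pt p m (a s) (w s)"] Wf_tseq)
  also have "\<dots> = Lf p (pt p m (a s) (w s)) (m + k) - Lf p (vtrunc m (a s)) (m + k)"
    by (simp add: Lf_pt_diff[OF p0])
  also have "Lf p (pt p m (a s) (w s)) (m + k) = Wf p (v s) (t s) (m + k)"
    by (simp add: v_def t_def Wf_tseq)
  also have "\<dots> = (\<Sum>d\<in>insert 0 {m<..m + k}. Lf p (v s) (m + k - d) * t s d ^ (p ^ (m + k - d)))"
    unfolding Wf_def by (rule sum.mono_neutral_right) (use p0 in \<open>auto simp: t_def tseq_low\<close>)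
  also have "\<dots> = Lf p (v s) (m + k) + (\<Sum>d\<in>{m<..m + k}. Lf p (v s) (m + k - d) * t s d ^ (p ^ (m + k - d)))"
    by (simp add: t_def)
  also have "(\<Sum>d\<in>{m<..m + k}. Lf p (v s) (m + k - d) * t s d ^ (p ^ (m + k - d))) = (\<Sum>d\<in>{1..k}. Lf p (v s) (k - d) * ?x d ^ (p ^ (k - d)))"
    by (rule sum.reindex_bij_witness[where i = "\<lambda>d. m + d" and j = "\<lambda>d. d - m"]) (auto simp: add.commute)
  also have "\<dots> = Wf p (v s) ?x k"
    unfolding Wf_def by (rule sum.mono_neutral_left) (use p0 in \<open>auto simp: Suc_le_eq\<close>)
  finally show ?thesis by (simp add: v_def Lf_pt_diff[OF p0])
qed

text \<open>\<open>tseq_relation\<close> is solved for the t_(m+d). Its right side contains t_i only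
  for i \<le> k < m + k, which is covered by induction.\<close>

lemma tseq_integral:
  fixes a y w :: "'s \<Rightarrow> nat \<Rightarrow> rat"
  assumes p: "Factorial_Ring.prime p" and C: "ratring C" and m: "m > 0"
    and a: "\<And>i. 1 \<le> i \<Longrightarrow> i \<le> m \<Longrightarrow> (\<lambda>s. a s i) \<in> zpoly C G"
    and y: "\<And>i. 1 \<le> i \<Longrightarrow> (\<lambda>s. y s i) \<in> zpoly C G"
    and w: "\<And>i. 1 \<le> i \<Longrightarrow> (\<lambda>s. w s i) \<in> zpoly C G"
  shows "(\<lambda>s. tseq p (pt p m (a s) (y s)) (pt p m (a s) (w s)) n) \<in> zpoly C G"
proof (induction n rule: less_induct)
  case (less n)
  have p0: "p > 0" using p prime_gt_0_nat by blast
  define v where "v s = pt p m (a s) (y s)" for s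
  define t where "t s = tseq p (pt p m (a s) (y s)) (pt p m (a s) (w s))" for s
  consider "n = 0" | "1 \<le> n" "n \<le> m" | k where "n = m + k" "k \<ge> 1"
    by (metis Suc_leI add_gr_0 le_add_diff_inverse not_less_eq_eq One_nat_def less_imp_le_nat nat_neq_iff not_less zero_less_diff)
  then show ?case
  proof cases
    case 1
    then show ?thesis by (auto intro: zpoly.const ratring_1[OF C])
  next
    case 2
    then show ?thesis by (auto simp: tseq_low[OF p0] intro: zpoly.const ratring_0[OF C])
  next
    case (3 k)
    interpret witt p C G v k
      by unfold_locales (auto simp: v_def intro!: p C pt_integral m a y)
    have yB: "(\<lambda>s. zero0 (y s) i) \<in> zpoly C G" for i
      unfolding zero0_def by (rule zpoly_if) (auto intro: y zpoly.const ratring_0[OF C])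
    have wB: "(\<lambda>s. zero0 (w s) i) \<in> zpoly C G" for i
      unfolding zero0_def by (rule zpoly_if) (auto intro: w zpoly.const ratring_0[OF C])
    have "Wit p (zpoly C G) v k (\<lambda>k s. (\<Sum>j\<le>k. Wf p (v s) (t s) j * zero0 (w s) (k - j) ^ (p ^ j)) - Wf p (v s) (zero0 (y s)) k)"
    proof (intro diff comp Wit_seq yB)
      fix i j assume ij: "i + j \<le> k"
      show "(\<lambda>s. t s i * zero0 (w s) j ^ (p ^ i)) \<in> zpoly C G"
      proof (cases "j = 0")
        case True
        then show ?thesis using p0 by (auto simp: zero0_def zero_power intro: zpoly.const ratring_0[OF C])
      next
        case False
        then have "i < n" using ij 3 m by simp
        then show ?thesis unfolding t_def by (intro zpoly.mult less.IH zpoly_power[OF C] wB)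
      qed
    qed
    then have "(\<lambda>s. if k = 0 then 0 else t s (m + k)) \<in> zpoly C G"
    proof (rule Wit_unique[where z = "\<lambda>s d. if d = 0 then 0 else t s (m + d)"])
      show "(\<Sum>j\<le>k. Wf p (v s) (t s) j * zero0 (w s) (k - j) ^ (p ^ j)) - Wf p (v s) (zero0 (y s)) k
         = Wf p (v s) (\<lambda>d. if d = 0 then 0 else t s (m + d)) k" for k s
        using tseq_relation[OF p0, where a = a and y = y and w = w and s = s and k = k and m = m]
        unfolding v_def t_def by simp
    qed simp
    then show ?thesis using 3 by (simp add: t_def)
  qed
qed

text \<open>\<open>tseq_relation\<close> is solved for the coordinates y of the source. Its
  coefficients come from the \<ell>_j of the source, and the v_n of the source are integral over the
  target and the t's by \<open>left_integral\<close>.\<close>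

lemma lam_integral:
  fixes a y w :: "'s \<Rightarrow> nat \<Rightarrow> rat"
  assumes p: "Factorial_Ring.prime p" and C: "ratring C" and m: "m > 0"
    and a: "\<And>i. 1 \<le> i \<Longrightarrow> i \<le> m \<Longrightarrow> (\<lambda>s. a s i) \<in> zpoly C G"
    and w: "\<And>i. 1 \<le> i \<Longrightarrow> (\<lambda>s. w s i) \<in> zpoly C G"
    and t: "\<And>n. (\<lambda>s. tseq p (pt p m (a s) (y s)) (pt p m (a s) (w s)) n) \<in> zpoly C G"
    and k: "k \<ge> 1"
  shows "(\<lambda>s. y s k) \<in> zpoly C G"
proof -
  have p0: "p > 0" using p prime_gt_0_nat by blast
  define v where "v s = pt p m (a s) (y s)" for s
  define t' where "t' s = tseq p (pt p m (a s) (y s)) (pt p m (a s) (w s))" for s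
  have v: "(\<lambda>s. v s i) \<in> zpoly C G" if "1 \<le> i" for i
    unfolding v_def
    by (rule left_integral[OF p C, where v' = "\<lambda>s. pt p m (a s) (w s)"])
      (use that in \<open>auto intro!: pt_integral p C m a w t\<close>)
  interpret witt p C G v k
    by unfold_locales (auto intro!: p C v)
  have wB: "(\<lambda>s. zero0 (w s) i) \<in> zpoly C G" for i
    unfolding zero0_def by (rule zpoly_if) (auto intro: w zpoly.const ratring_0[OF C])
  have "Wit p (zpoly C G) v k (\<lambda>k s. (\<Sum>j\<le>k. Wf p (v s) (t' s) j * zero0 (w s) (k - j) ^ (p ^ j)) - Wf p (v s) (\<lambda>d. if d = 0 then 0 else t' s (m + d)) k)"
    by (intro diff comp Wit_seq zpoly.mult zpoly_power[OF C] wB zpoly_if) (auto simp: t'_def intro!: t zpoly.const ratring_0[OF C])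
  then have "(\<lambda>s. zero0 (y s) k) \<in> zpoly C G"
  proof (rule Wit_unique)
    show "(\<Sum>j\<le>k. Wf p (v s) (t' s) j * zero0 (w s) (k - j) ^ (p ^ j)) - Wf p (v s) (\<lambda>d. if d = 0 then 0 else t' s (m + d)) k
       = Wf p (v s) (zero0 (y s)) k" for k s
      using tseq_relation[OF p0, where a = a and y = y and w = w and s = s and k = k and m = m]
      unfolding v_def t'_def by simp
  qed simp
  then show ?thesis using k by (simp add: zero0_def)
qed

text \<open>Taken out of the simplifier, so that functions are computed with as ring elements and
  evaluated only on demand.\<close>

lemmas fun_ring_apply = plus_fun_apply zero_fun_apply times_fun_apply one_fun_apply minus_apply uminus_apply
declare fun_ring_apply [simp del]

lemma sum_fun_apply: "sum f I x = (\<Sum>i\<in>I. f i x)"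
  by (induction I rule: infinite_finite_induct) (auto simp: fun_ring_apply)

section \<open>Quotients of free abelian groups\<close>

text \<open>Shared by the tensor powers of the cobar complex, by the tensor square of BP_*(BP) and
  by the products with T. A chosen representative is known up to a null element only
  (\<open>rep_class\<close>), so its values are controlled once null elements are known to go to
  zero or into a given subgroup.\<close>

locale free_quotient =
  fixes S :: "'x set" and R :: "('x \<Rightarrow>\<^sub>0 int) set"
  assumes R: "R \<subseteq> carrier (free_Abelian_group S)"
begin

abbreviation "F \<equiv> free_Abelian_group S"
abbreviation "N \<equiv> generate F R"

lemma N_subgroup: "subgroup N F"
  by (rule group.generate_is_subgroup[OF group_free_Abelian_group R])

lemma N_carrier: "c \<in> N \<Longrightarrow> Poly_Mapping.keys c \<subseteq> S"
  using subgroup.mem_carrier[OF N_subgroup] by simp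

lemma N_0: "0 \<in> N"
  using subgroup.one_closed[OF N_subgroup] by simp

lemma N_add: "c \<in> N \<Longrightarrow> d \<in> N \<Longrightarrow> c + d \<in> N"
  using subgroup.m_closed[OF N_subgroup] by fastforce

lemma N_uminus: "c \<in> N \<Longrightarrow> - c \<in> N"
  using subgroup.m_inv_closed[OF N_subgroup] N_carrier by fastforce

lemma N_diff: "c \<in> N \<Longrightarrow> d \<in> N \<Longrightarrow> c - d \<in> N"
  using N_add[OF _ N_uminus] by fastforce

lemma N_rel: "c \<in> R \<Longrightarrow> c \<in> N"
  by (rule generate.incl)

lemma N_induct:
  assumes "c \<in> N" "P 0" "\<And>c d. P c \<Longrightarrow> P d \<Longrightarrow> P (c - d)" "\<And>c. c \<in> R \<Longrightarrow> P c"
  shows "P c"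
  using assms(1)
proof induction
  case one
  then show ?case using assms(2) by simp
next
  case (incl h)
  then show ?case by (rule assms(4))
next
  case (inv h)
  have "inv\<^bsub>F\<^esub> h = 0 - h" using inv R by auto
  then show ?case using assms(3)[OF assms(2) assms(4)[OF inv]] by simp
next
  case (eng h1 h2)
  have "P (h1 - (0 - h2))" by (intro assms(3) eng assms(2))
  then show ?case by simp
qed

lemma class_explicit: "N #>\<^bsub>F\<^esub> c = {n + c | n. n \<in> N}"
  by (auto simp: r_coset_def)

lemma class_eq_iff:
  "N #>\<^bsub>F\<^esub> c = N #>\<^bsub>F\<^esub> d \<longleftrightarrow> c - d \<in> N"
proof
  assume eq: "N #>\<^bsub>F\<^esub> c = N #>\<^bsub>F\<^esub> d"
  have "0 + c \<in> N #>\<^bsub>F\<^esub> c" unfolding class_explicit using N_0 by blast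
  then obtain n where "n \<in> N" "c = n + d" using eq unfolding class_explicit by auto
  then show "c - d \<in> N" by simp
next
  assume *: "c - d \<in> N"
  have "n + c \<in> N #>\<^bsub>F\<^esub> d" if "n \<in> N" for n
  proof -
    have "n + c = (n + (c - d)) + d" by simp
    then show ?thesis unfolding class_explicit using N_add[OF that *] by blast
  qed
  moreover have "n + d \<in> N #>\<^bsub>F\<^esub> c" if "n \<in> N" for n
  proof -
    have "n + d = (n - (c - d)) + c" by simp
    then show ?thesis unfolding class_explicit using N_diff[OF that *] by blast
  qed
  ultimately show "N #>\<^bsub>F\<^esub> c = N #>\<^bsub>F\<^esub> d"
    by (auto simp: class_explicit)
qed

lemma rep_class: "rep (N #>\<^bsub>F\<^esub> c) - c \<in> N"
proof -
  have "0 + c \<in> N #>\<^bsub>F\<^esub> c" unfolding class_explicit using N_0 by blast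
  then have "rep (N #>\<^bsub>F\<^esub> c) \<in> N #>\<^bsub>F\<^esub> c" unfolding rep_def by (rule someI)
  then show ?thesis unfolding class_explicit by auto
qed

lemma rep_class_carrier:
  assumes "Poly_Mapping.keys c \<subseteq> S" shows "Poly_Mapping.keys (rep (N #>\<^bsub>F\<^esub> c)) \<subseteq> S"
proof -
  have "rep (N #>\<^bsub>F\<^esub> c) = (rep (N #>\<^bsub>F\<^esub> c) - c) + c" by simp
  then show ?thesis using keys_add[of "rep (N #>\<^bsub>F\<^esub> c) - c" c] N_carrier[OF rep_class[of c]] assms by auto
qed

lemma carrier_quot: "X \<in> carrier (F Mod N) \<longleftrightarrow> (\<exists>c. Poly_Mapping.keys c \<subseteq> S \<and> X = N #>\<^bsub>F\<^esub> c)"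
  by (simp add: carrier_FactGroup image_iff Bex_def)

lemma class_rep: "X \<in> carrier (F Mod N) \<Longrightarrow> N #>\<^bsub>F\<^esub> rep X = X"
  using rep_class class_eq_iff by (auto simp: carrier_quot)

lemma keys_rep: "X \<in> carrier (F Mod N) \<Longrightarrow> Poly_Mapping.keys (rep X) \<subseteq> S"
  using rep_class_carrier by (auto simp: carrier_quot)

lemma N_normal: "N \<lhd> F"
  by (rule comm_group.normal_iff_subgroup[THEN iffD2, OF abelian_free_Abelian_group N_subgroup])

lemma mult_quot:
  assumes "Poly_Mapping.keys c \<subseteq> S" "Poly_Mapping.keys d \<subseteq> S"
  shows "(N #>\<^bsub>F\<^esub> c) \<otimes>\<^bsub>F Mod N\<^esub> (N #>\<^bsub>F\<^esub> d) = N #>\<^bsub>F\<^esub> (c + d)"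
  using normal.rcos_sum[OF N_normal, of c d] assms by (simp add: FactGroup_def)

lemma one_quot: "\<one>\<^bsub>F Mod N\<^esub> = N"
  by (simp add: FactGroup_def)

lemma class_0: "N #>\<^bsub>F\<^esub> 0 = N"
  by (simp add: class_explicit)

lemma class_eq_one: "N #>\<^bsub>F\<^esub> c = N \<longleftrightarrow> c \<in> N"
  using class_eq_iff[of c 0] by (simp add: class_0)

lemma quot_comm_group: "comm_group (F Mod N)"
  using abelian_free_Abelian_group N_subgroup by (rule comm_group.abelian_FactGroup)

lemma rep_mult:
  assumes "X \<in> carrier (F Mod N)" "Y \<in> carrier (F Mod N)"
  shows "rep (X \<otimes>\<^bsub>F Mod N\<^esub> Y) - (rep X + rep Y) \<in> N"
proof -
  have "X \<otimes>\<^bsub>F Mod N\<^esub> Y = N #>\<^bsub>F\<^esub> (rep X + rep Y)"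
    using mult_quot[OF keys_rep keys_rep] class_rep assms by metis
  then show ?thesis using rep_class by simp
qed

end

inductive_set asp :: "'r::ab_group_add set \<Rightarrow> 'r set" for X where
  zero: "0 \<in> asp X"
| base: "x \<in> X \<Longrightarrow> x \<in> asp X"
| diff: "x \<in> asp X \<Longrightarrow> y \<in> asp X \<Longrightarrow> x - y \<in> asp X"

lemma asp_hom:
  assumes "x \<in> asp X" "h 0 = 0" "\<And>x y. h (x - y) = h x - h y" "\<And>x. x \<in> X \<Longrightarrow> h x \<in> Z"
    and "0 \<in> Z" "\<And>x y. x \<in> Z \<Longrightarrow> y \<in> Z \<Longrightarrow> x - y \<in> Z"
  shows "h x \<in> Z"
  using assms(1) by induction (auto simp: assms)

definition addsub :: "'r::ab_group_add set \<Rightarrow> bool" where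
  "addsub X \<longleftrightarrow> 0 \<in> X \<and> (\<forall>x\<in>X. \<forall>y\<in>X. x - y \<in> X)"

lemma addsub_0: "addsub X \<Longrightarrow> 0 \<in> X" by (simp add: addsub_def)
lemma addsub_diff: "addsub X \<Longrightarrow> x \<in> X \<Longrightarrow> y \<in> X \<Longrightarrow> x - y \<in> X" by (simp add: addsub_def)
lemma addsub_uminus: "addsub X \<Longrightarrow> x \<in> X \<Longrightarrow> - x \<in> X"
  using addsub_diff[of X 0 x] addsub_0 by auto
lemma addsub_add: "addsub X \<Longrightarrow> x \<in> X \<Longrightarrow> y \<in> X \<Longrightarrow> x + y \<in> X"
  using addsub_diff[of X x "- y"] addsub_uminus by auto
lemma addsub_sum: "addsub X \<Longrightarrow> (\<And>i. i \<in> I \<Longrightarrow> f i \<in> X) \<Longrightarrow> sum f I \<in> X"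
  by (induction I rule: infinite_finite_induct) (auto intro: addsub_0 addsub_add)
lemma addsub_of_int: 
  fixes X :: "'r::comm_ring_1 set"
  assumes "addsub X" "x \<in> X" shows "of_int n * x \<in> X"
proof -
  have *: "of_nat k * x \<in> X" for k
    by (induction k) (auto simp: distrib_right intro: addsub_0 addsub_add assms)
  obtain a b where "n = int a - int b" by (rule int_diff_cases)
  then show ?thesis using *[of a] *[of b] addsub_diff[OF assms(1)] by (auto simp: left_diff_distrib)
qed
lemma addsub_asp: "addsub (asp X)"
  by (auto simp: addsub_def intro: asp.intros)
lemma addsub_zero: "addsub {0}"
  by (simp add: addsub_def)
lemma addsub_flin: "addsub X \<Longrightarrow> (\<And>w. w \<in> Poly_Mapping.keys c \<Longrightarrow> f w \<in> X) \<Longrightarrow> flin f c \<in> X"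
  by (rule flin_in) (auto intro: addsub_0 addsub_diff)

lemma flin_in_mod:
  fixes f g :: "'x \<Rightarrow> 'r::comm_ring_1"
  assumes "addsub X" "\<And>w. w \<in> Poly_Mapping.keys c \<Longrightarrow> f w - g w \<in> X" shows "flin f c - flin g c \<in> X"
proof -
  have "flin f c - flin g c = flin (\<lambda>w. f w - g w) c" by (simp add: flin_def sum_subtractf right_diff_distrib)
  then show ?thesis using addsub_flin[OF assms(1), of c "\<lambda>w. f w - g w"] assms(2) by simp
qed


section \<open>Function models of cobar complexes\<close>

text \<open>A function of \<open>(a, Y)\<close> stands for a function on chains of points, the \<open>j\<close>-th point having
  coordinates \<open>(a, Y j)\<close>.  In cobar degree \<open>s\<close> the points \<open>Y 0, \<dots>, Y s\<close> are used for the tensor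
  factors, and \<open>Y (s + 1)\<close> is a parameter for the coefficient comodule.\<close>

type_synonym chainfun = "(nat \<Rightarrow> rat) \<Rightarrow> (nat \<Rightarrow> nat \<Rightarrow> rat) \<Rightarrow> rat"

text \<open>What follows the first tensor factor sees the chain from its second point on, so g
  \<otimes> f becomes \<open>g * Sh f\<close>. Balancedness is then automatic: the right unit of b
  at (Y 0, Y 1) is b at Y 1, that is, \<open>Sh\<close> of its left unit.\<close>

definition Sh :: "chainfun \<Rightarrow> chainfun" where
  "Sh f a Y = f a (\<lambda>i. Y (Suc i))"

text \<open>Coface: the point \<open>Y i\<close> is omitted from the chain.\<close>

definition cf :: "nat \<Rightarrow> chainfun \<Rightarrow> chainfun" where
  "cf i f a Y = f a (\<lambda>q. if q < i then Y q else Y (Suc q))"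

lemma Sh_simps [simp]:
  "Sh 0 = 0" "Sh 1 = 1" "Sh (f + g) = Sh f + Sh g" "Sh (f - g) = Sh f - Sh g" "Sh (f * g) = Sh f * Sh g" "Sh (- f) = - Sh f"
  by (simp_all add: Sh_def fun_eq_iff fun_ring_apply)

lemma cf_simps [simp]:
  "cf i 0 = 0" "cf i 1 = 1" "cf i (f + g) = cf i f + cf i g" "cf i (f - g) = cf i f - cf i g"
  "cf i (f * g) = cf i f * cf i g" "cf i (- f) = - cf i f"
  by (simp_all add: cf_def fun_eq_iff fun_ring_apply)

lemma cf_0: "cf 0 f = Sh f"
  by (simp add: cf_def Sh_def fun_eq_iff)

lemma cf_Suc_Sh: "cf (Suc i) (Sh f) = Sh (cf i f)"
proof (intro ext)
  fix a Y
  show "cf (Suc i) (Sh f) a Y = Sh (cf i f) a Y"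
    unfolding cf_def Sh_def by (rule arg_cong[where f = "f a"]) auto
qed

lemma cf_sum: "cf i (sum f I) = (\<Sum>j\<in>I. cf i (f j))"
  by (induction I rule: infinite_finite_induct) auto

lemma Sh_sum: "Sh (sum f I) = (\<Sum>j\<in>I. Sh (f j))"
  by (induction I rule: infinite_finite_induct) auto

lemma Sh_flin: "Sh (flin f c) = flin (\<lambda>w. Sh (f w)) c"
  by (rule flin_hom[of Sh]) auto

text \<open>\<open>Pre G K s\<close> represents \<open>\<Gamma> \<otimes> \<dots> \<otimes> \<Gamma> \<otimes> K\<close> with \<open>s\<close> factors when \<open>G\<close> represents \<open>\<Gamma>\<close>.\<close>

primrec Pre :: "chainfun set \<Rightarrow> chainfun set \<Rightarrow> nat \<Rightarrow> chainfun set" where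
  "Pre G K 0 = K"
| "Pre G K (Suc s) = asp {g * Sh f | g f. g \<in> G \<and> f \<in> Pre G K s}"

lemma addsub_Pre: "addsub K \<Longrightarrow> addsub (Pre G K s)"
  by (cases s) (auto intro: addsub_asp)

lemma Pre_mono: "K \<subseteq> J \<Longrightarrow> Pre G K s \<subseteq> Pre G J s"
proof (induction s)
  case (Suc s)
  have "x \<in> Pre G J (Suc s)" if "x \<in> Pre G K (Suc s)" for x
    using that[unfolded Pre.simps]
    by induction (use Suc in \<open>auto intro: asp.intros\<close>)
  then show ?case by blast
qed simp

lemma Pre_zero: "Pre G {0} s = {0}"
proof (induction s)
  case (Suc s)
  have "x = 0" if "x \<in> asp {g * Sh f | g f. g \<in> G \<and> f \<in> {0}}" for x
    using that by induction auto
  then show ?case using Suc by (auto intro: asp.zero)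
qed simp

lemma PreI: "g \<in> G \<Longrightarrow> f \<in> Pre G K s \<Longrightarrow> g * Sh f \<in> Pre G K (Suc s)"
  by (auto intro: asp.base)

definition pr :: "('g \<Rightarrow> chainfun) \<Rightarrow> 'g list \<Rightarrow> chainfun \<Rightarrow> chainfun" where
  "pr gf gs f = foldr (\<lambda>g f. gf g * Sh f) gs f"

lemma pr_simps [simp]: "pr gf [] f = f" "pr gf (g # gs) f = gf g * Sh (pr gf gs f)"
  by (simp_all add: pr_def)

lemma pr_append: "pr gf (gs @ hs) f = pr gf gs (pr gf hs f)"
  by (simp add: pr_def)

lemma pr_0 [simp]: "pr gf gs 0 = 0"
  by (induction gs) auto
lemma pr_add [simp]: "pr gf gs (f + g) = pr gf gs f + pr gf gs g"
  by (induction gs) (auto simp: distrib_left)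
lemma pr_diff [simp]: "pr gf gs (f - g) = pr gf gs f - pr gf gs g"
  by (induction gs) (auto simp: right_diff_distrib)

lemma pr_flin: "pr gf gs (flin f c) = flin (\<lambda>w. pr gf gs (f w)) c"
  by (rule flin_hom[of "pr gf gs"]) auto

lemma pr_Pre: "gf ` set gs \<subseteq> G \<Longrightarrow> f \<in> Pre G K s \<Longrightarrow> pr gf gs f \<in> Pre G K (length gs + s)"
  by (induction gs) (auto intro: asp.base)

definition wfn :: "('g \<Rightarrow> chainfun) \<Rightarrow> ('m \<Rightarrow> chainfun) \<Rightarrow> 'g list \<times> 'm \<Rightarrow> chainfun" where
  "wfn gf mu w = pr gf (fst w) (mu (snd w))"

definition phi :: "('g \<Rightarrow> chainfun) \<Rightarrow> ('m \<Rightarrow> chainfun) \<Rightarrow> ('g list \<times> 'm \<Rightarrow>\<^sub>0 int) \<Rightarrow> chainfun" where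
  "phi gf mu = flin (wfn gf mu)"

text \<open>\<open>gf\<close> gives the function of an element of \<Gamma>, \<open>sc\<close> that
  of a scalar. \<open>total_induct\<close> and \<open>indep\<close> say that \<Gamma> is free on the
  \<open>bas e\<close> as a module over the right unit; \<open>indep\<close> admits arbitrary
  functions of the later points as coefficients, since these will come from the rest of a
  tensor.\<close>

locale algebroid_functions =
  fixes H :: "('a, 'g, 'h) algebroid_scheme" and gf :: "'g \<Rightarrow> chainfun" and bas :: "'e \<Rightarrow> 'g" and sc :: "'a \<Rightarrow> chainfun"
  assumes one_closed: "\<one>\<^bsub>total H\<^esub> \<in> carrier (total H)"
    and add_closed: "g \<in> carrier (total H) \<Longrightarrow> h \<in> carrier (total H) \<Longrightarrow> g \<oplus>\<^bsub>total H\<^esub> h \<in> carrier (total H)"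
    and mult_closed: "g \<in> carrier (total H) \<Longrightarrow> h \<in> carrier (total H) \<Longrightarrow> g \<otimes>\<^bsub>total H\<^esub> h \<in> carrier (total H)"
    and lunit_closed: "b \<in> carrier (base H) \<Longrightarrow> lunit H b \<in> carrier (total H)"
    and runit_closed: "b \<in> carrier (base H) \<Longrightarrow> runit H b \<in> carrier (total H)"
    and gf_one: "gf \<one>\<^bsub>total H\<^esub> = 1"
    and gf_add: "g \<in> carrier (total H) \<Longrightarrow> h \<in> carrier (total H) \<Longrightarrow> gf (g \<oplus>\<^bsub>total H\<^esub> h) = gf g + gf h"
    and gf_mult: "g \<in> carrier (total H) \<Longrightarrow> h \<in> carrier (total H) \<Longrightarrow> gf (g \<otimes>\<^bsub>total H\<^esub> h) = gf g * gf h"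
    and gf_lunit: "b \<in> carrier (base H) \<Longrightarrow> gf (lunit H b) = sc b"
    and gf_runit: "b \<in> carrier (base H) \<Longrightarrow> gf (runit H b) = Sh (sc b)"
    and bas_closed: "bas e \<in> carrier (total H)"
    and total_induct: "\<And>P g. g \<in> carrier (total H) \<Longrightarrow>
        (\<And>e b. b \<in> carrier (base H) \<Longrightarrow> P (bas e \<otimes>\<^bsub>total H\<^esub> runit H b)) \<Longrightarrow>
        (\<And>g h. g \<in> carrier (total H) \<Longrightarrow> h \<in> carrier (total H) \<Longrightarrow> P g \<Longrightarrow> P h \<Longrightarrow> P (g \<oplus>\<^bsub>total H\<^esub> h)) \<Longrightarrow> P g"
    and indep: "\<And>E f e. finite E \<Longrightarrow> (\<Sum>e\<in>E. gf (bas e) * Sh (f e)) = 0 \<Longrightarrow> e \<in> E \<Longrightarrow> f e = 0"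
begin

lemmas total_cases = total_induct[consumes 1, case_names bas add]

abbreviation "GG \<equiv> gf ` carrier (total H)"

lemma Pre_sc:
  assumes "b \<in> carrier (base H)" "\<And>f. f \<in> K \<Longrightarrow> sc b * f \<in> K" "f \<in> Pre GG K s"
  shows "sc b * f \<in> Pre GG K s"
proof (cases s)
  case 0
  then show ?thesis using assms by simp
next
  case (Suc s')
  have "sc b * f \<in> Pre GG K (Suc s')"
    using assms(3)[unfolded Suc Pre.simps]
  proof (rule asp_hom)
    fix x assume "x \<in> {g * Sh f |g f. g \<in> GG \<and> f \<in> Pre GG K s'}"
    then obtain g f where x: "x = gf g * Sh f" "g \<in> carrier (total H)" "f \<in> Pre GG K s'" by auto
    have "sc b * x = gf (lunit H b \<otimes>\<^bsub>total H\<^esub> g) * Sh f"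
      using x assms(1) by (simp add: gf_mult lunit_closed gf_lunit mult.assoc)
    then show "sc b * x \<in> Pre GG K (Suc s')"
      using x assms(1) by (auto intro!: PreI simp: mult_closed lunit_closed simp del: Pre.simps)
  qed (auto simp: right_diff_distrib intro: asp.intros)
  then show ?thesis by (simp add: Suc)
qed

text \<open>Write g as a sum of terms \<open>bas e\<close> times a right unit; the right unit of b
  becomes \<open>Sh (sc b)\<close> and is absorbed by the next factor. Tensors in normal form are
  compared with this expansion in \<open>normal_indep\<close>.\<close>

lemma Pre_Suc_normal:
  assumes K: "addsub K" "\<And>b f. b \<in> carrier (base H) \<Longrightarrow> f \<in> K \<Longrightarrow> sc b * f \<in> K"
    and f: "f \<in> Pre GG K (Suc s)"
  shows "\<exists>E k. finite E \<and> (\<forall>e. k e \<in> Pre GG K s) \<and> f = (\<Sum>e\<in>E. gf (bas e) * Sh (k e))"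
proof -
  let ?X = "{f. \<exists>E k. finite E \<and> (\<forall>e. k e \<in> Pre GG K s) \<and> f = (\<Sum>e\<in>E. gf (bas e) * Sh (k e))}"
  have as: "addsub (Pre GG K s)" by (rule addsub_Pre[OF K(1)])
  have Xdiff: "f - g \<in> ?X" if fg: "f \<in> ?X" "g \<in> ?X" for f g
  proof -
    obtain E k where E: "finite E" "\<And>e. k e \<in> Pre GG K s" "f = (\<Sum>e\<in>E. gf (bas e) * Sh (k e))" using fg by auto
    obtain D l where D: "finite D" "\<And>e. l e \<in> Pre GG K s" "g = (\<Sum>e\<in>D. gf (bas e) * Sh (l e))" using fg by auto
    let ?k = "\<lambda>e. (if e \<in> E then k e else 0) - (if e \<in> D then l e else 0)"
    have "(\<Sum>e\<in>E. gf (bas e) * Sh (k e)) = (\<Sum>e\<in>E \<union> D. gf (bas e) * Sh (if e \<in> E then k e else 0))"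
      by (rule sum.mono_neutral_cong_left) (use E D in auto)
    moreover have "(\<Sum>e\<in>D. gf (bas e) * Sh (l e)) = (\<Sum>e\<in>E \<union> D. gf (bas e) * Sh (if e \<in> D then l e else 0))"
      by (rule sum.mono_neutral_cong_left) (use E D in auto)
    ultimately have "f - g = (\<Sum>e\<in>E \<union> D. gf (bas e) * Sh (?k e))"
      by (simp add: E(3) D(3) sum_subtractf right_diff_distrib)
    moreover have "?k e \<in> Pre GG K s" for e
      using E(2) D(2) addsub_0[OF as] addsub_diff[OF as] by auto
    ultimately show ?thesis using E(1) D(1) by (intro CollectI exI[of _ "E \<union> D"] exI[of _ ?k]) auto
  qed
  have zero: "0 \<in> ?X" by (intro CollectI exI[of _ "{}"] exI[of _ "\<lambda>_. 0"]) (auto intro: addsub_0[OF as])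
  have X: "addsub ?X" using zero Xdiff by (simp only: addsub_def) blast
  have gen: "gf g * Sh f \<in> ?X" if f: "f \<in> Pre GG K s" and g: "g \<in> carrier (total H)" for g f
    using g
  proof (induction rule: total_cases)
    case (bas e b)
    note 1 = bas
    have "gf (bas e \<otimes>\<^bsub>total H\<^esub> runit H b) * Sh f = (\<Sum>e'\<in>{e}. gf (bas e') * Sh (sc b * f))"
      using 1 by (simp add: gf_mult bas_closed runit_closed gf_runit mult.assoc)
    moreover have "sc b * f \<in> Pre GG K s" by (rule Pre_sc[OF 1 K(2)[OF 1] f])
    ultimately show ?case by (intro CollectI exI[of _ "{e}"] exI[of _ "\<lambda>_. sc b * f"]) simp
  next
    case (add g h)
    then show ?case using addsub_add[OF X add(3,4)] by (simp add: gf_add distrib_right)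
  qed
  have "f \<in> ?X"
    using f[unfolded Pre.simps]
  proof induction
    case (base x)
    then obtain g f' where "x = gf g * Sh f'" "g \<in> carrier (total H)" "f' \<in> Pre GG K s" by auto
    then show ?case using gen[of f' g] by (simp only:)
  qed (rule zero, rule Xdiff)
  then show ?thesis by blast
qed

end

text \<open>The elements of \<open>M\<close> are represented by functions modulo \<open>K\<close>.  For \<open>D\<^sup>0\<close> and \<open>T\<close> one has \<open>K = 0\<close>, but for
  \<open>E\<^sup>1 = D\<^sup>0/BP\<^sub>*\<close> the functions coming from \<open>BP\<^sub>*\<close> have to be divided out.\<close>

locale cobar_model = algebroid_functions H gf bas sc
  for H :: "('a, 'g, 'h) algebroid_scheme" and gf :: "'g \<Rightarrow> chainfun" and bas :: "'e \<Rightarrow> 'g" and sc :: "'a \<Rightarrow> chainfun" +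
  fixes M :: "('a, 'm, 'c) module_scheme" and mu :: "'m \<Rightarrow> chainfun" and K :: "chainfun set"
  assumes K: "addsub K" and K_sc: "\<And>b f. b \<in> carrier (base H) \<Longrightarrow> f \<in> K \<Longrightarrow> sc b * f \<in> K"
    and M_zero: "\<zero>\<^bsub>M\<^esub> \<in> carrier M" and M_zz: "\<zero>\<^bsub>M\<^esub> \<oplus>\<^bsub>M\<^esub> \<zero>\<^bsub>M\<^esub> = \<zero>\<^bsub>M\<^esub>"
    and M_add: "x \<in> carrier M \<Longrightarrow> y \<in> carrier M \<Longrightarrow> x \<oplus>\<^bsub>M\<^esub> y \<in> carrier M"
    and M_smult: "b \<in> carrier (base H) \<Longrightarrow> x \<in> carrier M \<Longrightarrow> b \<odot>\<^bsub>M\<^esub> x \<in> carrier M"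
    and M_neg: "x \<in> carrier M \<Longrightarrow> \<exists>y\<in>carrier M. x \<oplus>\<^bsub>M\<^esub> y = \<zero>\<^bsub>M\<^esub>"
    and mu_add: "x \<in> carrier M \<Longrightarrow> y \<in> carrier M \<Longrightarrow> mu (x \<oplus>\<^bsub>M\<^esub> y) - (mu x + mu y) \<in> K"
    and mu_smult: "b \<in> carrier (base H) \<Longrightarrow> x \<in> carrier M \<Longrightarrow> mu (b \<odot>\<^bsub>M\<^esub> x) - sc b * mu x \<in> K"
    and mu_inj: "x \<in> carrier M \<Longrightarrow> mu x \<in> K \<Longrightarrow> x = \<zero>\<^bsub>M\<^esub>"
begin

section \<open>Normal forms of tensors and the test for null formal sums\<close>

abbreviation "words \<equiv> cobar_words H M"

lemma relations_carrier: "cobar_relations H M s \<subseteq> carrier (free_Abelian_group (words s))"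
proof -
  have "Poly_Mapping.keys c \<subseteq> words s" if "c \<in> cobar_relations H M s" for c
    using that unfolding cobar_relations_def
  proof (elim UnE CollectE exE conjE)
    fix xs g h ys x
    assume c: "c = frag_of (xs @ [g \<oplus>\<^bsub>total H\<^esub> h] @ ys, x) - frag_of (xs @ [g] @ ys, x) - frag_of (xs @ [h] @ ys, x)"
      and "(xs @ [g] @ ys, x) \<in> words s" "(xs @ [h] @ ys, x) \<in> words s"
    then show ?thesis
      using keys_diff[of "frag_of (xs @ [g \<oplus>\<^bsub>total H\<^esub> h] @ ys, x) - frag_of (xs @ [g] @ ys, x)" "frag_of (xs @ [h] @ ys, x)"]
        keys_diff[of "frag_of (xs @ [g \<oplus>\<^bsub>total H\<^esub> h] @ ys, x)" "frag_of (xs @ [g] @ ys, x)"]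
      by (force simp: cobar_words_def keys_frag_of add_closed)
  next
    fix gs x y
    assume c: "c = frag_of (gs, x \<oplus>\<^bsub>M\<^esub> y) - frag_of (gs, x) - frag_of (gs, y)"
      and "(gs, x) \<in> words s" "(gs, y) \<in> words s"
    then show ?thesis
      using keys_diff[of "frag_of (gs, x \<oplus>\<^bsub>M\<^esub> y) - frag_of (gs, x)" "frag_of (gs, y)"]
        keys_diff[of "frag_of (gs, x \<oplus>\<^bsub>M\<^esub> y)" "frag_of (gs, x)"]
      by (force simp: cobar_words_def keys_frag_of M_add)
  next
    fix xs g h ys b x
    assume c: "c = frag_of (xs @ [g \<otimes>\<^bsub>total H\<^esub> runit H b, h] @ ys, x) - frag_of (xs @ [g, lunit H b \<otimes>\<^bsub>total H\<^esub> h] @ ys, x)"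
      and "b \<in> carrier (base H)" "(xs @ [g, h] @ ys, x) \<in> words s"
    then show ?thesis
      using keys_diff[of "frag_of (xs @ [g \<otimes>\<^bsub>total H\<^esub> runit H b, h] @ ys, x)" "frag_of (xs @ [g, lunit H b \<otimes>\<^bsub>total H\<^esub> h] @ ys, x)"]
      by (force simp: cobar_words_def keys_frag_of mult_closed runit_closed lunit_closed)
  next
    fix xs g b x
    assume c: "c = frag_of (xs @ [g \<otimes>\<^bsub>total H\<^esub> runit H b], x) - frag_of (xs @ [g], b \<odot>\<^bsub>M\<^esub> x)"
      and "b \<in> carrier (base H)" "(xs @ [g], x) \<in> words s"
    then show ?thesis
      using keys_diff[of "frag_of (xs @ [g \<otimes>\<^bsub>total H\<^esub> runit H b], x)" "frag_of (xs @ [g], b \<odot>\<^bsub>M\<^esub> x)"]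
      by (force simp: cobar_words_def keys_frag_of mult_closed runit_closed M_smult)
  qed
  then show ?thesis by auto
qed

sublocale Q: free_quotient "cobar_words H M s" "cobar_relations H M s" for s
  by unfold_locales (rule relations_carrier)

lemma null_eq: "cobar_null H M s = Q.N s"
  by (simp add: cobar_null_def)

lemma tensor_eq: "cobar_tensor H M s = Q.F s Mod Q.N s"
  by (simp add: cobar_tensor_def null_eq)

lemma class_eq: "cobar_class H M s c = Q.N s #>\<^bsub>Q.F s\<^esub> c"
  by (simp add: cobar_class_def null_eq)

abbreviation "\<phi> \<equiv> phi gf mu"

lemma wordD: "(gs, x) \<in> words s \<Longrightarrow> length gs = s \<and> set gs \<subseteq> carrier (total H) \<and> x \<in> carrier M"
  by (simp add: cobar_words_def)

lemma wordI: "length gs = s \<Longrightarrow> set gs \<subseteq> carrier (total H) \<Longrightarrow> x \<in> carrier M \<Longrightarrow> (gs, x) \<in> words s"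
  by (simp add: cobar_words_def)

lemma pr_K: "set gs \<subseteq> carrier (total H) \<Longrightarrow> k \<in> K \<Longrightarrow> pr gf gs k \<in> Pre GG K (length gs)"
  using pr_Pre[of gf gs GG k K 0] by auto

text \<open>Additivity in a \<Gamma>-slot and balancing between two \<Gamma>-factors hold exactly
  for functions. Only the relations that touch the last slot produce an error, which is an element
  of \<open>K\<close> preceded by \<Gamma>-factors.\<close>

lemma phi_relation:
  assumes "c \<in> cobar_relations H M s" shows "\<phi> c \<in> Pre GG K s"
  using assms unfolding cobar_relations_def
proof (elim UnE CollectE exE conjE)
  fix xs g h ys x
  assume c: "c = frag_of (xs @ [g \<oplus>\<^bsub>total H\<^esub> h] @ ys, x) - frag_of (xs @ [g] @ ys, x) - frag_of (xs @ [h] @ ys, x)"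
    and w: "(xs @ [g] @ ys, x) \<in> words s" "(xs @ [h] @ ys, x) \<in> words s"
  have gh: "gf (g \<oplus>\<^bsub>total H\<^esub> h) = gf g + gf h" by (rule gf_add) (use w in \<open>auto simp: cobar_words_def\<close>)
  have "\<phi> c = pr gf xs (gf (g \<oplus>\<^bsub>total H\<^esub> h) * Sh (pr gf ys (mu x)) - gf g * Sh (pr gf ys (mu x)) - gf h * Sh (pr gf ys (mu x)))"
    by (simp add: c phi_def flin_diff wfn_def pr_append)
  also have "\<dots> = 0" by (simp add: gh algebra_simps)
  finally show ?thesis using addsub_0[OF addsub_Pre[OF K]] by simp
next
  fix gs x y
  assume c: "c = frag_of (gs, x \<oplus>\<^bsub>M\<^esub> y) - frag_of (gs, x) - frag_of (gs, y)"
    and w: "(gs, x) \<in> words s" "(gs, y) \<in> words s"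
  have "\<phi> c = pr gf gs (mu (x \<oplus>\<^bsub>M\<^esub> y) - (mu x + mu y))"
    by (simp add: c phi_def flin_diff wfn_def)
  then show ?thesis using pr_K[OF _ mu_add] w by (auto dest!: wordD)
next
  fix xs g h ys b x
  assume c: "c = frag_of (xs @ [g \<otimes>\<^bsub>total H\<^esub> runit H b, h] @ ys, x) - frag_of (xs @ [g, lunit H b \<otimes>\<^bsub>total H\<^esub> h] @ ys, x)"
    and b: "b \<in> carrier (base H)" and w: "(xs @ [g, h] @ ys, x) \<in> words s"
  have "gf (g \<otimes>\<^bsub>total H\<^esub> runit H b) = gf g * Sh (sc b)" "gf (lunit H b \<otimes>\<^bsub>total H\<^esub> h) = sc b * gf h"
    using w b by (auto simp: cobar_words_def gf_mult runit_closed lunit_closed gf_runit gf_lunit)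
  then have "\<phi> c = 0"
    by (simp add: c phi_def flin_diff wfn_def pr_append mult.assoc)
  then show ?thesis using addsub_0[OF addsub_Pre[OF K]] by simp
next
  fix xs g b x
  assume c: "c = frag_of (xs @ [g \<otimes>\<^bsub>total H\<^esub> runit H b], x) - frag_of (xs @ [g], b \<odot>\<^bsub>M\<^esub> x)"
    and b: "b \<in> carrier (base H)" and w: "(xs @ [g], x) \<in> words s"
  have e: "gf (g \<otimes>\<^bsub>total H\<^esub> runit H b) = gf g * Sh (sc b)"
    using w b by (auto simp: cobar_words_def gf_mult runit_closed gf_runit)
  have "\<phi> c = pr gf xs (gf g * Sh (sc b) * Sh (mu x)) - pr gf xs (gf g * Sh (mu (b \<odot>\<^bsub>M\<^esub> x)))"
    by (simp add: c phi_def flin_diff wfn_def pr_append e)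
  also have "\<dots> = pr gf (xs @ [g]) (- (mu (b \<odot>\<^bsub>M\<^esub> x) - sc b * mu x))"
    by (simp add: pr_append mult.assoc right_diff_distrib flip: pr_diff)
  also have "\<dots> \<in> Pre GG K (length (xs @ [g]))"
    by (rule pr_K[OF _ addsub_uminus[OF K mu_smult[OF b]]]) (use w in \<open>auto dest!: wordD\<close>)
  finally show ?thesis using w by (auto dest!: wordD)
qed

lemma phi_null: "c \<in> Q.N s \<Longrightarrow> \<phi> c \<in> Pre GG K s"
  by (erule Q.N_induct)
    (auto simp: phi_def flin_diff intro: addsub_0[OF addsub_Pre[OF K]] addsub_diff[OF addsub_Pre[OF K]] phi_relation[unfolded phi_def])

lemma null_add_last: "(gs, x) \<in> words s \<Longrightarrow> (gs, y) \<in> words s \<Longrightarrow>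
    frag_of (gs, x \<oplus>\<^bsub>M\<^esub> y) - frag_of (gs, x) - frag_of (gs, y) \<in> Q.N s"
  by (rule Q.N_rel) (unfold cobar_relations_def, blast)

lemma null_zero_word: "(gs, \<zero>\<^bsub>M\<^esub>) \<in> words s \<Longrightarrow> frag_of (gs, \<zero>\<^bsub>M\<^esub>) \<in> Q.N s"
  using null_add_last[of gs "\<zero>\<^bsub>M\<^esub>" s "\<zero>\<^bsub>M\<^esub>"] Q.N_uminus by (fastforce simp: M_zz)

text \<open>The tensor product as a direct sum of copies of M indexed by the basis words of length
  s; \<open>E\<close> contains the support and \<open>Z\<close> gives the coefficients.\<close>

definition nform :: "nat \<Rightarrow> ('g list \<times> 'm \<Rightarrow>\<^sub>0 int) \<Rightarrow> bool" where
  "nform s c \<longleftrightarrow> (\<exists>E Z. finite E \<and> (\<forall>e\<in>E. length e = s) \<and> (\<forall>e. Z e \<in> carrier M) \<and>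
      c - (\<Sum>e\<in>E. frag_of (map bas e, Z e)) \<in> Q.N s)"

lemma bas_word: "length e = s \<Longrightarrow> x \<in> carrier M \<Longrightarrow> (map bas e, x) \<in> words s"
  by (rule wordI) (auto intro: bas_closed)

lemma nform_null: "c - d \<in> Q.N s \<Longrightarrow> nform s d \<Longrightarrow> nform s c"
proof -
  assume 1: "c - d \<in> Q.N s" and "nform s d"
  then obtain E Z where E: "finite E" "\<forall>e\<in>E. length e = s" "\<forall>e. Z e \<in> carrier M" "d - (\<Sum>e\<in>E. frag_of (map bas e, Z e)) \<in> Q.N s"
    unfolding nform_def by (elim exE conjE)
  have "(c - d) + (d - (\<Sum>e\<in>E. frag_of (map bas e, Z e))) \<in> Q.N s" by (rule Q.N_add[OF 1 E(4)])
  then have "c - (\<Sum>e\<in>E. frag_of (map bas e, Z e)) \<in> Q.N s" by simp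
  then show ?thesis unfolding nform_def using E(1-3) by (intro exI[of _ E] exI[of _ Z] conjI)
qed

lemma nform_word: "length e = s \<Longrightarrow> x \<in> carrier M \<Longrightarrow> nform s (frag_of (map bas e, x))"
  unfolding nform_def by (intro exI[of _ "{e}"] exI[of _ "\<lambda>_. x"]) (auto intro: Q.N_0)

lemma nform_0: "nform s 0"
  unfolding nform_def by (intro exI[of _ "{}"] exI[of _ "\<lambda>_. \<zero>\<^bsub>M\<^esub>"]) (auto intro: Q.N_0 M_zero)

lemma N_sum: "(\<And>i. i \<in> I \<Longrightarrow> f i \<in> Q.N s) \<Longrightarrow> sum f I \<in> Q.N s"
  by (induction I rule: infinite_finite_induct) (auto intro: Q.N_0 Q.N_add)

lemma nform_add:
  assumes "nform s c" "nform s d" shows "nform s (c + d)"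
proof -
  obtain E Z where E: "finite E" "\<And>e. e \<in> E \<Longrightarrow> length e = s" "\<And>e. Z e \<in> carrier M" "c - (\<Sum>e\<in>E. frag_of (map bas e, Z e)) \<in> Q.N s"
    using assms(1) unfolding nform_def by blast
  obtain D W where D: "finite D" "\<And>e. e \<in> D \<Longrightarrow> length e = s" "\<And>e. W e \<in> carrier M" "d - (\<Sum>e\<in>D. frag_of (map bas e, W e)) \<in> Q.N s"
    using assms(2) unfolding nform_def by blast
  \<comment> \<open>Each basis word must carry a single coefficient, so both families are extended
    by zero to the union of their supports and added there; words with coefficient zero are
    null.\<close>
  define Z' where "Z' e = (if e \<in> E then Z e else \<zero>\<^bsub>M\<^esub>)" for e
  define W' where "W' e = (if e \<in> D then W e else \<zero>\<^bsub>M\<^esub>)" for e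
  have len: "length e = s" if "e \<in> E \<union> D" for e using that E(2) D(2) by blast
  have c: "Z' e \<in> carrier M" "W' e \<in> carrier M" for e using E(3) D(3) M_zero by (auto simp: Z'_def W'_def)
  have 1: "(\<Sum>e\<in>E \<union> D. frag_of (map bas e, Z' e)) - (\<Sum>e\<in>E. frag_of (map bas e, Z e)) \<in> Q.N s"
  proof -
    have U: "E \<union> D = E \<union> (D - E)" by auto
    have "(\<Sum>e\<in>E \<union> D. frag_of (map bas e, Z' e)) = (\<Sum>e\<in>E. frag_of (map bas e, Z' e)) + (\<Sum>e\<in>D - E. frag_of (map bas e, Z' e))"
      by (subst U, rule sum.union_disjoint) (use E(1) D(1) in auto)
    moreover have "(\<Sum>e\<in>E. frag_of (map bas e, Z' e)) = (\<Sum>e\<in>E. frag_of (map bas e, Z e))" by (rule sum.cong) (auto simp: Z'_def)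
    moreover have "(\<Sum>e\<in>D - E. frag_of (map bas e, Z' e)) \<in> Q.N s"
      by (rule N_sum) (auto simp: Z'_def intro!: null_zero_word bas_word D M_zero)
    ultimately show ?thesis by simp
  qed
  have 2: "(\<Sum>e\<in>E \<union> D. frag_of (map bas e, W' e)) - (\<Sum>e\<in>D. frag_of (map bas e, W e)) \<in> Q.N s"
  proof -
    have U: "E \<union> D = D \<union> (E - D)" by auto
    have "(\<Sum>e\<in>E \<union> D. frag_of (map bas e, W' e)) = (\<Sum>e\<in>D. frag_of (map bas e, W' e)) + (\<Sum>e\<in>E - D. frag_of (map bas e, W' e))"
      by (subst U, rule sum.union_disjoint) (use E(1) D(1) in auto)
    moreover have "(\<Sum>e\<in>D. frag_of (map bas e, W' e)) = (\<Sum>e\<in>D. frag_of (map bas e, W e))" by (rule sum.cong) (auto simp: W'_def)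
    moreover have "(\<Sum>e\<in>E - D. frag_of (map bas e, W' e)) \<in> Q.N s"
      by (rule N_sum) (auto simp: W'_def intro!: null_zero_word bas_word E M_zero)
    ultimately show ?thesis by simp
  qed
  have 3: "(\<Sum>e\<in>E \<union> D. frag_of (map bas e, Z' e \<oplus>\<^bsub>M\<^esub> W' e) - frag_of (map bas e, Z' e) - frag_of (map bas e, W' e)) \<in> Q.N s"
    by (rule N_sum) (intro null_add_last bas_word c len)
  have "(c - (\<Sum>e\<in>E. frag_of (map bas e, Z e))) + (d - (\<Sum>e\<in>D. frag_of (map bas e, W e)))
     - ((\<Sum>e\<in>E \<union> D. frag_of (map bas e, Z' e)) - (\<Sum>e\<in>E. frag_of (map bas e, Z e)))
     - ((\<Sum>e\<in>E \<union> D. frag_of (map bas e, W' e)) - (\<Sum>e\<in>D. frag_of (map bas e, W e)))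
     - (\<Sum>e\<in>E \<union> D. frag_of (map bas e, Z' e \<oplus>\<^bsub>M\<^esub> W' e) - frag_of (map bas e, Z' e) - frag_of (map bas e, W' e)) \<in> Q.N s"
    by (intro Q.N_diff Q.N_add E D 1 2 3)
  then have "c + d - (\<Sum>e\<in>E \<union> D. frag_of (map bas e, Z' e \<oplus>\<^bsub>M\<^esub> W' e)) \<in> Q.N s"
    by (simp add: sum_subtractf sum.distrib algebra_simps)
  then show ?thesis
    unfolding nform_def
    by (intro exI[of _ "E \<union> D"] exI[of _ "\<lambda>e. Z' e \<oplus>\<^bsub>M\<^esub> W' e"]) (auto intro: E D M_add c)
qed

lemma nform_uminus:
  assumes "nform s c" shows "nform s (- c)"
proof -
  obtain E Z where E: "finite E" "\<And>e. e \<in> E \<Longrightarrow> length e = s" "\<And>e. Z e \<in> carrier M" "c - (\<Sum>e\<in>E. frag_of (map bas e, Z e)) \<in> Q.N s"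
    using assms(1) unfolding nform_def by blast
  have "\<forall>e. \<exists>w. w \<in> carrier M \<and> Z e \<oplus>\<^bsub>M\<^esub> w = \<zero>\<^bsub>M\<^esub>" using M_neg E(3) by blast
  from choice[OF this] obtain W where W: "\<And>e. W e \<in> carrier M" "\<And>e. Z e \<oplus>\<^bsub>M\<^esub> W e = \<zero>\<^bsub>M\<^esub>" by blast
  have 1: "(\<Sum>e\<in>E. frag_of (map bas e, Z e \<oplus>\<^bsub>M\<^esub> W e) - frag_of (map bas e, Z e) - frag_of (map bas e, W e)) \<in> Q.N s"
    by (rule N_sum) (auto intro!: null_add_last bas_word W E)
  have 2: "(\<Sum>e\<in>E. frag_of (map bas e, Z e \<oplus>\<^bsub>M\<^esub> W e)) \<in> Q.N s"
    unfolding W by (rule N_sum) (auto intro!: null_zero_word bas_word M_zero E)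
  have eq: "- c - (\<Sum>e\<in>E. frag_of (map bas e, W e)) = (\<Sum>e\<in>E. frag_of (map bas e, Z e \<oplus>\<^bsub>M\<^esub> W e) - frag_of (map bas e, Z e) - frag_of (map bas e, W e)) - (\<Sum>e\<in>E. frag_of (map bas e, Z e \<oplus>\<^bsub>M\<^esub> W e)) - (c - (\<Sum>e\<in>E. frag_of (map bas e, Z e)))"
    by (simp add: sum_subtractf sum.distrib)
  have "- c - (\<Sum>e\<in>E. frag_of (map bas e, W e)) \<in> Q.N s"
    unfolding eq by (intro Q.N_diff 1 2 E)
  then show ?thesis
    unfolding nform_def using E W by (intro exI[of _ E] exI[of _ W]) auto
qed

text \<open>The prefix e is already in basis form. The first remaining factor is expanded in the
  basis, and its right unit scalar moves into the next factor, or into M when there is none. This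
  shortens \<open>gs\<close> but alters its new head, hence the generalisation over all
  words.\<close>

lemma nform_of_word:
  fixes e :: "'e list"
  shows "set gs \<subseteq> carrier (total H) \<Longrightarrow> x \<in> carrier M \<Longrightarrow> length e + length gs = s \<Longrightarrow> nform s (frag_of (map bas e @ gs, x))"
proof (induction "length gs" arbitrary: gs x e)
  case 0
  then show ?case using nform_word by simp
next
  case (Suc n)
  then obtain g hs where gs: "gs = g # hs" by (cases gs) auto
  have g: "g \<in> carrier (total H)" using Suc gs by auto
  have "\<forall>hs x (e :: 'e list). n = length hs \<longrightarrow> set hs \<subseteq> carrier (total H) \<longrightarrow> x \<in> carrier M \<longrightarrow> Suc (length e + length hs) = s \<longrightarrow> nform s (frag_of (map bas e @ g # hs, x))"
    using g
  proof (induction rule: total_cases)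
    case (bas e' b)
    note 1 = bas
    show ?case
    proof (intro allI impI)
      fix hs x and e :: "'e list" assume h: "n = length hs" "set hs \<subseteq> carrier (total H)" "x \<in> carrier M" "Suc (length e + length hs) = s"
      let ?g = "bas e' \<otimes>\<^bsub>total H\<^esub> runit H b"
      show "nform s (frag_of (map bas e @ ?g # hs, x))"
      proof (cases hs)
        case Nil
        have "frag_of (map bas e @ [?g], x) - frag_of (map bas e @ [bas e'], b \<odot>\<^bsub>M\<^esub> x) \<in> Q.N s"
        proof (rule Q.N_rel)
          have "(map bas e @ [bas e'], x) \<in> words s" using h Nil by (intro wordI) (auto intro: bas_closed)
          then show "frag_of (map bas e @ [?g], x) - frag_of (map bas e @ [bas e'], b \<odot>\<^bsub>M\<^esub> x) \<in> cobar_relations H M s"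
            unfolding cobar_relations_def using 1 by blast
        qed
        moreover have "nform s (frag_of (map bas (e @ [e']), b \<odot>\<^bsub>M\<^esub> x))"
          by (rule nform_word) (use h Nil 1 M_smult in auto)
        ultimately show ?thesis using nform_null Nil by simp
      next
        case (Cons h' hs')
        have hc: "h' \<in> carrier (total H)" "set hs' \<subseteq> carrier (total H)" using h Cons by auto
        have "frag_of (map bas e @ [?g, h'] @ hs', x) - frag_of (map bas e @ [bas e', lunit H b \<otimes>\<^bsub>total H\<^esub> h'] @ hs', x) \<in> Q.N s"
        proof (rule Q.N_rel)
          have "(map bas e @ [bas e', h'] @ hs', x) \<in> words s" using h Cons by (intro wordI) (auto intro: bas_closed)
          then show "frag_of (map bas e @ [?g, h'] @ hs', x) - frag_of (map bas e @ [bas e', lunit H b \<otimes>\<^bsub>total H\<^esub> h'] @ hs', x) \<in> cobar_relations H M s"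
            unfolding cobar_relations_def using 1 by blast
        qed
        moreover have "nform s (frag_of (map bas (e @ [e']) @ (lunit H b \<otimes>\<^bsub>total H\<^esub> h') # hs', x))"
          by (rule Suc.hyps(1)) (use h hc Cons 1 in \<open>auto simp: mult_closed lunit_closed\<close>)
        ultimately show ?thesis using nform_null Cons by simp
      qed
    qed
  next
    case (add g h)
    note 2 = add
    show ?case
    proof (intro allI impI)
      fix hs x and e :: "'e list" assume a: "n = length hs" "set hs \<subseteq> carrier (total H)" "x \<in> carrier M" "Suc (length e + length hs) = s"
      have "frag_of (map bas e @ [g \<oplus>\<^bsub>total H\<^esub> h] @ hs, x) - frag_of (map bas e @ [g] @ hs, x) - frag_of (map bas e @ [h] @ hs, x) \<in> Q.N s"
      proof (rule Q.N_rel)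
        have "(map bas e @ [g] @ hs, x) \<in> words s" "(map bas e @ [h] @ hs, x) \<in> words s"
          using a 2(1,2) by (auto intro!: wordI bas_closed)
        then show "frag_of (map bas e @ [g \<oplus>\<^bsub>total H\<^esub> h] @ hs, x) - frag_of (map bas e @ [g] @ hs, x) - frag_of (map bas e @ [h] @ hs, x) \<in> cobar_relations H M s"
          unfolding cobar_relations_def by blast
      qed
      moreover have "nform s (frag_of (map bas e @ g # hs, x) + frag_of (map bas e @ h # hs, x))"
        using 2(3,4) a by (intro nform_add) auto
      ultimately show "nform s (frag_of (map bas e @ (g \<oplus>\<^bsub>total H\<^esub> h) # hs, x))"
        using nform_null by (simp add: diff_diff_eq)
    qed
  qed
  then show ?case using Suc gs by auto
qed

lemma nform_all:
  assumes "Poly_Mapping.keys c \<subseteq> words s" shows "nform s c"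
  using assms
proof (induction c rule: frag_induction)
  case zero
  then show ?case by (rule nform_0)
next
  case (one w)
  obtain gs x where w: "w = (gs, x)" by (cases w)
  show ?case using nform_of_word[of gs x "[]" s] one by (auto simp: w dest!: wordD)
next
  case (diff a b)
  then show ?case using nform_add[OF diff(1) nform_uminus[OF diff(2)]] by simp
qed

text \<open>Sort the words by their first letter x. By \<open>indep\<close> and
  \<open>Pre_Suc_normal\<close> the function following \<open>bas x\<close> already lies in
  \<open>Pre GG K s\<close>, and the induction hypothesis applies to the tails.\<close>

lemma normal_indep:
  assumes "finite E" "\<And>e. e \<in> E \<Longrightarrow> length e = s" "\<And>e. Z e \<in> carrier M"
    and "(\<Sum>e\<in>E. wfn gf mu (map bas e, Z e)) \<in> Pre GG K s" and "e \<in> E"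
  shows "Z e = \<zero>\<^bsub>M\<^esub>"
  using assms
proof (induction s arbitrary: E Z e)
  case 0
  then have "E = {[]}" "e = []" by fastforce+
  then show ?case using 0 by (auto simp: wfn_def intro: mu_inj)
next
  case (Suc s)
  let ?A = "hd ` E"
  let ?t = "\<lambda>x. {u. x # u \<in> E}"
  let ?S = "\<lambda>x. (\<Sum>u\<in>?t x. wfn gf mu (map bas u, Z (x # u)))"
  have ft: "finite (?t x)" for x
    by (rule finite_surj[of E _ tl]) (use Suc in \<open>auto simp: image_iff intro!: bexI[of _ "x # _"]\<close>)
  have ne: "u \<noteq> []" if "u \<in> E" for u using Suc.prems(2)[OF that] by auto
  have "(\<Sum>e\<in>E. wfn gf mu (map bas e, Z e)) = (\<Sum>(x, u)\<in>(SIGMA x:?A. ?t x). gf (bas x) * Sh (wfn gf mu (map bas u, Z (x # u))))"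
  proof (rule sum.reindex_bij_witness[where i = "\<lambda>(x, u). x # u" and j = "\<lambda>e. (hd e, tl e)"])
    fix e assume e: "e \<in> E"
    then obtain x u where xu: "e = x # u" using ne by (cases e) auto
    show "(case (hd e, tl e) of (x, u) \<Rightarrow> x # u) = e" by (simp add: xu)
    show "(hd e, tl e) \<in> (SIGMA x:?A. ?t x)" using e by (force simp: xu)
    show "(case (hd e, tl e) of (x, u) \<Rightarrow> gf (bas x) * Sh (wfn gf mu (map bas u, Z (x # u)))) = wfn gf mu (map bas e, Z e)"
      by (simp add: xu wfn_def)
  qed auto
  also have "\<dots> = (\<Sum>x\<in>?A. gf (bas x) * Sh (?S x))"
    using Suc.prems(1) ft by (simp add: sum.Sigma[symmetric] Sh_sum sum_distrib_left)
  finally have eq: "(\<Sum>e\<in>E. wfn gf mu (map bas e, Z e)) = (\<Sum>x\<in>?A. gf (bas x) * Sh (?S x))" .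
  obtain D k where D: "finite D" "\<And>x. k x \<in> Pre GG K s" "(\<Sum>e\<in>E. wfn gf mu (map bas e, Z e)) = (\<Sum>x\<in>D. gf (bas x) * Sh (k x))"
    using Pre_Suc_normal[OF K K_sc Suc.prems(4)] by blast
  \<comment> \<open>The two expansions are compared on the union of their supports, with 0 where a
    letter does not occur.\<close>
  let ?d = "\<lambda>x. (if x \<in> ?A then ?S x else 0) - (if x \<in> D then k x else 0)"
  have "(\<Sum>x\<in>?A. gf (bas x) * Sh (?S x)) = (\<Sum>x\<in>?A \<union> D. gf (bas x) * Sh (if x \<in> ?A then ?S x else 0))"
    by (rule sum.mono_neutral_cong_left) (use Suc.prems(1) D in auto)
  moreover have "(\<Sum>x\<in>D. gf (bas x) * Sh (k x)) = (\<Sum>x\<in>?A \<union> D. gf (bas x) * Sh (if x \<in> D then k x else 0))"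
    by (rule sum.mono_neutral_cong_left) (use Suc.prems(1) D in auto)
  ultimately have "(\<Sum>x\<in>?A \<union> D. gf (bas x) * Sh (?d x)) = 0"
    using eq D(3) by (simp add: sum_subtractf right_diff_distrib)
  then have d0: "?d x = 0" if "x \<in> ?A \<union> D" for x
    using indep[of "?A \<union> D" ?d x] that Suc.prems(1) D(1) by blast
  obtain x u where e: "e = x # u" using ne[OF Suc.prems(5)] by (cases e) auto
  have xA: "x \<in> ?A" using e Suc.prems(5) by force
  have S: "?S x \<in> Pre GG K s"
    using d0[of x] xA D(2)[of x] addsub_0[OF addsub_Pre[OF K]] by (auto split: if_splits)
  show ?case unfolding e
  proof (rule Suc.IH[where E = "?t x" and Z = "\<lambda>u. Z (x # u)"])
    show "length v = s" if "v \<in> ?t x" for v using Suc.prems(2)[of "x # v"] that by auto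
  qed (use ft Suc.prems e S in auto)
qed

text \<open>In a normal form of c all coefficients vanish by \<open>normal_indep\<close>, so the
  normal form is null, and so is c. This is the step that makes functions a faithful model of the
  tensor product.\<close>

lemma null_if_phi:
  assumes c: "Poly_Mapping.keys c \<subseteq> words s" and ph: "\<phi> c \<in> Pre GG K s"
  shows "c \<in> Q.N s"
proof -
  obtain E Z where E: "finite E" "\<And>e. e \<in> E \<Longrightarrow> length e = s" "\<And>e. Z e \<in> carrier M" "c - (\<Sum>e\<in>E. frag_of (map bas e, Z e)) \<in> Q.N s"
    using nform_all[OF c] unfolding nform_def by blast
  have "\<phi> (\<Sum>e\<in>E. frag_of (map bas e, Z e)) = \<phi> c - \<phi> (c - (\<Sum>e\<in>E. frag_of (map bas e, Z e)))"
    by (simp add: phi_def flin_diff)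
  also have "\<dots> \<in> Pre GG K s"
    by (intro addsub_diff[OF addsub_Pre[OF K]] ph phi_null E)
  finally have "(\<Sum>e\<in>E. wfn gf mu (map bas e, Z e)) \<in> Pre GG K s"
    by (simp add: phi_def flin_sum)
  then have "Z e = \<zero>\<^bsub>M\<^esub>" if "e \<in> E" for e
    by (intro normal_indep[where E = E and Z = Z and s = s]) (use E that in auto)
  then have "(\<Sum>e\<in>E. frag_of (map bas e, Z e)) \<in> Q.N s"
    by (intro N_sum) (auto intro!: null_zero_word bas_word M_zero E)
  from Q.N_add[OF E(4) this] show ?thesis by simp
qed

theorem null_iff: "Poly_Mapping.keys c \<subseteq> words s \<Longrightarrow> c \<in> Q.N s \<longleftrightarrow> \<phi> c \<in> Pre GG K s"
  using phi_null null_if_phi by blast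

text \<open>A union of cosets of \<open>K\<close>, so that \<open>Pre GG Img s\<close> modulo
  \<open>Pre GG K s\<close> is the tensor product.\<close>

definition Img :: "chainfun set" where
  "Img = {f. \<exists>x\<in>carrier M. f - mu x \<in> K}"

lemma phi_in_Img:
  assumes "Poly_Mapping.keys c \<subseteq> words s" shows "\<phi> c \<in> Pre GG (asp Img) s"
  unfolding phi_def
proof (rule addsub_flin)
  show "addsub (Pre GG (asp Img) s)" by (intro addsub_Pre addsub_asp)
  fix w assume "w \<in> Poly_Mapping.keys c"
  then obtain gs x where w: "w = (gs, x)" "length gs = s" "set gs \<subseteq> carrier (total H)" "x \<in> carrier M"
    using assms by (auto simp: cobar_words_def)
  have "mu x \<in> Img" unfolding Img_def using w(4) addsub_0[OF K] by force
  then show "wfn gf mu w \<in> Pre GG (asp Img) s"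
    using pr_Pre[of gf gs GG "mu x" "asp Img" 0] w by (auto simp: wfn_def intro: asp.base)
qed

lemma Img_addsub: "addsub Img"
proof -
  have mu0: "mu \<zero>\<^bsub>M\<^esub> \<in> K"
    using mu_add[OF M_zero M_zero] addsub_uminus[OF K] by (fastforce simp: M_zz)
  have "f - g \<in> Img" if fg: "f \<in> Img" "g \<in> Img" for f g
  proof -
    obtain x y where x: "x \<in> carrier M" "f - mu x \<in> K" "y \<in> carrier M" "g - mu y \<in> K" using fg by (auto simp: Img_def)
    obtain z where z: "z \<in> carrier M" "y \<oplus>\<^bsub>M\<^esub> z = \<zero>\<^bsub>M\<^esub>" using M_neg x by blast
    have yz: "mu y + mu z \<in> K"
      using addsub_diff[OF K mu0 mu_add[OF x(3) z(1)]] z by simp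
    have "f - g - mu (x \<oplus>\<^bsub>M\<^esub> z) = (f - mu x) - (g - mu y) - (mu (x \<oplus>\<^bsub>M\<^esub> z) - (mu x + mu z)) - (mu y + mu z)"
      by (simp add: algebra_simps)
    also have "\<dots> \<in> K" by (intro addsub_diff[OF K] x yz mu_add z)
    finally show ?thesis unfolding Img_def using M_add[OF x(1) z(1)] by blast
  qed
  moreover have "0 \<in> Img" unfolding Img_def using M_zero addsub_uminus[OF K mu0] by auto
  ultimately show ?thesis by (simp add: addsub_def)
qed

lemma phi_Img: "Poly_Mapping.keys c \<subseteq> words s \<Longrightarrow> \<phi> c \<in> Pre GG Img s"
proof -
  have "asp Img \<subseteq> Img"
  proof
    fix x assume "x \<in> asp Img"
    then show "x \<in> Img" by induction (auto intro: addsub_0[OF Img_addsub] addsub_diff[OF Img_addsub])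
  qed
  then show "Poly_Mapping.keys c \<subseteq> words s \<Longrightarrow> \<phi> c \<in> Pre GG Img s"
    using phi_in_Img Pre_mono by blast
qed

lemma phi_surj:
  assumes "f \<in> Pre GG Img s"
  shows "\<exists>c. Poly_Mapping.keys c \<subseteq> words s \<and> \<phi> c - f \<in> Pre GG K s"
  using assms
proof (induction s arbitrary: f)
  case 0
  then obtain x where x: "x \<in> carrier M" "f - mu x \<in> K" by (auto simp: Img_def)
  have "\<phi> (frag_of ([], x)) - f = - (f - mu x)" by (simp add: phi_def wfn_def)
  then have "\<phi> (frag_of ([], x)) - f \<in> Pre GG K 0" using addsub_uminus[OF K x(2)] by simp
  then show ?case using x by (intro exI[of _ "frag_of ([], x)"]) (auto simp: cobar_words_def keys_frag_of)
next
  case (Suc s)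
  have as: "addsub (Pre GG K (Suc s))" by (rule addsub_Pre[OF K])
  show ?case using Suc.prems[unfolded Pre.simps]
  proof induction
    case zero
    then show ?case using addsub_0[OF as] by (intro exI[of _ 0]) (simp add: phi_def)
  next
    case (base x)
    then obtain g f where x: "x = gf g * Sh f" "g \<in> carrier (total H)" "f \<in> Pre GG Img s" by auto
    obtain c where c: "Poly_Mapping.keys c \<subseteq> words s" "\<phi> c - f \<in> Pre GG K s" using Suc.IH[OF x(3)] by blast
    let ?c = "frag_extend (\<lambda>w. frag_of (g # fst w, snd w)) c"
    have "\<phi> ?c = gf g * Sh (\<phi> c)"
      by (simp add: phi_def flin_frag_extend wfn_def Sh_flin flin_mult_left)
    then have "\<phi> ?c - x = gf g * Sh (\<phi> c - f)" by (simp add: x right_diff_distrib)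
    then have "\<phi> ?c - x \<in> Pre GG K (Suc s)" using PreI[of "gf g" GG] x(2) c(2) by fastforce
    moreover have "Poly_Mapping.keys ?c \<subseteq> words (Suc s)"
    proof -
      have "Poly_Mapping.keys (frag_of (g # fst w, snd w)) \<subseteq> words (Suc s)" if "w \<in> Poly_Mapping.keys c" for w
        using c(1) that x(2) by (cases w) (fastforce simp: keys_frag_of cobar_words_def)
      then show ?thesis using keys_frag_extend[of "\<lambda>w. frag_of (g # fst w, snd w)" c] by blast
    qed
    ultimately show ?case by blast
  next
    case (diff x y)
    then obtain c d where c: "Poly_Mapping.keys c \<subseteq> words (Suc s)" "\<phi> c - x \<in> Pre GG K (Suc s)"
      "Poly_Mapping.keys d \<subseteq> words (Suc s)" "\<phi> d - y \<in> Pre GG K (Suc s)" by blast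
    have eq: "\<phi> (c - d) - (x - y) = (\<phi> c - x) - (\<phi> d - y)" by (simp add: phi_def flin_diff)
    have "\<phi> (c - d) - (x - y) \<in> Pre GG K (Suc s)" unfolding eq by (rule addsub_diff[OF as c(2) c(4)])
    then show ?case using c keys_diff[of c d] by (intro exI[of _ "c - d"]) auto
  qed
qed

lemma K_Img: "K \<subseteq> Img"
proof
  fix k assume k: "k \<in> K"
  have "mu \<zero>\<^bsub>M\<^esub> \<in> K"
    using mu_add[OF M_zero M_zero] addsub_uminus[OF K] by (fastforce simp: M_zz)
  then show "k \<in> Img" unfolding Img_def using M_zero addsub_diff[OF K k] by blast
qed

end

section \<open>Ext groups in terms of functions\<close>

text \<open>In degree s a function uses Y 0, ..., Y (s + 1), the last point being the parameter of
  the coefficients. Its differential uses one more point, and i stops at s + 1, so the parameter is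
  never omitted.\<close>

definition delta :: "nat \<Rightarrow> chainfun \<Rightarrow> chainfun" where
  "delta s f = (\<Sum>i\<le>Suc s. (- 1) ^ i * cf i f)"

lemma delta_0 [simp]: "delta s 0 = 0"
  by (simp add: delta_def)

lemma delta_diff: "delta s (f - g) = delta s f - delta s g"
  by (simp add: delta_def sum_subtractf right_diff_distrib)

lemma delta_add: "delta s (f + g) = delta s f + delta s g"
  by (simp add: delta_def sum.distrib distrib_left)

lemma minus_one_power_in: "addsub X \<Longrightarrow> x \<in> X \<Longrightarrow> (- 1) ^ i * x \<in> X" for x :: "'r::comm_ring_1"
  by (cases "even i") (auto intro: addsub_uminus)

definition agrp :: "'r::ab_group_add set \<Rightarrow> 'r monoid" where
  "agrp Z = \<lparr>carrier = Z, monoid.mult = (+), one = 0\<rparr>"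

lemma agrp_simps [simp]: "carrier (agrp Z) = Z" "x \<otimes>\<^bsub>agrp Z\<^esub> y = x + y" "\<one>\<^bsub>agrp Z\<^esub> = 0"
  by (simp_all add: agrp_def)

lemma group_agrp: "addsub Z \<Longrightarrow> group (agrp Z)"
  by (rule groupI) (auto intro: addsub_add addsub_0 addsub_uminus add.assoc bexI[of _ "- _"])

lemma group_if_epi:
  assumes "group G" "h \<in> hom G H" "h ` carrier G = carrier H" "h \<one>\<^bsub>G\<^esub> = \<one>\<^bsub>H\<^esub>"
  shows "group (H :: ('b, 'c) monoid_scheme)"
proof -
  have "group (H\<lparr>carrier := h ` carrier G, one := h \<one>\<^bsub>G\<^esub>\<rparr>)"
    by (rule group.hom_imp_img_group[OF assms(1,2)])
  then show ?thesis by (simp add: assms(3,4))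
qed

text \<open>Each isomorphism of the theorem arises from two surjections out of one group of
  functions, so only kernels have to be compared. That the targets are groups follows from
  \<open>group_if_epi\<close>.\<close>

lemma iso_of_same_kernel:
  assumes G: "group G"
    and h: "h \<in> hom G H" "h ` carrier G = carrier H" "h \<one>\<^bsub>G\<^esub> = \<one>\<^bsub>H\<^esub>"
    and k: "k \<in> hom G K" "k ` carrier G = carrier K" "k \<one>\<^bsub>G\<^esub> = \<one>\<^bsub>K\<^esub>"
    and eq: "\<And>x. x \<in> carrier G \<Longrightarrow> h x = \<one>\<^bsub>H\<^esub> \<longleftrightarrow> k x = \<one>\<^bsub>K\<^esub>"
  shows "H \<cong> K"
proof -
  interpret h: group_hom G H h
    using G h group_if_epi[OF G h] by (simp add: group_hom_def group_hom_axioms_def)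
  interpret k: group_hom G K k
    using G k group_if_epi[OF G k] by (simp add: group_hom_def group_hom_axioms_def)
  have "kernel G H h = kernel G K k" using eq by (auto simp: kernel_def)
  then have "G Mod kernel G H h \<cong> H" "G Mod kernel G H h \<cong> K"
    using h.FactGroup_iso[OF h(2)] k.FactGroup_iso[OF k(2)] by auto
  moreover have "group (G Mod kernel G H h)" by (rule normal.factorgroup_is_group[OF h.normal_kernel])
  ultimately show ?thesis using group.iso_sym iso_trans by blast
qed

section \<open>Coproduct, coaction and cobar differential on functions\<close>

lemma phi_word_1:
  assumes "length hs = 1"
  shows "pr gf hs (gf h * Sh r) = wfn gf gf (hs, h) * Sh (Sh r)"
proof -
  obtain h' where "hs = [h']" using assms by (cases hs) auto
  then show ?thesis by (simp add: wfn_def mult.assoc)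
qed

text \<open>The coproduct is \<open>cf 1\<close>, omission of the middle point. An element of
  \<Gamma> depends on Y 0 and Y 1 only, so omitting a later point does not affect it.\<close>

locale hopf_functions = algebroid_functions H gf bas sc
  for H :: "('a, 'g, 'h) hopf_algebroid_scheme" and gf :: "'g \<Rightarrow> chainfun" and bas :: "'e \<Rightarrow> 'g" and sc :: "'a \<Rightarrow> chainfun" +
  assumes gf_local: "i \<ge> 2 \<Longrightarrow> cf i (gf g) = gf g"
    and comult_keys: "g \<in> carrier (total H) \<Longrightarrow> Poly_Mapping.keys (rep (comult H g)) \<subseteq> cobar_words H (total_module H) 1"
    and comult_phi: "g \<in> carrier (total H) \<Longrightarrow> phi gf gf (rep (comult H g)) = cf 1 (gf g)"
begin

lemma comult_word:
  assumes "g \<in> carrier (total H)" "(hs, h) \<in> Poly_Mapping.keys (rep (comult H g))"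
  shows "length hs = 1 \<and> set hs \<subseteq> carrier (total H) \<and> h \<in> carrier (total H)"
  using comult_keys[OF assms(1)] assms(2) by (auto simp: cobar_words_def total_module_def ring.defs module.defs)

lemma pr_comult:
  assumes "g \<in> carrier (total H)"
  shows "flin (\<lambda>(hs, h). pr gf hs (gf h * Sh r)) (rep (comult H g)) = cf 1 (gf g * Sh r)"
proof -
  have "flin (\<lambda>(hs, h). pr gf hs (gf h * Sh r)) (rep (comult H g)) = flin (\<lambda>w. wfn gf gf w * Sh (Sh r)) (rep (comult H g))"
    by (rule flin_cong) (use comult_word[OF assms] phi_word_1 in fastforce)
  also have "\<dots> = cf 1 (gf g) * Sh (Sh r)"
    by (simp add: flin_mult_right comult_phi[OF assms, unfolded phi_def])
  finally show ?thesis by (simp add: cf_Suc_Sh cf_0)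
qed

lemma cf_pr:
  assumes "i \<ge> 1" shows "cf (length xs + i) (pr gf xs f) = pr gf xs (cf i f)"
proof (induction xs)
  case (Cons g xs)
  have "cf (length (g # xs) + i) (pr gf (g # xs) f) = cf (Suc (length xs + i)) (gf g) * Sh (cf (length xs + i) (pr gf xs f))"
    by (simp add: cf_Suc_Sh)
  then show ?case using Cons assms by (simp add: gf_local)
qed simp

lemma Sh_Pre: "addsub J \<Longrightarrow> f \<in> Pre GG J s \<Longrightarrow> Sh f \<in> Pre GG J (Suc s)"
  using PreI[of 1 GG f J s] gf_one one_closed by (metis image_eqI mult_1)

text \<open>\<open>cf 0\<close> puts the factor 1 in front, \<open>cf 1\<close> replaces the first
  factor by its coproduct, and a later coface acts on the remaining factors. The assumption on
  \<open>J\<close> takes care of the end of the word, where the coaction acts.\<close>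

lemma cf_Pre:
  assumes J: "addsub J" "\<And>k. k \<in> J \<Longrightarrow> cf 1 k \<in> Pre GG J 1"
  shows "f \<in> Pre GG J s \<Longrightarrow> i \<le> Suc s \<Longrightarrow> cf i f \<in> Pre GG J (Suc s)"
proof (induction s arbitrary: f i)
  case 0
  then show ?case using J Sh_Pre[OF J(1), of f 0] by (cases i) (auto simp: cf_0)
next
  case (Suc s)
  have as: "addsub (Pre GG J (Suc (Suc s)))" by (rule addsub_Pre[OF J(1)])
  show ?case
    using Suc.prems(1)[unfolded Pre.simps(2)]
  proof (rule asp_hom[where h = "cf i"])
    fix x assume "x \<in> {g * Sh f |g f. g \<in> GG \<and> f \<in> Pre GG J s}"
    then obtain g f where x: "x = gf g * Sh f" "g \<in> carrier (total H)" "f \<in> Pre GG J s" by auto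
    consider "i = 0" | "i = 1" | j where "i = Suc j" "j \<ge> 1" by (cases i) force+
    then show "cf i x \<in> Pre GG J (Suc (Suc s))"
    proof cases
      case 1
      have "x \<in> Pre GG J (Suc s)" unfolding x(1) by (rule PreI) (use x in auto)
      then show ?thesis using Sh_Pre[OF J(1)] 1 by (simp add: cf_0 del: Pre.simps)
    next
      case 2
      have "flin (\<lambda>(hs, h). pr gf hs (gf h * Sh f)) (rep (comult H g)) \<in> Pre GG J (Suc (Suc s))"
      proof (rule addsub_flin[OF as])
        fix w assume w: "w \<in> Poly_Mapping.keys (rep (comult H g))"
        obtain hs h where w': "w = (hs, h)" by (cases w)
        then have hs: "length hs = 1" "set hs \<subseteq> carrier (total H)" "h \<in> carrier (total H)"
          using comult_word[OF x(2)] w by blast+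
        have "gf h * Sh f \<in> Pre GG J (Suc s)" by (rule PreI) (use x hs in auto)
        then have "pr gf hs (gf h * Sh f) \<in> Pre GG J (length hs + Suc s)"
          by (intro pr_Pre) (use hs in auto)
        then show "(case w of (hs, h) \<Rightarrow> pr gf hs (gf h * Sh f)) \<in> Pre GG J (Suc (Suc s))"
          using hs by (simp add: w' del: Pre.simps)
      qed
      then show ?thesis unfolding pr_comult[OF x(2)] 2 x(1) .
    next
      case (3 j)
      have "cf i x = gf g * Sh (cf j f)" using 3 by (simp add: x(1) gf_local cf_Suc_Sh)
      moreover have "cf j f \<in> Pre GG J (Suc s)" by (rule Suc.IH[OF x(3)]) (use 3 Suc.prems in simp)
      ultimately show ?thesis using PreI[of "gf g" GG] x(2) by (simp del: Pre.simps)
    qed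
  qed (auto intro: addsub_0[OF as] addsub_diff[OF as] simp del: Pre.simps)
qed

lemma delta_Pre:
  assumes J: "addsub J" "\<And>k. k \<in> J \<Longrightarrow> cf 1 k \<in> Pre GG J 1" and f: "f \<in> Pre GG J s"
  shows "delta s f \<in> Pre GG J (Suc s)"
  unfolding delta_def
  by (rule addsub_sum[OF addsub_Pre[OF J(1)]], rule minus_one_power_in[OF addsub_Pre[OF J(1)]], rule cf_Pre[OF J f]) auto

end

text \<open>The coaction is omission of Y 1. A function of Y 0 alone is unchanged, which is x
  \<mapsto> \<eta>_L(x) \<otimes> 1; for T, whose functions involve t from Y 0 to the parameter Y 1,
  it is the coproduct.\<close>

locale comodule_model = hopf_functions H gf bas sc + cobar_model H gf bas sc M mu K
  for H :: "('a, 'g, 'h) hopf_algebroid_scheme" and gf :: "'g \<Rightarrow> chainfun" and bas :: "'e \<Rightarrow> 'g" and sc :: "'a \<Rightarrow> chainfun"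
    and M :: "('a, 'g, 'm, 'c) comodule_scheme" and mu :: "'m \<Rightarrow> chainfun" and K :: "chainfun set" +
  assumes coact_keys: "x \<in> carrier M \<Longrightarrow> Poly_Mapping.keys (rep (coact M x)) \<subseteq> words 1"
    and coact_phi: "x \<in> carrier M \<Longrightarrow> \<phi> (rep (coact M x)) - cf 1 (mu x) \<in> Pre GG K 1"
    and K_cf: "k \<in> K \<Longrightarrow> cf 1 k \<in> Pre GG K 1"
begin

abbreviation "PK s \<equiv> Pre GG K s"
abbreviation "PI s \<equiv> Pre GG Img s"

lemma PK: "addsub (PK s)" by (rule addsub_Pre[OF K])
lemma PI: "addsub (PI s)" by (rule addsub_Pre[OF Img_addsub])
lemma PK_PI: "PK s \<subseteq> PI s" by (rule Pre_mono[OF K_Img])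

lemma delta_PK: "f \<in> PK s \<Longrightarrow> delta s f \<in> PK (Suc s)"
  by (rule delta_Pre[OF K K_cf])

lemma sum_split_ends: "(\<Sum>i\<le>Suc n. f i) = f 0 + (\<Sum>j<n. f (Suc j)) + f (Suc n)"
  for f :: "nat \<Rightarrow> 'r::comm_monoid_add"
  using sum.atMost_Suc_shift[of f n] sum.lessThan_Suc[of "\<lambda>j. f (Suc j)" n]
  by (simp add: lessThan_Suc_atMost add.assoc)

text \<open>The unit in front is \<open>cf 0\<close>, the coproduct at letter j, counted from 0, is
  \<open>cf (j + 1)\<close>, and the coaction is \<open>cf (s + 1)\<close>. Only the coaction is
  known merely modulo \<open>K\<close>, whence the error term.\<close>

lemma phi_diff_word:
  assumes "(gs, x) \<in> words s"
  shows "\<phi> (cobar_diff_word H M (gs, x)) - delta s (wfn gf mu (gs, x)) \<in> PK (Suc s)"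
proof -
  have w: "length gs = s" "set gs \<subseteq> carrier (total H)" "x \<in> carrier M" using wordD[OF assms] by auto
  let ?f = "wfn gf mu (gs, x)"
  have mid: "flin (wfn gf mu) (frag_extend (\<lambda>(hs, h). frag_of (take j gs @ hs @ [h] @ drop (Suc j) gs, x)) (rep (comult H (gs ! j)))) = cf (Suc j) ?f"
    if j: "j < s" for j
  proof -
    let ?r = "pr gf (drop (Suc j) gs) (mu x)"
    have g: "gs ! j \<in> carrier (total H)" using j w by auto
    have "flin (wfn gf mu) (frag_extend (\<lambda>(hs, h). frag_of (take j gs @ hs @ [h] @ drop (Suc j) gs, x)) (rep (comult H (gs ! j))))
       = flin (\<lambda>q. pr gf (take j gs) ((\<lambda>(hs, h). pr gf hs (gf h * Sh ?r)) q)) (rep (comult H (gs ! j)))"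
      unfolding flin_frag_extend by (rule flin_cong) (auto simp: wfn_def pr_append)
    also have "\<dots> = pr gf (take j gs) (cf 1 (gf (gs ! j) * Sh ?r))"
      unfolding pr_flin[symmetric] pr_comult[OF g] ..
    also have "\<dots> = cf (length (take j gs) + 1) (pr gf (take j gs) (gf (gs ! j) * Sh ?r))"
      by (rule cf_pr[symmetric]) simp
    also have "pr gf (take j gs) (gf (gs ! j) * Sh ?r) = pr gf (take j gs @ gs ! j # drop (Suc j) gs) (mu x)"
      by (simp add: pr_append)
    also have "take j gs @ gs ! j # drop (Suc j) gs = gs" using j w id_take_nth_drop[of j gs] by simp
    finally have *: "flin (wfn gf mu) (frag_extend (\<lambda>(hs, h). frag_of (take j gs @ hs @ [h] @ drop (Suc j) gs, x)) (rep (comult H (gs ! j))))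
       = cf (length (take j gs) + 1) (pr gf gs (mu x))" .
    have len: "length (take j gs) + 1 = Suc j" using j w by simp
    have f: "?f = pr gf gs (mu x)" by (simp add: wfn_def)
    show ?thesis using * unfolding len f .
  qed
  have last: "flin (wfn gf mu) (frag_extend (\<lambda>(hs, y). frag_of (gs @ hs, y)) (rep (coact M x))) = pr gf gs (\<phi> (rep (coact M x)))"
    unfolding flin_frag_extend phi_def pr_flin by (rule flin_cong) (auto simp: wfn_def pr_append)
  have first: "wfn gf mu (\<one>\<^bsub>total H\<^esub> # gs, x) = cf 0 ?f" by (simp add: wfn_def gf_one cf_0)
  have one: "of_int ((- 1) ^ k) = ((- 1) ^ k :: chainfun)" for k by simp
  have "\<phi> (cobar_diff_word H M (gs, x)) = cf 0 ?f + (\<Sum>j<s. (- 1) ^ (j + 1) * cf (Suc j) ?f) + (- 1) ^ (s + 1) * pr gf gs (\<phi> (rep (coact M x)))"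
  proof -
    have "\<phi> (cobar_diff_word H M (gs, x)) = cf 0 ?f + (\<Sum>j<s. (- 1) ^ (j + 1) *
        flin (wfn gf mu) (frag_extend (\<lambda>(hs, h). frag_of (take j gs @ hs @ [h] @ drop (Suc j) gs, x)) (rep (comult H (gs ! j)))))
        + (- 1) ^ (s + 1) * pr gf gs (\<phi> (rep (coact M x)))"
      by (simp only: cobar_diff_word_def prod.case phi_def flin_add flin_of flin_sum flin_cmul first last[unfolded phi_def] one w(1))
    also have "(\<Sum>j<s. (- 1) ^ (j + 1) * flin (wfn gf mu) (frag_extend (\<lambda>(hs, h). frag_of (take j gs @ hs @ [h] @ drop (Suc j) gs, x)) (rep (comult H (gs ! j)))))
       = (\<Sum>j<s. (- 1) ^ (j + 1) * cf (Suc j) ?f)"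
      by (rule sum.cong) (use mid in auto)
    finally show ?thesis .
  qed
  moreover have "delta s ?f = cf 0 ?f + (\<Sum>j<s. (- 1) ^ (j + 1) * cf (Suc j) ?f) + (- 1) ^ (s + 1) * cf (s + 1) ?f"
    unfolding delta_def sum_split_ends by simp
  moreover have "cf (s + 1) ?f = pr gf gs (cf 1 (mu x))"
    using cf_pr[of 1 gs "mu x"] w by (simp add: wfn_def)
  ultimately have "\<phi> (cobar_diff_word H M (gs, x)) - delta s ?f = (- 1) ^ (s + 1) * pr gf gs (\<phi> (rep (coact M x)) - cf 1 (mu x))"
    by (simp add: right_diff_distrib)
  also have "\<dots> \<in> PK (Suc s)"
    using pr_Pre[of gf gs GG _ K 1, OF _ coact_phi[OF w(3)]] w
    by (intro minus_one_power_in[OF PK]) (auto simp del: Pre.simps)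
  finally show ?thesis .
qed

lemma keys_diff_word:
  assumes "(gs, x) \<in> words s"
  shows "Poly_Mapping.keys (cobar_diff_word H M (gs, x)) \<subseteq> words (Suc s)"
proof -
  have w: "length gs = s" "set gs \<subseteq> carrier (total H)" "x \<in> carrier M" using wordD[OF assms] by auto
  have in1: "c \<in> carrier (free_Abelian_group (words (Suc s))) \<Longrightarrow> d \<in> carrier (free_Abelian_group (words (Suc s))) \<Longrightarrow> c + d \<in> carrier (free_Abelian_group (words (Suc s)))" for c d
    using keys_add[of c d] by auto
  have "Poly_Mapping.keys (frag_of (\<one>\<^bsub>total H\<^esub> # gs, x)) \<subseteq> words (Suc s)"
    using w one_closed by (auto simp: keys_frag_of intro!: wordI)
  moreover have "Poly_Mapping.keys (\<Sum>j<length gs. frag_cmul ((-1) ^ (j + 1))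
        (frag_extend (\<lambda>(hs, h). frag_of (take j gs @ hs @ [h] @ drop (Suc j) gs, x)) (rep (comult H (gs ! j))))) \<subseteq> words (Suc s)"
  proof (rule order_trans[OF keys_sum], rule UN_least)
    fix j assume j: "j \<in> {..<length gs}"
    have g: "gs ! j \<in> carrier (total H)" using j w by auto
    have "Poly_Mapping.keys (frag_extend (\<lambda>(hs, h). frag_of (take j gs @ hs @ [h] @ drop (Suc j) gs, x)) (rep (comult H (gs ! j)))) \<subseteq> words (Suc s)"
    proof (rule order_trans[OF keys_frag_extend], rule UN_least)
      fix q assume q: "q \<in> Poly_Mapping.keys (rep (comult H (gs ! j)))"
      obtain hs h where q': "q = (hs, h)" by (cases q)
      have "length hs = 1" "set hs \<subseteq> carrier (total H)" "h \<in> carrier (total H)" using comult_word[OF g] q q' by blast+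
      moreover from this have "set (take j gs @ hs @ [h] @ drop (Suc j) gs) \<subseteq> carrier (total H)"
        using w(2) set_take_subset[of j gs] set_drop_subset[of "Suc j" gs] unfolding set_append by auto
      ultimately have "(take j gs @ hs @ [h] @ drop (Suc j) gs, x) \<in> words (Suc s)"
        using w j by (intro wordI) auto
      then show "Poly_Mapping.keys (case q of (hs, h) \<Rightarrow> frag_of (take j gs @ hs @ [h] @ drop (Suc j) gs, x)) \<subseteq> words (Suc s)"
        by (simp add: q' keys_frag_of)
    qed
    then show "Poly_Mapping.keys (frag_cmul ((-1) ^ (j + 1)) (frag_extend (\<lambda>(hs, h). frag_of (take j gs @ hs @ [h] @ drop (Suc j) gs, x)) (rep (comult H (gs ! j))))) \<subseteq> words (Suc s)"
      using keys_cmul by fast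
  qed
  moreover have "Poly_Mapping.keys (frag_cmul ((-1) ^ (length gs + 1)) (frag_extend (\<lambda>(hs, y). frag_of (gs @ hs, y)) (rep (coact M x)))) \<subseteq> words (Suc s)"
  proof -
    have "Poly_Mapping.keys (frag_extend (\<lambda>(hs, y). frag_of (gs @ hs, y)) (rep (coact M x))) \<subseteq> words (Suc s)"
    proof (rule order_trans[OF keys_frag_extend], rule UN_least)
      fix q assume q: "q \<in> Poly_Mapping.keys (rep (coact M x))"
      obtain hs y where q': "q = (hs, y)" by (cases q)
      have "length hs = 1" "set hs \<subseteq> carrier (total H)" "y \<in> carrier M" using coact_keys[OF w(3)] q q' wordD by blast+
      then show "Poly_Mapping.keys (case q of (hs, y) \<Rightarrow> frag_of (gs @ hs, y)) \<subseteq> words (Suc s)"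
        using w by (auto simp: q' keys_frag_of intro!: wordI)
    qed
    then show ?thesis using keys_cmul by fast
  qed
  ultimately show ?thesis
    unfolding cobar_diff_word_def prod.case carrier_free_Abelian_group_iff[symmetric]
    by (intro in1)
qed

abbreviation "DW \<equiv> frag_extend (cobar_diff_word H M)"

lemma keys_DW: "Poly_Mapping.keys c \<subseteq> words s \<Longrightarrow> Poly_Mapping.keys (DW c) \<subseteq> words (Suc s)"
proof (rule order_trans[OF keys_frag_extend], rule UN_least)
  fix w assume "Poly_Mapping.keys c \<subseteq> words s" "w \<in> Poly_Mapping.keys c"
  then show "Poly_Mapping.keys (cobar_diff_word H M w) \<subseteq> words (Suc s)"
    using keys_diff_word[of "fst w" "snd w" s] by auto
qed

lemma phi_DW:
  assumes "Poly_Mapping.keys c \<subseteq> words s"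
  shows "\<phi> (DW c) - delta s (\<phi> c) \<in> PK (Suc s)"
  using assms
proof (induction c rule: frag_induction)
  case zero
  then show ?case using addsub_0[OF PK] by (simp add: phi_def del: Pre.simps)
next
  case (one w)
  then show ?case using phi_diff_word[of "fst w" "snd w"] by (simp add: phi_def del: Pre.simps)
next
  case (diff a b)
  have eq: "\<phi> (DW (a - b)) - delta s (\<phi> (a - b)) = (\<phi> (DW a) - delta s (\<phi> a)) - (\<phi> (DW b) - delta s (\<phi> b))"
    by (simp add: phi_def frag_extend_diff flin_diff delta_diff)
  show ?case unfolding eq by (rule addsub_diff[OF PK diff])
qed

text \<open>All formal sums with function f up to \<open>K\<close>. Given as a set, the class
  depends on f alone and no representative has to be chosen; for f in \<open>PI s\<close> it is a
  coset of the null sums.\<close>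

definition cls :: "nat \<Rightarrow> chainfun \<Rightarrow> ('g list \<times> 'm \<Rightarrow>\<^sub>0 int) set" where
  "cls s f = {c. Poly_Mapping.keys c \<subseteq> words s \<and> \<phi> c - f \<in> PK s}"

lemma cls_eq:
  assumes "Poly_Mapping.keys c \<subseteq> words s" "\<phi> c - f \<in> PK s"
  shows "cls s f = Q.N s #>\<^bsub>Q.F s\<^esub> c"
proof -
  have "d \<in> cls s f \<longleftrightarrow> (\<exists>n\<in>Q.N s. d = n + c)" for d
  proof
    assume d: "d \<in> cls s f"
    have "d - c \<in> Q.N s"
    proof (rule null_if_phi)
      show "Poly_Mapping.keys (d - c) \<subseteq> words s" using d assms keys_diff[of d c] by (auto simp: cls_def)
      have "\<phi> (d - c) = (\<phi> d - f) - (\<phi> c - f)" by (simp add: phi_def flin_diff)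
      then show "\<phi> (d - c) \<in> PK s" using addsub_diff[OF PK, of "\<phi> d - f" s "\<phi> c - f"] d assms by (simp add: cls_def del: Pre.simps)
    qed
    then show "\<exists>n\<in>Q.N s. d = n + c" by (intro bexI[of _ "d - c"]) auto
  next
    assume "\<exists>n\<in>Q.N s. d = n + c"
    then obtain n where n: "n \<in> Q.N s" "d = n + c" by blast
    have eq: "\<phi> d - f = \<phi> n + (\<phi> c - f)" by (simp add: n phi_def flin_add)
    have "\<phi> d - f \<in> PK s" unfolding eq by (rule addsub_add[OF PK phi_null[OF n(1)] assms(2)])
    then show "d \<in> cls s f"
      using n Q.N_carrier[OF n(1)] keys_add[of n c] assms by (auto simp: cls_def simp del: Pre.simps)
  qed
  then show ?thesis by (auto simp: Q.class_explicit)
qed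

lemma cls_exists:
  assumes "f \<in> PI s"
  obtains c where "Poly_Mapping.keys c \<subseteq> words s" "\<phi> c - f \<in> PK s" "cls s f = Q.N s #>\<^bsub>Q.F s\<^esub> c"
  using phi_surj[OF assms] cls_eq by blast

lemma cls_carrier: "f \<in> PI s \<Longrightarrow> cls s f \<in> carrier (cobar_tensor H M s)"
  by (rule cls_exists) (auto simp: tensor_eq Q.carrier_quot)

lemma carrier_cls:
  assumes "X \<in> carrier (cobar_tensor H M s)"
  shows "\<phi> (rep X) \<in> PI s \<and> X = cls s (\<phi> (rep X))"
proof -
  have X: "Poly_Mapping.keys (rep X) \<subseteq> words s" "Q.N s #>\<^bsub>Q.F s\<^esub> rep X = X"
    using assms Q.keys_rep Q.class_rep by (auto simp: tensor_eq)
  show ?thesis using phi_Img[OF X(1)] cls_eq[OF X(1), of "\<phi> (rep X)"] addsub_0[OF PK] X(2) by (simp del: Pre.simps)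
qed

lemma cls_mult:
  assumes "f \<in> PI s" "g \<in> PI s"
  shows "cls s f \<otimes>\<^bsub>cobar_tensor H M s\<^esub> cls s g = cls s (f + g)"
proof -
  obtain c where c: "Poly_Mapping.keys c \<subseteq> words s" "\<phi> c - f \<in> PK s" "cls s f = Q.N s #>\<^bsub>Q.F s\<^esub> c" using cls_exists[OF assms(1)] .
  obtain d where d: "Poly_Mapping.keys d \<subseteq> words s" "\<phi> d - g \<in> PK s" "cls s g = Q.N s #>\<^bsub>Q.F s\<^esub> d" using cls_exists[OF assms(2)] .
  have eq: "\<phi> (c + d) - (f + g) = (\<phi> c - f) + (\<phi> d - g)" by (simp add: phi_def flin_add)
  have "cls s (f + g) = Q.N s #>\<^bsub>Q.F s\<^esub> (c + d)"
  proof (rule cls_eq)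
    show "Poly_Mapping.keys (c + d) \<subseteq> words s" using c d keys_add[of c d] by auto
    show "\<phi> (c + d) - (f + g) \<in> PK s" unfolding eq by (rule addsub_add[OF PK c(2) d(2)])
  qed
  then show ?thesis using Q.mult_quot[OF c(1) d(1)] by (simp add: tensor_eq c d)
qed

lemma cls_eq_iff:
  assumes "f \<in> PI s" "g \<in> PI s"
  shows "cls s f = cls s g \<longleftrightarrow> f - g \<in> PK s"
proof -
  obtain c where c: "Poly_Mapping.keys c \<subseteq> words s" "\<phi> c - f \<in> PK s" "cls s f = Q.N s #>\<^bsub>Q.F s\<^esub> c" using cls_exists[OF assms(1)] .
  obtain d where d: "Poly_Mapping.keys d \<subseteq> words s" "\<phi> d - g \<in> PK s" "cls s g = Q.N s #>\<^bsub>Q.F s\<^esub> d" using cls_exists[OF assms(2)] .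
  have k: "Poly_Mapping.keys (c - d) \<subseteq> words s" using c d keys_diff[of c d] by auto
  have e1: "\<phi> (c - d) = (\<phi> c - f) - (\<phi> d - g) + (f - g)" and e2: "f - g = \<phi> (c - d) - ((\<phi> c - f) - (\<phi> d - g))"
    by (simp_all add: phi_def flin_diff)
  have "cls s f = cls s g \<longleftrightarrow> \<phi> (c - d) \<in> PK s"
    unfolding c(3) d(3) Q.class_eq_iff null_iff[OF k] ..
  also have "\<dots> \<longleftrightarrow> f - g \<in> PK s"
    using addsub_add[OF PK addsub_diff[OF PK c(2) d(2)]] addsub_diff[OF PK _ addsub_diff[OF PK c(2) d(2)]] e1 e2 by metis
  finally show ?thesis .
qed

lemma one_eq_cls: "\<one>\<^bsub>cobar_tensor H M s\<^esub> = cls s 0"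
  using cls_eq[of 0 s 0] addsub_0[OF PK] by (simp add: tensor_eq Q.one_quot Q.class_0 phi_def del: Pre.simps)

lemma cls_eq_one: "f \<in> PI s \<Longrightarrow> cls s f = \<one>\<^bsub>cobar_tensor H M s\<^esub> \<longleftrightarrow> f \<in> PK s"
  using cls_eq_iff[of f s 0] addsub_0[OF PI] by (simp add: one_eq_cls del: Pre.simps)

lemma diff_cls:
  assumes "f \<in> PI s"
  shows "cobar_diff H M s (cls s f) = cls (Suc s) (delta s f)"
proof -
  obtain c where c: "Poly_Mapping.keys c \<subseteq> words s" "\<phi> c - f \<in> PK s" "cls s f = Q.N s #>\<^bsub>Q.F s\<^esub> c" using cls_exists[OF assms] .
  let ?r = "rep (cls s f)"
  have r: "Poly_Mapping.keys ?r \<subseteq> words s" unfolding c(3) by (rule Q.rep_class_carrier[OF c(1)])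
  have eq: "\<phi> ?r - f = \<phi> (?r - c) + (\<phi> c - f)" by (simp add: phi_def flin_diff)
  have rf: "\<phi> ?r - f \<in> PK s" unfolding eq
    by (rule addsub_add[OF PK phi_null c(2)]) (unfold c(3), rule Q.rep_class)
  have "\<phi> (DW ?r) - delta s f = (\<phi> (DW ?r) - delta s (\<phi> ?r)) + delta s (\<phi> ?r - f)" by (simp add: delta_diff)
  also have "\<dots> \<in> PK (Suc s)" by (rule addsub_add[OF PK phi_DW[OF r] delta_PK[OF rf]])
  finally have "cls (Suc s) (delta s f) = Q.N (Suc s) #>\<^bsub>Q.F (Suc s)\<^esub> DW ?r"
    by (rule cls_eq[OF keys_DW[OF r]])
  then show ?thesis by (simp add: cobar_diff_def class_eq)
qed

lemma delta_PI: "f \<in> PI s \<Longrightarrow> delta s f \<in> PI (Suc s)"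
proof -
  assume "f \<in> PI s"
  then obtain c where c: "Poly_Mapping.keys c \<subseteq> words s" "\<phi> c - f \<in> PK s" using cls_exists by blast
  have eq: "delta s f = \<phi> (DW c) - (\<phi> (DW c) - delta s (\<phi> c)) - delta s (\<phi> c - f)" by (simp add: delta_diff)
  show ?thesis unfolding eq
    by (intro addsub_diff[OF PI] phi_Img keys_DW c subsetD[OF PK_PI phi_DW[OF c(1)]] subsetD[OF PK_PI delta_PK[OF c(2)]])
qed

text \<open>Cocycles are required modulo \<open>PK\<close>, while \<open>Bc\<close> consists of
  actual differentials; the ambiguity coming from \<open>K\<close> is added back in
  \<open>eps_eq_iff\<close>.\<close>

definition Zc :: "nat \<Rightarrow> chainfun set" where
  "Zc s = {f \<in> PI s. delta s f \<in> PK (Suc s)}"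

definition Bc :: "nat \<Rightarrow> chainfun set" where
  "Bc s = (case s of 0 \<Rightarrow> {0} | Suc r \<Rightarrow> delta r ` PI r)"

lemma cocycles_eq: "cobar_cocycles H M s = cls s ` Zc s"
proof -
  have "X \<in> cobar_cocycles H M s \<longleftrightarrow> X \<in> cls s ` Zc s" for X
  proof
    assume "X \<in> cobar_cocycles H M s"
    then have X: "X \<in> carrier (cobar_tensor H M s)" "cobar_diff H M s X = \<one>\<^bsub>cobar_tensor H M (Suc s)\<^esub>"
      by (auto simp: cobar_cocycles_def kernel_def)
    let ?f = "\<phi> (rep X)"
    have f: "?f \<in> PI s" "X = cls s ?f" using carrier_cls[OF X(1)] by auto
    have "delta s ?f \<in> PK (Suc s)"
      using X(2) f(2) diff_cls[OF f(1)] cls_eq_one[OF delta_PI[OF f(1)]] by simp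
    then show "X \<in> cls s ` Zc s" using f by (auto simp: Zc_def simp del: Pre.simps)
  next
    assume "X \<in> cls s ` Zc s"
    then obtain f where f: "f \<in> PI s" "delta s f \<in> PK (Suc s)" "X = cls s f" by (auto simp: Zc_def)
    then show "X \<in> cobar_cocycles H M s"
      using cls_carrier[OF f(1)] diff_cls[OF f(1)] cls_eq_one[OF delta_PI[OF f(1)]]
      by (auto simp: cobar_cocycles_def kernel_def)
  qed
  then show ?thesis by blast
qed

lemma coboundaries_eq: "cobar_coboundaries H M s = cls s ` Bc s"
proof (cases s)
  case 0
  then show ?thesis by (simp add: cobar_coboundaries_def Bc_def one_eq_cls)
next
  case (Suc r)
  have "carrier (cobar_tensor H M r) = cls r ` PI r"
  proof (intro equalityI subsetI)
    fix X assume "X \<in> carrier (cobar_tensor H M r)"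
    from carrier_cls[OF this] show "X \<in> cls r ` PI r" by (intro image_eqI) auto
  qed (use cls_carrier in blast)
  then have "cobar_coboundaries H M s = cobar_diff H M r ` cls r ` PI r"
    by (simp add: cobar_coboundaries_def Suc)
  also have "\<dots> = cls s ` Bc s"
    by (auto simp: image_image Suc Bc_def diff_cls image_iff simp del: Pre.simps)
  finally show ?thesis .
qed

lemma Zc_addsub: "addsub (Zc s)"
  using addsub_0[OF PI] addsub_0[OF PK] addsub_diff[OF PI] addsub_diff[OF PK]
  by (auto simp: Zc_def addsub_def delta_diff simp del: Pre.simps)

lemma Bc_PI: "Bc s \<subseteq> PI s"
  using delta_PI addsub_0[OF PI] by (auto simp: Bc_def simp del: Pre.simps split: nat.splits)

lemma Bc_addsub: "addsub (Bc s)"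
proof (cases s)
  case 0
  then show ?thesis by (simp add: Bc_def addsub_zero)
next
  case (Suc r)
  have "delta r f - delta r g \<in> delta r ` PI r" if "f \<in> PI r" "g \<in> PI r" for f g
    using addsub_diff[OF PI that] delta_diff[of r f g] by (metis image_eqI)
  moreover have "0 \<in> delta r ` PI r" using addsub_0[OF PI, of r] delta_0[of r] by (metis image_eqI)
  ultimately show ?thesis by (auto simp: Bc_def Suc addsub_def simp del: Pre.simps)
qed

definition eps :: "nat \<Rightarrow> chainfun \<Rightarrow> ('g list \<times> 'm \<Rightarrow>\<^sub>0 int) set set" where
  "eps s f = cobar_coboundaries H M s #>\<^bsub>cobar_tensor H M s\<^esub> cls s f"

lemma eps_explicit: "f \<in> PI s \<Longrightarrow> eps s f = (\<lambda>b. cls s (b + f)) ` Bc s"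
  using Bc_PI[of s] by (force simp: eps_def r_coset_def coboundaries_eq cls_mult subset_iff)

lemma eps_eq_iff:
  assumes "f \<in> PI s" "g \<in> PI s"
  shows "eps s f = eps s g \<longleftrightarrow> (\<exists>b\<in>Bc s. f - g - b \<in> PK s)"
proof
  assume eq: "eps s f = eps s g"
  have "cls s (0 + f) \<in> eps s f" unfolding eps_explicit[OF assms(1)] using addsub_0[OF Bc_addsub] by blast
  then obtain b where b: "b \<in> Bc s" "cls s f = cls s (b + g)" unfolding eq eps_explicit[OF assms(2)] by auto
  have "f - (b + g) \<in> PK s"
    using cls_eq_iff[OF assms(1), of "b + g"] b Bc_PI addsub_add[OF PI _ assms(2)] by blast
  then show "\<exists>b\<in>Bc s. f - g - b \<in> PK s" using b(1) by (intro bexI[of _ b]) (simp_all add: algebra_simps)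
next
  assume "\<exists>b\<in>Bc s. f - g - b \<in> PK s"
  then obtain b where b: "b \<in> Bc s" "f - g - b \<in> PK s" by blast
  have bI: "b' \<in> PI s" if "b' \<in> Bc s" for b' using that Bc_PI by blast
  have 1: "cls s (b' + f) = cls s ((b' + b) + g)" if b': "b' \<in> Bc s" for b'
  proof (rule cls_eq_iff[THEN iffD2])
    show "b' + f \<in> PI s" "(b' + b) + g \<in> PI s" using b' b bI assms by (auto intro!: addsub_add[OF PI] simp del: Pre.simps)
    have eq: "b' + f - (b' + b + g) = f - g - b" by simp
    show "b' + f - (b' + b + g) \<in> PK s" unfolding eq by (rule b(2))
  qed
  show "eps s f = eps s g"
    unfolding eps_explicit[OF assms(1)] eps_explicit[OF assms(2)]
  proof (intro equalityI image_subsetI)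
    fix b' assume b': "b' \<in> Bc s"
    show "cls s (b' + f) \<in> (\<lambda>b. cls s (b + g)) ` Bc s"
      unfolding 1[OF b'] using addsub_add[OF Bc_addsub b' b(1)] by blast
    have "cls s (b' + g) = cls s ((b' - b) + f)"
      using 1[OF addsub_diff[OF Bc_addsub b' b(1)]] by simp
    then show "cls s (b' + g) \<in> (\<lambda>b. cls s (b + f)) ` Bc s"
      using addsub_diff[OF Bc_addsub b' b(1)] by blast
  qed
qed

lemma eps_mult:
  assumes f: "f \<in> PI s" and g: "g \<in> PI s"
  shows "eps s f <#>\<^bsub>cobar_tensor H M s\<^esub> eps s g = eps s (f + g)"
proof -
  have bI: "b' \<in> PI s" if "b' \<in> Bc s" for b' using that Bc_PI by blast
  have "eps s f <#>\<^bsub>cobar_tensor H M s\<^esub> eps s g = {cls s ((b + f) + (b' + g)) | b b'. b \<in> Bc s \<and> b' \<in> Bc s}"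
    unfolding eps_explicit[OF f] eps_explicit[OF g] set_mult_def
    using bI f g by (force simp: cls_mult addsub_add[OF PI] simp del: Pre.simps)
  also have "\<dots> = (\<lambda>b. cls s (b + (f + g))) ` Bc s"
  proof (intro equalityI subsetI)
    fix X assume "X \<in> {cls s ((b + f) + (b' + g)) | b b'. b \<in> Bc s \<and> b' \<in> Bc s}"
    then obtain b b' where b: "b \<in> Bc s" "b' \<in> Bc s" "X = cls s ((b + f) + (b' + g))" by blast
    have eq: "(b + f) + (b' + g) = (b + b') + (f + g)" by simp
    show "X \<in> (\<lambda>b. cls s (b + (f + g))) ` Bc s"
      unfolding b(3) eq using addsub_add[OF Bc_addsub b(1,2)] by (rule imageI)
  next
    fix X assume "X \<in> (\<lambda>b. cls s (b + (f + g))) ` Bc s"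
    then obtain b where b: "b \<in> Bc s" "X = cls s (b + (f + g))" by blast
    have eq: "b + (f + g) = (b + f) + (0 + g)" by simp
    show "X \<in> {cls s ((b + f) + (b' + g)) | b b'. b \<in> Bc s \<and> b' \<in> Bc s}"
      unfolding b(2) eq using b(1) addsub_0[OF Bc_addsub] by blast
  qed
  also have "\<dots> = eps s (f + g)" by (rule eps_explicit[symmetric, OF addsub_add[OF PI f g]])
  finally show ?thesis .
qed

lemma carrier_Ext: "carrier (Ext_comod H M s) = eps s ` Zc s"
  by (auto simp: Ext_comod_def carrier_FactGroup cocycles_eq eps_def r_coset_def image_image)

lemma mult_Ext: "X \<otimes>\<^bsub>Ext_comod H M s\<^esub> Y = X <#>\<^bsub>cobar_tensor H M s\<^esub> Y"
  by (simp add: Ext_comod_def FactGroup_def set_mult_def)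

lemma eps_0: "eps s 0 = cobar_coboundaries H M s"
  using eps_explicit[of 0 s] addsub_0[OF PI] by (simp add: coboundaries_eq del: Pre.simps)

lemma one_Ext: "\<one>\<^bsub>Ext_comod H M s\<^esub> = eps s 0"
  by (simp add: Ext_comod_def FactGroup_def eps_0)

theorem eps_hom: "eps s \<in> hom (agrp (Zc s)) (Ext_comod H M s)"
  by (rule homI) (auto simp: carrier_Ext mult_Ext eps_mult Zc_def simp del: Pre.simps)

text \<open>With \<open>eps_hom\<close> and \<open>carrier_Ext\<close> this presents the Ext group
  as \<open>Zc s\<close> modulo the sum of \<open>Bc s\<close> and the part of \<open>PK s\<close>
  that it contains, so that Ext can be computed with functions alone.\<close>

theorem eps_eq_one:
  assumes "f \<in> Zc s"
  shows "eps s f = \<one>\<^bsub>Ext_comod H M s\<^esub> \<longleftrightarrow> (\<exists>b\<in>Bc s. f - b \<in> PK s)"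
  using eps_eq_iff[of f s 0] assms addsub_0[OF PI] by (simp add: one_Ext Zc_def del: Pre.simps)

lemma group_Ext: "group (Ext_comod H M s)"
  by (rule group_if_epi[OF group_agrp[OF Zc_addsub] eps_hom])
    (auto simp: carrier_Ext one_Ext)

end

section \<open>The Hopf algebroid \<open>\<Gamma>(m+1)\<close> as functions on pairs of points\<close>

lemma subring_cring:
  assumes C: "ratring C"
  shows "cring (subring_of_qpoly (polys_over C S))"
proof (rule cringI)
  show "abelian_group (subring_of_qpoly (polys_over C S))"
  proof (rule abelian_groupI)
    fix x assume x: "x \<in> carrier (subring_of_qpoly (polys_over C S))"
    then show "\<exists>y\<in>carrier (subring_of_qpoly (polys_over C S)). y \<oplus>\<^bsub>subring_of_qpoly (polys_over C S)\<^esub> x = \<zero>\<^bsub>subring_of_qpoly (polys_over C S)\<^esub>"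
      by (intro bexI[of _ "- x"]) (auto simp: subring_of_qpoly_def polys_over_uminus[OF C])
  qed (auto simp: subring_of_qpoly_def polys_over_add[OF C] polys_over_0 add.assoc add.commute)
  show "comm_monoid (subring_of_qpoly (polys_over C S))"
    by (rule comm_monoidI) (auto simp: subring_of_qpoly_def polys_over_mult[OF C] polys_over_1[OF C] mult.assoc mult.commute)
qed (auto simp: subring_of_qpoly_def distrib_right)

lemma subring_simps [simp]:
  "carrier (subring_of_qpoly S) = S" "x \<otimes>\<^bsub>subring_of_qpoly S\<^esub> y = x * y" "x \<oplus>\<^bsub>subring_of_qpoly S\<^esub> y = x + y"
  "\<one>\<^bsub>subring_of_qpoly S\<^esub> = 1" "\<zero>\<^bsub>subring_of_qpoly S\<^esub> = 0"
  by (simp_all add: subring_of_qpoly_def)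

lemma polys_over_ev_cong:
  assumes "f \<in> polys_over C S" "\<And>x. x \<in> S \<Longrightarrow> \<rho> x = \<tau> x"
  shows "ev \<rho> f = ev \<tau> f"
  by (rule ev_cong) (use assms in \<open>auto simp: polys_over_def\<close>)

definition low :: "nat \<Rightarrow> (gen \<Rightarrow> rat) \<Rightarrow> gen \<Rightarrow> rat" where
  "low m \<rho> x = (case x of gen.T n \<Rightarrow> if 1 \<le> n \<and> n \<le> m then 0 else \<rho> x | _ \<Rightarrow> \<rho> x)"

locale bp =
  fixes p m :: nat
  assumes prime_p: "Factorial_Ring.prime p" and m_pos: "m > 0"
begin

lemma p0: "p > 0" using prime_p prime_gt_0_nat by blast
lemma Zp: "ratring (Z_local p)" by (rule Z_local_ratring[OF prime_p])

abbreviation "R \<equiv> subring_of_qpoly (BPBP p)"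
abbreviation "J \<equiv> Gamma_ideal p (Suc m)"
abbreviation "prj \<equiv> Gamma_proj p (Suc m)"
abbreviation "H \<equiv> Gamma p (Suc m)"
abbreviation "HA \<equiv> Gamma_algebroid p (Suc m)"

lemma BP_sub_BPBP: "BP p \<subseteq> BPBP p"
  unfolding BP_def BPBP_def by (rule polys_over_mono) auto

lemma t_gen_BPBP: "t_gen n \<in> BPBP p"
  unfolding BPBP_def t_gen_def by (auto intro: polys_over_1[OF Zp] polys_over_qvar[OF Zp])

lemma R_cring: "cring R"
  unfolding BPBP_def by (rule subring_cring[OF Zp])

sublocale R: cring R by (rule R_cring)

lemma J_ideal: "ideal J R"
  unfolding Gamma_ideal_def by (rule R.genideal_ideal) (auto intro: t_gen_BPBP)

sublocale J: ideal J R by (rule J_ideal)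

lemma J_gen: "1 \<le> j \<Longrightarrow> j \<le> m \<Longrightarrow> t_gen j \<in> J"
  using R.genideal_self[of "t_gen ` {1..<Suc m}"] t_gen_BPBP unfolding Gamma_ideal_def by force

lemma J_ev:
  assumes "x \<in> J" shows "ev (low m \<rho>) x = 0"
proof -
  let ?I = "{x \<in> BPBP p. \<forall>\<rho>. ev (low m \<rho>) x = 0}"
  have "subgroup ?I (add_monoid R)"
  proof (rule group.subgroupI[OF R.a_group])
    show "?I \<noteq> {}" using polys_over_0 by (force simp: BPBP_def)
    fix x assume x: "x \<in> ?I"
    have "inv\<^bsub>add_monoid R\<^esub> x = - x"
      by (rule group.inv_equality[OF R.a_group]) (use x polys_over_uminus[OF Zp] in \<open>auto simp: BPBP_def\<close>)
    then show "inv\<^bsub>add_monoid R\<^esub> x \<in> ?I" using x polys_over_uminus[OF Zp] by (auto simp: BPBP_def ev_uminus)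
  next
    fix x y assume "x \<in> ?I" "y \<in> ?I"
    then show "x \<otimes>\<^bsub>add_monoid R\<^esub> y \<in> ?I" using polys_over_add[OF Zp] by (auto simp: BPBP_def ev_add)
  qed auto
  then have "ideal ?I R"
    by (intro idealI[OF R.ring_axioms]) (auto simp: ev_mult BPBP_def polys_over_mult[OF Zp])
  moreover have "t_gen ` {1..<Suc m} \<subseteq> ?I"
    by (auto simp: t_gen_BPBP ev_t_gen low_def)
  ultimately have "J \<subseteq> ?I" unfolding Gamma_ideal_def by (rule R.genideal_minimal)
  then show ?thesis using assms by auto
qed

lemma J_BPBP: "x \<in> J \<Longrightarrow> x \<in> BPBP p"
  using J.Icarr by simp

lemma J_add: "x \<in> J \<Longrightarrow> y \<in> J \<Longrightarrow> x + y \<in> J"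
  using J.a_closed by simp

lemma J_sum: "(\<And>i. i \<in> I \<Longrightarrow> f i \<in> J) \<Longrightarrow> sum f I \<in> J"
  by (induction I rule: infinite_finite_induct) (use J.zero_closed J_add in auto)

text \<open>Split x into the monomials that contain one of t_1, ..., t_m, each of which is in the
  ideal, and the rest \<open>x0\<close>. Setting these variables to zero does not change
  \<open>x0\<close>, so \<open>x0\<close> vanishes at every point and is 0.\<close>

lemma in_J_if_ev:
  assumes x: "x \<in> BPBP p" and ev0: "\<And>\<rho>. ev (low m \<rho>) x = 0"
  shows "x \<in> J"
proof -
  let ?low = "\<lambda>e. \<exists>j. 1 \<le> j \<and> j \<le> m \<and> gen.T j \<in> Poly_Mapping.keys e"
  let ?s = "\<lambda>e. Poly_Mapping.single e (Poly_Mapping.lookup x e)"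
  define x0 where "x0 = (\<Sum>e\<in>{e\<in>Poly_Mapping.keys x. \<not> ?low e}. ?s e)"
  define x1 where "x1 = (\<Sum>e\<in>{e\<in>Poly_Mapping.keys x. ?low e}. ?s e)"
  have x01: "x = x0 + x1"
  proof -
    have "x = (\<Sum>e\<in>{e\<in>Poly_Mapping.keys x. \<not> ?low e} \<union> {e\<in>Poly_Mapping.keys x. ?low e}. ?s e)"
      by (subst poly_mapping_sum_single) (rule sum.cong, auto)
    also have "\<dots> = x0 + x1" unfolding x0_def x1_def by (rule sum.union_disjoint) auto
    finally show ?thesis .
  qed
  have x1J: "x1 \<in> J" unfolding x1_def
  proof (rule J_sum)
    fix e assume "e \<in> {e\<in>Poly_Mapping.keys x. ?low e}"
    then obtain j where j: "1 \<le> j" "j \<le> m" "gen.T j \<in> Poly_Mapping.keys e" and e: "e \<in> Poly_Mapping.keys x" by auto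
    define e' where "e' = e - Poly_Mapping.single (gen.T j) 1"
    have ee: "e = Poly_Mapping.single (gen.T j) 1 + e'"
      using j(3) by (intro poly_mapping_eqI) (auto simp: e'_def lookup_add lookup_minus lookup_single in_keys_iff when_def)
    have k: "Poly_Mapping.keys e' \<subseteq> Poly_Mapping.keys e"
      by (auto simp: e'_def in_keys_iff lookup_minus)
    have "?s e = t_gen j * Poly_Mapping.single e' (Poly_Mapping.lookup x e)"
      using j(1) by (simp add: t_gen_def qvar_def mult_single) (metis One_nat_def ee)
    moreover have "Poly_Mapping.single e' (Poly_Mapping.lookup x e) \<in> BPBP p"
      unfolding BPBP_def by (rule polys_over_single) (use x e k in \<open>auto simp: BPBP_def polys_over_def\<close>)
    ultimately show "?s e \<in> J"
      using J.I_r_closed[OF J_gen[OF j(1,2)]] by simp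
  qed
  have "ev \<rho> x0 = 0" for \<rho>
  proof -
    have "ev \<rho> x0 = ev (low m \<rho>) x0"
      unfolding x0_def ev_sum ev_single
    proof (intro sum.cong refl arg_cong2[where f = "(*)"] mon_cong)
      fix e y assume "e \<in> {e\<in>Poly_Mapping.keys x. \<not> ?low e}" "y \<in> Poly_Mapping.keys e"
      then show "\<rho> y = low m \<rho> y" by (cases y) (auto simp: low_def)
    qed
    also have "\<dots> = ev (low m \<rho>) x - ev (low m \<rho>) x1" by (simp add: x01 ev_add)
    finally show ?thesis by (simp add: ev0 J_ev[OF x1J])
  qed
  then have "x0 = 0" by (rule ev_eq_0)
  then show ?thesis using x01 x1J by simp
qed

lemma prj_explicit: "prj x = {i + x | i. i \<in> J}"
  by (auto simp: Gamma_proj_def a_r_coset_def')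

lemma prj_self: "x \<in> prj x"
  unfolding prj_explicit using J.zero_closed by (intro CollectI exI[of _ 0]) auto

lemma rep_prj: "rep (prj x) - x \<in> J"
proof -
  have "rep (prj x) \<in> prj x" unfolding rep_def by (rule someI[of "\<lambda>z. z \<in> prj x", OF prj_self])
  then show ?thesis by (auto simp: prj_explicit)
qed

lemma J_uminus: "x \<in> J \<Longrightarrow> - x \<in> J"
proof -
  assume x: "x \<in> J"
  have "- 1 \<in> BPBP p" unfolding BPBP_def by (intro polys_over_uminus[OF Zp] polys_over_1[OF Zp])
  from J.I_r_closed[OF x, of "- 1"] this show ?thesis by simp
qed

lemma J_diff: "x \<in> J \<Longrightarrow> y \<in> J \<Longrightarrow> x - y \<in> J"
  using J_add[OF _ J_uminus] by fastforce

lemma prj_eq_iff: "prj x = prj y \<longleftrightarrow> x - y \<in> J"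
proof
  assume eq: "prj x = prj y"
  have "x \<in> prj y" unfolding eq[symmetric] by (rule prj_self)
  then show "x - y \<in> J" by (auto simp: prj_explicit)
next
  assume *: "x - y \<in> J"
  have "i + x \<in> prj y" if "i \<in> J" for i
  proof -
    have "i + x = (i + (x - y)) + y" by simp
    then show ?thesis unfolding prj_explicit using J_add[OF that *] by blast
  qed
  moreover have "i + y \<in> prj x" if "i \<in> J" for i
  proof -
    have "i + y = (i - (x - y)) + x" by simp
    then show ?thesis unfolding prj_explicit using J_diff[OF that *] by blast
  qed
  ultimately show "prj x = prj y" by (auto simp: prj_explicit)
qed

lemma rep_prj_BPBP: "x \<in> BPBP p \<Longrightarrow> rep (prj x) \<in> BPBP p"
  using polys_over_add[OF Zp, of "rep (prj x) - x" _ x] J_BPBP[OF rep_prj[of x]] by (auto simp: BPBP_def)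

lemma total_H: "total H = R Quot J" "total HA = R Quot J"
  by (simp_all add: Gamma_def Gamma_algebroid_def algebroid.defs hopf_algebroid.defs)

lemma base_H: "base H = subring_of_qpoly (BP p)" "base HA = subring_of_qpoly (BP p)"
  by (simp_all add: Gamma_def Gamma_algebroid_def algebroid.defs hopf_algebroid.defs)

lemma lunit_H: "lunit H = prj" "lunit HA = prj"
  by (simp_all add: Gamma_def Gamma_algebroid_def algebroid.defs hopf_algebroid.defs)

lemma runit_H: "runit H = (\<lambda>a. prj (eta_R p a))" "runit HA = (\<lambda>a. prj (eta_R p a))"
  by (simp_all add: Gamma_def Gamma_algebroid_def algebroid.defs hopf_algebroid.defs)

lemma carrier_total: "X \<in> carrier (total H) \<longleftrightarrow> (\<exists>x\<in>BPBP p. X = prj x)"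
  by (auto simp: total_H FactRing_def A_RCOSETS_def' Gamma_proj_def)

lemma prj_carrier: "x \<in> BPBP p \<Longrightarrow> prj x \<in> carrier (total H)"
  by (auto simp: carrier_total)

lemma rep_carrier: "X \<in> carrier (total H) \<Longrightarrow> rep X \<in> BPBP p \<and> prj (rep X) = X"
  using rep_prj_BPBP prj_eq_iff[THEN iffD2, OF rep_prj] unfolding carrier_total by blast

lemma total_add: "x \<in> BPBP p \<Longrightarrow> y \<in> BPBP p \<Longrightarrow> prj x \<oplus>\<^bsub>total H\<^esub> prj y = prj (x + y)"
  using J.a_rcos_sum[of x y] by (simp add: total_H FactRing_def Gamma_proj_def)

lemma total_mult: "x \<in> BPBP p \<Longrightarrow> y \<in> BPBP p \<Longrightarrow> prj x \<otimes>\<^bsub>total H\<^esub> prj y = prj (x * y)"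
  using J.rcoset_mult_add[of x y] by (simp add: total_H FactRing_def Gamma_proj_def)

lemma total_one: "\<one>\<^bsub>total H\<^esub> = prj 1"
  by (simp add: total_H FactRing_def Gamma_proj_def)

lemma total_zero: "\<zero>\<^bsub>total H\<^esub> = prj 0"
proof -
  have "prj 0 = J" by (auto simp: prj_explicit)
  then show ?thesis by (simp add: total_H FactRing_def)
qed

lemma BPBP_add: "x \<in> BPBP p \<Longrightarrow> y \<in> BPBP p \<Longrightarrow> x + y \<in> BPBP p"
  unfolding BPBP_def by (rule polys_over_add[OF Zp])
lemma BPBP_mult: "x \<in> BPBP p \<Longrightarrow> y \<in> BPBP p \<Longrightarrow> x * y \<in> BPBP p"
  unfolding BPBP_def by (rule polys_over_mult[OF Zp])
lemma BPBP_1: "1 \<in> BPBP p"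
  unfolding BPBP_def by (rule polys_over_1[OF Zp])
lemma BPBP_0: "0 \<in> BPBP p"
  unfolding BPBP_def by (rule polys_over_0)

definition penv :: "(nat \<Rightarrow> rat) \<Rightarrow> (nat \<Rightarrow> rat) \<Rightarrow> (nat \<Rightarrow> rat) \<Rightarrow> gen \<Rightarrow> rat" where
  "penv a y w = venv (pt p m a y) (tseq p (pt p m a y) (pt p m a w)) (\<lambda>_. 0)"

text \<open>Value at the pair (Y 0, Y 1), with t the morphism between the points. As t_1, ..., t_m
  vanish there, the choice of the representative does not matter (\<open>gf_prj\<close>).\<close>

definition gf :: "qpoly set \<Rightarrow> chainfun" where
  "gf X a Y = ev (penv a (Y 0) (Y 1)) (rep X)"

definition pv :: "qpoly \<Rightarrow> chainfun" where
  "pv f a Y = ev (venv (pt p m a (Y 0)) (\<lambda>_. 0) (\<lambda>_. 0)) f"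

lemma low_penv: "low m (penv a y w) = penv a y w"
  by (auto simp: fun_eq_iff low_def penv_def tseq_low[OF p0] split: gen.splits)

lemma gf_prj: "gf (prj x) a Y = ev (penv a (Y 0) (Y 1)) x"
  using J_ev[OF rep_prj[of x], of "penv a (Y 0) (Y 1)"] by (simp add: gf_def low_penv ev_diff)

text \<open>On the variables of BP_*(BP), every assignment with t_1 = ... = t_m = 0 comes from a
  pair of points: the source is v in its coordinates, the target is supplied by
  \<open>exists_right_point\<close>. Hence functions on pairs separate the elements of
  \<Gamma>(m+1), see \<open>prj_eq_if_ev\<close>.\<close>

lemma exists_penv:
  assumes x: "x \<in> BPBP p"
  shows "\<exists>a y w. ev (low m \<rho>) x = ev (penv a y w) x"
proof -
  define t where "t n = (if n = 0 then 1 else low m \<rho> (gen.T n))" for n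
  obtain w where w: "tseq p (pt p m (v_at \<rho>) (lam p m (v_at \<rho>))) (pt p m (v_at \<rho>) w) = t"
    using exists_right_point[OF p0, of t m "v_at \<rho>"] by (auto simp: t_def low_def)
  have "ev (low m \<rho>) x = ev (penv (v_at \<rho>) (lam p m (v_at \<rho>)) w) x"
  proof (rule polys_over_ev_cong)
    show "x \<in> polys_over (Z_local p) (V ` {1..} \<union> gen.T ` {1..})" using x by (simp add: BPBP_def)
    fix z assume "z \<in> V ` {1..} \<union> gen.T ` {1..}"
    then show "low m \<rho> z = penv (v_at \<rho>) (lam p m (v_at \<rho>)) w z"
      by (auto simp: penv_def w pt_lam[OF p0]) (auto simp: low_def t_def)
  qed
  then show ?thesis by blast
qed

lemma prj_eq_if_ev:
  assumes "x \<in> BPBP p" "y \<in> BPBP p" "\<And>a u w. ev (penv a u w) x = ev (penv a u w) y"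
  shows "prj x = prj y"
proof -
  have xy: "x - y \<in> BPBP p" using assms polys_over_diff[OF Zp] by (simp add: BPBP_def)
  have "x - y \<in> J"
  proof (rule in_J_if_ev[OF xy])
    fix \<rho>
    show "ev (low m \<rho>) (x - y) = 0" using exists_penv[OF xy, of \<rho>] assms(3) by (auto simp: ev_diff)
  qed
  then show ?thesis by (simp add: prj_eq_iff)
qed

lemma gf_eqD:
  assumes "X \<in> carrier (total H)" "X' \<in> carrier (total H)" "gf X = gf X'"
  shows "X = X'"
proof -
  obtain x x' where x: "x \<in> BPBP p" "X = prj x" "x' \<in> BPBP p" "X' = prj x'" using assms by (auto simp: carrier_total)
  have "ev (penv a u w) x = ev (penv a u w) x'" for a u w
    using fun_cong[OF fun_cong[OF assms(3), of a], of "\<lambda>i. if i = 0 then u else w"] by (simp add: x gf_prj)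
  from prj_eq_if_ev[OF x(1,3) this] show ?thesis by (simp only: x(2,4))
qed

lemma eta_R_mult: "eta_R p (f * g) = eta_R p f * eta_R p g"
  by (rule ev_eqI) (simp add: eta_R_def ev_qsubst ev_mult)
lemma eta_R_1: "eta_R p 1 = 1"
  by (rule ev_eqI) (simp add: eta_R_def ev_qsubst)
lemma eta_R_qconst: "eta_R p (qconst c) = qconst c"
  by (rule ev_eqI) (simp add: eta_R_def ev_qsubst)
lemma eta_R_V: "eta_R p (qvar (V n)) = eta_R_v p n"
  by (rule ev_eqI) (simp add: eta_R_def ev_qsubst)

lemma eta_R_BPBP:
  assumes "b \<in> BP p" shows "eta_R p b \<in> BPBP p"
  unfolding BPBP_def
proof (rule polys_over_if_zpoly[OF Zp])
  have *: "(\<lambda>\<rho>. ev \<rho> (eta_R_v p n)) \<in> zpoly (Z_local p) ((\<lambda>x \<rho>. \<rho> x) ` (V ` {1..} \<union> gen.T ` {1..}))" if "n \<ge> 1" for n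
    by (rule zpoly_ev[OF Zp eta_R_v_integral[OF prime_p that, unfolded BPBP_def]]) (auto intro: zpoly.gen)
  show "(\<lambda>\<rho>. ev \<rho> (eta_R p b)) \<in> zpoly (Z_local p) ((\<lambda>x \<rho>. \<rho> x) ` (V ` {1..} \<union> gen.T ` {1..}))"
    unfolding eta_R_def ev_qsubst
    by (rule zpoly_ev[OF Zp assms[unfolded BP_def]]) (use * in auto)
qed

lemma BP_BPBP: "b \<in> BP p \<Longrightarrow> b \<in> BPBP p"
  using BP_sub_BPBP by blast

lemma ev_penv_eta_R:
  assumes "b \<in> BP p"
  shows "ev (penv a y w) (eta_R p b) = ev (venv (pt p m a w) t u) b"
proof -
  have "ev (penv a y w) (eta_R p b) = ev (venv (act p (v_at (penv a y w)) (t_at (penv a y w))) t u) b"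
    by (rule ev_eta_R[OF assms[unfolded BP_def]])
  also have "t_at (penv a y w) = tseq p (pt p m a y) (pt p m a w)" by (auto simp: penv_def fun_eq_iff)
  also have "v_at (penv a y w) = pt p m a y" by (auto simp: penv_def fun_eq_iff)
  also have "ev (venv (act p (pt p m a y) (tseq p (pt p m a y) (pt p m a w))) t u) b = ev (venv (pt p m a w) t u) b"
    by (rule polys_over_ev_cong[OF assms[unfolded BP_def]]) (auto simp: act_tseq[OF p0])
  finally show ?thesis .
qed

lemma gf_lunit': "b \<in> BP p \<Longrightarrow> gf (prj b) = pv b"
  unfolding fun_eq_iff gf_prj pv_def penv_def BP_def
  by (intro allI polys_over_ev_cong) auto

lemma gf_runit': "b \<in> BP p \<Longrightarrow> gf (prj (eta_R p b)) = Sh (pv b)"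
  unfolding fun_eq_iff gf_prj pv_def Sh_def by (auto intro!: ev_penv_eta_R)

section \<open>\<Gamma>(m+1) as a free right module on the monomials in t_(m+1), t_(m+2), ..\<close>

definition tmon :: "(nat \<Rightarrow>\<^sub>0 nat) \<Rightarrow> qpoly" where
  "tmon e = (\<Prod>n\<in>Poly_Mapping.keys e. t_gen (Suc m + n) ^ Poly_Mapping.lookup e n)"

definition bas :: "(nat \<Rightarrow>\<^sub>0 nat) \<Rightarrow> qpoly set" where
  "bas e = prj (tmon e)"

lemma ev_tmon: "ev \<rho> (tmon e) = mon (\<lambda>n. \<rho> (gen.T (Suc m + n))) e"
  by (simp add: tmon_def ev_prod ev_power ev_t_gen mon_def)

lemma tmon_add: "tmon (e + e') = tmon e * tmon e'"
  by (rule ev_eqI) (simp add: ev_tmon ev_mult mon_add)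

lemma tmon_0: "tmon 0 = 1" by (simp add: tmon_def)

lemma BPBP_power: "x \<in> BPBP p \<Longrightarrow> x ^ n \<in> BPBP p"
  unfolding BPBP_def by (rule polys_over_power[OF Zp])

lemma BPBP_prod: "(\<And>i. i \<in> I \<Longrightarrow> f i \<in> BPBP p) \<Longrightarrow> prod f I \<in> BPBP p"
  by (induction I rule: infinite_finite_induct) (auto intro: BPBP_1 BPBP_mult)

lemma tmon_BPBP: "tmon e \<in> BPBP p"
  unfolding tmon_def by (intro BPBP_prod BPBP_power t_gen_BPBP)

text \<open>Span of the monomials over the right unit. It is generated additively only; closure
  under products, which makes it receive polynomial expressions, is \<open>W_mult\<close>.\<close>

inductive_set W :: "qpoly set" where
  gen: "b \<in> BP p \<Longrightarrow> tmon e * eta_R p b \<in> W"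
| add: "x \<in> W \<Longrightarrow> y \<in> W \<Longrightarrow> x + y \<in> W"

lemma W_BPBP: "x \<in> W \<Longrightarrow> x \<in> BPBP p"
  by (induction rule: W.induct) (auto intro: BPBP_mult BPBP_add tmon_BPBP eta_R_BPBP)

lemma W_mult: "x \<in> W \<Longrightarrow> y \<in> W \<Longrightarrow> x * y \<in> W"
proof (induction rule: W.induct)
  case (gen b e)
  from gen(2) show ?case
  proof (induction rule: W.induct)
    case (gen b' e')
    have eq: "tmon e * eta_R p b * (tmon e' * eta_R p b') = tmon (e + e') * eta_R p (b * b')"
      by (simp add: tmon_add eta_R_mult)
    show ?case unfolding eq
      by (rule W.gen) (use gen \<open>b \<in> BP p\<close> polys_over_mult[OF Zp] in \<open>auto simp: BP_def\<close>)
  qed (auto simp: distrib_left intro: W.add)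
qed (auto simp: distrib_right intro: W.add)

lemma W_t: "n > m \<Longrightarrow> t_gen n \<in> W"
proof -
  assume "n > m"
  then obtain k where k: "n = Suc m + k" by (metis less_iff_Suc_add add_Suc)
  have "tmon (Poly_Mapping.single k 1) * eta_R p 1 = t_gen n"
    by (rule ev_eqI) (simp add: ev_tmon ev_mult eta_R_1 ev_t_gen k)
  moreover have "1 \<in> BP p" by (simp add: BP_def polys_over_1[OF Zp])
  ultimately show ?thesis using W.gen by metis
qed

lemma W_eta: "b \<in> BP p \<Longrightarrow> eta_R p b \<in> W"
  using W.gen[of b 0] by (simp add: tmon_0)

lemma W_const: "c \<in> Z_local p \<Longrightarrow> qconst c \<in> W"
  using W_eta[of "qconst c"] by (simp add: eta_R_qconst BP_def polys_over_qconst)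

text \<open>Once t_1, ..., t_m are set to 0, the v_n are integral polynomials in the right units and
  the t's by \<open>left_integral\<close>. So every polynomial in v and t can be rewritten, modulo
  the ideal, as an element of \<open>W\<close>.\<close>

lemma W_surj:
  assumes x: "x \<in> BPBP p" shows "\<exists>y\<in>W. prj y = prj x"
proof -
  let ?t = "\<lambda>\<rho> n. if n = 0 then 1 else if n \<le> m then 0 else \<rho> (gen.T n)"
  \<comment> \<open>Generators after the rewriting: the right units of the v_n, with t_1 = ... = t_m
    = 0, and the t_n with n > m.\<close>
  let ?G = "(\<lambda>i \<rho>. act p (v_at \<rho>) (?t \<rho>) i) ` {1..} \<union> (\<lambda>n \<rho>. \<rho> (gen.T n)) ` {m<..}"
  have ts: "tseq p (v_at \<rho>) (act p (v_at \<rho>) (?t \<rho>)) = ?t \<rho>" for \<rho>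
    by (rule tseq_unique) (simp add: Lf_act[OF p0])
  have tz: "(\<lambda>\<rho>. ?t \<rho> n) \<in> zpoly (Z_local p) ?G" for n
    by (cases "n = 0"; cases "n \<le> m") (auto intro: zpoly.const ratring_1[OF Zp] ratring_0[OF Zp] zpoly.gen)
  have vz: "(\<lambda>\<rho>. \<rho> (V n)) \<in> zpoly (Z_local p) ?G" if "n \<ge> 1" for n
    by (rule left_integral[OF prime_p Zp, where v' = "\<lambda>\<rho>. act p (v_at \<rho>) (?t \<rho>)"])
      (use that tz in \<open>auto simp: ts intro: zpoly.gen\<close>)
  have "(\<lambda>\<rho>. ev (low m \<rho>) x) \<in> zpoly (Z_local p) ?G"
  proof (rule zpoly_ev[OF Zp x[unfolded BPBP_def]])
    fix z assume "z \<in> V ` {1..} \<union> gen.T ` {1..}"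
    then consider n where "z = V n" "n \<ge> 1" | n where "z = gen.T n" "n \<ge> 1" by auto
    then show "(\<lambda>\<rho>. low m \<rho> z) \<in> zpoly (Z_local p) ?G"
    proof cases
      case (1 n)
      then show ?thesis using vz[of n] by (simp add: low_def)
    next
      case (2 n)
      then show ?thesis using tz[of n] by (cases "n \<le> m") (auto simp: low_def)
    qed
  qed
  then have "\<exists>y\<in>W. \<forall>\<rho>. ev (low m \<rho>) x = ev (low m \<rho>) y"
  proof -
    have "\<exists>y\<in>W. \<forall>\<rho>. f \<rho> = ev (low m \<rho>) y" if "f \<in> zpoly (Z_local p) ?G" for f
      using that
    proof induction
      case (const c)
      then show ?case using W_const by (intro bexI[of _ "qconst c"]) auto
    next
      case (gen g)
      then consider i where "g = (\<lambda>\<rho>. act p (v_at \<rho>) (?t \<rho>) i)" "i \<ge> 1" | n where "g = (\<lambda>\<rho>. \<rho> (gen.T n))" "n > m" by auto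
      then show ?case
      proof cases
        case (1 i)
        have "?t \<rho> = t_at (low m \<rho>)" "v_at \<rho> = v_at (low m \<rho>)" for \<rho> by (auto simp: low_def fun_eq_iff)
        then have "g \<rho> = ev (low m \<rho>) (eta_R_v p i)" for \<rho> using 1 by (simp only: ev_eta_R_v)
        moreover have "eta_R_v p i \<in> W"
          using W_eta[of "qvar (V i)"] 1(2) by (simp add: eta_R_V BP_def polys_over_qvar[OF Zp])
        ultimately show ?thesis by blast
      next
        case (2 n)
        then show ?thesis using W_t[of n] by (intro bexI[of _ "t_gen n"]) (auto simp: ev_t_gen low_def)
      qed
    next
      case (add f g)
      then obtain y z where "y \<in> W" "z \<in> W" "\<forall>\<rho>. f \<rho> = ev (low m \<rho>) y" "\<forall>\<rho>. g \<rho> = ev (low m \<rho>) z" by auto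
      then show ?case by (intro bexI[of _ "y + z"]) (auto simp: ev_add intro: W.add)
    next
      case (mult f g)
      then obtain y z where "y \<in> W" "z \<in> W" "\<forall>\<rho>. f \<rho> = ev (low m \<rho>) y" "\<forall>\<rho>. g \<rho> = ev (low m \<rho>) z" by auto
      then show ?case by (intro bexI[of _ "y * z"]) (auto simp: ev_mult intro: W_mult)
    qed
    then show ?thesis using \<open>(\<lambda>\<rho>. ev (low m \<rho>) x) \<in> zpoly (Z_local p) ?G\<close> by blast
  qed
  then obtain y where y: "y \<in> W" "\<And>\<rho>. ev (low m \<rho>) x = ev (low m \<rho>) y" by blast
  have "y - x \<in> J"
  proof (rule in_J_if_ev)
    show "y - x \<in> BPBP p" using W_BPBP[OF y(1)] x polys_over_diff[OF Zp] by (simp add: BPBP_def)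
  qed (simp add: ev_diff y(2))
  then show ?thesis using y(1) prj_eq_iff by blast
qed

text \<open>Fix a and the points from the second on. By \<open>exists_left_point\<close> the first
  point can be chosen so that t_(m+1), t_(m+2), ... take any prescribed values, and independence of
  monomials forces each coefficient to vanish.\<close>

lemma gf_indep:
  assumes fin: "finite E" and sum0: "(\<Sum>e\<in>E. gf (bas e) * Sh (f e)) = 0" and e: "e \<in> E"
  shows "f e = 0"
proof (intro ext)
  fix a Y
  have "(\<Sum>e\<in>E. f e a Y * mon \<rho> e) = 0" for \<rho>
  proof -
    \<comment> \<open>Variable n of a monomial in \<open>tmon\<close> stands for t_(m+1+n), hence
      the shift.\<close>
    define t where "t n = (if n = 0 then 1 else if n \<le> m then 0 else \<rho> (n - Suc m))" for n
    obtain y where y: "tseq p (pt p m a y) (pt p m a (Y 0)) = t"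
      using exists_left_point[OF p0, of t m a "Y 0"] by (auto simp: t_def)
    let ?Y = "\<lambda>i. case i of 0 \<Rightarrow> y | Suc j \<Rightarrow> Y j"
    have "gf (bas e) a ?Y = mon \<rho> e" for e
      by (simp add: bas_def gf_prj ev_tmon penv_def y) (simp add: t_def)
    moreover have "Sh (f e) a ?Y = f e a Y" for e by (simp add: Sh_def)
    ultimately have "(\<Sum>e\<in>E. gf (bas e) * Sh (f e)) a ?Y = (\<Sum>e\<in>E. f e a Y * mon \<rho> e)"
      by (simp add: sum_fun_apply fun_ring_apply mult.commute)
    then show ?thesis by (simp add: sum0 fun_ring_apply)
  qed
  then show "f e a Y = 0 a Y" using mon_independent[OF fin _ e, of "\<lambda>e. f e a Y"] by (simp add: fun_ring_apply)
qed

lemma algebroid: "algebroid_functions H gf bas pv"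
proof
  show "\<one>\<^bsub>total H\<^esub> \<in> carrier (total H)" unfolding total_one by (rule prj_carrier[OF BPBP_1])
  show "gf \<one>\<^bsub>total H\<^esub> = 1" unfolding total_one by (simp add: fun_eq_iff gf_prj fun_ring_apply)
  fix g h assume g: "g \<in> carrier (total H)" and h: "h \<in> carrier (total H)"
  obtain x y where xy: "x \<in> BPBP p" "g = prj x" "y \<in> BPBP p" "h = prj y" using g h by (auto simp: carrier_total)
  show "g \<oplus>\<^bsub>total H\<^esub> h \<in> carrier (total H)" using xy by (auto simp: total_add intro!: prj_carrier BPBP_add)
  show "g \<otimes>\<^bsub>total H\<^esub> h \<in> carrier (total H)" using xy by (auto simp: total_mult intro!: prj_carrier BPBP_mult)
  show "gf (g \<oplus>\<^bsub>total H\<^esub> h) = gf g + gf h" using xy by (simp add: total_add fun_eq_iff gf_prj fun_ring_apply ev_add)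
  show "gf (g \<otimes>\<^bsub>total H\<^esub> h) = gf g * gf h" using xy by (simp add: total_mult fun_eq_iff gf_prj fun_ring_apply ev_mult)
next
  fix b assume "b \<in> carrier (base H)"
  then have b: "b \<in> BP p" by (simp add: base_H)
  show "lunit H b \<in> carrier (total H)" unfolding lunit_H by (rule prj_carrier[OF BP_BPBP[OF b]])
  show "runit H b \<in> carrier (total H)" unfolding runit_H by (rule prj_carrier[OF eta_R_BPBP[OF b]])
  show "gf (lunit H b) = pv b" unfolding lunit_H by (rule gf_lunit'[OF b])
  show "gf (runit H b) = Sh (pv b)" unfolding runit_H by (rule gf_runit'[OF b])
next
  show "bas e \<in> carrier (total H)" for e unfolding bas_def by (rule prj_carrier[OF tmon_BPBP])
next
  fix P g
  assume g: "g \<in> carrier (total H)"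
    and b: "\<And>e b. b \<in> carrier (base H) \<Longrightarrow> P (bas e \<otimes>\<^bsub>total H\<^esub> runit H b)"
    and a: "\<And>g h. g \<in> carrier (total H) \<Longrightarrow> h \<in> carrier (total H) \<Longrightarrow> P g \<Longrightarrow> P h \<Longrightarrow> P (g \<oplus>\<^bsub>total H\<^esub> h)"
  have "P (prj y)" if "y \<in> W" for y
    using that
  proof induction
    case (gen c e)
    then show ?case using b[of c e] by (simp add: base_H bas_def runit_H total_mult tmon_BPBP eta_R_BPBP)
  next
    case (add x y)
    then show ?case using a[of "prj x" "prj y"] by (simp add: total_add W_BPBP prj_carrier)
  qed
  then show "P g" using g W_surj by (metis carrier_total)
next
  show "finite E \<Longrightarrow> (\<Sum>e\<in>E. gf (bas e) * Sh (f e)) = 0 \<Longrightarrow> e \<in> E \<Longrightarrow> f e = 0" for E f e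
    by (rule gf_indep)
qed

sublocale algebroid_functions H gf bas pv by (rule algebroid)

end

lemma flin_apply2: "flin f c a Y = flin (\<lambda>w. f w a Y) c" for f :: "'w \<Rightarrow> chainfun"
  by (rule flin_hom[of "\<lambda>F. F a Y"]) (auto simp: fun_ring_apply)

lemma eval_tensor_flin:
  "eval_tensor p = flin (\<lambda>w. hd (fst w) * qsubst (\<lambda>x. case x of V n \<Rightarrow> eta_R_v p n | gen.T n \<Rightarrow> qvar (U n) | U n \<Rightarrow> qvar x) (snd w))"
  by (simp add: fun_eq_iff eval_tensor_def flin_def)

lemma (in cobar_model) phi_rep_class: "\<phi> (rep (cobar_class H M s c)) - \<phi> c \<in> Pre GG K s"
  using phi_null[OF Q.rep_class[of s c]] by (simp add: class_eq phi_def flin_diff)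

lemma (in cobar_model) keys_rep_class: "Poly_Mapping.keys c \<subseteq> words s \<Longrightarrow> Poly_Mapping.keys (rep (cobar_class H M s c)) \<subseteq> words s"
  unfolding class_eq by (rule Q.rep_class_carrier)

lemma (in cobar_model) class_carrier: "Poly_Mapping.keys c \<subseteq> words s \<Longrightarrow> cobar_class H M s c \<in> carrier (cobar_tensor H M s)"
  unfolding class_eq tensor_eq Q.carrier_quot by blast

lemma (in cobar_model) class_eqI:
  assumes "Poly_Mapping.keys c \<subseteq> words s" "Poly_Mapping.keys d \<subseteq> words s" "\<phi> c - \<phi> d \<in> Pre GG K s"
  shows "cobar_class H M s c = cobar_class H M s d"
proof -
  have "c - d \<in> Q.N s"
    by (rule null_if_phi) (use assms keys_diff[of c d] in \<open>auto simp: phi_def flin_diff\<close>)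
  then show ?thesis unfolding class_eq Q.class_eq_iff .
qed

lemma (in cobar_model) class_rep_eq: "X \<in> carrier (cobar_tensor H M s) \<Longrightarrow> cobar_class H M s (rep X) = X \<and> Poly_Mapping.keys (rep X) \<subseteq> words s"
  unfolding class_eq tensor_eq using Q.class_rep Q.keys_rep by blast

text \<open>One module occurs inside several records; the model reads only its carrier, addition,
  zero and scalar multiplication.\<close>

lemma cobar_model_cong:
  assumes "cobar_model H gf bas sc M mu K" "carrier M' = carrier M" "add M' = add M" "zero M' = zero M" "smult M' = smult M"
  shows "cobar_model H gf bas sc M' mu K"
  using assms(1) unfolding cobar_model_def cobar_model_axioms_def assms(2-) .

lemma cobar_words_cong: "carrier M' = carrier M \<Longrightarrow> cobar_words H M' s = cobar_words H M s"
  by (simp add: cobar_words_def)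

lemma cobar_null_cong:
  assumes "carrier M' = carrier M" "add M' = add M" "smult M' = smult M"
  shows "cobar_null H M' s = cobar_null H M s"
  unfolding cobar_null_def cobar_relations_def cobar_words_cong[OF assms(1)] assms(2,3) ..

lemma cobar_class_cong:
  assumes "carrier M' = carrier M" "add M' = add M" "smult M' = smult M"
  shows "cobar_class H M' s = cobar_class H M s"
  unfolding cobar_class_def[abs_def] cobar_null_cong[OF assms] cobar_words_cong[OF assms(1)] ..

lemma frag_extend_id: "frag_extend (\<lambda>(gs, x). frag_of (gs, id x)) c = c"
proof -
  have "frag_extend (\<lambda>(gs, x). frag_of (gs, id x)) c = frag_extend frag_of c"
    by (rule frag_extend_eq) auto
  then show ?thesis by (simp only: frag_expansion[of c, symmetric])
qed

text \<open>Elements of \<Gamma> \<otimes> S and of \<Gamma> \<otimes> M get their functions from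
  the same formula and, as \<open>K\<close> is 0 for both, are determined by them. So a lift of the
  coaction is unique, and it exists once its function comes from \<Gamma> \<otimes> S.\<close>

lemma coact_subcomodule:
  assumes M: "cobar_model H gf bas sc M mu {0}" and S: "cobar_model H gf bas sc (M\<lparr>carrier := S\<rparr>) mu {0}"
    and SM: "S \<subseteq> carrier M" and x: "x \<in> S"
    and X: "coact M x \<in> carrier (cobar_tensor H M 1)" "phi gf mu (rep (coact M x)) = F"
    and c: "Poly_Mapping.keys c \<subseteq> cobar_words H (M\<lparr>carrier := S\<rparr>) 1" "phi gf mu c = F"
  shows "coact (subcomodule H M S) x = cobar_class H (M\<lparr>carrier := S\<rparr>) 1 c"
proof -
  interpret M: cobar_model H gf bas sc M mu "{0}" by (rule M)
  interpret S: cobar_model H gf bas sc "M\<lparr>carrier := S\<rparr>" mu "{0}" by (rule S)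
  have wSM: "S.words 1 \<subseteq> M.words 1" using SM by (auto simp: cobar_words_def)
  have map: "cobar_map H M id 1 Z = cobar_class H M 1 (rep Z)" for Z
    unfolding cobar_map_def frag_extend_id ..
  have XM: "cobar_class H M 1 (rep (coact M x)) = coact M x" "Poly_Mapping.keys (rep (coact M x)) \<subseteq> M.words 1"
    using M.class_rep_eq[OF X(1)] by auto
  have "(THE Z. Z \<in> carrier (cobar_tensor H (M\<lparr>carrier := S\<rparr>) 1) \<and> cobar_map H M id 1 Z = coact M x) = cobar_class H (M\<lparr>carrier := S\<rparr>) 1 c"
  proof (rule the_equality)
    let ?Z = "cobar_class H (M\<lparr>carrier := S\<rparr>) 1 c"
    have k: "Poly_Mapping.keys (rep ?Z) \<subseteq> M.words 1" using S.keys_rep_class[OF c(1)] wSM by blast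
    have "phi gf mu (rep ?Z) = F" using S.phi_rep_class[of 1 c] c(2) by (simp add: Pre_zero del: Pre.simps)
    then have "cobar_class H M 1 (rep ?Z) = cobar_class H M 1 (rep (coact M x))"
      using X(2) by (intro M.class_eqI k XM(2)) (simp add: Pre_zero del: Pre.simps)
    then show "?Z \<in> carrier (cobar_tensor H (M\<lparr>carrier := S\<rparr>) 1) \<and> cobar_map H M id 1 ?Z = coact M x"
      using S.class_carrier[OF c(1)] XM(1) unfolding map by simp
  next
    fix Z assume Z: "Z \<in> carrier (cobar_tensor H (M\<lparr>carrier := S\<rparr>) 1) \<and> cobar_map H M id 1 Z = coact M x"
    have Z': "cobar_class H (M\<lparr>carrier := S\<rparr>) 1 (rep Z) = Z" "Poly_Mapping.keys (rep Z) \<subseteq> S.words 1" using S.class_rep_eq Z by blast+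
    have "phi gf mu (rep (cobar_class H M 1 (rep Z))) - phi gf mu (rep Z) = 0"
      using M.phi_rep_class[of 1 "rep Z"] by (simp add: Pre_zero del: Pre.simps)
    then have "phi gf mu (rep Z) = F" using Z X(2) unfolding map by simp
    then have "cobar_class H (M\<lparr>carrier := S\<rparr>) 1 (rep Z) = cobar_class H (M\<lparr>carrier := S\<rparr>) 1 c"
      by (intro S.class_eqI Z'(2) c(1)) (simp add: c(2) Pre_zero del: Pre.simps)
    then show "Z = cobar_class H (M\<lparr>carrier := S\<rparr>) 1 c" using Z'(1) by simp
  qed
  then show ?thesis by (simp add: subcomodule_def)
qed

context bp
begin

lemma total_module_simps [simp]:
  "carrier (total_module H) = carrier (total H)" "add (total_module H) = add (total H)"
  "zero (total_module H) = zero (total H)" "smult (total_module H) = (\<lambda>a g. lunit H a \<otimes>\<^bsub>total H\<^esub> g)"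
  by (simp_all add: total_module_def ring.defs module.defs)

lemma gf_zero: "gf (prj 0) = 0"
  by (simp add: fun_eq_iff gf_prj fun_ring_apply)

lemma BPBP_uminus: "x \<in> BPBP p \<Longrightarrow> - x \<in> BPBP p"
  unfolding BPBP_def by (rule polys_over_uminus[OF Zp])

lemma zero_closed': "\<zero>\<^bsub>total H\<^esub> \<in> carrier (total H)"
  unfolding total_zero by (rule prj_carrier[OF BPBP_0])

lemma total_model: "cobar_model H gf bas pv (total_module H) gf {0}"
proof (unfold_locales, goal_cases)
  case (6 b x)
  then show ?case by (simp add: mult_closed lunit_closed) next
  case 1 show ?case by (rule addsub_zero) next
  case 2 then show ?case by simp next
  case 3 show ?case using zero_closed' by simp next
  case 4 show ?case by (simp add: total_zero total_add BPBP_0) next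
  case (5 x y) then show ?case by (simp add: add_closed) next
  case (7 x)
  then obtain z where z: "z \<in> BPBP p" "x = prj z" by (auto simp: carrier_total)
  then show ?case by (intro bexI[of _ "prj (- z)"]) (auto simp: total_add BPBP_uminus total_zero intro: prj_carrier) next
  case (8 x y) then show ?case by (simp add: gf_add) next
  case (9 b x) then show ?case by (simp add: gf_mult lunit_closed gf_lunit) next
  case (10 x) then show ?case using gf_eqD[OF _ zero_closed'] by (simp add: total_zero gf_zero)
qed


sublocale TM: cobar_model H gf bas pv "total_module H" gf "{0}" by (rule total_model)

text \<open>The coproduct of \<open>Gamma\<close> is given by classes over the record that has no
  coproduct yet; tensor products read only the fields common to both records.\<close>

lemma HA_class: "cobar_class HA (total_module HA) = cobar_class H (total_module H)"
proof -
  have "total_module HA = total_module H"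
    by (simp add: total_module_def total_H lunit_H)
  moreover have "cobar_words HA (total_module H) s = cobar_words H (total_module H) s" for s
    by (simp add: cobar_words_def total_H)
  moreover from this have "cobar_relations HA (total_module H) s = cobar_relations H (total_module H) s" for s
    unfolding cobar_relations_def by (simp only: total_H base_H lunit_H runit_H)
  ultimately show ?thesis
    by (simp add: fun_eq_iff cobar_class_def cobar_null_def)
qed

section \<open>The coproduct of BP_*(BP) and its image in \<Gamma>(m+1)\<close>

abbreviation "Hb \<equiv> BPBP_algebroid p"
abbreviation "Mb \<equiv> total_module Hb"

abbreviation "usub \<equiv> (\<lambda>x. case x of V n \<Rightarrow> eta_R_v p n | gen.T n \<Rightarrow> qvar (U n) | U n \<Rightarrow> qvar x)"

lemma Hb_simps [simp]: "total Hb = R" "base Hb = subring_of_qpoly (BP p)" "lunit Hb = id" "runit Hb = eta_R p"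
  "carrier Mb = BPBP p" "add Mb = (+)" "smult Mb = (*)"
  by (simp_all add: BPBP_algebroid_def total_module_def ring.defs module.defs subring_of_qpoly_def fun_eq_iff)

lemma usub_mult: "qsubst \<sigma> (f * g) = qsubst \<sigma> f * qsubst \<sigma> g"
  by (rule ev_eqI) (simp add: ev_qsubst ev_mult)
lemma usub_add: "qsubst \<sigma> (f + g) = qsubst \<sigma> f + qsubst \<sigma> g"
  by (rule ev_eqI) (simp add: ev_qsubst ev_add)
lemma usub_1: "qsubst \<sigma> 1 = 1"
  by (rule ev_eqI) (simp add: ev_qsubst)

lemma usub_BP: "b \<in> BP p \<Longrightarrow> qsubst usub b = eta_R p b"
  unfolding eta_R_def
  by (rule ev_eqI) (auto simp: ev_qsubst BP_def intro!: polys_over_ev_cong)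

lemma words_b: "w \<in> cobar_words Hb Mb 1 \<longleftrightarrow> (\<exists>g h. w = ([g], h) \<and> g \<in> BPBP p \<and> h \<in> BPBP p)"
  by (auto simp: cobar_words_def length_Suc_conv)

lemmas words_b' = words_b[unfolded One_nat_def]

lemma rel_b:
  assumes "c \<in> cobar_relations Hb Mb 1"
  shows "Poly_Mapping.keys c \<subseteq> cobar_words Hb Mb 1 \<and> eval_tensor p c = 0"
proof -
  have k3: "Poly_Mapping.keys (frag_of u - frag_of v - frag_of w) \<subseteq> {u, v, w}" for u v w :: "qpoly list \<times> qpoly"
    using keys_diff[of "frag_of u - frag_of v" "frag_of w"] keys_diff[of "frag_of u" "frag_of v"] by (auto simp: keys_frag_of)
  have k2: "Poly_Mapping.keys (frag_of u - frag_of v) \<subseteq> {u, v}" for u v :: "qpoly list \<times> qpoly"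
    using keys_diff[of "frag_of u" "frag_of v"] by (auto simp: keys_frag_of)
  have "(\<exists>g h x. c = frag_of ([g + h], x) - frag_of ([g], x) - frag_of ([h], x) \<and> g \<in> BPBP p \<and> h \<in> BPBP p \<and> x \<in> BPBP p)
    \<or> (\<exists>g x y. c = frag_of ([g], x + y) - frag_of ([g], x) - frag_of ([g], y) \<and> g \<in> BPBP p \<and> x \<in> BPBP p \<and> y \<in> BPBP p)
    \<or> (\<exists>g b x. c = frag_of ([g * eta_R p b], x) - frag_of ([g], b * x) \<and> g \<in> BPBP p \<and> b \<in> BP p \<and> x \<in> BPBP p)"
    (is "?A \<or> ?B \<or> ?C")
    using assms unfolding cobar_relations_def Hb_simps subring_simps
  proof (elim UnE CollectE exE conjE)
    fix xs g h ys x
    assume c: "c = frag_of (xs @ [g + h] @ ys, x) - frag_of (xs @ [g] @ ys, x) - frag_of (xs @ [h] @ ys, x)"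
      and w: "(xs @ [g] @ ys, x) \<in> cobar_words Hb Mb 1" "(xs @ [h] @ ys, x) \<in> cobar_words Hb Mb 1"
    have "xs = [] \<and> ys = []" using w(1) by (auto simp: cobar_words_def)
    then have "?A" using c w by (intro exI[of _ g] exI[of _ h] exI[of _ x]) (auto simp: words_b words_b')
    then show ?thesis by blast
  next
    fix gs x y
    assume c: "c = frag_of (gs, x + y) - frag_of (gs, x) - frag_of (gs, y)"
      and w: "(gs, x) \<in> cobar_words Hb Mb 1" "(gs, y) \<in> cobar_words Hb Mb 1"
    obtain g where "gs = [g]" using w(1) by (auto simp: words_b words_b')
    then have "?B" using c w by (intro exI[of _ g] exI[of _ x] exI[of _ y]) (auto simp: words_b words_b')
    then show ?thesis by blast
  next
    fix xs g h ys b x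
    assume "(xs @ [g, h] @ ys, x) \<in> cobar_words Hb Mb 1"
    then show ?thesis by (auto simp: cobar_words_def)
  next
    fix xs g b x
    assume c: "c = frag_of (xs @ [g * eta_R p b], x) - frag_of (xs @ [g], b * x)" and b: "b \<in> BP p"
      and w: "(xs @ [g], x) \<in> cobar_words Hb Mb 1"
    have "xs = []" using w(1) by (auto simp: cobar_words_def)
    then have "?C" using c w b by (intro exI[of _ g] exI[of _ b] exI[of _ x]) (auto simp: words_b words_b')
    then show ?thesis by blast
  qed
  then consider g h x where "c = frag_of ([g + h], x) - frag_of ([g], x) - frag_of ([h], x)" "g \<in> BPBP p" "h \<in> BPBP p" "x \<in> BPBP p"
    | g x y where "c = frag_of ([g], x + y) - frag_of ([g], x) - frag_of ([g], y)" "g \<in> BPBP p" "x \<in> BPBP p" "y \<in> BPBP p"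
    | g b x where "c = frag_of ([g * eta_R p b], x) - frag_of ([g], b * x)" "g \<in> BPBP p" "b \<in> BP p" "x \<in> BPBP p"
    by blast
  then show ?thesis
  proof cases
    case 1
    then show ?thesis using k3[of "([g + h], x)" "([g], x)" "([h], x)"]
      by (auto simp: words_b words_b' eval_tensor_flin flin_diff distrib_right BPBP_add)
  next
    case 2
    then show ?thesis using k3[of "([g], x + y)" "([g], x)" "([g], y)"]
      by (auto simp: words_b words_b' eval_tensor_flin flin_diff usub_add distrib_left BPBP_add)
  next
    case 3
    then show ?thesis using k2[of "([g * eta_R p b], x)" "([g], b * x)"]
      by (auto simp: words_b words_b' eval_tensor_flin flin_diff usub_mult usub_BP eta_R_BPBP BP_BPBP BPBP_mult)
  qed
qed

sublocale Qb: free_quotient "cobar_words Hb Mb 1" "cobar_relations Hb Mb 1"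
  by unfold_locales (use rel_b in auto)

lemma eval_null_b: "c \<in> Qb.N \<Longrightarrow> eval_tensor p c = 0"
  by (erule Qb.N_induct) (use rel_b in \<open>auto simp: eval_tensor_flin flin_diff\<close>)

definition Imb :: "qpoly set" where
  "Imb = {eval_tensor p c | c. Poly_Mapping.keys c \<subseteq> cobar_words Hb Mb 1}"

lemma Imb_word: "g \<in> BPBP p \<Longrightarrow> h \<in> BPBP p \<Longrightarrow> g * qsubst usub h \<in> Imb"
  unfolding Imb_def by (intro CollectI exI[of _ "frag_of ([g], h)"]) (auto simp: eval_tensor_flin keys_frag_of words_b words_b')

lemma Imb_addsub: "addsub Imb"
proof -
  have "eval_tensor p c - eval_tensor p d \<in> Imb" if "Poly_Mapping.keys c \<subseteq> cobar_words Hb Mb 1" "Poly_Mapping.keys d \<subseteq> cobar_words Hb Mb 1" for c d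
    unfolding Imb_def using that keys_diff[of c d] by (intro CollectI exI[of _ "c - d"]) (auto simp: eval_tensor_flin flin_diff)
  moreover have "0 \<in> Imb" unfolding Imb_def by (intro CollectI exI[of _ 0]) (auto simp: eval_tensor_flin)
  ultimately show ?thesis by (auto simp: addsub_def Imb_def)
qed

lemma Imb_mult:
  assumes "x \<in> Imb" "y \<in> Imb" shows "x * y \<in> Imb"
proof -
  let ?e = "\<lambda>w. hd (fst w) * qsubst usub (snd w)"
  obtain c d where c: "Poly_Mapping.keys c \<subseteq> cobar_words Hb Mb 1" "x = flin ?e c"
    and d: "Poly_Mapping.keys d \<subseteq> cobar_words Hb Mb 1" "y = flin ?e d"
    using assms by (auto simp: Imb_def eval_tensor_flin)
  have "flin (\<lambda>w. flin (\<lambda>w'. ?e w * ?e w') d) c \<in> Imb"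
  proof (intro addsub_flin[OF Imb_addsub])
    fix w w' assume k: "w \<in> Poly_Mapping.keys c" "w' \<in> Poly_Mapping.keys d"
    obtain g h where w1: "w = ([g], h)" "g \<in> BPBP p" "h \<in> BPBP p"
      using words_b[THEN iffD1, OF subsetD[OF c(1) k(1)]] by blast
    obtain g' h' where w2: "w' = ([g'], h')" "g' \<in> BPBP p" "h' \<in> BPBP p"
      using words_b[THEN iffD1, OF subsetD[OF d(1) k(2)]] by blast
    note w = w1 w2
    have "?e w * ?e w' = (g * g') * qsubst usub (h * h')" by (simp add: w usub_mult)
    also have "\<dots> \<in> Imb" by (rule Imb_word) (use w BPBP_mult in auto)
    finally show "?e w * ?e w' \<in> Imb" .
  qed
  also have "flin (\<lambda>w. flin (\<lambda>w'. ?e w * ?e w') d) c = x * y"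
    unfolding flin_mult_left c(2) d(2) flin_mult_right ..
  finally show ?thesis .
qed

text \<open>The image of \<open>eval_tensor\<close> is closed under products and contains v_n, t_n
  and, from 1 \<otimes> t_n, also u_n. Therefore the formal sum chosen in \<open>BPBP_comult\<close>
  exists.\<close>

lemma Imb_all:
  assumes f: "f \<in> polys_over (Z_local p) (V ` {1..} \<union> gen.T ` {1..} \<union> U ` {1..})"
  shows "f \<in> Imb"
proof -
  let ?S = "V ` {1..} \<union> gen.T ` {1..} \<union> U ` {1..}"
  have "\<exists>h\<in>Imb. \<forall>\<rho>. ev \<rho> h = F \<rho>" if "F \<in> zpoly (Z_local p) (pgens ?S)" for F
    using that
  proof induction
    case (const c)
    have "qconst c * qsubst usub 1 \<in> Imb" by (rule Imb_word) (auto simp: BPBP_def polys_over_qconst const polys_over_1[OF Zp])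
    then show ?case by (intro bexI) (auto simp: usub_1)
  next
    case (gen g)
    then consider n where "g = (\<lambda>\<rho>. \<rho> (V n))" "n \<ge> 1" | n where "g = (\<lambda>\<rho>. \<rho> (gen.T n))" "n \<ge> 1" | n where "g = (\<lambda>\<rho>. \<rho> (U n))" "n \<ge> 1"
      by (auto simp: pgens_def)
    then show ?case
    proof cases
      case (1 n)
      have "qvar (V n) * qsubst usub 1 \<in> Imb" by (rule Imb_word) (use 1 in \<open>auto simp: BPBP_def polys_over_qvar[OF Zp] polys_over_1[OF Zp]\<close>)
      then show ?thesis using 1 by (intro bexI) (auto simp: usub_1)
    next
      case (2 n)
      have "qvar (gen.T n) * qsubst usub 1 \<in> Imb" by (rule Imb_word) (use 2 in \<open>auto simp: BPBP_def polys_over_qvar[OF Zp] polys_over_1[OF Zp]\<close>)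
      then show ?thesis using 2 by (intro bexI) (auto simp: usub_1)
    next
      case (3 n)
      have "1 * qsubst usub (qvar (gen.T n)) \<in> Imb" by (rule Imb_word) (use 3 in \<open>auto simp: BPBP_def polys_over_qvar[OF Zp] polys_over_1[OF Zp]\<close>)
      then show ?thesis using 3 by (intro bexI) (auto simp: ev_qsubst)
    qed
  next
    case (add f g)
    then obtain h h' where "h \<in> Imb" "h' \<in> Imb" "\<forall>\<rho>. ev \<rho> h = f \<rho>" "\<forall>\<rho>. ev \<rho> h' = g \<rho>" by auto
    then show ?case by (intro bexI[of _ "h + h'"]) (auto simp: ev_add intro: addsub_add[OF Imb_addsub])
  next
    case (mult f g)
    then obtain h h' where "h \<in> Imb" "h' \<in> Imb" "\<forall>\<rho>. ev \<rho> h = f \<rho>" "\<forall>\<rho>. ev \<rho> h' = g \<rho>" by auto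
    then show ?case by (intro bexI[of _ "h * h'"]) (auto simp: ev_mult intro: Imb_mult)
  qed
  moreover have "(\<lambda>\<rho>. ev \<rho> f) \<in> zpoly (Z_local p) (pgens ?S)"
    by (rule zpoly_ev[OF Zp f]) (rule zpoly_at)
  ultimately obtain h where h: "h \<in> Imb" "\<And>\<rho>. ev \<rho> h = ev \<rho> f" by blast
  have "h = f" by (rule ev_eqI) (rule h(2))
  then show ?thesis using h(1) by simp
qed

lemma Delta_rational_integral:
  assumes x: "x \<in> BPBP p"
  shows "Delta_rational p x \<in> polys_over (Z_local p) (V ` {1..} \<union> gen.T ` {1..} \<union> U ` {1..})"
proof (rule polys_over_if_zpoly[OF Zp], fold pgens_def)
  let ?S = "V ` {1..} \<union> gen.T ` {1..} \<union> U ` {1..}"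
  have D: "(\<lambda>\<rho>. ev \<rho> (Delta_t p n)) \<in> zpoly (Z_local p) (pgens ?S)" for n
    by (rule zpoly_ev[OF Zp Delta_t_integral[OF prime_p]]) (rule zpoly_at)
  show "(\<lambda>\<rho>. ev \<rho> (Delta_rational p x)) \<in> zpoly (Z_local p) (pgens ?S)"
    unfolding Delta_rational_def ev_qsubst
    by (rule zpoly_ev[OF Zp x[unfolded BPBP_def]]) (use D zpoly_at in auto)
qed

lemma BPBP_comult_rep:
  assumes x: "x \<in> BPBP p"
  shows "Poly_Mapping.keys (rep (BPBP_comult p x)) \<subseteq> cobar_words Hb Mb 1" "eval_tensor p (rep (BPBP_comult p x)) = Delta_rational p x"
proof -
  let ?P = "\<lambda>c. c \<in> carrier (free_Abelian_group (cobar_words Hb Mb 1)) \<and> eval_tensor p c = Delta_rational p x"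
  have "Delta_rational p x \<in> Imb" by (rule Imb_all[OF Delta_rational_integral[OF x]])
  then have "\<exists>c. ?P c" by (auto simp: Imb_def)
  then have s: "?P (SOME c. ?P c)" by (rule someI_ex)
  have eq: "BPBP_comult p x = Qb.N #>\<^bsub>Qb.F\<^esub> (SOME c. ?P c)"
    by (simp add: BPBP_comult_def Let_def cobar_class_def cobar_null_def)
  show "Poly_Mapping.keys (rep (BPBP_comult p x)) \<subseteq> cobar_words Hb Mb 1"
    unfolding eq by (rule Qb.rep_class_carrier) (use s in simp)
  have "eval_tensor p (rep (BPBP_comult p x) - (SOME c. ?P c)) = 0"
    unfolding eq by (rule eval_null_b[OF Qb.rep_class])
  then show "eval_tensor p (rep (BPBP_comult p x)) = Delta_rational p x"
    using s by (simp add: eval_tensor_flin flin_diff)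
qed

text \<open>Over a chain of three points, v is taken at Y 0, t is the morphism from Y 0 to Y 1 and u
  the one from Y 1 to Y 2. The second tensor factor is then read at (Y 1, Y 2), and \<Delta> gives
  the composite from Y 0 to Y 2 by \<open>Dt_tseq\<close>.\<close>

lemma ev_three_points:
  fixes a Y
  defines "\<rho> \<equiv> venv (pt p m a (Y 0)) (tseq p (pt p m a (Y 0)) (pt p m a (Y 1))) (tseq p (pt p m a (Y 1)) (pt p m a (Y 2)))"
  assumes g: "g \<in> BPBP p" and h: "h \<in> BPBP p"
  shows "ev \<rho> (g * qsubst usub h) = (gf (prj g) * Sh (gf (prj h))) a Y"
    and "ev \<rho> (Delta_rational p h) = gf (prj h) a (\<lambda>q. if q < 1 then Y q else Y (Suc q))"
proof -
  have at: "v_at \<rho> = pt p m a (Y 0)" "t_at \<rho> = tseq p (pt p m a (Y 0)) (pt p m a (Y 1))" "u_at \<rho> = tseq p (pt p m a (Y 1)) (pt p m a (Y 2))"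
    by (auto simp: \<rho>_def fun_eq_iff)
  have "ev \<rho> g = ev (penv a (Y 0) (Y 1)) g"
    by (rule polys_over_ev_cong[OF g[unfolded BPBP_def]]) (auto simp: \<rho>_def penv_def)
  moreover have "ev \<rho> (qsubst usub h) = ev (penv a (Y 1) (Y 2)) h"
    unfolding ev_qsubst
  proof (rule polys_over_ev_cong[OF h[unfolded BPBP_def]])
    fix x assume "x \<in> V ` {1..} \<union> gen.T ` {1..}"
    then consider n where "x = V n" "n \<ge> 1" | n where "x = gen.T n" by auto
    then show "ev \<rho> (usub x) = penv a (Y 1) (Y 2) x"
    proof cases
      case (1 n)
      then show ?thesis by (simp add: ev_eta_R_v at act_tseq[OF p0] penv_def)
    next
      case (2 n)
      then show ?thesis by (simp add: \<rho>_def penv_def)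
    qed
  qed
  ultimately show "ev \<rho> (g * qsubst usub h) = (gf (prj g) * Sh (gf (prj h))) a Y"
    by (simp add: ev_mult fun_ring_apply gf_prj Sh_def numeral_2_eq_2)
  show "ev \<rho> (Delta_rational p h) = gf (prj h) a (\<lambda>q. if q < 1 then Y q else Y (Suc q))"
    unfolding Delta_rational_def ev_qsubst gf_prj
  proof (rule polys_over_ev_cong[OF h[unfolded BPBP_def]])
    fix x assume "x \<in> V ` {1..} \<union> gen.T ` {1..}"
    then consider n where "x = V n" "n \<ge> 1" | n where "x = gen.T n" by auto
    then show "ev \<rho> (case x of gen.T n \<Rightarrow> Delta_t p n | _ \<Rightarrow> qvar x) = penv a (if (0::nat) < 1 then Y 0 else Y (Suc 0)) (if (1::nat) < 1 then Y 1 else Y (Suc 1)) x"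
    proof cases
      case (1 n)
      then show ?thesis by (simp add: \<rho>_def penv_def)
    next
      case (2 n)
      then show ?thesis by (simp add: ev_Delta_t at Dt_tseq penv_def numeral_2_eq_2)
    qed
  qed
qed

lemma comult_spec:
  assumes X: "X \<in> carrier (total H)"
  shows "\<exists>c. Poly_Mapping.keys c \<subseteq> TM.words 1 \<and> comult H X = cobar_class H (total_module H) 1 c \<and> phi gf gf c = cf 1 (gf X)"
proof -
  have x: "rep X \<in> BPBP p" "prj (rep X) = X" using rep_carrier[OF X] by auto
  let ?d = "rep (BPBP_comult p (rep X))"
  let ?b = "\<lambda>(gs, g). frag_of (map prj gs, prj g)"
  have d: "Poly_Mapping.keys ?d \<subseteq> cobar_words Hb Mb 1" "eval_tensor p ?d = Delta_rational p (rep X)"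
    by (rule BPBP_comult_rep[OF x(1)])+
  have "comult H X = cobar_class HA (total_module HA) 1 (frag_extend ?b ?d)"
    by (simp add: Gamma_def algebroid.defs hopf_algebroid.defs)
  then have "comult H X = cobar_class H (total_module H) 1 (frag_extend ?b ?d)"
    by (simp only: HA_class)
  moreover have "Poly_Mapping.keys (frag_extend ?b ?d) \<subseteq> TM.words 1"
  proof (rule order_trans[OF keys_frag_extend], rule UN_least)
    fix w assume "w \<in> Poly_Mapping.keys ?d"
    then obtain g h where "w = ([g], h)" "g \<in> BPBP p" "h \<in> BPBP p" using d(1) words_b[of w] by blast
    then show "Poly_Mapping.keys (?b w) \<subseteq> TM.words 1" by (auto simp: keys_frag_of cobar_words_def intro!: prj_carrier)
  qed
  moreover have "phi gf gf (frag_extend ?b ?d) = cf 1 (gf X)"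
  proof (intro ext)
    fix a :: "nat \<Rightarrow> rat" and Y :: "nat \<Rightarrow> nat \<Rightarrow> rat"
    let ?\<rho> = "venv (pt p m a (Y 0)) (tseq p (pt p m a (Y 0)) (pt p m a (Y 1))) (tseq p (pt p m a (Y 1)) (pt p m a (Y 2)))"
    have "phi gf gf (frag_extend ?b ?d) a Y = flin (\<lambda>w. flin (wfn gf gf) (?b w) a Y) ?d"
      unfolding phi_def flin_frag_extend flin_apply2 ..
    also have "\<dots> = flin (\<lambda>w. ev ?\<rho> (hd (fst w) * qsubst usub (snd w))) ?d"
    proof (rule flin_cong)
      fix w assume "w \<in> Poly_Mapping.keys ?d"
      then obtain g h where w: "w = ([g], h)" "g \<in> BPBP p" "h \<in> BPBP p" using d(1) words_b[of w] by blast
      show "flin (wfn gf gf) (?b w) a Y = ev ?\<rho> (hd (fst w) * qsubst usub (snd w))"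
        using ev_three_points(1)[OF w(2,3), of a Y] by (simp add: w(1) wfn_def)
    qed
    also have "\<dots> = ev ?\<rho> (Delta_rational p (rep X))"
      unfolding d(2)[symmetric] eval_tensor_flin ev_flin ..
    also have "\<dots> = cf 1 (gf X) a Y"
      using ev_three_points(2)[OF x(1) x(1), of a Y] by (simp add: x(2) cf_def)
    finally show "phi gf gf (frag_extend ?b ?d) a Y = cf 1 (gf X) a Y" .
  qed
  ultimately show ?thesis by blast
qed

lemma hopf: "hopf_functions H gf bas pv"
proof unfold_locales
  show "cf i (gf g) = gf g" if "2 \<le> i" for i g
    using that by (simp add: fun_eq_iff cf_def gf_def)
next
  fix g assume g: "g \<in> carrier (total H)"
  obtain c where c: "Poly_Mapping.keys c \<subseteq> TM.words 1" "comult H g = cobar_class H (total_module H) 1 c" "phi gf gf c = cf 1 (gf g)"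
    using comult_spec[OF g] by blast
  show "Poly_Mapping.keys (rep (comult H g)) \<subseteq> cobar_words H (total_module H) 1"
    unfolding c(2) by (rule TM.keys_rep_class[OF c(1)])
  show "phi gf gf (rep (comult H g)) = cf 1 (gf g)"
    using TM.phi_rep_class[of 1 c] by (simp add: c(2,3) Pre_zero del: Pre.simps)
qed

sublocale hopf_functions H gf bas pv by (rule hopf)

end

section \<open>The comodule \<open>D\<^sup>0\<close>\<close>

text \<open>\<open>zpoly\<close> speaks of functions of one argument; this passes from functions of
  the pair (a, Y) to \<open>chainfun\<close>.\<close>

definition cur :: "((nat \<Rightarrow> rat) \<times> (nat \<Rightarrow> nat \<Rightarrow> rat) \<Rightarrow> rat) \<Rightarrow> chainfun" where
  "cur F a Y = F (a, Y)"

lemma cur_simps: "cur (\<lambda>z. F z + G z) = cur F + cur G" "cur (\<lambda>z. F z * G z) = cur F * cur G"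
  by (simp_all add: fun_eq_iff cur_def fun_ring_apply)

lemma zpoly_multiplier:
  assumes F: "F \<in> zpoly C G" and Z: "addsub Z"
    and c: "\<And>c f. c \<in> C \<Longrightarrow> f \<in> Z \<Longrightarrow> cur (\<lambda>_. c) * f \<in> Z"
    and g: "\<And>g f. g \<in> G \<Longrightarrow> f \<in> Z \<Longrightarrow> cur g * f \<in> Z"
  shows "f \<in> Z \<Longrightarrow> cur F * f \<in> Z"
  using F
proof (induction arbitrary: f)
  case (add F G)
  then show ?case by (simp add: cur_simps distrib_right addsub_add[OF Z])
next
  case (mult F G)
  then show ?case by (simp add: cur_simps mult.assoc)
qed (auto intro: c g)

context bp
begin

abbreviation "Rq \<equiv> subring_of_qpoly BP_rational"

lemma Rq_cring: "cring Rq"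
  unfolding BP_rational_def by (rule subring_cring[OF ratring_UNIV])

lemma Rq_uminus: "f \<in> BP_rational \<Longrightarrow> \<ominus>\<^bsub>Rq\<^esub> f = - f"
proof -
  assume f: "f \<in> BP_rational"
  interpret cring Rq by (rule Rq_cring)
  show ?thesis
    by (rule minus_equality) (use f polys_over_uminus[OF ratring_UNIV] in \<open>auto simp: BP_rational_def\<close>)
qed

lemma BP_rational: "f \<in> BP_rational \<Longrightarrow> g \<in> BP_rational \<Longrightarrow> f + g \<in> BP_rational"
  "f \<in> BP_rational \<Longrightarrow> g \<in> BP_rational \<Longrightarrow> f - g \<in> BP_rational"
  "f \<in> BP_rational \<Longrightarrow> g \<in> BP_rational \<Longrightarrow> f * g \<in> BP_rational"
  "f \<in> BP_rational \<Longrightarrow> - f \<in> BP_rational" "0 \<in> BP_rational" "1 \<in> BP_rational" "qconst c \<in> BP_rational"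
  unfolding BP_rational_def
  by (auto intro: polys_over_add polys_over_diff polys_over_mult polys_over_uminus polys_over_0 polys_over_1 polys_over_qconst ratring_UNIV)

lemma BP_sub_rational: "b \<in> BP p \<Longrightarrow> b \<in> BP_rational"
  unfolding BP_def BP_rational_def using polys_over_mono[of "Z_local p" UNIV "V ` {1..}" "V ` {1..}"] by auto

lemma pv_simps: "pv (f + g) = pv f + pv g" "pv (f - g) = pv f - pv g" "pv (f * g) = pv f * pv g" "pv (- f) = - pv f"
  "pv 0 = 0" "pv 1 = 1"
  by (simp_all add: fun_eq_iff pv_def fun_ring_apply ev_add ev_diff ev_mult ev_uminus)

lemma pv_inj:
  assumes f: "f \<in> BP_rational" and pv0: "pv f = 0" shows "f = 0"
proof (rule ev_eq_0)
  fix \<rho>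
  have "ev \<rho> f = ev (venv (pt p m (v_at \<rho>) (lam p m (v_at \<rho>))) (\<lambda>_. 0) (\<lambda>_. 0)) f"
    by (rule polys_over_ev_cong[OF f[unfolded BP_rational_def]]) (auto simp: pt_lam[OF p0])
  also have "\<dots> = pv f (v_at \<rho>) (\<lambda>_. lam p m (v_at \<rho>))" by (simp add: pv_def)
  finally show "ev \<rho> f = 0" by (simp add: pv0 fun_ring_apply)
qed

lemma Lf_rational: "(\<And>i. 1 \<le> i \<Longrightarrow> (\<lambda>s. v s i) \<in> zpoly UNIV G) \<Longrightarrow> (\<lambda>s. Lf p (v s) n) \<in> zpoly UNIV G"
proof (induction n rule: less_induct)
  case (less n)
  show ?case
  proof (cases "n = 0")
    case True
    then show ?thesis by (auto intro: zpoly.const)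
  next
    case False
    have "(\<lambda>s. 1 / of_nat p * (\<Sum>j<n. Lf p (v s) j * v s (n - j) ^ (p ^ j))) \<in> zpoly UNIV G"
      by (intro zpoly.mult[OF zpoly.const] zpoly_sum[OF ratring_UNIV] zpoly.mult zpoly_power[OF ratring_UNIV] less) (use less in auto)
    then show ?thesis using False by (subst Lf.simps) simp
  qed
qed

lemma hat_lambda_rational: "hat_lambda p m k \<in> BP_rational"
  unfolding BP_rational_def
proof (rule polys_over_if_zpoly[OF ratring_UNIV], fold pgens_def)
  let ?Z = "zpoly UNIV (pgens (V ` {1..}))"
  have L: "(\<lambda>\<rho>. Lf p (v_at \<rho>) n) \<in> ?Z" for n by (rule Lf_rational) (auto intro: zpoly_at)
  have L': "(\<lambda>\<rho>. Lf p (vtrunc m (v_at \<rho>)) n) \<in> ?Z" for n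
    by (rule Lf_rational) (auto simp: vtrunc_def intro!: zpoly_if zpoly_at zpoly.const)
  have "(\<lambda>\<rho>. lam p m (v_at \<rho>) k) \<in> ?Z" for k
  proof (induction k rule: less_induct)
    case (less k)
    show ?case
      by (subst lam.simps)
        (intro zpoly_diff[OF ratring_UNIV] zpoly_sum[OF ratring_UNIV] zpoly.mult zpoly_power[OF ratring_UNIV] L L' less, auto)
  qed
  then show "(\<lambda>\<rho>. ev \<rho> (hat_lambda p m k)) \<in> ?Z" by (simp add: ev_hat_lambda)
qed

definition D0set :: "qpoly set" where
  "D0set = generate_ring Rq (A_sub p m \<union> hat_lambda p m ` {1..})"

lemma D0_gens: "A_sub p m \<union> hat_lambda p m ` {1..} \<subseteq> BP_rational"
proof -
  have "A_sub p m \<subseteq> BP_rational"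
    unfolding A_sub_def BP_rational_def by (rule polys_over_mono) auto
  then show ?thesis using hat_lambda_rational by auto
qed

lemma D0_rational: "f \<in> D0set \<Longrightarrow> f \<in> BP_rational"
  using ring.generate_ring_in_carrier[OF cring.axioms(1)[OF Rq_cring], of "A_sub p m \<union> hat_lambda p m ` {1..}" f] D0_gens
  unfolding subring_simps D0set_def by blast

lemma D0_add: "f \<in> D0set \<Longrightarrow> g \<in> D0set \<Longrightarrow> f + g \<in> D0set"
  unfolding D0set_def using generate_ring.eng_add[of f Rq _ g] by simp
lemma D0_mult: "f \<in> D0set \<Longrightarrow> g \<in> D0set \<Longrightarrow> f * g \<in> D0set"
  unfolding D0set_def using generate_ring.eng_mult[of f Rq _ g] by simp
lemma D0_uminus: "f \<in> D0set \<Longrightarrow> - f \<in> D0set"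
  using Rq_uminus[OF D0_rational[of f]] generate_ring.a_inv[of f Rq "A_sub p m \<union> hat_lambda p m ` {1..}"]
  unfolding D0set_def by simp
lemma D0_1: "1 \<in> D0set"
  unfolding D0set_def using generate_ring.one[of Rq] by simp
lemma D0_diff: "f \<in> D0set \<Longrightarrow> g \<in> D0set \<Longrightarrow> f - g \<in> D0set"
  using D0_add[OF _ D0_uminus] by fastforce
lemma D0_0: "0 \<in> D0set"
  using D0_diff[OF D0_1 D0_1] by simp
lemma D0_A: "f \<in> A_sub p m \<Longrightarrow> f \<in> D0set"
  unfolding D0set_def by (rule generate_ring.incl) auto
lemma D0_hat_lambda: "k \<ge> 1 \<Longrightarrow> hat_lambda p m k \<in> D0set"
  unfolding D0set_def by (rule generate_ring.incl) auto

definition cgens :: "nat \<Rightarrow> ((nat \<Rightarrow> rat) \<times> (nat \<Rightarrow> nat \<Rightarrow> rat) \<Rightarrow> rat) set" where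
  "cgens s = {\<lambda>z. fst z i | i. 1 \<le> i \<and> i \<le> m} \<union> {\<lambda>z. snd z j k | j k. j \<le> s \<and> 1 \<le> k}"

abbreviation "CP s \<equiv> zpoly (Z_local p) (cgens s)"

lemma CP_a: "1 \<le> i \<Longrightarrow> i \<le> m \<Longrightarrow> (\<lambda>z. fst z i) \<in> CP s"
  by (rule zpoly.gen) (auto simp: cgens_def)
lemma CP_y: "j \<le> s \<Longrightarrow> 1 \<le> k \<Longrightarrow> (\<lambda>z. snd z j k) \<in> CP s"
  by (rule zpoly.gen) (auto simp: cgens_def)

lemmas CP_a' = CP_a[unfolded One_nat_def]
lemmas CP_y' = CP_y[unfolded One_nat_def]

lemma pv_a: "1 \<le> i \<Longrightarrow> i \<le> m \<Longrightarrow> pv (qvar (V i)) a Y = a i"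
  by (simp add: pv_def pt_low[OF p0])

lemma pv_lambda: "k \<ge> 1 \<Longrightarrow> pv (hat_lambda p m k) a Y = Y 0 k"
  by (simp add: pv_def ev_hat_lambda lam_pt[OF p0])

lemma D0_CP:
  assumes "f \<in> D0set" shows "(\<lambda>z. pv f (fst z) (snd z)) \<in> CP 0"
  using assms unfolding D0set_def
proof (induction rule: generate_ring.induct)
  case one
  then show ?case by (auto simp: pv_simps fun_ring_apply intro: zpoly.const ratring_1[OF Zp])
next
  case (incl h)
  then consider "h \<in> A_sub p m" | k where "h = hat_lambda p m k" "k \<ge> 1" by auto
  then show ?case
  proof cases
    case 1
    then show ?thesis
      unfolding pv_def A_sub_def
      by (rule zpoly_ev[OF Zp]) (auto simp: pt_low[OF p0] intro: CP_a CP_a')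
  next
    case (2 k)
    then show ?thesis by (auto simp: pv_lambda intro: CP_y)
  qed
next
  case (a_inv h)
  have "(\<lambda>z. (\<lambda>_. 0) z - pv h (fst z) (snd z)) \<in> CP 0"
    by (intro zpoly_diff[OF Zp] zpoly.const ratring_0[OF Zp] a_inv)
  then show ?case using Rq_uminus[OF D0_rational[unfolded D0set_def, OF a_inv(1)]] by (simp add: pv_simps fun_ring_apply)
next
  case (eng_add f g)
  then show ?case by (simp add: pv_simps fun_ring_apply zpoly.add)
next
  case (eng_mult f g)
  then show ?case by (simp add: pv_simps fun_ring_apply zpoly.mult)
qed

text \<open>The generators of D^0 are polynomials in a and the coordinate functions of Y 0, so with
  \<open>D0_CP\<close> the functions of D^0 are all p-locally integral polynomials in these
  coordinates.\<close>

lemma CP0_D0: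
  assumes "F \<in> CP 0" shows "\<exists>f\<in>D0set. pv f = cur F"
  using assms
proof induction
  case (const c)
  have "qconst c \<in> D0set" by (rule D0_A) (auto simp: A_sub_def polys_over_qconst const)
  then show ?case by (intro bexI) (auto simp: fun_eq_iff pv_def cur_def)
next
  case (gen g)
  then consider i where "g = (\<lambda>z. fst z i)" "1 \<le> i" "i \<le> m" | k where "g = (\<lambda>z. snd z 0 k)" "1 \<le> k"
    by (auto simp: cgens_def)
  then show ?case
  proof cases
    case (1 i)
    have "qvar (V i) \<in> D0set" by (rule D0_A) (use 1 in \<open>auto simp: A_sub_def polys_over_qvar[OF Zp]\<close>)
    then show ?thesis using 1 by (intro bexI) (auto simp: fun_eq_iff pv_a cur_def)
  next
    case (2 k)
    then show ?thesis using D0_hat_lambda by (intro bexI[of _ "hat_lambda p m k"]) (auto simp: fun_eq_iff pv_lambda cur_def)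
  qed
next
  case (add F G)
  then obtain f g where "f \<in> D0set" "g \<in> D0set" "pv f = cur F" "pv g = cur G" by blast
  then show ?case using D0_add by (intro bexI[of _ "f + g"]) (auto simp: pv_simps cur_simps)
next
  case (mult F G)
  then obtain f g where "f \<in> D0set" "g \<in> D0set" "pv f = cur F" "pv g = cur G" by blast
  then show ?case using D0_mult by (intro bexI[of _ "f * g"]) (auto simp: pv_simps cur_simps)
qed

lemma pt_CP: "n \<ge> 1 \<Longrightarrow> j \<le> s \<Longrightarrow> (\<lambda>z. pt p m (fst z) (snd z j) n) \<in> CP s"
  by (rule pt_integral[OF prime_p Zp m_pos]) (auto intro: CP_a CP_y CP_a' CP_y')

lemmas pt_CP' = pt_CP[unfolded One_nat_def]

text \<open>By \<open>pt_integral\<close> the v_n are integral polynomials in v_1, ..., v_m and the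
  \<lambda>^_k, so b has the same function as an element of D^0; \<open>pv_inj\<close> turns this
  into equality.\<close>

lemma BP_D0: assumes b: "b \<in> BP p" shows "b \<in> D0set"
proof -
  have "(\<lambda>z. pv b (fst z) (snd z)) \<in> CP 0"
    unfolding pv_def by (rule zpoly_ev[OF Zp b[unfolded BP_def]]) (auto intro: pt_CP pt_CP')
  then obtain f where f: "f \<in> D0set" "pv f = cur (\<lambda>z. pv b (fst z) (snd z))" using CP0_D0 by blast
  have "pv (f - b) = 0" using f(2) by (simp add: pv_simps fun_eq_iff cur_def fun_ring_apply)
  then have "f - b = 0" by (intro pv_inj BP_rational(2) D0_rational[OF f(1)] BP_sub_rational[OF b])
  then show ?thesis using f(1) by simp
qed

lemma BP_closed: "b \<in> BP p \<Longrightarrow> c \<in> BP p \<Longrightarrow> b + c \<in> BP p" "b \<in> BP p \<Longrightarrow> c \<in> BP p \<Longrightarrow> b - c \<in> BP p"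
  "b \<in> BP p \<Longrightarrow> c \<in> BP p \<Longrightarrow> b * c \<in> BP p" "b \<in> BP p \<Longrightarrow> - b \<in> BP p" "0 \<in> BP p" "1 \<in> BP p"
  "r \<in> Z_local p \<Longrightarrow> qconst r \<in> BP p" "n \<ge> 1 \<Longrightarrow> qvar (V n) \<in> BP p" "of_nat k \<in> BP p"
proof -
  show "of_nat k \<in> BP p"
    unfolding BP_def using polys_over_qconst[OF ratring_of_nat[OF Zp, of k]] by (simp add: qconst_def)
qed (auto simp: BP_def intro: polys_over_add polys_over_diff polys_over_mult polys_over_uminus polys_over_0 polys_over_1 polys_over_qconst polys_over_qvar Zp)

text \<open>The reason is that \<open>\<lambda>^\<^sub>k\<close> at the left point is integral over \<open>\<lambda>^\<close> at the right point and
  the \<open>t\<close>'s.\<close>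

lemma Pre_multiplier:
  assumes Z: "addsub Z" "\<And>d f. d \<in> D0set \<Longrightarrow> f \<in> Z \<Longrightarrow> pv d * f \<in> Z"
    and F: "F \<in> CP s" and f: "f \<in> Pre GG Z s"
  shows "cur F * f \<in> Pre GG Z s"
proof -
  have sc: "pv b * f \<in> Pre GG Z s" if "b \<in> BP p" "f \<in> Pre GG Z s" for b f s
    by (rule Pre_sc) (use that Z(2) BP_D0 in \<open>auto simp: base_H\<close>)
  have const: "cur (\<lambda>_. c) * f \<in> Pre GG Z s" if "c \<in> Z_local p" "f \<in> Pre GG Z s" for c f s
  proof -
    have "cur (\<lambda>_. c) = pv (qconst c)" by (simp add: fun_eq_iff cur_def pv_def)
    then show ?thesis using sc[of "qconst c" f s] that BP_closed(7) by simp
  qed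
  have a: "cur (\<lambda>z. fst z i) * f \<in> Pre GG Z s" if "1 \<le> i" "i \<le> m" "f \<in> Pre GG Z s" for i f s
  proof -
    have "cur (\<lambda>z. fst z i) = pv (qvar (V i))" using that by (simp add: fun_eq_iff cur_def pv_a)
    then show ?thesis using sc[of "qvar (V i)" f s] that BP_closed(8) by simp
  qed
  have "\<forall>g\<in>cgens s. \<forall>f\<in>Pre GG Z s. cur g * f \<in> Pre GG Z s"
  proof (induction s)
    case 0
    show ?case
    proof (intro ballI)
      fix g f assume g: "g \<in> cgens 0" and f: "f \<in> Pre GG Z 0"
      then consider i where "g = (\<lambda>z. fst z i)" "1 \<le> i" "i \<le> m" | k where "g = (\<lambda>z. snd z 0 k)" "1 \<le> k"
        by (auto simp: cgens_def)
      then show "cur g * f \<in> Pre GG Z 0"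
      proof cases
        case (1 i)
        then show ?thesis using a f by blast
      next
        case (2 k)
        have "cur g = pv (hat_lambda p m k)" using 2 by (simp add: fun_eq_iff cur_def pv_lambda)
        then show ?thesis using Z(2)[OF D0_hat_lambda[OF 2(2)]] f by simp
      qed
    qed
  next
    case (Suc s)
    have as: "addsub (Pre GG Z (Suc s))" by (rule addsub_Pre[OF Z(1)])
    have y: "cur (\<lambda>z. snd z (Suc j) k) * f \<in> Pre GG Z (Suc s)" if jk: "j \<le> s" "1 \<le> k" and f: "f \<in> Pre GG Z (Suc s)" for j k f
      using f[unfolded Pre.simps]
    proof (rule asp_hom)
      fix x assume "x \<in> {g * Sh f |g f. g \<in> GG \<and> f \<in> Pre GG Z s}"
      then obtain g f where x: "x = g * Sh f" "g \<in> GG" "f \<in> Pre GG Z s" by blast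
      have "cur (\<lambda>z. snd z (Suc j) k) = Sh (cur (\<lambda>z. snd z j k))" by (simp add: fun_eq_iff cur_def Sh_def)
      then have eq: "cur (\<lambda>z. snd z (Suc j) k) * x = g * Sh (cur (\<lambda>z. snd z j k) * f)"
        by (simp add: x(1) mult.left_commute)
      have "cur (\<lambda>z. snd z j k) * f \<in> Pre GG Z s" using Suc jk x(3) by (auto simp: cgens_def)
      then show "cur (\<lambda>z. snd z (Suc j) k) * x \<in> Pre GG Z (Suc s)" unfolding eq by (rule PreI[OF x(2)])
    qed (auto simp: right_diff_distrib intro: addsub_0[OF as] addsub_diff[OF as] simp del: Pre.simps)
    have t: "cur (\<lambda>z. tseq p (pt p m (fst z) (snd z 0)) (pt p m (fst z) (snd z 1)) n) * f \<in> Pre GG Z (Suc s)" if f: "f \<in> Pre GG Z (Suc s)" for n f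
      using f[unfolded Pre.simps]
    proof (rule asp_hom)
      fix x assume "x \<in> {g * Sh f |g f. g \<in> GG \<and> f \<in> Pre GG Z s}"
      then obtain g f where x: "x = gf g * Sh f" "g \<in> carrier (total H)" "f \<in> Pre GG Z s" by blast
      have "cur (\<lambda>z. tseq p (pt p m (fst z) (snd z 0)) (pt p m (fst z) (snd z 1)) n) = gf (prj (t_gen n))"
        by (cases "n = 0") (auto simp: fun_eq_iff cur_def gf_prj ev_t_gen penv_def)
      then have eq: "cur (\<lambda>z. tseq p (pt p m (fst z) (snd z 0)) (pt p m (fst z) (snd z 1)) n) * x = gf (prj (t_gen n) \<otimes>\<^bsub>total H\<^esub> g) * Sh f"
        by (simp add: x(1) gf_mult[OF prj_carrier[OF t_gen_BPBP] x(2)] mult.assoc)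
      show "cur (\<lambda>z. tseq p (pt p m (fst z) (snd z 0)) (pt p m (fst z) (snd z 1)) n) * x \<in> Pre GG Z (Suc s)"
        unfolding eq by (rule PreI[OF _ x(3)]) (intro imageI mult_closed prj_carrier t_gen_BPBP x(2))
    qed (auto simp: right_diff_distrib intro: addsub_0[OF as] addsub_diff[OF as] simp del: Pre.simps)
    \<comment> \<open>The coordinates of Y 1 act on the remaining tensor, where the induction
      hypothesis holds, and the values of t act on the first factor as elements of \<Gamma>.
      Multiplication by the coordinates of Y 0 is reduced to these.\<close>
    let ?G = "{\<lambda>z. fst z i | i. 1 \<le> i \<and> i \<le> m} \<union> {\<lambda>z. snd z (Suc 0) k | k. 1 \<le> k}
      \<union> {\<lambda>z. tseq p (pt p m (fst z) (snd z 0)) (pt p m (fst z) (snd z 1)) n | n. True}"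
    have lz: "(\<lambda>z. snd z 0 k) \<in> zpoly (Z_local p) ?G" if "1 \<le> k" for k
      by (rule lam_integral[OF prime_p Zp m_pos, where a = fst and w = "\<lambda>z. snd z 1"])
        (use that in \<open>auto intro: zpoly.gen\<close>)
    have lam: "cur (\<lambda>z. snd z 0 k) * f \<in> Pre GG Z (Suc s)" if "1 \<le> k" "f \<in> Pre GG Z (Suc s)" for k f
    proof (rule zpoly_multiplier[OF lz[OF that(1)] as const _ that(2)])
      fix g f assume g: "g \<in> ?G" and f: "f \<in> Pre GG Z (Suc s)"
      from g consider i where "g = (\<lambda>z. fst z i)" "1 \<le> i" "i \<le> m" | k where "g = (\<lambda>z. snd z (Suc 0) k)" "1 \<le> k"
        | n where "g = (\<lambda>z. tseq p (pt p m (fst z) (snd z 0)) (pt p m (fst z) (snd z 1)) n)"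
        by blast
      then show "cur g * f \<in> Pre GG Z (Suc s)"
        by cases (use a[OF _ _ f] y[OF _ _ f, of 0] t[OF f] in auto)
    qed
    show ?case
    proof (intro ballI)
      fix g f assume g: "g \<in> cgens (Suc s)" and f: "f \<in> Pre GG Z (Suc s)"
      from g consider i where "g = (\<lambda>z. fst z i)" "1 \<le> i" "i \<le> m" | j k where "g = (\<lambda>z. snd z j k)" "j \<le> Suc s" "1 \<le> k"
        by (auto simp: cgens_def)
      then show "cur g * f \<in> Pre GG Z (Suc s)"
      proof cases
        case (1 i)
        then show ?thesis using a f by blast
      next
        case (2 j k)
        then show ?thesis using lam[OF _ f] y[OF _ _ f] by (cases j) auto
      qed
    qed
  qed
  then show ?thesis
    using zpoly_multiplier[OF F addsub_Pre[OF Z(1)] const _ f] by blast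
qed

section \<open>Comodule structures on \<rat> \<otimes> BP_* and D^0\<close>

lemma rational_module_simps [simp]:
  "carrier rational_module = BP_rational" "add rational_module = (+)" "zero rational_module = 0" "smult rational_module = (*)"
  by (simp_all add: rational_module_def subring_of_qpoly_def ring.defs module.defs)

lemma rational_comod_simps [simp]:
  "carrier (rational_comod p k) = BP_rational" "add (rational_comod p k) = (+)" "zero (rational_comod p k) = 0" "smult (rational_comod p k) = (*)"
  by (simp_all add: rational_comod_def rational_module_def subring_of_qpoly_def ring.defs module.defs comodule.defs)

lemma rational_model: "cobar_model H gf bas pv rational_module pv {0}"
proof (unfold_locales, goal_cases)
  case 1 show ?case by (rule addsub_zero) next
  case (7 x) then show ?case by (intro bexI[of _ "- x"]) (auto intro: BP_rational) next
  case (6 b x) then show ?case by (auto simp: base_H intro: BP_rational BP_sub_rational) next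
  case (10 x) then show ?case using pv_inj by simp
qed (auto simp: BP_rational pv_simps)

lemma D0_model: "cobar_model H gf bas pv (rational_module\<lparr>carrier := D0set\<rparr>) pv {0}"
proof (unfold_locales, goal_cases)
  case 1 show ?case by (rule addsub_zero) next
  case (7 x) then show ?case by (intro bexI[of _ "- x"]) (auto intro: D0_uminus) next
  case (6 b x) then show ?case by (auto simp: base_H intro: D0_mult BP_D0) next
  case (10 x) then show ?case using pv_inj D0_rational by simp
qed (auto simp: D0_add D0_0 pv_simps)

lemma exists_denominator: assumes "f \<in> BP_rational" shows "\<exists>N::nat. N > 0 \<and> of_nat N * f \<in> BP p"
proof -
  have "\<exists>N::nat. N > 0 \<and> (\<forall>e\<in>E. of_nat N * Poly_Mapping.lookup f e \<in> Z_local p)" if "finite E" for E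
    using that
  proof induction
    case empty
    then show ?case by (intro exI[of _ 1]) auto
  next
    case (insert e E)
    then obtain N :: nat where N: "N > 0" "\<And>e. e \<in> E \<Longrightarrow> of_nat N * Poly_Mapping.lookup f e \<in> Z_local p" by blast
    obtain a b where ab: "quotient_of (Poly_Mapping.lookup f e) = (a, b)" by (cases "quotient_of (Poly_Mapping.lookup f e)")
    have b: "b > 0" using quotient_of_denom_pos[OF ab] .
    have l: "Poly_Mapping.lookup f e = of_int a / of_int b" using quotient_of_div[OF ab] .
    have "of_nat (N * nat b) * Poly_Mapping.lookup f e = of_nat N * of_int a" using b l by simp
    then have "of_nat (N * nat b) * Poly_Mapping.lookup f e \<in> Z_local p"
      by (simp only:) (intro ratring_mult[OF Zp] ratring_of_nat[OF Zp] ratring_of_int[OF Zp])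
    moreover have "of_nat (N * nat b) * Poly_Mapping.lookup f e' \<in> Z_local p" if "e' \<in> E" for e'
      using ratring_mult[OF Zp ratring_of_nat[OF Zp, of "nat b"] N(2)[OF that]] by (simp add: mult.assoc mult.left_commute)
    ultimately show ?case using N(1) b by (intro exI[of _ "N * nat b"]) auto
  qed
  from this[OF finite_keys] obtain N :: nat where N: "N > 0" "\<And>e. e \<in> Poly_Mapping.keys f \<Longrightarrow> of_nat N * Poly_Mapping.lookup f e \<in> Z_local p" by blast
  have "of_nat N * f = (\<Sum>e\<in>Poly_Mapping.keys f. Poly_Mapping.single e (of_nat N * Poly_Mapping.lookup f e))"
    by (subst poly_mapping_sum_single[of f])
      (simp add: sum_distrib_left single_of_nat[symmetric] mult_single del: single_of_nat)
  also have "\<dots> \<in> BP p"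
    unfolding BP_def by (intro polys_over_sum[OF Zp] polys_over_single N) (use assms in \<open>auto simp: BP_rational_def polys_over_def\<close>)
  finally show ?thesis using N(1) by blast
qed

lemma cf_1_pv: "cf 1 (pv f) = pv f"
  by (simp add: fun_eq_iff cf_def pv_def)

abbreviation "RM \<equiv> rational_comod p (Suc m)"

lemma rational_comod_model: "cobar_model H gf bas pv RM pv {0}"
  by (rule cobar_model_cong[OF rational_model]) simp_all

text \<open>Constants are not affected by \<open>Sh\<close>, so the factors N and 1/N cancel; N can
  be chosen by \<open>exists_denominator\<close>.\<close>

lemma coact_rational:
  assumes x: "x \<in> BP_rational"
  shows "coact RM x \<in> carrier (cobar_tensor H RM 1)" "phi gf pv (rep (coact RM x)) = pv x"
proof -
  interpret M: cobar_model H gf bas pv RM pv "{0}" by (rule rational_comod_model)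
  define N where "N = (SOME N::nat. N > 0 \<and> of_nat N * x \<in> BP p)"
  have N: "N > 0" "of_nat N * x \<in> BP p"
    using someI_ex[OF exists_denominator[OF x]] by (auto simp: N_def)
  let ?c = "frag_of ([prj (of_nat N * x)], qconst (1 / of_nat N))"
  have cl: "cobar_class H rational_module 1 = cobar_class H RM 1"
    by (rule cobar_class_cong) simp_all
  have "coact RM x = cobar_class H rational_module 1 ?c"
    by (simp add: rational_comod_def comodule.defs module.defs Let_def N_def lunit_H)
  then have co: "coact RM x = cobar_class H RM 1 ?c" by (simp only: cl)
  have k: "Poly_Mapping.keys ?c \<subseteq> M.words 1"
    using N BP_rational(7) by (auto simp: keys_frag_of cobar_words_def intro!: prj_carrier BP_BPBP)
  show "coact RM x \<in> carrier (cobar_tensor H RM 1)" unfolding co by (rule M.class_carrier[OF k])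
  have "phi gf pv ?c = gf (prj (of_nat N * x)) * Sh (pv (qconst (1 / of_nat N)))" by (simp add: phi_def wfn_def)
  also have "\<dots> = pv (of_nat N * x) * pv (qconst (1 / of_nat N))"
    by (simp add: gf_lunit'[OF N(2)] fun_eq_iff fun_ring_apply Sh_def pv_def)
  also have "\<dots> = pv x"
    using N(1) by (simp add: fun_eq_iff fun_ring_apply pv_def ev_mult ev_of_nat)
  finally have "phi gf pv ?c = pv x" .
  then show "phi gf pv (rep (coact RM x)) = pv x"
    using M.phi_rep_class[of 1 ?c] unfolding co by (simp add: Pre_zero del: Pre.simps)
qed

abbreviation "DM \<equiv> D0_comod p m"

lemma DM_simps [simp]: "carrier DM = D0set" "add DM = (+)" "zero DM = 0" "smult DM = (*)"
  by (simp_all add: D0_comod_def subcomodule_def D0set_def)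

lemma DM_sub_model: "cobar_model H gf bas pv (RM\<lparr>carrier := D0set\<rparr>) pv {0}"
  by (rule cobar_model_cong[OF D0_model]) simp_all

lemma DM_model: "cobar_model H gf bas pv DM pv {0}"
  by (rule cobar_model_cong[OF D0_model]) simp_all

text \<open>The coaction has to be lifted to \<Gamma> \<otimes> D^0. Its function is
  \<open>pv x\<close>, a polynomial in the coordinates of Y 0; multiplying the function of 1
  \<otimes> 1 by it does not leave \<Gamma> \<otimes> D^0 by \<open>Pre_multiplier\<close>, and this
  provides the lift.\<close>

lemma coact_D0:
  assumes x: "x \<in> D0set"
  shows "Poly_Mapping.keys (rep (coact DM x)) \<subseteq> cobar_words H DM 1" "phi gf pv (rep (coact DM x)) = cf 1 (pv x)"
proof -
  interpret S: cobar_model H gf bas pv "RM\<lparr>carrier := D0set\<rparr>" pv "{0}" by (rule DM_sub_model)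
  have Img: "S.Img = pv ` D0set" by (auto simp: S.Img_def)
  have CP1: "(\<lambda>z. pv x (fst z) (snd z)) \<in> CP 1"
    using zpoly_subst[OF D0_CP[OF x], of "\<lambda>z. z" "cgens 1"] by (auto simp: cgens_def intro: zpoly.gen)
  have "cur (\<lambda>z. pv x (fst z) (snd z)) * 1 \<in> Pre GG S.Img 1"
  proof (rule Pre_multiplier[OF S.Img_addsub _ CP1])
    show "pv d * f \<in> S.Img" if "d \<in> D0set" "f \<in> S.Img" for d f
      using that D0_mult by (auto simp: Img pv_simps(3)[symmetric])
    have "1 \<in> S.Img" using D0_1 pv_simps(6) by (force simp: Img)
    then have "gf \<one>\<^bsub>total H\<^esub> * Sh 1 \<in> Pre GG S.Img (Suc 0)" by (intro PreI) (auto simp: one_closed)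
    then show "1 \<in> Pre GG S.Img 1" by (simp add: gf_one)
  qed
  then have "pv x \<in> Pre GG S.Img 1" by (simp add: cur_def[abs_def])
  then obtain c where c: "Poly_Mapping.keys c \<subseteq> S.words 1" "phi gf pv c = pv x"
    using S.phi_surj[of "pv x" 1] by (auto simp: Pre_zero simp del: Pre.simps)
  have co: "coact DM x = cobar_class H (RM\<lparr>carrier := D0set\<rparr>) 1 c"
    unfolding D0_comod_def Suc_eq_plus1[symmetric] D0set_def[symmetric]
    using coact_subcomodule[OF rational_comod_model DM_sub_model _ x coact_rational[OF D0_rational[OF x]] c] D0_rational
    by auto
  have "cobar_words H DM 1 = S.words 1" by (rule cobar_words_cong) simp
  then show "Poly_Mapping.keys (rep (coact DM x)) \<subseteq> cobar_words H DM 1"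
    using S.keys_rep_class[OF c(1)] unfolding co by simp
  show "phi gf pv (rep (coact DM x)) = cf 1 (pv x)"
    unfolding co cf_1_pv using S.phi_rep_class[of 1 c] c(2) by (simp add: Pre_zero del: Pre.simps)
qed

lemma DM_comodule: "comodule_model H gf bas pv DM pv {0}"
proof -
  interpret cobar_model H gf bas pv DM pv "{0}" by (rule DM_model)
  show ?thesis
    by unfold_locales (auto simp: coact_D0 Pre_zero simp del: Pre.simps dest: subsetD[OF coact_D0(1)])
qed

lemma BP_addsub: "addsub (pv ` BP p)"
proof -
  have "0 \<in> pv ` BP p" using pv_simps(5) BP_closed(5) by (metis image_eqI)
  moreover have "pv b - pv c \<in> pv ` BP p" if "b \<in> BP p" "c \<in> BP p" for b c
    using BP_closed(2)[OF that] pv_simps(2) by (metis image_eqI)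
  ultimately show ?thesis by (auto simp: addsub_def)
qed

lemma cf_BP: "x \<in> pv ` BP p \<Longrightarrow> cf 1 x \<in> Pre GG (pv ` BP p) 1"
proof -
  assume "x \<in> pv ` BP p"
  then obtain b where b: "b \<in> BP p" "x = pv b" by blast
  have "gf (prj b) * Sh (pv 1) \<in> Pre GG (pv ` BP p) (Suc 0)"
    using b(1) BP_closed(6) by (intro PreI imageI prj_carrier BP_BPBP) auto
  then show ?thesis using b by (simp add: cf_1_pv[unfolded One_nat_def] gf_lunit' pv_simps)
qed

end

section \<open>The comodule \<open>T\<^sub>m\<^sup>(\<^sup>i\<^sup>)\<close>\<close>

text \<open>Dependence on a and the first point only. It separates the coefficients in D^0 or E^1
  from t_(m+1), which varies with Y 1.\<close>

definition first_local :: "chainfun \<Rightarrow> bool" where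
  "first_local f \<longleftrightarrow> (\<forall>a Y Z. Y 0 = Z 0 \<longrightarrow> f a Y = f a Z)"

locale bp_T = bp p m for p m :: nat + fixes i :: nat
begin

abbreviation "q \<equiv> p ^ i"

text \<open>The function of t_(m+1), by \<open>tseq_first\<close>.\<close>

definition th :: chainfun where
  "th a Y = Y 1 1 - Y 0 1"

lemma gf_t: "gf (prj (t_gen (Suc m) ^ l)) = th ^ l"
proof -
  have *: "(f ^ l) a Y = f a Y ^ l" for f :: chainfun and a Y
    by (induction l) (auto simp: fun_ring_apply)
  show ?thesis
    by (simp add: fun_eq_iff gf_prj ev_power ev_t_gen penv_def tseq_first[OF p0] * th_def)
qed

definition tpol :: "(nat \<Rightarrow> qpoly) \<Rightarrow> qpoly" where
  "tpol a = (\<Sum>l<q. a l * t_gen (Suc m) ^ l)"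

definition Tset :: "qpoly set set" where
  "Tset = {prj (tpol a) | a. \<forall>l. a l \<in> BP p}"

text \<open>The functions of T \<otimes> N when \<open>X\<close> holds those of N, as T is free on
  the powers of t_(m+1) below q.\<close>

definition tsp :: "chainfun set \<Rightarrow> chainfun set" where
  "tsp X = {\<Sum>l<q. th ^ l * k l | k. \<forall>l. k l \<in> X}"

lemma BPBP_sum: "(\<And>j. j \<in> I \<Longrightarrow> f j \<in> BPBP p) \<Longrightarrow> sum f I \<in> BPBP p"
  by (induction I rule: infinite_finite_induct) (auto intro: BPBP_0 BPBP_add)

lemma t_power_BPBP: "b \<in> BP p \<Longrightarrow> b * t_gen (Suc m) ^ l \<in> BPBP p"
  by (intro BPBP_mult BPBP_power t_gen_BPBP BP_BPBP)

lemma tpol_BPBP: "(\<And>l. a l \<in> BP p) \<Longrightarrow> tpol a \<in> BPBP p"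
  unfolding tpol_def by (intro BPBP_sum t_power_BPBP)

lemma gf_prj_add: "gf (prj (x + y)) = gf (prj x) + gf (prj y)"
  by (simp add: fun_eq_iff gf_prj fun_ring_apply ev_add)
lemma gf_prj_mult: "gf (prj (x * y)) = gf (prj x) * gf (prj y)"
  by (simp add: fun_eq_iff gf_prj fun_ring_apply ev_mult)
lemma gf_prj_sum: "gf (prj (sum f I)) = (\<Sum>j\<in>I. gf (prj (f j)))"
  by (induction I rule: infinite_finite_induct) (auto simp: gf_zero gf_prj_add)

lemma gf_term: "b \<in> BP p \<Longrightarrow> gf (prj (b * t_gen (Suc m) ^ l)) = th ^ l * pv b"
  by (simp add: gf_prj_mult gf_t gf_lunit' mult.commute)

lemma gf_tpol: "(\<And>l. a l \<in> BP p) \<Longrightarrow> gf (prj (tpol a)) = (\<Sum>l<q. th ^ l * pv (a l))"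
  by (simp add: tpol_def gf_prj_sum gf_term)

lemma Tset_carrier: "Tset \<subseteq> carrier (total H)"
  using tpol_BPBP by (auto simp: Tset_def intro!: prj_carrier)

lemma gf_Tset: "gf ` Tset = tsp (pv ` BP p)"
proof (intro equalityI subsetI)
  fix f assume "f \<in> gf ` Tset"
  then obtain a where "\<forall>l. a l \<in> BP p" "f = gf (prj (tpol a))" by (auto simp: Tset_def)
  then show "f \<in> tsp (pv ` BP p)" unfolding tsp_def by (intro CollectI exI[of _ "\<lambda>l. pv (a l)"]) (auto simp: gf_tpol)
next
  fix f assume "f \<in> tsp (pv ` BP p)"
  then obtain k where k: "\<forall>l. k l \<in> pv ` BP p" "f = (\<Sum>l<q. th ^ l * k l)" by (auto simp: tsp_def)
  then have "\<forall>l. \<exists>b. b \<in> BP p \<and> k l = pv b" by blast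
  then obtain a where a: "\<And>l. a l \<in> BP p" "\<And>l. k l = pv (a l)" by metis
  have "f = gf (prj (tpol a))" using a k by (simp add: gf_tpol)
  then show "f \<in> gf ` Tset" using a(1) by (auto simp: Tset_def)
qed

lemma tsp_addsub: assumes X: "addsub X" shows "addsub (tsp X)"
  unfolding addsub_def
proof (intro conjI ballI)
  show "0 \<in> tsp X" unfolding tsp_def using addsub_0[OF X] by (intro CollectI exI[of _ "\<lambda>_. 0"]) auto
  fix f g assume "f \<in> tsp X" "g \<in> tsp X"
  then obtain k l where "\<forall>j. k j \<in> X" "f = (\<Sum>j<q. th ^ j * k j)" "\<forall>j. l j \<in> X" "g = (\<Sum>j<q. th ^ j * l j)" by (auto simp: tsp_def)
  then show "f - g \<in> tsp X" unfolding tsp_def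
    using addsub_diff[OF X] by (intro CollectI exI[of _ "\<lambda>j. k j - l j"]) (auto simp: sum_subtractf right_diff_distrib)
qed

lemma tsp_power:
  assumes "addsub X" "x \<in> X" "l < q" shows "th ^ l * x \<in> tsp X"
proof -
  have "(\<Sum>j<q. th ^ j * (if j = l then x else 0)) = th ^ l * x"
    using assms(3) by (subst sum.remove[of _ l]) auto
  then show ?thesis unfolding tsp_def using assms(2) addsub_0[OF assms(1)]
    by (intro CollectI exI[of _ "\<lambda>j. if j = l then x else 0"]) auto
qed

lemma tsp_mult:
  assumes "f \<in> tsp X" "\<And>x. x \<in> X \<Longrightarrow> b * x \<in> Z" shows "b * f \<in> tsp Z"
proof -
  obtain k where k: "\<forall>l. k l \<in> X" "f = (\<Sum>l<q. th ^ l * k l)" using assms(1) by (auto simp: tsp_def)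
  have "b * f = (\<Sum>l<q. th ^ l * (b * k l))" by (simp add: k(2) sum_distrib_left mult.left_commute)
  then show ?thesis using k(1) assms(2) unfolding tsp_def by (intro CollectI exI[of _ "\<lambda>l. b * k l"]) auto
qed

lemma tsp_T_mult:
  assumes X: "addsub X" "\<And>b x. b \<in> BP p \<Longrightarrow> x \<in> X \<Longrightarrow> pv b * x \<in> X" and t: "t \<in> Tset" and x: "x \<in> X"
  shows "gf t * x \<in> tsp X"
proof -
  obtain a where a: "\<And>l. a l \<in> BP p" "t = prj (tpol a)" using t by (auto simp: Tset_def)
  have "gf t * x = (\<Sum>l<q. th ^ l * (pv (a l) * x))" by (simp add: a gf_tpol sum_distrib_right mult.assoc)
  then show ?thesis using X(2) a(1) x unfolding tsp_def by (intro CollectI exI[of _ "\<lambda>l. pv (a l) * x"]) auto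
qed

lemma tsp_zero: "tsp {0} = {0}"
proof -
  have "(\<Sum>l<q. th ^ l * k l) = 0" if "\<forall>l. k l = (0::chainfun)" for k using that by simp
  then have "tsp {0} \<subseteq> {0}" unfolding tsp_def by auto
  then show ?thesis using addsub_0[OF tsp_addsub[OF addsub_zero]] by blast
qed

lemma tsp_mono: "X \<subseteq> Z \<Longrightarrow> tsp X \<subseteq> tsp Z"
  unfolding tsp_def by blast

text \<open>With Y 0 fixed and Y 1 moving, the coefficients are constant and \<open>th\<close> takes
  every rational value, so a polynomial in one variable vanishes identically.\<close>

lemma th_independent:
  assumes f: "\<And>l. first_local (f l)" and sum0: "(\<Sum>l<q. th ^ l * f l) = 0" and l: "l < q"
  shows "f l = 0"
proof (intro ext)
  fix a Y
  \<comment> \<open>Powers of one variable are encoded as monomials over \<open>unit\<close>, so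
    that \<open>mon_independent\<close> applies.\<close>
  let ?e = "\<lambda>l. Poly_Mapping.single () l"
  have inj: "inj_on ?e {..<q}" by (rule inj_onI) (metis lookup_single_eq)
  have pw: "(g ^ l) a Y = g a Y ^ l" for g :: chainfun and a Y l
    by (induction l) (auto simp: fun_ring_apply)
  have "(\<Sum>e\<in>?e ` {..<q}. f (Poly_Mapping.lookup e ()) a Y * mon \<rho> e) = 0" for \<rho> :: "unit \<Rightarrow> rat"
  proof -
    let ?Y = "Y(1 := \<lambda>_. Y 0 1 + \<rho> ())"
    have Y0: "?Y 0 = Y 0" by simp
    have "(\<Sum>e\<in>?e ` {..<q}. f (Poly_Mapping.lookup e ()) a Y * mon \<rho> e) = (\<Sum>l<q. f l a Y * \<rho> () ^ l)"
    proof (subst sum.reindex[OF inj], rule sum.cong[OF refl], unfold o_def)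
      fix l show "f (Poly_Mapping.lookup (?e l) ()) a Y * mon \<rho> (?e l) = f l a Y * \<rho> () ^ l"
        by (cases "l = 0") (auto simp: mon_def)
    qed
    also have "\<dots> = (\<Sum>l<q. th ^ l * f l) a ?Y"
      unfolding sum_fun_apply fun_ring_apply pw
    proof (rule sum.cong[OF refl])
      fix l have "f l a ?Y = f l a Y" using f Y0 unfolding first_local_def by blast
      then show "f l a Y * \<rho> () ^ l = th a ?Y ^ l * f l a ?Y" by (simp add: th_def)
    qed
    finally show ?thesis by (simp add: sum0 fun_ring_apply)
  qed
  from mon_independent[OF _ this, of "?e l"] l show "f l a Y = 0 a Y" by (auto simp: fun_ring_apply)
qed

text \<open>t_(m+1) is primitive in \<Gamma>(m+1): differences of the first coordinate telescope
  along the chain.\<close>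

lemma cf_th: "cf 1 th = th + Sh th"
  by (simp add: fun_eq_iff cf_def th_def Sh_def fun_ring_apply)

lemma cf_power: "cf j (f ^ n) = cf j f ^ n"
  by (induction n) auto
lemma Sh_power: "Sh (f ^ n) = Sh f ^ n"
  by (induction n) auto

text \<open>\<open>\<Delta>(t\<^sup>l)\<close> has its right factors again in the span of the powers of \<open>t\<close>.\<close>

lemma cf_tsp_Pre:
  assumes X: "addsub X" and l: "l < q" and u: "u \<in> Pre GG X 1"
  shows "cf 1 (th ^ l) * u \<in> Pre GG (tsp X) 1"
proof -
  have as: "addsub (Pre GG (tsp X) (Suc 0))" by (rule addsub_Pre[OF tsp_addsub[OF X]])
  have "cf 1 (th ^ l) * u \<in> Pre GG (tsp X) (Suc 0)"
    using u[unfolded One_nat_def Pre.simps]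
  proof (rule asp_hom)
    fix x assume "x \<in> {g * Sh f |g f. g \<in> GG \<and> f \<in> X}"
    then obtain g f where x: "x = gf g * Sh f" "g \<in> carrier (total H)" "f \<in> X" by auto
    have "cf 1 (th ^ l) = (\<Sum>b\<le>l. of_nat (l choose b) * Sh (th ^ b) * th ^ (l - b))"
      unfolding cf_power cf_th by (subst add.commute) (simp add: binomial_ring Sh_power)
    then have "cf 1 (th ^ l) * x = (\<Sum>b\<le>l. of_nat (l choose b) * Sh (th ^ b) * th ^ (l - b) * x)"
      by (simp add: sum_distrib_right)
    also have "\<dots> = (\<Sum>b\<le>l. of_int (int (l choose b)) * (gf (prj (t_gen (Suc m) ^ (l - b)) \<otimes>\<^bsub>total H\<^esub> g) * Sh (th ^ b * f)))"
      by (rule sum.cong[OF refl])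
        (simp add: x(1) gf_mult[OF prj_carrier[OF BPBP_power[OF t_gen_BPBP]] x(2)] gf_t ac_simps)
    also have "\<dots> \<in> Pre GG (tsp X) (Suc 0)"
    proof (intro addsub_sum[OF as] addsub_of_int[OF as] PreI imageI mult_closed prj_carrier BPBP_power t_gen_BPBP x(2))
      fix b assume "b \<in> {..l}"
      then have "th ^ b * f \<in> tsp X" using l by (intro tsp_power[OF X x(3)]) auto
      then show "th ^ b * f \<in> Pre GG (tsp X) 0" by simp
    qed
    finally show "cf 1 (th ^ l) * x \<in> Pre GG (tsp X) (Suc 0)" .
  qed (auto simp: right_diff_distrib intro: addsub_0[OF as] addsub_diff[OF as] simp del: Pre.simps)
  then show ?thesis by simp
qed

lemma cf_T_Pre:
  assumes X: "addsub X" "\<And>b x. b \<in> BP p \<Longrightarrow> x \<in> X \<Longrightarrow> pv b * x \<in> X" and t: "t \<in> Tset" and u: "u \<in> Pre GG X 1"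
  shows "cf 1 (gf t) * u \<in> Pre GG (tsp X) 1"
proof -
  obtain a where a: "\<And>l. a l \<in> BP p" "t = prj (tpol a)" using t by (auto simp: Tset_def)
  have "cf 1 (gf t) * u = (\<Sum>l<q. cf 1 (th ^ l) * (pv (a l) * u))"
    by (simp add: a gf_tpol cf_sum cf_1_pv[unfolded One_nat_def] sum_distrib_right mult.assoc)
  also have "\<dots> \<in> Pre GG (tsp X) 1"
    by (intro addsub_sum[OF addsub_Pre[OF tsp_addsub[OF X(1)]]] cf_tsp_Pre[OF X(1)] Pre_sc u)
      (use X(2) a(1) in \<open>auto simp: base_H\<close>)
  finally show ?thesis .
qed

lemma cf_tsp:
  assumes X: "addsub X" and cf: "\<And>x. x \<in> X \<Longrightarrow> cf 1 x \<in> Pre GG X 1" and f: "f \<in> tsp X"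
  shows "cf 1 f \<in> Pre GG (tsp X) 1"
proof -
  obtain k where k: "\<forall>l. k l \<in> X" "f = (\<Sum>l<q. th ^ l * k l)" using f by (auto simp: tsp_def)
  have "cf 1 f = (\<Sum>l<q. cf 1 (th ^ l) * cf 1 (k l))" by (simp add: k(2) cf_sum)
  also have "\<dots> \<in> Pre GG (tsp X) 1"
    by (intro addsub_sum[OF addsub_Pre[OF tsp_addsub[OF X]]] cf_tsp_Pre[OF X]) (use cf k(1) in auto)
  finally show ?thesis .
qed

abbreviation "TC \<equiv> T_comod p m i"
abbreviation "TT \<equiv> total_comodule H"

lemma total_comodule_simps [simp]:
  "carrier TT = carrier (total H)" "add TT = add (total H)" "zero TT = zero (total H)"
  "smult TT = (\<lambda>a g. lunit H a \<otimes>\<^bsub>total H\<^esub> g)" "coact TT = comult H"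
  by (simp_all add: total_comodule_def total_module_def ring.defs module.defs comodule.defs)

lemma TT_model: "cobar_model H gf bas pv TT gf {0}"
  by (rule cobar_model_cong[OF total_model]) simp_all

lemma TC_eq: "TC = subcomodule H TT Tset"
  by (simp add: T_comod_def Tset_def tpol_def)

lemma TC_simps [simp]: "carrier TC = Tset" "add TC = add (total H)" "zero TC = zero (total H)"
  "smult TC = (\<lambda>a g. lunit H a \<otimes>\<^bsub>total H\<^esub> g)"
  by (simp_all add: TC_eq subcomodule_def)

lemma tpol_add: "tpol a + tpol b = tpol (\<lambda>l. a l + b l)"
  by (simp add: tpol_def sum.distrib distrib_right)
lemma tpol_mult: "b * tpol a = tpol (\<lambda>l. b * a l)"
  by (simp add: tpol_def sum_distrib_left mult.assoc)
lemma tpol_0: "tpol (\<lambda>_. 0) = 0"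
  by (simp add: tpol_def)

lemma TsetI: "(\<And>l. a l \<in> BP p) \<Longrightarrow> prj (tpol a) \<in> Tset"
  by (auto simp: Tset_def)

lemma Tset_0: "\<zero>\<^bsub>total H\<^esub> \<in> Tset"
  using TsetI[of "\<lambda>_. 0"] BP_closed(5) by (simp add: total_zero tpol_0)

lemma T_sub_model: "cobar_model H gf bas pv (TT\<lparr>carrier := Tset\<rparr>) gf {0}"
proof (unfold_locales, goal_cases)
  case 1 show ?case by (rule addsub_zero) next
  case 2 then show ?case by simp next
  case 3 show ?case using Tset_0 by simp next
  case 4 show ?case by (simp add: total_zero total_add BPBP_0) next
  case (5 x y)
  then obtain a b where "\<And>l. a l \<in> BP p" "\<And>l. b l \<in> BP p" "x = prj (tpol a)" "y = prj (tpol b)" by (auto simp: Tset_def)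
  then show ?case by (auto simp: total_add tpol_BPBP tpol_add intro!: TsetI BP_closed) next
  case (6 b x)
  then obtain a where "\<And>l. a l \<in> BP p" "x = prj (tpol a)" "b \<in> BP p" by (auto simp: Tset_def base_H)
  then show ?case by (auto simp: lunit_H total_mult tpol_BPBP BP_BPBP tpol_mult intro!: TsetI BP_closed) next
  case (7 x)
  then obtain a where a: "\<And>l. a l \<in> BP p" "x = prj (tpol a)" by (auto simp: Tset_def)
  then have "prj (tpol (\<lambda>l. - a l)) \<in> Tset" by (intro TsetI BP_closed)
  then show ?case using a BP_closed(4)
    by (intro bexI[of _ "prj (tpol (\<lambda>l. - a l))"]) (auto simp: total_add tpol_BPBP tpol_add tpol_0 total_zero) next
  case (8 x y) then show ?case using Tset_carrier by (auto simp: gf_add subset_iff) next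
  case (9 b x) then show ?case using Tset_carrier by (auto simp: gf_mult lunit_closed gf_lunit subset_iff) next
  case (10 x) then show ?case using gf_eqD[OF _ zero_closed'] Tset_carrier by (auto simp: total_zero gf_zero subset_iff)
qed

lemma TC_model: "cobar_model H gf bas pv TC gf {0}"
  by (rule cobar_model_cong[OF T_sub_model]) simp_all

text \<open>By \<open>cf_tsp\<close> the function \<open>cf 1 (gf x)\<close> comes from \<Gamma>
  \<otimes> T; this is the lift that \<open>coact_subcomodule\<close> asks for.\<close>

lemma coact_T:
  assumes x: "x \<in> Tset"
  shows "Poly_Mapping.keys (rep (coact TC x)) \<subseteq> cobar_words H TC 1" "phi gf gf (rep (coact TC x)) = cf 1 (gf x)"
proof -
  interpret S: cobar_model H gf bas pv "TT\<lparr>carrier := Tset\<rparr>" gf "{0}" by (rule T_sub_model)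
  interpret M: cobar_model H gf bas pv TT gf "{0}" by (rule TT_model)
  have Img: "S.Img = tsp (pv ` BP p)" unfolding gf_Tset[symmetric] by (auto simp: S.Img_def)
  have "gf x \<in> tsp (pv ` BP p)" using x gf_Tset by blast
  then have "cf 1 (gf x) \<in> Pre GG S.Img 1" unfolding Img by (intro cf_tsp BP_addsub cf_BP)
  then obtain c where c: "Poly_Mapping.keys c \<subseteq> S.words 1" "phi gf gf c = cf 1 (gf x)"
    using S.phi_surj[of "cf 1 (gf x)" 1] by (auto simp: Pre_zero simp del: Pre.simps)
  have xc: "x \<in> carrier (total H)" using x Tset_carrier by blast
  have cl: "cobar_class H (total_module H) 1 = cobar_class H TT 1" "cobar_words H (total_module H) 1 = cobar_words H TT 1"
    by (rule cobar_class_cong cobar_words_cong, simp_all)+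
  obtain d where d: "Poly_Mapping.keys d \<subseteq> M.words 1" "comult H x = cobar_class H TT 1 d" "phi gf gf d = cf 1 (gf x)"
    using comult_spec[OF xc] unfolding cl by blast
  have co0: "coact TT x \<in> carrier (cobar_tensor H TT 1)" "phi gf gf (rep (coact TT x)) = cf 1 (gf x)"
    using M.class_carrier[OF d(1)] M.phi_rep_class[of 1 d] d by (simp_all add: Pre_zero del: Pre.simps)
  have co: "coact TC x = cobar_class H (TT\<lparr>carrier := Tset\<rparr>) 1 c"
    unfolding TC_eq using coact_subcomodule[OF TT_model T_sub_model _ x co0 c] Tset_carrier by auto
  have "cobar_words H TC 1 = S.words 1" by (rule cobar_words_cong) simp
  then show "Poly_Mapping.keys (rep (coact TC x)) \<subseteq> cobar_words H TC 1"
    using S.keys_rep_class[OF c(1)] unfolding co by simp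
  show "phi gf gf (rep (coact TC x)) = cf 1 (gf x)"
    unfolding co using S.phi_rep_class[of 1 c] c(2) by (simp add: Pre_zero del: Pre.simps)
qed

lemma TC_comodule: "comodule_model H gf bas pv TC gf {0}"
proof -
  interpret cobar_model H gf bas pv TC gf "{0}" by (rule TC_model)
  show ?thesis
    by unfold_locales (auto simp: coact_T Pre_zero simp del: Pre.simps dest: subsetD[OF coact_T(1)])
qed

sublocale T: comodule_model H gf bas pv TC gf "{0}" by (rule TC_comodule)

lemma TC_Img: "T.Img = tsp (pv ` BP p)"
  unfolding gf_Tset[symmetric] by (auto simp: T.Img_def)

end

section \<open>Tensor products with \<open>T\<^sub>m\<^sup>(\<^sup>i\<^sup>)\<close>\<close>

text \<open>Serves for both N = D^0 and N = E^1, with \<open>KN\<close> the functions that N divides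
  out. The locality assumptions guarantee that the coefficients of the powers of \<open>th\<close>
  can be recovered from a function by \<open>th_independent\<close>.\<close>

locale tensor_model = bp_T p m i + N: comodule_model "Gamma p (Suc m)" "bp.gf p m" "bp.bas p m" "bp.pv p m" N muN KN
  for p m i :: nat and N :: "(qpoly, qpoly set, 'n) comodule" and muN :: "'n \<Rightarrow> chainfun" and KN :: "chainfun set" +
  assumes muN_local: "y \<in> carrier N \<Longrightarrow> first_local (muN y)" and KN_local: "k \<in> KN \<Longrightarrow> first_local k"
begin

abbreviation "B \<equiv> subring_of_qpoly (BP p)"
abbreviation "trel \<equiv> tensor_relations B TC N"

definition mT :: "qpoly set \<times> 'n \<Rightarrow> chainfun" where
  "mT w = gf (fst w) * muN (snd w)"

definition muT :: "(qpoly set \<times> 'n \<Rightarrow>\<^sub>0 int) set \<Rightarrow> chainfun" where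
  "muT z = flin mT (rep z)"

abbreviation "KT \<equiv> tsp KN"

lemma KT: "addsub KT" by (rule tsp_addsub[OF N.K])

lemma KN_sc: "b \<in> BP p \<Longrightarrow> k \<in> KN \<Longrightarrow> pv b * k \<in> KN"
  using N.K_sc[of b k] by (simp add: base_H)

lemma T_KN: "t \<in> Tset \<Longrightarrow> k \<in> KN \<Longrightarrow> gf t * k \<in> KT"
  by (rule tsp_T_mult[OF N.K KN_sc])

lemma T_add: "x \<in> Tset \<Longrightarrow> y \<in> Tset \<Longrightarrow> x \<oplus>\<^bsub>total H\<^esub> y \<in> Tset"
  using T.M_add[of x y] by simp

lemma T_smult: "b \<in> BP p \<Longrightarrow> x \<in> Tset \<Longrightarrow> lunit H b \<otimes>\<^bsub>total H\<^esub> x \<in> Tset"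
  using T.M_smult[of b x] by (simp add: base_H)

lemma gf_T_add: "x \<in> Tset \<Longrightarrow> y \<in> Tset \<Longrightarrow> gf (x \<oplus>\<^bsub>total H\<^esub> y) = gf x + gf y"
  using Tset_carrier by (auto intro!: gf_add)

lemma gf_T_smult: "b \<in> BP p \<Longrightarrow> x \<in> Tset \<Longrightarrow> gf (lunit H b \<otimes>\<^bsub>total H\<^esub> x) = pv b * gf x"
  using Tset_carrier gf_mult[of "lunit H b" x] lunit_closed[of b] gf_lunit[of b] by (auto simp: base_H)

lemma rel_T:
  assumes "c \<in> trel"
  shows "Poly_Mapping.keys c \<subseteq> Tset \<times> carrier N \<and> flin mT c \<in> KT"
proof -
  have k3: "Poly_Mapping.keys (frag_of u - frag_of v - frag_of w) \<subseteq> {u, v, w}" for u v w :: "qpoly set \<times> 'n"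
    using keys_diff[of "frag_of u - frag_of v" "frag_of w"] keys_diff[of "frag_of u" "frag_of v"] by (auto simp: keys_frag_of)
  have k2: "Poly_Mapping.keys (frag_of u - frag_of v) \<subseteq> {u, v}" for u v :: "qpoly set \<times> 'n"
    using keys_diff[of "frag_of u" "frag_of v"] by (auto simp: keys_frag_of)
  show ?thesis
    using assms unfolding tensor_relations_def TC_simps subring_simps
  proof (elim UnE CollectE exE conjE)
    fix x x' y
    assume c: "c = frag_of (x \<oplus>\<^bsub>total H\<^esub> x', y) - frag_of (x, y) - frag_of (x', y)" and xy: "x \<in> Tset" "x' \<in> Tset" "y \<in> carrier N"
    have "flin mT c = 0" by (simp add: c flin_diff mT_def gf_T_add xy distrib_right)
    then show ?thesis using k3[of "(x \<oplus>\<^bsub>total H\<^esub> x', y)" "(x, y)" "(x', y)"] xy T_add addsub_0[OF KT] by (auto simp: c)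
  next
    fix x y y'
    assume c: "c = frag_of (x, y \<oplus>\<^bsub>N\<^esub> y') - frag_of (x, y) - frag_of (x, y')" and xy: "x \<in> Tset" "y \<in> carrier N" "y' \<in> carrier N"
    have "flin mT c = gf x * (muN (y \<oplus>\<^bsub>N\<^esub> y') - (muN y + muN y'))" unfolding c flin_diff flin_of mT_def by (simp add: algebra_simps)
    then have "flin mT c \<in> KT" using T_KN[OF xy(1) N.mu_add[OF xy(2,3)]] by simp
    then show ?thesis using k3[of "(x, y \<oplus>\<^bsub>N\<^esub> y')" "(x, y)" "(x, y')"] xy N.M_add by (auto simp: c)
  next
    fix b x y
    assume c: "c = frag_of (lunit H b \<otimes>\<^bsub>total H\<^esub> x, y) - frag_of (x, b \<odot>\<^bsub>N\<^esub> y)" and xy: "b \<in> BP p" "x \<in> Tset" "y \<in> carrier N"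
    have b: "b \<in> carrier (base H)" using xy by (simp add: base_H)
    have "flin mT c = - (gf x * (muN (b \<odot>\<^bsub>N\<^esub> y) - pv b * muN y))" by (simp add: c flin_diff mT_def gf_T_smult xy algebra_simps)
    then have "flin mT c \<in> KT" using addsub_uminus[OF KT T_KN[OF xy(2) N.mu_smult[OF b xy(3)]]] by simp
    then show ?thesis using k2[of "(lunit H b \<otimes>\<^bsub>total H\<^esub> x, y)" "(x, b \<odot>\<^bsub>N\<^esub> y)"] xy T_smult N.M_smult[OF b] by (auto simp: c)
  qed
qed

sublocale QT: free_quotient "Tset \<times> carrier N" trel
  by unfold_locales (use rel_T in auto)

lemma tnull_eq: "tensor_null B TC N = QT.N"
  by (simp add: tensor_null_def)

lemma tclass_eq: "tensor_class B TC N c = QT.N #>\<^bsub>QT.F\<^esub> c"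
  by (simp add: tensor_class_def tnull_eq)

lemma flin_tnull: "c \<in> QT.N \<Longrightarrow> flin mT c \<in> KT"
  by (erule QT.N_induct) (use rel_T addsub_0[OF KT] addsub_diff[OF KT] in \<open>auto simp: flin_diff\<close>)

abbreviation "TN \<equiv> tensor_comodule H TC N"

lemma TN_simps:
  "carrier TN = carrier (QT.F Mod QT.N)" "zero TN = QT.N" "add TN = (\<otimes>\<^bsub>QT.F Mod QT.N\<^esub>)"
  "smult TN = (\<lambda>a X. tensor_class B TC N (frag_extend (\<lambda>(x, y). frag_of (lunit H a \<otimes>\<^bsub>total H\<^esub> x, y)) (rep X)))"
  by (simp_all add: tensor_comodule_def tensor_module_def Let_def module.defs comodule.defs base_H tnull_eq QT.one_quot)

lemma tclass_carrier: "Poly_Mapping.keys c \<subseteq> Tset \<times> carrier N \<Longrightarrow> tensor_class B TC N c \<in> carrier TN"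
  unfolding TN_simps QT.carrier_quot tclass_eq by blast

lemma TN_rep: "z \<in> carrier TN \<Longrightarrow> Poly_Mapping.keys (rep z) \<subseteq> Tset \<times> carrier N \<and> tensor_class B TC N (rep z) = z"
  unfolding TN_simps tclass_eq using QT.keys_rep QT.class_rep by blast

lemma muT_class: "muT (tensor_class B TC N c) - flin mT c \<in> KT"
  using flin_tnull[OF QT.rep_class[of c]] by (simp add: muT_def tclass_eq flin_diff)

lemma keys_scale:
  assumes "Poly_Mapping.keys c \<subseteq> Tset \<times> carrier N" "b \<in> BP p"
  shows "Poly_Mapping.keys (frag_extend (\<lambda>(x, y). frag_of (lunit H b \<otimes>\<^bsub>total H\<^esub> x, y)) c) \<subseteq> Tset \<times> carrier N"
  by (rule order_trans[OF keys_frag_extend]) (use assms T_smult in \<open>auto simp: keys_frag_of\<close>)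

lemma flin_scale:
  assumes "Poly_Mapping.keys c \<subseteq> Tset \<times> carrier N" "b \<in> BP p"
  shows "flin mT (frag_extend (\<lambda>(x, y). frag_of (lunit H b \<otimes>\<^bsub>total H\<^esub> x, y)) c) = pv b * flin mT c"
proof -
  have "flin mT (frag_extend (\<lambda>(x, y). frag_of (lunit H b \<otimes>\<^bsub>total H\<^esub> x, y)) c) = flin (\<lambda>w. pv b * mT w) c"
    unfolding flin_frag_extend
    by (rule flin_cong) (use assms in \<open>auto simp: mT_def gf_T_smult mult.assoc split: prod.splits\<close>)
  then show ?thesis by (simp add: flin_mult_left)
qed

text \<open>Every element of \<open>T \<otimes> N\<close> is \<open>\<Sum> t\<^sup>l \<otimes> n\<^sub>l\<close>, because \<open>T\<close> is free on the powers of \<open>t\<close>.\<close>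

definition tvec :: "(nat \<Rightarrow> 'n) \<Rightarrow> (qpoly set \<times> 'n \<Rightarrow>\<^sub>0 int)" where
  "tvec n = (\<Sum>l<q. frag_of (prj (t_gen (Suc m) ^ l), n l))"

definition tform :: "(qpoly set \<times> 'n \<Rightarrow>\<^sub>0 int) \<Rightarrow> bool" where
  "tform c \<longleftrightarrow> (\<exists>n. (\<forall>l. n l \<in> carrier N) \<and> c - tvec n \<in> QT.N)"

lemma t_power_Tset: "l < q \<Longrightarrow> prj (t_gen (Suc m) ^ l) \<in> Tset"
proof -
  assume l: "l < q"
  have "tpol (\<lambda>j. if j = l then 1 else 0) = t_gen (Suc m) ^ l"
    unfolding tpol_def using l by (subst sum.remove[of _ l]) auto
  moreover have "prj (tpol (\<lambda>j. if j = l then 1 else 0)) \<in> Tset" by (rule TsetI) (auto intro: BP_closed)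
  ultimately show ?thesis by simp
qed

lemma QT_sum: "(\<And>l. l \<in> I \<Longrightarrow> f l \<in> QT.N) \<Longrightarrow> sum f I \<in> QT.N"
  by (induction I rule: infinite_finite_induct) (auto intro: QT.N_0 QT.N_add)

lemma rel_left: "x \<in> Tset \<Longrightarrow> x' \<in> Tset \<Longrightarrow> y \<in> carrier N \<Longrightarrow>
    frag_of (x \<oplus>\<^bsub>total H\<^esub> x', y) - frag_of (x, y) - frag_of (x', y) \<in> QT.N"
  by (rule QT.N_rel) (auto simp: tensor_relations_def)
lemma rel_right: "x \<in> Tset \<Longrightarrow> y \<in> carrier N \<Longrightarrow> y' \<in> carrier N \<Longrightarrow>
    frag_of (x, y \<oplus>\<^bsub>N\<^esub> y') - frag_of (x, y) - frag_of (x, y') \<in> QT.N"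
  by (rule QT.N_rel) (auto simp: tensor_relations_def)
lemma rel_scale: "b \<in> BP p \<Longrightarrow> x \<in> Tset \<Longrightarrow> y \<in> carrier N \<Longrightarrow>
    frag_of (lunit H b \<otimes>\<^bsub>total H\<^esub> x, y) - frag_of (x, b \<odot>\<^bsub>N\<^esub> y) \<in> QT.N"
  by (rule QT.N_rel) (auto simp: tensor_relations_def)

lemma N_smult: "b \<in> BP p \<Longrightarrow> y \<in> carrier N \<Longrightarrow> b \<odot>\<^bsub>N\<^esub> y \<in> carrier N"
  using N.M_smult[of b y] by (simp add: base_H)

lemma tform_word:
  assumes x: "x \<in> Tset" and y: "y \<in> carrier N" shows "tform (frag_of (x, y))"
proof -
  obtain a where a: "\<And>l. a l \<in> BP p" "x = prj (tpol a)" using x by (auto simp: Tset_def)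
  let ?t = "\<lambda>l. prj (a l * t_gen (Suc m) ^ l)"
  have tT: "?t l \<in> Tset" if "l < q" for l
    using T_smult[OF a(1)[of l] t_power_Tset[OF that]]
    by (simp add: lunit_H total_mult BP_BPBP[OF a(1)] BPBP_power t_gen_BPBP)
  have z: "frag_of (\<zero>\<^bsub>total H\<^esub>, y) \<in> QT.N"
  proof -
    have "\<zero>\<^bsub>total H\<^esub> \<oplus>\<^bsub>total H\<^esub> \<zero>\<^bsub>total H\<^esub> = \<zero>\<^bsub>total H\<^esub>" by (simp add: total_zero total_add BPBP_0)
    then show ?thesis using QT.N_uminus[OF rel_left[OF Tset_0 Tset_0 y]] by simp
  qed
  \<comment> \<open>Additivity in the left slot is a relation between two summands, so the
    polynomial is taken apart one term at a time; each partial sum has to lie in T for the relation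
    to apply.\<close>
  have step: "prj (\<Sum>l<j. a l * t_gen (Suc m) ^ l) \<in> Tset \<and> frag_of (prj (\<Sum>l<j. a l * t_gen (Suc m) ^ l), y) - (\<Sum>l<j. frag_of (?t l, y)) \<in> QT.N"
    if "j \<le> q" for j
    using that
  proof (induction j)
    case 0
    then show ?case using z Tset_0 by (simp add: total_zero)
  next
    case (Suc j)
    let ?s = "prj (\<Sum>l<j. a l * t_gen (Suc m) ^ l)"
    have s: "?s \<in> Tset" "frag_of (?s, y) - (\<Sum>l<j. frag_of (?t l, y)) \<in> QT.N" using Suc by auto
    have t: "?t j \<in> Tset" using Suc tT by simp
    have eq: "?s \<oplus>\<^bsub>total H\<^esub> ?t j = prj (\<Sum>l<Suc j. a l * t_gen (Suc m) ^ l)"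
      using t_power_BPBP[OF a(1)] by (simp add: total_add BPBP_sum)
    have "frag_of (?s \<oplus>\<^bsub>total H\<^esub> ?t j, y) - (\<Sum>l<Suc j. frag_of (?t l, y))
       = (frag_of (?s \<oplus>\<^bsub>total H\<^esub> ?t j, y) - frag_of (?s, y) - frag_of (?t j, y)) + (frag_of (?s, y) - (\<Sum>l<j. frag_of (?t l, y)))"
      by simp
    also have "\<dots> \<in> QT.N" by (intro QT.N_add rel_left s t y)
    finally show ?case using T_add[OF s(1) t] by (simp add: eq)
  qed
  have 1: "frag_of (x, y) - (\<Sum>l<q. frag_of (?t l, y)) \<in> QT.N"
    using step[of q] by (simp add: a(2) tpol_def)
  have 2: "(\<Sum>l<q. frag_of (?t l, y)) - tvec (\<lambda>l. a l \<odot>\<^bsub>N\<^esub> y) \<in> QT.N"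
    unfolding tvec_def sum_subtractf[symmetric]
  proof (rule QT_sum)
    fix l assume "l \<in> {..<q}"
    then show "frag_of (?t l, y) - frag_of (prj (t_gen (Suc m) ^ l), a l \<odot>\<^bsub>N\<^esub> y) \<in> QT.N"
      using rel_scale[OF a(1)[of l] t_power_Tset[of l] y]
      by (simp add: lunit_H total_mult BP_BPBP[OF a(1)] BPBP_power t_gen_BPBP)
  qed
  have "frag_of (x, y) - tvec (\<lambda>l. a l \<odot>\<^bsub>N\<^esub> y) \<in> QT.N" using QT.N_add[OF 1 2] by simp
  then show ?thesis unfolding tform_def using N_smult[OF a(1) y] by (intro exI[of _ "\<lambda>l. a l \<odot>\<^bsub>N\<^esub> y"]) auto
qed

lemma tvec_add:
  assumes "\<And>l. n l \<in> carrier N" "\<And>l. k l \<in> carrier N"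
  shows "tvec (\<lambda>l. n l \<oplus>\<^bsub>N\<^esub> k l) - tvec n - tvec k \<in> QT.N"
  unfolding tvec_def sum_subtractf[symmetric]
  by (rule QT_sum) (use rel_right[OF t_power_Tset] assms in auto)

lemma tvec_zero: "tvec (\<lambda>_. \<zero>\<^bsub>N\<^esub>) \<in> QT.N"
  using QT.N_uminus[OF tvec_add[of "\<lambda>_. \<zero>\<^bsub>N\<^esub>" "\<lambda>_. \<zero>\<^bsub>N\<^esub>"]] by (simp add: N.M_zero N.M_zz)

lemma tform_diff:
  assumes "tform c" "tform d" shows "tform (c - d)"
proof -
  obtain n k where n: "\<And>l. n l \<in> carrier N" "c - tvec n \<in> QT.N" and k: "\<And>l. k l \<in> carrier N" "d - tvec k \<in> QT.N"
    using assms by (auto simp: tform_def)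
  obtain k' where k': "\<And>l. k' l \<in> carrier N" "\<And>l. k l \<oplus>\<^bsub>N\<^esub> k' l = \<zero>\<^bsub>N\<^esub>"
    using N.M_neg[OF k(1)] by metis
  have "c - d - tvec (\<lambda>l. n l \<oplus>\<^bsub>N\<^esub> k' l) = (c - tvec n) - (d - tvec k) - (tvec (\<lambda>l. n l \<oplus>\<^bsub>N\<^esub> k' l) - tvec n - tvec k')
      + (tvec (\<lambda>l. k l \<oplus>\<^bsub>N\<^esub> k' l) - tvec k - tvec k') - tvec (\<lambda>l. k l \<oplus>\<^bsub>N\<^esub> k' l)" by simp
  also have "\<dots> \<in> QT.N"
    using tvec_zero by (intro QT.N_diff[OF QT.N_add[OF QT.N_diff[OF QT.N_diff[OF n(2) k(2)] tvec_add] tvec_add]] n k k') (simp add: k'(2))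
  finally show ?thesis unfolding tform_def using N.M_add[OF n(1) k'(1)] by (intro exI[of _ "\<lambda>l. n l \<oplus>\<^bsub>N\<^esub> k' l"]) auto
qed

lemma tform_all: "Poly_Mapping.keys c \<subseteq> Tset \<times> carrier N \<Longrightarrow> tform c"
proof (induction c rule: frag_induction)
  case zero
  then show ?case unfolding tform_def using N.M_zero QT.N_uminus[OF tvec_zero] by (intro exI[of _ "\<lambda>_. \<zero>\<^bsub>N\<^esub>"]) simp
next
  case (one w)
  then show ?case using tform_word by (cases w) auto
qed (rule tform_diff)

lemma flin_tvec: "flin mT (tvec n) = (\<Sum>l<q. th ^ l * muN (n l))"
  by (simp add: tvec_def flin_sum mT_def gf_t)

lemma first_local_diff: "first_local f \<Longrightarrow> first_local g \<Longrightarrow> first_local (f - g)"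
  unfolding first_local_def fun_ring_apply by metis

text \<open>In the form given by \<open>tvec\<close> the coefficients have functions in
  \<open>KN\<close> by \<open>th_independent\<close>, hence are zero in N by \<open>mu_inj\<close>.
  This is the injectivity of T \<otimes> N into functions modulo \<open>KT\<close>.\<close>

lemma tnull_if_mT:
  assumes c: "Poly_Mapping.keys c \<subseteq> Tset \<times> carrier N" "flin mT c \<in> KT" shows "c \<in> QT.N"
proof -
  obtain n where n: "\<And>l. n l \<in> carrier N" "c - tvec n \<in> QT.N" using tform_all[OF c(1)] by (auto simp: tform_def)
  have "flin mT c - flin mT (c - tvec n) \<in> KT" by (rule addsub_diff[OF KT c(2) flin_tnull[OF n(2)]])
  then have "flin mT (tvec n) \<in> KT" by (simp add: flin_diff)
  then obtain k where k: "\<And>l. k l \<in> KN" "(\<Sum>l<q. th ^ l * muN (n l)) = (\<Sum>l<q. th ^ l * k l)"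
    unfolding flin_tvec by (auto simp: tsp_def)
  have "muN (n l) - k l = 0" if "l < q" for l
  proof (rule th_independent[OF _ _ that])
    show "first_local (muN (n l) - k l)" for l by (intro first_local_diff muN_local KN_local n k)
    show "(\<Sum>l<q. th ^ l * (muN (n l) - k l)) = 0" using k(2) by (simp add: right_diff_distrib sum_subtractf)
  qed
  then have "n l = \<zero>\<^bsub>N\<^esub>" if "l < q" for l using N.mu_inj[OF n(1)[of l]] k(1)[of l] that by simp
  then have "tvec n = tvec (\<lambda>_. \<zero>\<^bsub>N\<^esub>)" unfolding tvec_def by (intro sum.cong) auto
  then show ?thesis using QT.N_add[OF n(2) tvec_zero] by simp
qed

lemma TN_model: "cobar_model H gf bas pv TN muT KT"
proof (unfold_locales, goal_cases)
  case 1 show ?case by (rule KT) next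
  case (2 b f)
  then show ?case using KN_sc by (intro tsp_mult[of f KN]) (auto simp: base_H) next
  case 3
  show ?case unfolding TN_simps QT.carrier_quot using QT.class_0 by (intro exI[of _ 0]) auto next
  case 4
  show ?case using QT.mult_quot[of 0 0] by (simp add: TN_simps QT.class_0) next
  case (5 x y)
  then show ?case
    unfolding TN_simps using monoid.m_closed[OF comm_monoid.axioms(1)[OF comm_group.axioms(1)[OF QT.quot_comm_group]]] by blast next
  case (6 b x)
  then have b: "b \<in> BP p" by (simp add: base_H)
  show ?case using tclass_carrier[OF keys_scale[OF _ b]] TN_rep[OF 6(2)] by (simp add: TN_simps(4)) next
  case (7 x)
  show ?case
  proof (intro bexI)
    have k: "Poly_Mapping.keys (rep x) \<subseteq> Tset \<times> carrier N" "tensor_class B TC N (rep x) = x" using TN_rep[OF 7] by auto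
    show "tensor_class B TC N (- rep x) \<in> carrier TN" by (rule tclass_carrier) (use k in simp)
    show "x \<oplus>\<^bsub>TN\<^esub> tensor_class B TC N (- rep x) = \<zero>\<^bsub>TN\<^esub>"
      using QT.mult_quot[of "rep x" "- rep x"] k by (simp add: TN_simps tclass_eq QT.class_0)
  qed next
  case (8 x y)
  then show ?case using flin_tnull[OF QT.rep_mult[of x y]] by (simp add: TN_simps muT_def flin_diff flin_add) next
  case (9 b x)
  then have b: "b \<in> BP p" by (simp add: base_H)
  show ?case
    using muT_class[of "frag_extend (\<lambda>(x, y). frag_of (lunit H b \<otimes>\<^bsub>total H\<^esub> x, y)) (rep x)"] flin_scale[OF _ b, of "rep x"] TN_rep[OF 9(2)]
    by (simp add: TN_simps(4) muT_def) next
  case (10 x)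
  have "rep x \<in> QT.N" by (rule tnull_if_mT) (use TN_rep[OF 10(1)] 10(2) in \<open>auto simp: muT_def\<close>)
  then have "QT.N #>\<^bsub>QT.F\<^esub> rep x = QT.N" using QT.class_eq_one by blast
  then show ?case using TN_rep[OF 10(1)] by (simp add: tclass_eq TN_simps(2))
qed

sublocale TNm: cobar_model H gf bas pv TN muT KT by (rule TN_model)

lemma flin_mult_flin: "flin f c * flin g d = flin (\<lambda>x. flin (\<lambda>y. f x * g y) d) c" for f :: "'x \<Rightarrow> chainfun" and g :: "'y \<Rightarrow> chainfun"
  by (simp add: flin_mult_left flin_mult_right)

definition cow :: "qpoly set list \<times> qpoly set \<Rightarrow> qpoly set list \<times> 'n \<Rightarrow> (qpoly set list \<times> (qpoly set \<times> 'n \<Rightarrow>\<^sub>0 int) set \<Rightarrow>\<^sub>0 int)" where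
  "cow = (\<lambda>(gs, x'') (hs, y''). frag_of ([hd gs \<otimes>\<^bsub>total H\<^esub> hd hs], tensor_class B TC N (frag_of (x'', y''))))"

lemma cow_spec:
  assumes u: "u \<in> cobar_words H TC 1" and v: "v \<in> N.words 1"
  shows "Poly_Mapping.keys (cow u v) \<subseteq> TNm.words 1"
    and "phi gf muT (cow u v) - wfn gf gf u * wfn gf muN v \<in> Pre GG KT 1"
proof -
  obtain g x where u': "u = ([g], x)" "g \<in> carrier (total H)" "x \<in> Tset"
    using u by (cases u) (auto simp: cobar_words_def length_Suc_conv)
  obtain h y where v': "v = ([h], y)" "h \<in> carrier (total H)" "y \<in> carrier N"
    using v by (cases v) (auto simp: cobar_words_def length_Suc_conv)
  let ?z = "tensor_class B TC N (frag_of (x, y))"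
  have z: "?z \<in> carrier TN" by (rule tclass_carrier) (use u' v' in \<open>auto simp: keys_frag_of\<close>)
  show "Poly_Mapping.keys (cow u v) \<subseteq> TNm.words 1"
    using z u' v' by (auto simp: cow_def keys_frag_of cobar_words_def mult_closed)
  have "phi gf muT (cow u v) - wfn gf gf u * wfn gf muN v = gf (g \<otimes>\<^bsub>total H\<^esub> h) * Sh (muT ?z - flin mT (frag_of (x, y)))"
    by (simp add: cow_def phi_def wfn_def u'(1) v'(1) gf_mult[OF u'(2) v'(2)] mT_def algebra_simps)
  also have "\<dots> \<in> Pre GG KT (Suc 0)"
    by (intro PreI imageI mult_closed u' v') (use muT_class[of "frag_of (x, y)"] in \<open>simp only: Pre.simps\<close>)
  finally show "phi gf muT (cow u v) - wfn gf gf u * wfn gf muN v \<in> Pre GG KT 1" by simp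
qed

definition cof :: "(qpoly set \<times> 'n \<Rightarrow>\<^sub>0 int) \<Rightarrow> (qpoly set list \<times> (qpoly set \<times> 'n \<Rightarrow>\<^sub>0 int) set \<Rightarrow>\<^sub>0 int)" where
  "cof c = frag_extend (\<lambda>(x, y). frag_extend (\<lambda>u. frag_extend (cow u) (rep (coact N y))) (rep (coact TC x))) c"

lemma coact_TN: "coact TN z = cobar_class H TN 1 (cof (rep z))"
proof -
  have "coact TN z = cobar_class H (tensor_module B TC N) 1 (cof (rep z))"
    unfolding cof_def cow_def by (simp add: tensor_comodule_def module.defs comodule.defs base_H case_prod_unfold)
  moreover have "cobar_class H (tensor_module B TC N) 1 = cobar_class H TN 1"
    by (rule cobar_class_cong) (simp_all add: tensor_comodule_def tensor_module_def Let_def module.defs comodule.defs base_H)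
  ultimately show ?thesis by simp
qed

lemma PKT: "addsub (Pre GG KT 1)" by (rule addsub_Pre[OF KT])

text \<open>\<open>cf 1\<close> is multiplicative, so the diagonal coaction has the right function.
  Two errors occur: the passage to a class of T \<otimes> N (\<open>muT_class\<close>), and the
  coaction of N, known modulo \<open>KN\<close>. Multiplied by \<open>cf 1 (gf x)\<close>, the
  latter spreads over the powers of t but is kept within \<open>KT\<close> by
  \<open>cf_T_Pre\<close>.\<close>

lemma cof_word:
  assumes x: "x \<in> Tset" and y: "y \<in> carrier N"
  shows "Poly_Mapping.keys (cof (frag_of (x, y))) \<subseteq> TNm.words 1"
    and "phi gf muT (cof (frag_of (x, y))) - cf 1 (gf x * muN y) \<in> Pre GG KT 1"
proof -
  have kT: "Poly_Mapping.keys (rep (coact TC x)) \<subseteq> cobar_words H TC 1" and fT: "flin (wfn gf gf) (rep (coact TC x)) = cf 1 (gf x)"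
    using coact_T[OF x] by (auto simp: phi_def)
  have kN: "Poly_Mapping.keys (rep (coact N y)) \<subseteq> N.words 1" by (rule N.coact_keys[OF y])
  have c: "cof (frag_of (x, y)) = frag_extend (\<lambda>u. frag_extend (cow u) (rep (coact N y))) (rep (coact TC x))"
    by (simp add: cof_def)
  show "Poly_Mapping.keys (cof (frag_of (x, y))) \<subseteq> TNm.words 1"
    unfolding c
  proof (rule order_trans[OF keys_frag_extend], rule UN_least, rule order_trans[OF keys_frag_extend], rule UN_least)
    fix u v assume "u \<in> Poly_Mapping.keys (rep (coact TC x))" "v \<in> Poly_Mapping.keys (rep (coact N y))"
    then show "Poly_Mapping.keys (cow u v) \<subseteq> TNm.words 1" using cow_spec(1) kT kN by blast
  qed
  have 1: "phi gf muT (cof (frag_of (x, y))) - flin (wfn gf gf) (rep (coact TC x)) * flin (wfn gf muN) (rep (coact N y)) \<in> Pre GG KT 1"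
    unfolding c phi_def flin_frag_extend flin_mult_flin
  proof (rule flin_in_mod[OF PKT], rule flin_in_mod[OF PKT])
    fix u v assume "u \<in> Poly_Mapping.keys (rep (coact TC x))" "v \<in> Poly_Mapping.keys (rep (coact N y))"
    then show "flin (wfn gf muT) (cow u v) - wfn gf gf u * wfn gf muN v \<in> Pre GG KT 1"
      using cow_spec(2)[of u v] kT kN unfolding phi_def by blast
  qed
  have 2: "cf 1 (gf x) * (flin (wfn gf muN) (rep (coact N y)) - cf 1 (muN y)) \<in> Pre GG KT 1"
    by (rule cf_T_Pre[OF N.K KN_sc x N.coact_phi[OF y, unfolded phi_def]])
  show "phi gf muT (cof (frag_of (x, y))) - cf 1 (gf x * muN y) \<in> Pre GG KT 1"
    using addsub_add[OF PKT 1 2] unfolding fT by (simp add: algebra_simps del: Pre.simps)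
qed

lemma cof_all:
  assumes "Poly_Mapping.keys c \<subseteq> Tset \<times> carrier N"
  shows "Poly_Mapping.keys (cof c) \<subseteq> TNm.words 1 \<and> phi gf muT (cof c) - cf 1 (flin mT c) \<in> Pre GG KT 1"
  using assms
proof (induction c rule: frag_induction)
  case zero
  then show ?case using addsub_0[OF PKT] by (simp add: cof_def phi_def del: Pre.simps)
next
  case (one w)
  then show ?case using cof_word[of "fst w" "snd w"] by (auto simp: mT_def simp del: Pre.simps)
next
  case (diff a b)
  have ab: "cof (a - b) = cof a - cof b" by (simp add: cof_def frag_extend_diff)
  have eq: "phi gf muT (cof (a - b)) - cf 1 (flin mT (a - b)) = (phi gf muT (cof a) - cf 1 (flin mT a)) - (phi gf muT (cof b) - cf 1 (flin mT b))"
    by (simp add: ab phi_def flin_diff)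
  show ?case unfolding eq using diff addsub_diff[OF PKT] keys_diff[of "cof a" "cof b"] by (auto simp: ab simp del: Pre.simps)
qed

theorem TN_comodule: "comodule_model H gf bas pv TN muT KT"
proof (unfold_locales, goal_cases)
  case (1 z)
  then show ?case unfolding coact_TN using TNm.keys_rep_class cof_all TN_rep[OF 1] by blast
next
  case (2 z)
  have k: "Poly_Mapping.keys (rep z) \<subseteq> Tset \<times> carrier N" using TN_rep[OF 2] by auto
  show ?case
    using addsub_add[OF PKT TNm.phi_rep_class[of 1 "cof (rep z)"] conjunct2[OF cof_all[OF k]]]
    unfolding coact_TN muT_def by (simp del: Pre.simps)
next
  case (3 k)
  then show ?case using cf_tsp[OF N.K N.K_cf] by blast
qed

lemma TN_Img: "TNm.Img = tsp N.Img"
proof (intro equalityI subsetI)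
  fix f assume "f \<in> TNm.Img"
  then obtain z where z: "z \<in> carrier TN" "f - muT z \<in> KT" by (auto simp: TNm.Img_def)
  have k: "Poly_Mapping.keys (rep z) \<subseteq> Tset \<times> carrier N" using TN_rep[OF z(1)] by auto
  have as: "addsub (tsp N.Img)" by (rule tsp_addsub[OF N.Img_addsub])
  have "muT z \<in> tsp N.Img"
    unfolding muT_def
  proof (rule addsub_flin[OF as])
    fix w assume "w \<in> Poly_Mapping.keys (rep z)"
    then have w: "fst w \<in> Tset" "snd w \<in> carrier N" using k by auto
    obtain a where a: "\<And>l. a l \<in> BP p" "fst w = prj (tpol a)" using w(1) by (auto simp: Tset_def)
    have I: "pv (a l) * muN (snd w) \<in> N.Img" for l
    proof -
      have "a l \<in> carrier (base H)" using a by (simp add: base_H)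
      from addsub_uminus[OF N.K N.mu_smult[OF this w(2)]] N.M_smult[OF this w(2)]
      show ?thesis unfolding N.Img_def by auto
    qed
    have "mT w = (\<Sum>l<q. th ^ l * (pv (a l) * muN (snd w)))" by (simp add: mT_def a gf_tpol sum_distrib_right mult.assoc)
    then show "mT w \<in> tsp N.Img" unfolding tsp_def using I by (intro CollectI exI[of _ "\<lambda>l. pv (a l) * muN (snd w)"]) auto
  qed
  moreover have "f - muT z \<in> tsp N.Img" using z(2) tsp_mono[OF N.K_Img] by blast
  ultimately show "f \<in> tsp N.Img" using addsub_add[OF as, of "f - muT z" "muT z"] by simp
next
  fix f assume "f \<in> tsp N.Img"
  then obtain k where k: "\<And>l. k l \<in> N.Img" "f = (\<Sum>l<q. th ^ l * k l)" by (auto simp: tsp_def)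
  then have "\<forall>l. \<exists>x. x \<in> carrier N \<and> k l - muN x \<in> KN" by (auto simp: N.Img_def)
  then obtain n where n: "\<And>l. n l \<in> carrier N" "\<And>l. k l - muN (n l) \<in> KN" by metis
  let ?z = "tensor_class B TC N (tvec n)"
  have keys: "Poly_Mapping.keys (tvec n) \<subseteq> Tset \<times> carrier N"
    unfolding tvec_def by (rule order_trans[OF keys_sum]) (use t_power_Tset n in \<open>auto simp: keys_frag_of\<close>)
  have "f - flin mT (tvec n) = (\<Sum>l<q. th ^ l * (k l - muN (n l)))"
    by (simp add: flin_tvec k(2) right_diff_distrib sum_subtractf)
  then have "f - flin mT (tvec n) \<in> KT" unfolding tsp_def using n(2) by (intro CollectI exI[of _ "\<lambda>l. k l - muN (n l)"]) auto
  from addsub_diff[OF KT this muT_class[of "tvec n"]] have "f - muT ?z \<in> KT" by simp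
  then show "f \<in> TNm.Img" unfolding TNm.Img_def using tclass_carrier[OF keys] by blast
qed

end

section \<open>The comodules \<open>E\<^sup>1\<close>, \<open>T \<otimes> D\<^sup>0\<close> and \<open>T \<otimes> E\<^sup>1\<close>\<close>

context bp
begin

abbreviation "EM \<equiv> E1_comod p m"
abbreviation "eproj \<equiv> quotient_proj DM (BP p)"
abbreviation "QM \<equiv> quotient_module DM (BP p)"

lemma eproj_explicit: "eproj x = {b + x | b. b \<in> BP p}"
  by (auto simp: quotient_proj_def a_r_coset_def')

lemma eproj_eq_iff: "eproj x = eproj y \<longleftrightarrow> x - y \<in> BP p"
proof
  assume eq: "eproj x = eproj y"
  have "0 + x \<in> eproj x" unfolding eproj_explicit using BP_closed(5) by (intro CollectI exI[of _ 0]) auto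
  then have "0 + x \<in> eproj y" unfolding eq .
  then show "x - y \<in> BP p" by (auto simp: eproj_explicit)
next
  assume *: "x - y \<in> BP p"
  have "b + x \<in> eproj y" if "b \<in> BP p" for b
  proof -
    have "b + x = (b + (x - y)) + y" by simp
    then show ?thesis unfolding eproj_explicit using BP_closed(1)[OF that *] by blast
  qed
  moreover have "b + y \<in> eproj x" if "b \<in> BP p" for b
  proof -
    have "b + y = (b - (x - y)) + x" by simp
    then show ?thesis unfolding eproj_explicit using BP_closed(2)[OF that *] by blast
  qed
  ultimately show "eproj x = eproj y" by (auto simp: eproj_explicit)
qed

lemma rep_eproj: "rep (eproj x) - x \<in> BP p"
proof -
  have "x \<in> eproj x" unfolding eproj_explicit using BP_closed(5) by (intro CollectI exI[of _ 0]) auto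
  then have "rep (eproj x) \<in> eproj x" unfolding rep_def by (rule someI)
  then show ?thesis by (auto simp: eproj_explicit)
qed

lemma eproj_add: "eproj x <+>\<^bsub>DM\<^esub> eproj y = eproj (x + y)"
proof (intro equalityI subsetI)
  fix z assume "z \<in> eproj x <+>\<^bsub>DM\<^esub> eproj y"
  then obtain b c where "b \<in> BP p" "c \<in> BP p" "z = (b + x) + (c + y)" by (auto simp: set_add_def' eproj_explicit)
  then show "z \<in> eproj (x + y)" unfolding eproj_explicit using BP_closed(1)
    by (intro CollectI exI[of _ "b + c"]) (auto simp: algebra_simps)
next
  fix z assume "z \<in> eproj (x + y)"
  then obtain b where b: "b \<in> BP p" "z = (b + x) + (0 + y)" by (auto simp: eproj_explicit add.assoc)
  have "b + x \<in> eproj x" "0 + y \<in> eproj y" using b(1) BP_closed(5) by (auto simp: eproj_explicit intro: exI[of _ 0])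
  then show "z \<in> eproj x <+>\<^bsub>DM\<^esub> eproj y" unfolding b(2) by (auto simp: set_add_def')
qed

lemma EM_simps: "carrier EM = eproj ` D0set" "add EM = set_add DM" "zero EM = eproj 0" "smult EM = (\<lambda>a X. eproj (a * rep X))"
  "coact EM X = cobar_map H QM eproj 1 (coact DM (rep X))"
proof -
  have "BP p = eproj 0" by (auto simp: eproj_explicit)
  then show "zero EM = eproj 0" by (simp add: E1_comod_def quotient_comodule_def quotient_module_def module.defs comodule.defs)
qed (auto simp: E1_comod_def quotient_comodule_def quotient_module_def module.defs comodule.defs A_RCOSETS_def' quotient_proj_def)

lemma QM_simps: "carrier QM = carrier EM" "add QM = add EM" "smult QM = smult EM"
  by (simp_all add: E1_comod_def quotient_comodule_def quotient_module_def module.defs comodule.defs)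

lemma EM_rep: assumes "X \<in> eproj ` D0set" shows "rep X \<in> D0set" "eproj (rep X) = X"
proof -
  obtain x where x: "x \<in> D0set" "X = eproj x" using assms by blast
  have "(rep X - x) + x \<in> D0set" using D0_add[OF BP_D0[OF rep_eproj] x(1)] unfolding x(2) .
  then show "rep X \<in> D0set" by simp
  show "eproj (rep X) = X" unfolding x(2) eproj_eq_iff by (rule rep_eproj)
qed

definition muE :: "qpoly set \<Rightarrow> chainfun" where
  "muE X = pv (rep X)"

abbreviation "KE \<equiv> pv ` BP p"

lemma muE_eproj: "muE (eproj x) - pv x \<in> KE"
  using rep_eproj[of x] by (simp add: muE_def pv_simps(2)[symmetric])

lemma EM_model: "cobar_model H gf bas pv EM muE KE"
proof (unfold_locales, goal_cases)
  case 1 show ?case by (rule BP_addsub)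
next
  case (2 b f)
  then show ?case using BP_closed(3) by (auto simp: base_H pv_simps(3)[symmetric])
next
  case 3
  show ?case unfolding EM_simps using D0_0 by blast
next
  case 4
  show ?case unfolding EM_simps eproj_add by simp
next
  case (5 x y)
  then obtain u v where "u \<in> D0set" "v \<in> D0set" "x = eproj u" "y = eproj v" unfolding EM_simps by blast
  then show ?case unfolding EM_simps using D0_add by (auto simp: eproj_add)
next
  case (6 b x)
  then have "rep x \<in> D0set" "b \<in> D0set" using EM_rep(1) BP_D0 by (auto simp: EM_simps base_H)
  then show ?case using D0_mult unfolding EM_simps by blast
next
  case (7 x)
  then obtain z where z: "z \<in> D0set" "x = eproj z" unfolding EM_simps by blast
  have "eproj (- z) \<in> carrier EM" using D0_uminus[OF z(1)] by (simp add: EM_simps)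
  moreover have "x \<oplus>\<^bsub>EM\<^esub> eproj (- z) = \<zero>\<^bsub>EM\<^esub>" unfolding EM_simps z(2) eproj_add by simp
  ultimately show ?case by blast
next
  case (8 x y)
  then obtain u v where uv: "x = eproj u" "y = eproj v" unfolding EM_simps by blast
  have eq: "muE (x \<oplus>\<^bsub>EM\<^esub> y) - (muE x + muE y) = (muE (eproj (u + v)) - pv (u + v)) - (muE (eproj u) - pv u) - (muE (eproj v) - pv v)"
    unfolding uv EM_simps eproj_add by (simp add: pv_simps)
  show ?case unfolding eq by (intro addsub_diff[OF BP_addsub] muE_eproj)
next
  case (9 b x)
  show ?case using muE_eproj[of "b * rep x"] unfolding EM_simps by (simp add: muE_def pv_simps)
next
  case (10 x)
  then have x: "rep x \<in> D0set" "eproj (rep x) = x" using EM_rep unfolding EM_simps by blast+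
  obtain b where b: "b \<in> BP p" "pv (rep x) = pv b" using 10(2) unfolding muE_def by blast
  have "rep x - b = 0"
    by (intro pv_inj BP_rational(2) D0_rational[OF x(1)] BP_sub_rational[OF b(1)]) (simp add: pv_simps b(2))
  then have "x = eproj b" using x(2) by simp
  also have "\<dots> = eproj 0" unfolding eproj_eq_iff using b(1) by simp
  finally show ?case unfolding EM_simps .
qed

text \<open>The functions of E^1 are those of D^0 with a larger \<open>K\<close>. Hence T \<otimes>
  D^0 and T \<otimes> E^1 have the same cochain functions and differ only in what is divided out,
  and what T \<otimes> E^1 divides out are the functions of T: the short exact sequence becomes an
  inclusion of groups of functions and its quotient.\<close>

lemma EM_Img: "cobar_model.Img EM muE KE = pv ` D0set"
proof -
  interpret cobar_model H gf bas pv EM muE KE by (rule EM_model)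
  have "f \<in> pv ` D0set" if "f \<in> Img" for f
  proof -
    have "\<exists>X\<in>carrier EM. f - muE X \<in> KE" using that by (simp only: Img_def mem_Collect_eq)
    then obtain X where X': "X \<in> carrier EM" "f - muE X \<in> KE" by (rule bexE)
    have X: "X \<in> eproj ` D0set" using X'(1) by (simp only: EM_simps(1))
    obtain b where b: "b \<in> BP p" "f - pv (rep X) = pv b" using X'(2) unfolding muE_def by (rule imageE)
    have "f = pv (rep X + b)" using b(2) by (simp add: pv_simps diff_eq_eq add.commute)
    then show ?thesis using imageI[OF D0_add[OF EM_rep(1)[OF X(1)] BP_D0[OF b(1)]], of pv] by (simp only:)
  qed
  moreover have "pv x \<in> Img" if "x \<in> D0set" for x
  proof -
    have "pv x - muE (eproj x) \<in> KE" using addsub_uminus[OF K muE_eproj[of x]] by simp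
    moreover have "eproj x \<in> carrier EM" unfolding EM_simps(1) using that by (rule imageI)
    ultimately show ?thesis unfolding Img_def mem_Collect_eq by (intro bexI)
  qed
  ultimately show ?thesis by (intro equalityI subsetI) (auto elim!: imageE)
qed

lemma DM_Img: "cobar_model.Img DM pv {0} = pv ` D0set"
proof -
  interpret cobar_model H gf bas pv DM pv "{0}" by (rule DM_model)
  show ?thesis by (auto simp: Img_def)
qed

lemma EM_comodule: "comodule_model H gf bas pv EM muE KE"
proof -
  interpret cobar_model H gf bas pv EM muE KE by (rule EM_model)
  have P1: "addsub (Pre GG KE 1)" by (rule addsub_Pre[OF K])
  have coact: "Poly_Mapping.keys (rep (coact EM X)) \<subseteq> words 1 \<and> phi gf muE (rep (coact EM X)) - cf 1 (muE X) \<in> Pre GG KE 1"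
    if "X \<in> carrier EM" for X
  proof -
    from that have X: "rep X \<in> D0set" using EM_rep by (auto simp: EM_simps)
    have co: "coact EM X = cobar_class H EM 1 (frag_extend (\<lambda>(gs, x). frag_of (gs, eproj x)) (rep (coact DM (rep X))))"
      unfolding EM_simps(5) cobar_map_def cobar_class_cong[OF QM_simps] ..
    let ?c = "rep (coact DM (rep X))"
    let ?e = "frag_extend (\<lambda>(gs, x). frag_of (gs, eproj x)) ?c"
    have c: "Poly_Mapping.keys ?c \<subseteq> cobar_words H DM 1" "phi gf pv ?c = cf 1 (pv (rep X))"
      by (rule coact_D0[OF X])+
    have k: "Poly_Mapping.keys ?e \<subseteq> words 1"
      by (rule order_trans[OF keys_frag_extend], rule UN_least)
        (use c(1) in \<open>auto simp: keys_frag_of cobar_words_def EM_simps\<close>)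
    have "phi gf muE ?e - phi gf pv ?c \<in> Pre GG KE 1"
      unfolding phi_def flin_frag_extend
    proof (rule flin_in_mod[OF P1])
      fix w assume "w \<in> Poly_Mapping.keys ?c"
      then obtain g x where w: "w = ([g], x)" "g \<in> carrier (total H)" using c(1) by (auto simp: cobar_words_def length_Suc_conv)
      have "gf g * Sh (muE (eproj x) - pv x) \<in> Pre GG KE (Suc 0)"
        by (intro PreI imageI w) (simp add: muE_eproj)
      then show "flin (wfn gf muE) (case w of (gs, x) \<Rightarrow> frag_of (gs, eproj x)) - wfn gf pv w \<in> Pre GG KE 1"
        by (simp add: w wfn_def right_diff_distrib del: Pre.simps)
    qed
    from addsub_add[OF P1 phi_rep_class[of 1 ?e] this]
    have "phi gf muE (rep (coact EM X)) - cf 1 (muE X) \<in> Pre GG KE 1" by (simp add: co c(2) muE_def del: Pre.simps)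
    moreover have "Poly_Mapping.keys (rep (coact EM X)) \<subseteq> words 1" unfolding co by (rule keys_rep_class[OF k])
    ultimately show ?thesis by blast
  qed
  show ?thesis
  proof (unfold_locales, goal_cases)
    case (1 X) then show ?case using coact by blast
  next
    case (2 X) then show ?case using coact by blast
  next
    case (3 k) then show ?case by (rule cf_BP)
  qed
qed

lemma pv_first_local: "first_local (pv f)" "first_local 0"
  by (simp_all add: first_local_def pv_def fun_ring_apply)

end

context bp_T
begin

section \<open>The two tensor products side by side, and d_1 on functions\<close>

lemma TD_model: "tensor_model p m DM pv {0}"
proof -
  interpret comodule_model H gf bas pv DM pv "{0}" by (rule DM_comodule)
  show ?thesis by unfold_locales (auto simp: pv_first_local)
qed

lemma TE_model: "tensor_model p m EM muE KE"
proof -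
  interpret comodule_model H gf bas pv EM muE KE by (rule EM_comodule)
  show ?thesis by unfold_locales (auto simp: pv_first_local muE_def)
qed

sublocale TD: tensor_model p m i DM pv "{0}" by (rule TD_model)
sublocale TE: tensor_model p m i EM muE KE by (rule TE_model)

abbreviation "TDM \<equiv> T_D0 p m i"
abbreviation "TEM \<equiv> T_E1 p m i"
abbreviation "KK \<equiv> tsp KE"
abbreviation "DD \<equiv> tsp (pv ` D0set)"

lemma TDM_eq: "TDM = tensor_comodule H TC DM"
  by (simp add: T_D0_def)
lemma TEM_eq: "TEM = tensor_comodule H TC EM"
  by (simp add: T_E1_def)

lemma TDM_comodule: "comodule_model H gf bas pv TDM TD.muT {0}"
  using TD.TN_comodule unfolding TDM_eq tsp_zero .
lemma TEM_comodule: "comodule_model H gf bas pv TEM TE.muT KK"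
  using TE.TN_comodule unfolding TEM_eq .

lemma TDM_Img: "cobar_model.Img TDM TD.muT {0} = DD"
  using TD.TN_Img unfolding TDM_eq tsp_zero DM_Img .
lemma TEM_Img: "cobar_model.Img TEM TE.muT KK = DD"
  using TE.TN_Img unfolding TEM_eq EM_Img .

sublocale Td: comodule_model H gf bas pv TDM TD.muT "{0}" by (rule TDM_comodule)
sublocale Te: comodule_model H gf bas pv TEM TE.muT KK by (rule TEM_comodule)

abbreviation "tmap \<equiv> tensor_map_right (base H) TC EM eproj"

lemma tmap_spec:
  assumes z: "z \<in> carrier TDM"
  shows "tmap z \<in> carrier TEM" "TE.muT (tmap z) - TD.muT z \<in> KK"
proof -
  let ?e = "frag_extend (\<lambda>(x, y). frag_of (x, eproj y)) (rep z)"
  have k: "Poly_Mapping.keys (rep z) \<subseteq> Tset \<times> D0set" using TD.TN_rep[of z] z by (simp add: TDM_eq)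
  have eq: "tmap z = tensor_class TE.B TC EM ?e" by (simp add: tensor_map_right_def base_H)
  have ke: "Poly_Mapping.keys ?e \<subseteq> Tset \<times> carrier EM"
    by (rule order_trans[OF keys_frag_extend], rule UN_least) (use k in \<open>auto simp: keys_frag_of EM_simps\<close>)
  show "tmap z \<in> carrier TEM" unfolding eq TEM_eq by (rule TE.tclass_carrier[OF ke])
  have "flin TE.mT ?e - flin TD.mT (rep z) \<in> KK"
    unfolding flin_frag_extend
  proof (rule flin_in_mod[OF TE.KT])
    fix w assume w: "w \<in> Poly_Mapping.keys (rep z)"
    have "gf (fst w) * (muE (eproj (snd w)) - pv (snd w)) \<in> KK"
      by (rule TE.T_KN) (use w k muE_eproj in auto)
    then show "flin TE.mT (case w of (x, y) \<Rightarrow> frag_of (x, eproj y)) - TD.mT w \<in> KK"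
      by (simp add: TE.mT_def TD.mT_def case_prod_unfold right_diff_distrib)
  qed
  from addsub_add[OF TE.KT TE.muT_class[of ?e] this] show "TE.muT (tmap z) - TD.muT z \<in> KK"
    by (simp add: eq TD.muT_def)
qed

text \<open>The projection from D^0 to E^1 does not change functions, up to \<open>KK\<close>, so on
  functions d_1 is the identity.\<close>

lemma d1_eps:
  assumes g: "g \<in> Td.Zc 0" shows "d1 p m i (Td.eps 0 g) = Te.eps 0 g"
proof -
  have gI: "g \<in> Td.PI 0" using g by (simp add: Td.Zc_def)
  \<comment> \<open>In degree 0 the only coboundary is 0, so the Ext class is a singleton and its
    representative is the cocycle class itself.\<close>
  have "Td.eps 0 g = {Td.cls 0 g}" unfolding Td.eps_explicit[OF gI] by (simp add: Td.Bc_def)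
  then have r: "rep (Td.eps 0 g) = Td.cls 0 g" by (simp add: rep_def)
  let ?c = "rep (Td.cls 0 g)"
  let ?e = "frag_extend (\<lambda>(gs, x). frag_of (gs, tmap x)) ?c"
  have "?c \<in> Td.cls 0 g"
  proof -
    obtain c where "Poly_Mapping.keys c \<subseteq> Td.words 0" "phi gf TD.muT c - g \<in> Td.PK 0" using Td.cls_exists[OF gI] .
    then have "c \<in> Td.cls 0 g" by (simp add: Td.cls_def)
    then show ?thesis unfolding rep_def by (rule someI)
  qed
  then have c: "Poly_Mapping.keys ?c \<subseteq> Td.words 0" "phi gf TD.muT ?c = g" by (auto simp: Td.cls_def)
  have w: "\<exists>z. w = ([], z) \<and> z \<in> carrier TDM" if "w \<in> Poly_Mapping.keys ?c" for w
    using c(1) that by (auto simp: cobar_words_def)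
  have k: "Poly_Mapping.keys ?e \<subseteq> Te.words 0"
  proof (rule order_trans[OF keys_frag_extend], rule UN_least)
    fix v assume "v \<in> Poly_Mapping.keys ?c"
    then obtain z where "v = ([], z)" "z \<in> carrier TDM" using w by blast
    then show "Poly_Mapping.keys (case v of (gs, x) \<Rightarrow> frag_of (gs, tmap x)) \<subseteq> Te.words 0"
      using tmap_spec(1) by (simp add: keys_frag_of cobar_words_def)
  qed
  have "phi gf TE.muT ?e - phi gf TD.muT ?c \<in> KK"
    unfolding phi_def flin_frag_extend
  proof (rule flin_in_mod[OF TE.KT])
    fix v assume "v \<in> Poly_Mapping.keys ?c"
    then obtain z where "v = ([], z)" "z \<in> carrier TDM" using w by blast
    then show "flin (wfn gf TE.muT) (case v of (gs, x) \<Rightarrow> frag_of (gs, tmap x)) - wfn gf TD.muT v \<in> KK"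
      using tmap_spec(2) by (simp add: wfn_def)
  qed
  then have "phi gf TE.muT ?e - g \<in> Te.PK 0" by (simp add: c(2))
  then have "cobar_class H TEM 0 ?e = Te.cls 0 g" using Te.cls_eq[OF k] by (simp add: Te.class_eq)
  then have "cobar_map H TEM tmap 0 (rep (Td.eps 0 g)) = Te.cls 0 g" by (simp add: r cobar_map_def)
  then show ?thesis
    unfolding d1_def Ext_comod_map_def Te.eps_def Suc_eq_plus1[symmetric] by simp
qed

end

section \<open>Exactness of the cobar complex of \<open>T \<otimes> D\<^sup>0\<close>\<close>

definition skip :: "nat \<Rightarrow> nat \<Rightarrow> nat" where
  "skip i r = (if r < i then r else Suc r)"

lemma cf_skip: "cf i f a Y = f a (Y \<circ> skip i)"
  unfolding cf_def by (rule arg_cong[where f = "f a"]) (auto simp: skip_def)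

lemma cf_cf: "i \<le> j \<Longrightarrow> cf i (cf j f) = cf (Suc j) (cf i f)"
proof -
  assume ij: "i \<le> j"
  have "skip i \<circ> skip j = skip (Suc j) \<circ> skip i" using ij by (auto simp: skip_def fun_eq_iff)
  then show ?thesis by (intro ext) (simp only: cf_skip comp_assoc)
qed

lemma delta_apply: "delta s f a Y = (\<Sum>i\<le>Suc s. (- 1) ^ i * f a (Y \<circ> skip i))"
proof -
  have "((- 1) ^ i :: chainfun) a Y = (- 1) ^ i" for i
    by (induction i) (auto simp: fun_ring_apply)
  then show ?thesis by (simp add: delta_def sum_fun_apply times_fun_apply cf_skip del: sum.atMost_Suc)
qed

lemma delta_delta: "delta (Suc s) (delta s f) = 0"
proof -
  let ?g = "\<lambda>(i, j). (- 1) ^ (i + j) * cf i (cf j f)"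
  let ?A = "{(i, j). i \<le> Suc (Suc s) \<and> j \<le> Suc s \<and> i \<le> j}"
  let ?B = "{(i, j). i \<le> Suc (Suc s) \<and> j \<le> Suc s \<and> j < i}"
  have cfd: "cf i (delta s f) = (\<Sum>j\<le>Suc s. (- 1) ^ j * cf i (cf j f))" for i
  proof -
    have "cf i ((- 1) ^ j * g) = (- 1) ^ j * cf i g" for j g
      by (cases "even j") auto
    then show ?thesis by (simp add: delta_def cf_sum del: sum.atMost_Suc)
  qed
  have fin: "finite ?A" "finite ?B"
    by (rule finite_subset[of _ "{..Suc (Suc s)} \<times> {..Suc s}"]; auto)+
  have "delta (Suc s) (delta s f) = (\<Sum>i\<le>Suc (Suc s). \<Sum>j\<le>Suc s. ?g (i, j))"
    unfolding delta_def[of "Suc s"] cfd by (simp add: sum_distrib_left power_add mult.assoc del: sum.atMost_Suc)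
  also have "\<dots> = sum ?g ({..Suc (Suc s)} \<times> {..Suc s})" by (simp add: sum.cartesian_product del: sum.atMost_Suc)
  also have "{..Suc (Suc s)} \<times> {..Suc s} = ?A \<union> ?B" by auto
  also have "sum ?g (?A \<union> ?B) = sum ?g ?A + sum ?g ?B" by (rule sum.union_disjoint[OF fin]) auto
  also have "sum ?g ?A = (\<Sum>w\<in>?B. - ?g w)"
  proof (rule sum.reindex_bij_witness[of _ "\<lambda>(i, j). (j, i - 1)" "\<lambda>(i, j). (Suc j, i)"])
    fix w assume "w \<in> ?A"
    then obtain i j where w: "w = (i, j)" "i \<le> j" by auto
    show "- ?g (case w of (i, j) \<Rightarrow> (Suc j, i)) = ?g w" using cf_cf[OF w(2), of f] by (simp add: w(1) add.commute)
  qed auto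
  finally show ?thesis by (simp add: sum_negf)
qed

definition ins :: "nat \<Rightarrow> (nat \<Rightarrow> nat \<Rightarrow> rat) \<Rightarrow> nat \<Rightarrow> nat \<Rightarrow> rat" where
  "ins s Y r = (if r < s then Y r else if r = s then (\<lambda>_. 0) else Y (r - 1))"

text \<open>The contraction inserts the point with \<open>\<lambda>^ = 0\<close> just before the coefficient point.\<close>

definition contract :: "nat \<Rightarrow> chainfun \<Rightarrow> chainfun" where
  "contract s f a Y = f a (ins s Y)"

text \<open>Omitting one of the points before the inserted origin moves the origin from position s +
  2 to s + 1, where \<open>contract (Suc s)\<close> puts it; omitting the origin itself undoes the
  insertion, with sign (-1)^(s+2) = (-1)^s.\<close>

lemma delta_contract: "delta (Suc s) f a (ins (Suc (Suc s)) Y) = delta s (contract (Suc s) f) a Y + (- 1) ^ s * f a Y"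
proof -
  have 1: "ins (Suc (Suc s)) Y \<circ> skip i = ins (Suc s) (Y \<circ> skip i)" if "i \<le> Suc s" for i
    using that by (auto simp: fun_eq_iff ins_def skip_def)
  have 2: "ins (Suc (Suc s)) Y \<circ> skip (Suc (Suc s)) = Y"
    by (auto simp: fun_eq_iff ins_def skip_def)
  have "delta (Suc s) f a (ins (Suc (Suc s)) Y)
      = (\<Sum>i\<le>Suc s. (- 1) ^ i * f a (ins (Suc (Suc s)) Y \<circ> skip i)) + (- 1) ^ s * f a Y"
    unfolding delta_apply sum.atMost_Suc[of _ "Suc s"] 2 by simp
  also have "(\<Sum>i\<le>Suc s. (- 1) ^ i * f a (ins (Suc (Suc s)) Y \<circ> skip i)) = delta s (contract (Suc s) f) a Y"
    unfolding delta_apply contract_def by (rule sum.cong) (auto simp: 1)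
  finally show ?thesis .
qed

lemma delta_exact: assumes "delta (Suc s) f = 0" shows "f = delta s ((- 1) ^ Suc s * contract (Suc s) f)"
proof (intro ext)
  fix a Y
  have "delta s (contract (Suc s) f) a Y + (- 1) ^ s * f a Y = 0"
    using delta_contract[of s f a Y] by (simp add: assms fun_ring_apply)
  moreover have "delta s (- g) = - delta s g" for g using delta_diff[of s 0 g] by simp
  ultimately show "f a Y = delta s ((- 1) ^ Suc s * contract (Suc s) f) a Y"
    by (cases "even s") (auto simp: fun_ring_apply)
qed

context bp_T
begin

section \<open>The cochains of T \<otimes> D^0 are the polynomial functions\<close>

definition yv :: "nat \<Rightarrow> chainfun" where
  "yv s a Y = Y s 1"

definition LL :: "nat \<Rightarrow> chainfun set" where
  "LL s = {\<Sum>l<q. cur (F l) * yv (Suc s) ^ l | F. \<forall>l. F l \<in> CP s}"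

lemma cur_more: "cur (\<lambda>z. F z - G z) = cur F - cur G" "cur (\<lambda>_. 0) = 0" "cur (\<lambda>_. 1) = 1" "cur (\<lambda>z. - F z) = - cur F"
  by (simp_all add: fun_eq_iff cur_def fun_ring_apply)

lemma CP_const: "0 \<in> Z_local p" "1 \<in> Z_local p"
  using ratring_0[OF Zp] ratring_1[OF Zp] .

lemma LL_addsub: "addsub (LL s)"
  unfolding addsub_def
proof (intro conjI ballI)
  show "0 \<in> LL s" unfolding LL_def
    by (intro CollectI exI[of _ "\<lambda>_ _. 0"]) (auto simp: cur_more intro: zpoly.const CP_const)
  fix f g assume "f \<in> LL s" "g \<in> LL s"
  then obtain F G where F: "\<forall>l. F l \<in> CP s" "f = (\<Sum>l<q. cur (F l) * yv (Suc s) ^ l)"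
    and G: "\<forall>l. G l \<in> CP s" "g = (\<Sum>l<q. cur (G l) * yv (Suc s) ^ l)" by (auto simp: LL_def)
  have "f - g = (\<Sum>l<q. cur (\<lambda>z. F l z - G l z) * yv (Suc s) ^ l)"
    by (simp add: F G cur_more sum_subtractf left_diff_distrib)
  then show "f - g \<in> LL s" unfolding LL_def using F G
    by (intro CollectI exI[of _ "\<lambda>l z. F l z - G l z"]) (auto intro: zpoly_diff[OF Zp])
qed

lemma LL_mult:
  assumes "F \<in> CP s" "f \<in> LL s" shows "cur F * f \<in> LL s"
proof -
  obtain G where G: "\<forall>l. G l \<in> CP s" "f = (\<Sum>l<q. cur (G l) * yv (Suc s) ^ l)" using assms(2) by (auto simp: LL_def)
  have "cur F * f = (\<Sum>l<q. cur (\<lambda>z. F z * G l z) * yv (Suc s) ^ l)"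
    by (simp add: G cur_simps sum_distrib_left mult.assoc)
  then show ?thesis unfolding LL_def using G assms(1)
    by (intro CollectI exI[of _ "\<lambda>l z. F z * G l z"]) (auto intro: zpoly.mult)
qed

lemma LL_power: assumes "l < q" shows "yv (Suc s) ^ l \<in> LL s"
proof -
  have eq: "(\<Sum>j<q. cur (\<lambda>_. if j = l then 1 else 0) * yv (Suc s) ^ j) = yv (Suc s) ^ l"
    using assms by (subst sum.remove[of _ l]) (auto simp: cur_more)
  show ?thesis unfolding LL_def
    by (intro CollectI exI[of _ "\<lambda>j _. if j = l then 1 else 0"]) (auto simp: eq intro: zpoly.const CP_const)
qed

lemma th_yv: "th = yv 1 - yv 0" "yv 1 = th + yv 0"
  by (simp_all add: fun_eq_iff th_def yv_def fun_ring_apply)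

lemma cgensE:
  assumes "g \<in> cgens s"
  obtains n where "g = (\<lambda>z. fst z n)" "1 \<le> n" "n \<le> m" | j k where "g = (\<lambda>z. snd z j k)" "j \<le> s" "1 \<le> k"
  using assms by (auto simp: cgens_def)

lemma CP_mono: "F \<in> CP s \<Longrightarrow> s \<le> s' \<Longrightarrow> F \<in> CP s'"
proof (rule zpoly_subst[where h = "\<lambda>z. z"], assumption)
  fix g assume "s \<le> s'" "g \<in> cgens s"
  then show "(\<lambda>z. g z) \<in> CP s'" by (elim cgensE) (auto intro: CP_a CP_y CP_a' CP_y')
qed

lemma of_nat_Zp: "of_nat n \<in> Z_local p"
  using ratring_of_nat[OF Zp] .

lemma cur_of_nat: "cur (\<lambda>_. of_nat n) = of_nat n"
proof -
  have "of_nat n a Y = (of_nat n :: rat)" for a :: "nat \<Rightarrow> rat" and Y :: "nat \<Rightarrow> nat \<Rightarrow> rat"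
    by (induction n) (auto simp: fun_ring_apply)
  then show ?thesis by (simp add: fun_eq_iff cur_def)
qed

lemma yv_cur: "yv s = cur (\<lambda>z. snd z s 1)"
  by (simp add: fun_eq_iff yv_def cur_def)

lemma cur_power: "cur (\<lambda>z. F z ^ n) = cur F ^ n"
  by (induction n) (auto simp: cur_more cur_simps)

text \<open>As \<open>th\<close> is \<open>yv 1 - yv 0\<close>, the binomial formula turns powers of
  t below q into combinations of powers of w_1 below q with coefficients in the coordinates of Y
  0.\<close>

lemma DD_LL: "DD \<subseteq> LL 0"
proof
  fix f assume "f \<in> DD"
  then obtain k where k: "\<forall>l. k l \<in> pv ` D0set" "f = (\<Sum>l<q. th ^ l * k l)" by (auto simp: tsp_def)
  have "th ^ l * k l \<in> LL 0" if l: "l < q" for l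
  proof -
    obtain d where d: "d \<in> D0set" "k l = pv d" using k by blast
    have kc: "k l = cur (\<lambda>z. pv d (fst z) (snd z))" by (simp add: d(2) fun_eq_iff cur_def)
    have th: "th = (- yv 0) + yv 1" by (simp add: th_yv)
    have "th ^ l = (\<Sum>b\<le>l. of_nat (l choose b) * (- yv 0) ^ b * yv 1 ^ (l - b))"
      unfolding th by (rule binomial_ring)
    also have "\<dots> = (\<Sum>b\<le>l. cur (\<lambda>z. of_nat (l choose b) * (0 - snd z 0 1) ^ b) * yv (Suc 0) ^ (l - b))"
      by (rule sum.cong[OF refl]) (simp add: cur_simps cur_power cur_more cur_of_nat yv_cur)
    also have "\<dots> \<in> LL 0"
    proof (intro addsub_sum[OF LL_addsub] LL_mult LL_power zpoly.mult zpoly_power[OF Zp] zpoly_diff[OF Zp] zpoly.const CP_const of_nat_Zp CP_y)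
      show "l - b < q" for b using l by simp
    qed auto
    finally have "cur (\<lambda>z. pv d (fst z) (snd z)) * th ^ l \<in> LL 0" by (rule LL_mult[OF D0_CP[OF d(1)]])
    then show ?thesis by (simp add: kc mult.commute)
  qed
  then show "f \<in> LL 0" unfolding k(2) by (intro addsub_sum[OF LL_addsub]) auto
qed

lemma gf_CP:
  assumes "g \<in> carrier (total H)" shows "\<exists>F\<in>CP 1. gf g = cur F"
proof -
  obtain x where x: "x \<in> BPBP p" "g = prj x" using assms by (auto simp: carrier_total)
  let ?F = "\<lambda>z :: (nat \<Rightarrow> rat) \<times> (nat \<Rightarrow> nat \<Rightarrow> rat). ev (penv (fst z) (snd z 0) (snd z 1)) x"
  have ts: "(\<lambda>z. tseq p (pt p m (fst z) (snd z 0)) (pt p m (fst z) (snd z 1)) n) \<in> CP 1" for n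
    by (rule tseq_integral[OF prime_p Zp m_pos]) (auto intro: CP_a CP_y CP_a' CP_y')
  have "?F \<in> CP 1"
  proof (rule zpoly_ev[OF Zp x(1)[unfolded BPBP_def]])
    fix w assume "w \<in> V ` {1..} \<union> gen.T ` {1..}"
    then consider n where "w = V n" "n \<ge> 1" | n where "w = gen.T n" by auto
    then show "(\<lambda>z. penv (fst z) (snd z 0) (snd z 1) w) \<in> CP 1"
    proof cases
      case (1 n) then show ?thesis using pt_CP[of n 0 1] by (simp add: penv_def)
    next
      case (2 n) then show ?thesis using ts[of n] by (simp add: penv_def)
    qed
  qed
  moreover have "gf g = cur ?F" by (simp add: fun_eq_iff cur_def x(2) gf_prj)
  ultimately show ?thesis by blast
qed

lemma Sh_LL: assumes "f \<in> LL s" shows "Sh f \<in> LL (Suc s)"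
proof -
  obtain F where F: "\<forall>l. F l \<in> CP s" "f = (\<Sum>l<q. cur (F l) * yv (Suc s) ^ l)" using assms by (auto simp: LL_def)
  have "Sh (cur G) = cur (\<lambda>z. G (fst z, \<lambda>j. snd z (Suc j)))" for G by (simp add: fun_eq_iff cur_def Sh_def)
  moreover have "Sh (yv (Suc s)) = yv (Suc (Suc s))" by (simp add: fun_eq_iff yv_def Sh_def)
  ultimately have eq: "Sh f = (\<Sum>l<q. cur (\<lambda>z. F l (fst z, \<lambda>j. snd z (Suc j))) * yv (Suc (Suc s)) ^ l)"
    by (simp add: F(2) Sh_sum Sh_power)
  have "(\<lambda>z. G (fst z, \<lambda>j. snd z (Suc j))) \<in> CP (Suc s)" if "G \<in> CP s" for G
  proof (rule zpoly_subst[OF that])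
    fix g assume "g \<in> cgens s"
    then show "(\<lambda>z. g (fst z, \<lambda>j. snd z (Suc j))) \<in> CP (Suc s)"
      by (elim cgensE) (auto intro: CP_a CP_y CP_a' CP_y')
  qed
  then show ?thesis unfolding LL_def eq using F(1) by (intro CollectI exI[of _ "\<lambda>l z. F l (fst z, \<lambda>j. snd z (Suc j))"]) auto
qed

lemma Pre_DD_LL: "Pre GG DD s \<subseteq> LL s"
proof (induction s)
  case 0 then show ?case using DD_LL by simp
next
  case (Suc s)
  show ?case
  proof
    fix f assume "f \<in> Pre GG DD (Suc s)"
    then show "f \<in> LL (Suc s)"
      unfolding Pre.simps
    proof induction
      case (base x)
      then obtain g h where x: "x = gf g * Sh h" "g \<in> carrier (total H)" "h \<in> Pre GG DD s" by blast
      obtain F where F: "F \<in> CP 1" "gf g = cur F" using gf_CP[OF x(2)] by blast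
      show ?case unfolding x(1) F(2) by (intro LL_mult CP_mono[OF F(1)] Sh_LL subsetD[OF Suc x(3)]) simp
    qed (auto intro: addsub_0[OF LL_addsub] addsub_diff[OF LL_addsub])
  qed
qed

lemma D0_image_addsub: "addsub (pv ` D0set)"
proof -
  have "pv b - pv c \<in> pv ` D0set" if "b \<in> D0set" "c \<in> D0set" for b c
    using D0_diff[OF that] pv_simps(2) by (metis image_eqI)
  moreover have "0 \<in> pv ` D0set" using pv_simps(5) D0_0 by (metis image_eqI)
  ultimately show ?thesis by (auto simp: addsub_def)
qed

lemma DD_addsub: "addsub DD" by (rule tsp_addsub[OF D0_image_addsub])

lemma DD_mult: "d \<in> D0set \<Longrightarrow> f \<in> DD \<Longrightarrow> pv d * f \<in> DD"
proof (rule tsp_mult, assumption)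
  fix x assume "d \<in> D0set" "x \<in> pv ` D0set"
  then obtain e where "e \<in> D0set" "x = pv e" by blast
  then show "pv d * x \<in> pv ` D0set" using imageI[OF D0_mult[OF \<open>d \<in> D0set\<close> \<open>e \<in> D0set\<close>], of pv] by (simp only: pv_simps(3))
qed

text \<open>In degree 0, \<open>yv 1\<close> is \<open>th + yv 0\<close>, and \<open>yv 0\<close> is
  the function of \<lambda>^_1, which is in D^0. Higher degrees are reached by putting the factor 1
  of \<Gamma> in front.\<close>

lemma yv_Pre_DD: "l < q \<Longrightarrow> yv (Suc s) ^ l \<in> Pre GG DD s"
proof (induction s)
  case 0
  have y0: "yv 0 = pv (hat_lambda p m 1)" by (simp add: fun_eq_iff yv_def pv_lambda[of 1, simplified])
  have pw: "yv 0 ^ j \<in> pv ` D0set" for j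
  proof (induction j)
    case 0 then show ?case using D0_1 pv_simps(6) by (metis image_eqI power_0)
  next
    case (Suc j)
    then obtain d where d: "d \<in> D0set" "yv 0 ^ j = pv d" by blast
    have "yv 0 ^ Suc j = yv 0 * pv d" by (simp add: d(2))
    then have "yv 0 ^ Suc j = pv (hat_lambda p m 1 * d)" by (simp add: y0 pv_simps)
    then show ?case using D0_mult[OF D0_hat_lambda[of 1] d(1)] by simp
  qed
  have "yv 1 ^ l = (\<Sum>b\<le>l. of_int (int (l choose b)) * (th ^ b * yv 0 ^ (l - b)))"
    unfolding th_yv(2) by (simp add: binomial_ring mult.assoc)
  also have "\<dots> \<in> DD"
    by (intro addsub_sum[OF DD_addsub] addsub_of_int[OF DD_addsub] tsp_power[OF D0_image_addsub] pw) (use 0 in auto)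
  finally show ?case by simp
next
  case (Suc s)
  have "gf \<one>\<^bsub>total H\<^esub> * Sh (yv (Suc s) ^ l) \<in> Pre GG DD (Suc s)" by (intro PreI imageI one_closed Suc)
  moreover have "Sh (yv (Suc s)) = yv (Suc (Suc s))" by (simp add: fun_eq_iff yv_def Sh_def)
  ultimately show ?case by (simp add: gf_one Sh_power del: Pre.simps)
qed

text \<open>By \<open>gf_CP\<close> the functions of tensors are polynomials of the required shape;
  conversely \<open>Pre_multiplier\<close>, applied to the powers of w_1, shows that all of these
  occur.\<close>

lemma Pre_DD: "Pre GG DD s = LL s"
proof
  show "LL s \<subseteq> Pre GG DD s"
  proof
    fix f assume "f \<in> LL s"
    then obtain F where F: "\<forall>l. F l \<in> CP s" "f = (\<Sum>l<q. cur (F l) * yv (Suc s) ^ l)" by (auto simp: LL_def)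
    show "f \<in> Pre GG DD s"
      unfolding F(2) by (intro addsub_sum[OF addsub_Pre[OF DD_addsub]] Pre_multiplier[OF DD_addsub DD_mult] yv_Pre_DD) (use F(1) in auto)
  qed
qed (rule Pre_DD_LL)

text \<open>The coordinates of the inserted origin are 0, which is p-integral, so polynomials stay
  polynomials; the parameter moves from index s + 2 to s + 1.\<close>

lemma contract_LL: assumes "f \<in> LL (Suc s)" shows "contract (Suc s) f \<in> LL s"
proof -
  obtain F where F: "\<forall>l. F l \<in> CP (Suc s)" "f = (\<Sum>l<q. cur (F l) * yv (Suc (Suc s)) ^ l)" using assms by (auto simp: LL_def)
  have pw: "(g ^ l) a Y = g a Y ^ l" for g :: chainfun and a Y l
    by (induction l) (auto simp: fun_ring_apply)
  have eq: "contract (Suc s) f = (\<Sum>l<q. cur (\<lambda>z. F l (fst z, ins (Suc s) (snd z))) * yv (Suc s) ^ l)"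
    by (intro ext) (simp add: contract_def F(2) sum_fun_apply times_fun_apply pw cur_def yv_def ins_def[of "Suc s" _ "Suc (Suc s)"])
  have "(\<lambda>z. G (fst z, ins (Suc s) (snd z))) \<in> CP s" if "G \<in> CP (Suc s)" for G
  proof (rule zpoly_subst[OF that])
    fix g assume "g \<in> cgens (Suc s)"
    then consider i where "g = (\<lambda>z. fst z i)" "1 \<le> i" "i \<le> m" | j k where "g = (\<lambda>z. snd z j k)" "j \<le> Suc s" "1 \<le> k"
      by (auto simp: cgens_def)
    then show "(\<lambda>z. g (fst z, ins (Suc s) (snd z))) \<in> CP s"
    proof cases
      case (1 i) then show ?thesis using CP_a by simp
    next
      case (2 j k)
      then show ?thesis
        using CP_y[of j s k] zpoly.const[OF CP_const(1)] by (cases "j = Suc s") (auto simp: ins_def)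
    qed
  qed
  then show ?thesis unfolding LL_def eq using F(1) by (intro CollectI exI[of _ "\<lambda>l z. F l (fst z, ins (Suc s) (snd z))"]) auto
qed

lemma LL_exact:
  assumes f: "f \<in> LL (Suc s)" "delta (Suc s) f = 0" obtains g where "g \<in> LL s" "f = delta s g"
  using delta_exact[OF f(2)] minus_one_power_in[OF LL_addsub contract_LL[OF f(1)], of "Suc s"] that by blast

end

section \<open>The isomorphisms\<close>

text \<open>For the cokernel of d_1: it is presented as an image of a group of functions,
  \<open>W\<close> being the functions whose classes form the image of d_1. The last conclusion
  expresses the kernel by functions, as \<open>iso_of_same_kernel\<close> requires.\<close>

lemma agrp_quotient_epi:
  assumes G: "comm_group G" and e: "e \<in> hom (agrp Z) G" "e ` Z = carrier G" "e 0 = \<one>\<^bsub>G\<^esub>"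
    and Z: "addsub Z" and W: "addsub W" "W \<subseteq> Z"
  defines "k \<equiv> \<lambda>x. (e ` W) #>\<^bsub>G\<^esub> e x"
  shows "k \<in> hom (agrp Z) (G Mod e ` W)" "k ` Z = carrier (G Mod e ` W)" "k 0 = \<one>\<^bsub>G Mod e ` W\<^esub>"
    "\<And>x. x \<in> Z \<Longrightarrow> k x = \<one>\<^bsub>G Mod e ` W\<^esub> \<longleftrightarrow> (\<exists>w\<in>W. e (x - w) = \<one>\<^bsub>G\<^esub>)"
proof -
  interpret G: comm_group G by (rule G)
  have gz: "group (agrp Z)" by (rule group_agrp[OF Z])
  interpret h: group_hom "agrp Z" G e
    using gz G.group_axioms e(1) by (simp add: group_hom_def group_hom_axioms_def)
  have ee: "e (x + y) = e x \<otimes>\<^bsub>G\<^esub> e y" if "x \<in> Z" "y \<in> Z" for x y using hom_mult[OF e(1), of x y] that by simp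
  have ec: "e x \<in> carrier G" if "x \<in> Z" for x using e(2) that by blast
  have ei: "e (- x) = inv\<^bsub>G\<^esub> e x" if x: "x \<in> Z" for x
  proof -
    have "e (- x) \<otimes>\<^bsub>G\<^esub> e x = \<one>\<^bsub>G\<^esub>" using ee[OF addsub_uminus[OF Z x] x] e(3) by simp
    from sym[OF G.inv_equality[OF this ec[OF x] ec[OF addsub_uminus[OF Z x]]]] show ?thesis .
  qed
  have sub: "subgroup (e ` W) G"
  proof (rule G.subgroupI)
    show "e ` W \<subseteq> carrier G" "e ` W \<noteq> {}" using ec W addsub_0[OF W(1)] by auto
    fix a assume "a \<in> e ` W"
    then obtain x where x: "x \<in> W" "a = e x" by blast
    have "inv\<^bsub>G\<^esub> a = e (- x)" using ei[of x] x W(2) by auto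
    then show "inv\<^bsub>G\<^esub> a \<in> e ` W" using imageI[OF addsub_uminus[OF W(1) x(1)], of e] by simp
    fix b assume "b \<in> e ` W"
    then obtain y where y: "y \<in> W" "b = e y" by blast
    have "e (x + y) = e x \<otimes>\<^bsub>G\<^esub> e y" by (rule ee) (use x y W(2) in auto)
    then have "a \<otimes>\<^bsub>G\<^esub> b = e (x + y)" by (simp only: x(2) y(2))
    then show "a \<otimes>\<^bsub>G\<^esub> b \<in> e ` W" using imageI[OF addsub_add[OF W(1) x(1) y(1)], of e] by simp
  qed
  then interpret N: normal "e ` W" G by (rule G.subgroup_imp_normal)
  show "k \<in> hom (agrp Z) (G Mod e ` W)"
    using hom_compose[OF e(1) N.r_coset_hom_Mod] by (simp add: k_def comp_def)
  show "k ` Z = carrier (G Mod e ` W)"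
    unfolding carrier_FactGroup k_def e(2)[symmetric] by auto
  show k0: "k 0 = \<one>\<^bsub>G Mod e ` W\<^esub>"
    using G.coset_mult_one[OF subgroup.subset[OF sub]] by (simp add: k_def e(3) FactGroup_def)
  fix x assume x: "x \<in> Z"
  have "k x = \<one>\<^bsub>G Mod e ` W\<^esub> \<longleftrightarrow> (e ` W) #>\<^bsub>G\<^esub> e x = e ` W" by (simp add: k_def FactGroup_def)
  also have "\<dots> \<longleftrightarrow> e x \<in> e ` W"
    using G.coset_join1[OF _ ec[OF x] sub] G.coset_join2[OF ec[OF x] sub] subgroup.subset[OF sub] by blast
  also have "\<dots> \<longleftrightarrow> (\<exists>w\<in>W. e (x - w) = \<one>\<^bsub>G\<^esub>)"
  proof -
    have "e (x - w) = \<one>\<^bsub>G\<^esub> \<longleftrightarrow> e x = e w" if w: "w \<in> W" for w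
    proof -
      have wZ: "w \<in> Z" using w W(2) by blast
      have "e (x - w) = e x \<otimes>\<^bsub>G\<^esub> inv\<^bsub>G\<^esub> e w" using ee[OF x addsub_uminus[OF Z wZ]] ei[OF wZ] by simp
      moreover have "\<one>\<^bsub>G\<^esub> = e x \<otimes>\<^bsub>G\<^esub> inv\<^bsub>G\<^esub> e w \<longleftrightarrow> e x = \<one>\<^bsub>G\<^esub> \<otimes>\<^bsub>G\<^esub> e w"
        by (rule G.inv_solve_right[OF G.one_closed ec[OF x] ec[OF wZ]])
      ultimately show ?thesis unfolding G.l_one[OF ec[OF wZ]] by metis
    qed
    then show ?thesis by (auto simp: image_iff)
  qed
  finally show "k x = \<one>\<^bsub>G Mod e ` W\<^esub> \<longleftrightarrow> (\<exists>w\<in>W. e (x - w) = \<one>\<^bsub>G\<^esub>)" .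
qed

lemma (in comodule_model) comm_group_Ext: "comm_group (Ext_comod H M s)"
proof (rule group.group_comm_groupI[OF group_Ext])
  fix X Y assume "X \<in> carrier (Ext_comod H M s)" "Y \<in> carrier (Ext_comod H M s)"
  then obtain f g where fg: "f \<in> Zc s" "g \<in> Zc s" "X = eps s f" "Y = eps s g" by (auto simp: carrier_Ext)
  show "X \<otimes>\<^bsub>Ext_comod H M s\<^esub> Y = Y \<otimes>\<^bsub>Ext_comod H M s\<^esub> X"
    using hom_mult[OF eps_hom, of f s g] hom_mult[OF eps_hom, of g s f] fg by (simp add: add.commute)
qed

context bp_T
begin

lemma T_Zc: "T.Zc s = {f \<in> Pre GG KK s. delta s f = 0}"
  by (simp add: T.Zc_def TC_Img Pre_zero del: Pre.simps)
lemma Td_Zc: "Td.Zc s = {f \<in> LL s. delta s f = 0}"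
  by (simp add: Td.Zc_def TDM_Img Pre_DD Pre_zero del: Pre.simps)
lemma Te_Zc: "Te.Zc s = {f \<in> LL s. delta s f \<in> Pre GG KK (Suc s)}"
  by (simp add: Te.Zc_def TEM_Img Pre_DD del: Pre.simps)

lemma T_eps_one: "f \<in> T.Zc s \<Longrightarrow> T.eps s f = \<one>\<^bsub>Ext_comod H TC s\<^esub> \<longleftrightarrow> f \<in> T.Bc s"
  using T.eps_eq_one[of f s] by (simp add: Pre_zero del: Pre.simps)

lemma KK_LL: "Pre GG KK s \<subseteq> LL s"
  using Te.PK_PI[of s] by (simp add: TEM_Img Pre_DD del: Pre.simps)

lemma PKK: "addsub (Pre GG KK s)"
  using Te.PK .

text \<open>The connecting homomorphism of \<open>0 \<rightarrow> T \<rightarrow> T \<otimes> D\<^sup>0 \<rightarrow> T \<otimes> E\<^sup>1 \<rightarrow> 0\<close>.\<close>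

definition conn :: "nat \<Rightarrow> chainfun \<Rightarrow> (qpoly set list \<times> qpoly set \<Rightarrow>\<^sub>0 int) set set" where
  "conn s g = T.eps (Suc s) (delta s g)"

lemma delta_Zc: "g \<in> Te.Zc s \<Longrightarrow> delta s g \<in> T.Zc (Suc s)"
  by (simp add: T_Zc Te_Zc delta_delta del: Pre.simps)

text \<open>For surjectivity: a cocycle of T in degree s + 1 is a cocycle of T \<otimes> D^0, hence
  equals \<open>delta s g\<close> with g in \<open>LL s\<close> by \<open>LL_exact\<close>; and g is
  a cocycle for T \<otimes> E^1 because its differential is a function of T.\<close>

lemma conn_epi:
  "conn s \<in> hom (agrp (Te.Zc s)) (Ext_comod H TC (Suc s))"
  "conn s ` carrier (agrp (Te.Zc s)) = carrier (Ext_comod H TC (Suc s))"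
  "conn s \<one>\<^bsub>agrp (Te.Zc s)\<^esub> = \<one>\<^bsub>Ext_comod H TC (Suc s)\<^esub>"
proof -
  show "conn s \<in> hom (agrp (Te.Zc s)) (Ext_comod H TC (Suc s))"
    using hom_in_carrier[OF T.eps_hom] hom_mult[OF T.eps_hom] delta_Zc
    by (intro homI) (auto simp: conn_def delta_add)
  have "delta s ` Te.Zc s = T.Zc (Suc s)"
  proof (intro equalityI subsetI)
    fix f assume "f \<in> T.Zc (Suc s)"
    then have f: "f \<in> Pre GG KK (Suc s)" "delta (Suc s) f = 0" by (auto simp: T_Zc simp del: Pre.simps)
    obtain g where "g \<in> LL s" "f = delta s g" using LL_exact[OF subsetD[OF KK_LL f(1)] f(2)] .
    then show "f \<in> delta s ` Te.Zc s" using f(1) by (auto simp: Te_Zc simp del: Pre.simps)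
  qed (use delta_Zc in blast)
  then show "conn s ` carrier (agrp (Te.Zc s)) = carrier (Ext_comod H TC (Suc s))"
    by (simp add: T.carrier_Ext conn_def image_image[symmetric])
  show "conn s \<one>\<^bsub>agrp (Te.Zc s)\<^esub> = \<one>\<^bsub>Ext_comod H TC (Suc s)\<^esub>"
    by (simp add: conn_def T.one_Ext)
qed

text \<open>The coboundaries of T are the differentials of functions in \<open>Pre GG KK s\<close>,
  so triviality means that g can be corrected by such a k to a cocycle of T \<otimes> D^0.\<close>

lemma conn_eq_one:
  assumes g: "g \<in> Te.Zc s"
  shows "conn s g = \<one>\<^bsub>Ext_comod H TC (Suc s)\<^esub> \<longleftrightarrow> (\<exists>k\<in>Pre GG KK s. delta s (g - k) = 0)"
  unfolding conn_def T_eps_one[OF delta_Zc[OF g]] T.Bc_def nat.case TC_Img by (auto simp: delta_diff simp del: Pre.simps)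

lemma eps_epi: "Te.eps s ` carrier (agrp (Te.Zc s)) = carrier (Ext_comod H TEM s)" "Te.eps s \<one>\<^bsub>agrp (Te.Zc s)\<^esub> = \<one>\<^bsub>Ext_comod H TEM s\<^esub>"
  by (simp_all add: Te.carrier_Ext Te.one_Ext)

text \<open>Both groups are images of \<open>Te.Zc (Suc s)\<close>. In positive degree every cocycle
  of T \<otimes> D^0 is a differential, so being correctable to such a cocycle by a function of T is
  the same as being a coboundary modulo the functions of T.\<close>

theorem Ext_shift: "Ext_comod H TC (Suc (Suc s)) \<cong> Ext_comod H TEM (Suc s)"
proof (rule iso_of_same_kernel[OF group_agrp[OF Te.Zc_addsub[of "Suc s"]] conn_epi[of "Suc s"] Te.eps_hom[of "Suc s"]])
  show "Te.eps (Suc s) ` carrier (agrp (Te.Zc (Suc s))) = carrier (Ext_comod H TEM (Suc s))"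
    "Te.eps (Suc s) \<one>\<^bsub>agrp (Te.Zc (Suc s))\<^esub> = \<one>\<^bsub>Ext_comod H TEM (Suc s)\<^esub>" by (rule eps_epi)+
  fix g assume "g \<in> carrier (agrp (Te.Zc (Suc s)))"
  then have g: "g \<in> Te.Zc (Suc s)" by simp
  then have gL: "g \<in> LL (Suc s)" by (simp add: Te_Zc)
  have "(\<exists>k\<in>Pre GG KK (Suc s). delta (Suc s) (g - k) = 0) \<longleftrightarrow> (\<exists>b\<in>LL s. g - delta s b \<in> Pre GG KK (Suc s))"
  proof
    assume "\<exists>k\<in>Pre GG KK (Suc s). delta (Suc s) (g - k) = 0"
    then obtain k where k: "k \<in> Pre GG KK (Suc s)" "delta (Suc s) (g - k) = 0" by blast
    have "g - k \<in> LL (Suc s)" using addsub_diff[OF LL_addsub gL] KK_LL k(1) by blast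
    then obtain b where b: "b \<in> LL s" "g - k = delta s b" using LL_exact[OF _ k(2)] by blast
    then have "g - delta s b = k" by (metis add_diff_cancel_left' diff_add_cancel)
    then show "\<exists>b\<in>LL s. g - delta s b \<in> Pre GG KK (Suc s)" using b(1) k(1) by blast
  next
    assume "\<exists>b\<in>LL s. g - delta s b \<in> Pre GG KK (Suc s)"
    then obtain b where b: "b \<in> LL s" "g - delta s b \<in> Pre GG KK (Suc s)" by blast
    then show "\<exists>k\<in>Pre GG KK (Suc s). delta (Suc s) (g - k) = 0"
      by (intro bexI[OF _ b(2)]) (simp add: delta_diff delta_delta)
  qed
  then show "conn (Suc s) g = \<one>\<^bsub>Ext_comod H TC (Suc (Suc s))\<^esub> \<longleftrightarrow> Te.eps (Suc s) g = \<one>\<^bsub>Ext_comod H TEM (Suc s)\<^esub>"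
    unfolding conn_eq_one[OF g] Te.eps_eq_one[OF g] Te.Bc_def nat.case TEM_Img Pre_DD by blast
qed

lemma Td_sub_Te: "Td.Zc s \<subseteq> Te.Zc s"
  using addsub_0[OF PKK] by (auto simp: Td_Zc Te_Zc simp del: Pre.simps)

lemma d1_image: "d1 p m i ` carrier (Ext_comod H TDM 0) = Te.eps 0 ` Td.Zc 0"
  by (auto simp: Td.carrier_Ext d1_eps image_iff)

lemma Te_eps_0: "g \<in> Te.Zc 0 \<Longrightarrow> Te.eps 0 g = \<one>\<^bsub>Ext_comod H TEM 0\<^esub> \<longleftrightarrow> g \<in> KK"
  using Te.eps_eq_one[of g 0] by (simp add: Te.Bc_def)

text \<open>In degree 0 exactness does not help: the cocycles of T \<otimes> D^0 remain as the
  subgroup \<open>Td.Zc 0\<close> of \<open>Te.Zc 0\<close>, and by \<open>d1_image\<close> their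
  classes form the image of d_1. The connecting map is trivial on this subgroup plus
  \<open>KK\<close>.\<close>

theorem Ext_1: "Ext_comod H TC 1 \<cong> Ext_comod H TEM 0 Mod (d1 p m i ` carrier (Ext_comod H TDM 0))"
proof -
  have e: "Te.eps 0 ` Te.Zc 0 = carrier (Ext_comod H TEM 0)" "Te.eps 0 0 = \<one>\<^bsub>Ext_comod H TEM 0\<^esub>"
    by (simp_all add: Te.carrier_Ext Te.one_Ext)
  note q = agrp_quotient_epi[OF Te.comm_group_Ext Te.eps_hom e Te.Zc_addsub Td.Zc_addsub Td_sub_Te]
  have "Ext_comod H TC (Suc 0) \<cong> Ext_comod H TEM 0 Mod (Te.eps 0 ` Td.Zc 0)"
  proof (rule iso_of_same_kernel[OF group_agrp[OF Te.Zc_addsub[of 0]] conn_epi[of 0] q(1)])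
    fix g assume "g \<in> carrier (agrp (Te.Zc 0))"
    then have g: "g \<in> Te.Zc 0" by simp
    have gL: "g \<in> LL 0" using g by (simp add: Te_Zc)
    have "(\<exists>k\<in>Pre GG KK 0. delta 0 (g - k) = 0) \<longleftrightarrow> (\<exists>w\<in>Td.Zc 0. Te.eps 0 (g - w) = \<one>\<^bsub>Ext_comod H TEM 0\<^esub>)"
    proof
      assume "\<exists>k\<in>Pre GG KK 0. delta 0 (g - k) = 0"
      then obtain k where k: "k \<in> KK" "delta 0 (g - k) = 0" by auto
      have "k \<in> LL 0" using KK_LL[of 0] k(1) by auto
      then have w: "g - k \<in> Td.Zc 0" using k(2) addsub_diff[OF LL_addsub gL] by (simp add: Td_Zc)
      have "g - (g - k) \<in> Te.Zc 0" by (rule addsub_diff[OF Te.Zc_addsub g subsetD[OF Td_sub_Te w]])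
      then have "Te.eps 0 (g - (g - k)) = \<one>\<^bsub>Ext_comod H TEM 0\<^esub>" using Te_eps_0 k(1) by simp
      then show "\<exists>w\<in>Td.Zc 0. Te.eps 0 (g - w) = \<one>\<^bsub>Ext_comod H TEM 0\<^esub>" using w by blast
    next
      assume "\<exists>w\<in>Td.Zc 0. Te.eps 0 (g - w) = \<one>\<^bsub>Ext_comod H TEM 0\<^esub>"
      then obtain w where w: "w \<in> Td.Zc 0" "Te.eps 0 (g - w) = \<one>\<^bsub>Ext_comod H TEM 0\<^esub>" by blast
      have "g - w \<in> KK" using Te_eps_0[OF addsub_diff[OF Te.Zc_addsub g subsetD[OF Td_sub_Te w(1)]]] w(2) by blast
      then show "\<exists>k\<in>Pre GG KK 0. delta 0 (g - k) = 0" using w(1) by (intro bexI[of _ "g - w"]) (auto simp: Td_Zc)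
    qed
    then show "conn 0 g = \<one>\<^bsub>Ext_comod H TC (Suc 0)\<^esub> \<longleftrightarrow>
        (Te.eps 0 ` Td.Zc 0) #>\<^bsub>Ext_comod H TEM 0\<^esub> Te.eps 0 g = \<one>\<^bsub>Ext_comod H TEM 0 Mod (Te.eps 0 ` Td.Zc 0)\<^esub>"
      unfolding conn_eq_one[OF g] q(4)[OF g] .
  qed (use q in auto)
  then show ?thesis by (simp add: d1_image)
qed

text \<open>A cocycle of T \<otimes> D^0 in degree 0 is killed by d_1 exactly when its function lies
  in \<open>KK\<close>, that is, when it is a cocycle of T.\<close>

theorem Ext_0: "Ext_comod H TC 0 \<cong> (Ext_comod H TDM 0)
    \<lparr>carrier := kernel (Ext_comod H TDM 0) (Ext_comod H TEM 0) (d1 p m i)\<rparr>"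
proof -
  let ?K = "(Ext_comod H TDM 0)\<lparr>carrier := kernel (Ext_comod H TDM 0) (Ext_comod H TEM 0) (d1 p m i)\<rparr>"
  have sub: "T.Zc 0 \<subseteq> Td.Zc 0" using KK_LL[of 0] by (auto simp: T_Zc Td_Zc)
  have ker: "kernel (Ext_comod H TDM 0) (Ext_comod H TEM 0) (d1 p m i) = Td.eps 0 ` T.Zc 0"
  proof -
    have "d1 p m i (Td.eps 0 g) = \<one>\<^bsub>Ext_comod H TEM 0\<^esub> \<longleftrightarrow> g \<in> T.Zc 0" if g: "g \<in> Td.Zc 0" for g
      using g Te_eps_0[OF subsetD[OF Td_sub_Te g]] unfolding d1_eps[OF g] by (simp add: T_Zc Td_Zc)
    then show ?thesis using sub by (auto simp: kernel_def Td.carrier_Ext)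
  qed
  show ?thesis
  proof (rule iso_of_same_kernel[OF group_agrp[OF T.Zc_addsub] T.eps_hom, where k = "Td.eps 0"])
    show "T.eps 0 ` carrier (agrp (T.Zc 0)) = carrier (Ext_comod H TC 0)" by (simp add: T.carrier_Ext)
    show "T.eps 0 \<one>\<^bsub>agrp (T.Zc 0)\<^esub> = \<one>\<^bsub>Ext_comod H TC 0\<^esub>" by (simp add: T.one_Ext)
    show "Td.eps 0 \<in> hom (agrp (T.Zc 0)) ?K"
      using hom_mult[OF Td.eps_hom] sub by (intro homI) (auto simp: ker subset_iff)
    show "Td.eps 0 ` carrier (agrp (T.Zc 0)) = carrier ?K" by (simp add: ker)
    show "Td.eps 0 \<one>\<^bsub>agrp (T.Zc 0)\<^esub> = \<one>\<^bsub>?K\<^esub>" by (simp add: Td.one_Ext)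
    fix f assume "f \<in> carrier (agrp (T.Zc 0))"
    then have f: "f \<in> T.Zc 0" "f \<in> Td.Zc 0" using sub by auto
    show "T.eps 0 f = \<one>\<^bsub>Ext_comod H TC 0\<^esub> \<longleftrightarrow> Td.eps 0 f = \<one>\<^bsub>?K\<^esub>"
      using T.eps_eq_one[OF f(1)] Td.eps_eq_one[OF f(2)] by (simp add: T.Bc_def Td.Bc_def)
  qed
qed

end

theorem proposition5p4:
  fixes p m i :: nat
  assumes "Factorial_Ring.prime p" and "m > 0"
  shows "Ext_comod (Gamma p (m + 1)) (T_comod p m i) 0 \<cong>
           (Ext_comod (Gamma p (m + 1)) (T_D0 p m i) 0)
             \<lparr>carrier := kernel (Ext_comod (Gamma p (m + 1)) (T_D0 p m i) 0)
                               (Ext_comod (Gamma p (m + 1)) (T_E1 p m i) 0) (d1 p m i)\<rparr>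
       \<and> Ext_comod (Gamma p (m + 1)) (T_comod p m i) 1 \<cong>
           Ext_comod (Gamma p (m + 1)) (T_E1 p m i) 0
             Mod (d1 p m i ` carrier (Ext_comod (Gamma p (m + 1)) (T_D0 p m i) 0))
       \<and> (\<forall>n\<ge>2. Ext_comod (Gamma p (m + 1)) (T_comod p m i) n \<cong>
                 Ext_comod (Gamma p (m + 1)) (T_E1 p m i) (n - 1))"
proof -
  interpret bp_T p m i using assms by unfold_locales
  have "Ext_comod H TC n \<cong> Ext_comod H TEM (n - 1)" if n: "n \<ge> 2" for n
  proof -
    obtain s where "n = Suc (Suc s)" using n by (metis Suc_le_D numeral_2_eq_2 Suc_le_mono)
    then show ?thesis using Ext_shift by simp
  qed
  then show ?thesis using Ext_0 Ext_1 unfolding Suc_eq_plus1[symmetric] by blast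
qed

end
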